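(* Let $(A,(m_p)_{p\in\mathcal P})$ be a $\mathcal P$-tracial algebra and let $A_1$ and $A_2$ be two families of elements of $A$. Then: (1) if $A_1\cup A_2$ is deterministic, the $\mathfrak S$-freeness of $A_1$ and $A_2$ is equivalent to the freeness of $A_1$ and $A_2$ in the sense of Voiculescu for the linear form $m_{\mathrm{id}_1}$; (2) if $A_1$ and $A_2$ are $\mathcal B$-free or $\mathcal Bs$-free, then they are $\mathfrak S$-free. Moreover the following negative assertions hold: (a) if $A_1$ and $A_2$ are $\mathcal P$-free and if there exist $(a_1,a_2)\in A_1^2$ and $(b_1,b_2)\in A_2^2$ such that $\kappa^{\mathcal P}_{0_2}(a_1,a_2)\,\kappa^{\mathcal P}_{0_2}(b_1,b_2)\neq0$, where $0_2=\{\{1,2,1',2'\}\}$, then $A_1$ and $A_2$ are not $\mathfrak S$-free; in particular $\mathcal P$-freeness does not imply $\mathfrak S$-freeness in general; (b) $\mathcal P$-freeness of $A_1$ and $A_2$ does not in general imply $\mathcal B$-freeness of $A_1$ and $A_2$; (c) $\mathfrak S$-freeness of $A_1$ and $A_2$ does not in general imply $\mathcal B$-freeness of $A_1$ and $A_2$. (In (a)–(c), "does not in general imply" means that there exist a $\mathcal P$-tracial algebra and two families in it having the first property but not the second.)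
   Context: Partitions. For $k\ge 0$, $\mathcal P_k$ is the set of partitions of $\{1,\dots,k,1',\dots,k'\}$ and $\mathcal P=\bigcup_k\mathcal P_k$. A partition is drawn as a diagram with a top row $1,\dots,k$ and a bottom row $1',\dots,k'$. $\mathrm{nc}(p)$ is the number of blocks of $p$; $p\vee p'$ is the finest partition coarser than both; $\mathrm{id}_k=\{\{i,i'\}:1\le i\le k\}$. The cycles of $p$ are the blocks of $p\vee\mathrm{id}_k$. A permutation $\sigma\in\mathfrak S_k$ is identified with $\{\{i,\sigma(i)'\}\}\in\mathcal P_k$. $\mathcal B_k$ is the set of $p\in\mathcal P_k$ all of whose blocks have size $2$; $\mathcal Bs_k$ the set of those all of whose blocks have size at most $2$; $\mathfrak S=\bigcup_k\mathfrak S_k$, etc. $p\circ p'$ is obtained by putting $p'$ above $p$, identifying the bottom row of $p'$ with the top row of $p$, then erasing the middle row and keeping connections. $p\otimes p'$ is obtained by putting $p'$ to the right of $p$. Set $d(p,p')=\frac{\mathrm{nc}(p)+\mathrm{nc}(p')}{2}-\mathrm{nc}(p\vee p')$ and $p\le p'$ if $d(\mathrm{id}_k,p)+d(p,p')=d(\mathrm{id}_k,p')$ (a partial order). $\mathcal P$-tracial algebra. For $p\in\mathcal P_k$, $l\ge k$ and $1\le i_1<\dots<i_k\le l$, $\mathrm{Ins}^l_{(i_1,\dots,i_k)}(p)\in\mathcal P_l$ is obtained by relabelling $j\mapsto i_j$, $j'\mapsto i_j'$ in $p$ and adding the blocks $\{i,i'\}$ for $i\notin\{i_1,\dots,i_k\}$.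 A $\mathcal P$-tracial algebra $(A,(m_p)_{p\in\mathcal P})$ is a (complex) algebra $A$ with $k$-linear forms $m_p:A^k\to\mathbb C$ for $p\in\mathcal P_k$ ($m_\emptyset=1$) such that (1) $m_p(a_1,\dots,a_k)=m_{\sigma\circ p\circ\sigma^{-1}}(a_{\sigma^{-1}(1)},\dots,a_{\sigma^{-1}(k)})$ for all $\sigma\in\mathfrak S_k$; (2) $m_p\big(\prod_{i=1}^{n_1}a^{(1)}_i,\dots,\prod_{i=1}^{n_k}a_i^{(k)}\big)=m_{\mathrm{Ins}^{n}_{\mathbf i}(p)\circ\sigma}(a^{(1)}_1,\dots,a^{(1)}_{n_1},\dots,a^{(k)}_1,\dots,a^{(k)}_{n_k})$, with $n=\sum_j n_j$, $\mathbf i=(1,1+n_1,\dots,1+n_1+\dots+n_{k-1})$ and $\sigma=(1,\dots,n_1)(n_1+1,\dots,n_1+n_2)\cdots(n_1+\dots+n_{k-1}+1,\dots,n)$. A family of elements is deterministic if on the algebra it generates $m_{p_1\otimes p_2}(a_1,\dots,a_{k_1+k_2})=m_{p_1}(a_1,\dots,a_{k_1})m_{p_2}(a_{k_1+1},\dots,a_{k_1+k_2})$ for all $p_1\in\mathcal P_{k_1},p_2\in\mathcal P_{k_2}$. For $\mathcal C\in\{\mathcal P,\mathfrak S,\mathcal B,\mathcal Bs\}$, the $\mathcal C$-cumulants $(\kappa^{\mathcal C}_p)_{p\in\mathcal C}$ are the unique multilinear forms with $m_p=\sum_{p'\in\mathcal C_k,\,p'\le p}\kappa^{\mathcal C}_{p'}$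 for all $k$ and $p\in\mathcal C_k$. $\mathcal C$-freeness. Sub-algebras $A_1,A_2$ are $\mathcal C$-free if: (i) for all $k$, $p\in\mathcal C_k$, and $(a_1,\dots,a_k)$ with $a_i\in A_{\epsilon(i)}$, $\epsilon(i)\in\{1,2\}$, if some cycle of $p$ contains $i$ and $j$ with $\epsilon(i)\ne\epsilon(j)$ then $\kappa^{\mathcal C}_p(a_1,\dots,a_k)=0$; (ii) for $p_1\in\mathcal C_{k_1},p_2\in\mathcal C_{k_2}$, $(a_i)_{i\le k_1}\in A_1^{k_1}$, $(a_i)_{k_1<i\le k_1+k_2}\in A_2^{k_2}$: $\kappa^{\mathcal C}_{p_1\otimes p_2}(a_1,\dots,a_{k_1+k_2})=\kappa^{\mathcal C}_{p_1}(a_1,\dots,a_{k_1})\kappa^{\mathcal C}_{p_2}(a_{k_1+1},\dots,a_{k_1+k_2})$. Two families are $\mathcal C$-free if the algebras they generate are. Freeness in the sense of Voiculescu for a linear form $\phi$ is the usual notion of free probability for the generated algebras: $\phi$ vanishes on alternating products $a_1b_1\cdots a_kb_k$ and $a_1b_1\cdots a_k$ of elements taken alternately in the two algebras and centered for $\phi$. *)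

theory Defs
  imports
    Complex_Main
    "HOL-Library.Disjoint_Sets"
    "HOL-Library.Function_Algebras"
    "HOL-Combinatorics.Permutations"
begin

section \<open>Partition diagrams\<close>

text \<open>
  Vertices are numbered from 0: \<open>Inl i\<close> is the top vertex written $i+1$ in the literature and
  \<open>Inr i\<close> is the bottom vertex $(i+1)'$.  Since \<open>diagrams k\<close> and \<open>diagrams l\<close> are disjoint
  for distinct \<open>k\<close> and \<open>l\<close>, objects indexed by all diagrams need not carry the index \<open>k\<close>.
\<close>

type_synonym diagram = "(nat + nat) set set"

definition vertices :: "nat \<Rightarrow> (nat + nat) set" where
  "vertices k = {..<k} <+> {..<k}"

definition diagrams :: "nat \<Rightarrow> diagram set" where
  "diagrams k = {p. partition_on (vertices k) p}"

definition id_diagram :: "nat \<Rightarrow> diagram" where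
  "id_diagram k = (\<lambda>i. {Inl i, Inr i}) ` {..<k}"

definition perm_diagram :: "nat \<Rightarrow> (nat \<Rightarrow> nat) \<Rightarrow> diagram" where
  "perm_diagram k \<sigma> = (\<lambda>i. {Inl i, Inr (\<sigma> i)}) ` {..<k}"

definition perm_diagrams :: "nat \<Rightarrow> diagram set" where
  "perm_diagrams k = perm_diagram k ` {\<sigma>. \<sigma> permutes {..<k}}"

definition brauer_diagrams :: "nat \<Rightarrow> diagram set" where
  "brauer_diagrams k = {p \<in> diagrams k. \<forall>b\<in>p. card b = 2}"

definition rook_brauer_diagrams :: "nat \<Rightarrow> diagram set" where
  "rook_brauer_diagrams k = {p \<in> diagrams k. \<forall>b\<in>p. card b \<le> 2}"

text \<open>
  \<open>merge F\<close> is the partition of \<open>\<Union>F\<close> into the connected components of the hypergraph with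
  edges \<open>F\<close>.  It provides the join of two partitions (see \<open>join_is_finest\<close>) and, applied
  to a diagram with three rows, the composition of diagrams.
\<close>

definition merge :: "'v set set \<Rightarrow> 'v set set" where
  "merge F = \<Union>F // (\<Union>b\<in>F. b \<times> b)\<^sup>+"

definition join :: "'v set set \<Rightarrow> 'v set set \<Rightarrow> 'v set set" where
  "join p q = merge (p \<union> q)"

definition cycles :: "nat \<Rightarrow> diagram \<Rightarrow> diagram" where
  "cycles k p = join p (id_diagram k)"

text \<open>
  In \<open>diagram_comp p q\<close> the diagram \<open>q\<close> lies above \<open>p\<close>.  The vertices of the stacked
  diagram are pairs of a row (0, 1 or 2, from top to bottom) and a position.
\<close>

definition diagram_comp :: "diagram \<Rightarrow> diagram \<Rightarrow> diagram" where
  "diagram_comp p q =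
     (\<lambda>b. case_sum (Pair (0::nat)) (Pair 2) -` b) `
       merge ((`) (case_sum (Pair 0) (Pair 1)) ` q \<union> (`) (case_sum (Pair 1) (Pair 2)) ` p)
     - {{}}"

text \<open>\<open>diagram_tensor k p q\<close> is the tensor product of \<open>p \<in> diagrams k\<close> with \<open>q\<close> put to its right.\<close>

definition diagram_tensor :: "nat \<Rightarrow> diagram \<Rightarrow> diagram \<Rightarrow> diagram" where
  "diagram_tensor k p q = p \<union> (`) (map_sum ((+) k) ((+) k)) ` q"

definition diagram_dist :: "diagram \<Rightarrow> diagram \<Rightarrow> real" where
  "diagram_dist p q = (real (card p) + real (card q)) / 2 - real (card (join p q))"

definition geodesic_le :: "nat \<Rightarrow> diagram \<Rightarrow> diagram \<Rightarrow> bool" where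
  "geodesic_le k p q \<longleftrightarrow>
     diagram_dist (id_diagram k) p + diagram_dist p q = diagram_dist (id_diagram k) q"

definition insertion :: "nat \<Rightarrow> nat list \<Rightarrow> diagram \<Rightarrow> diagram" where
  "insertion l is p =
     (`) (map_sum ((!) is) ((!) is)) ` p \<union> {{Inl i, Inr i} |i. i < l \<and> i \<notin> set is}"

text \<open>
  For block sizes \<open>ns = [n\<^sub>1, \<dots>, n\<^sub>k]\<close>, \<open>offsets ns = [0, n\<^sub>1, n\<^sub>1 + n\<^sub>2, \<dots>]\<close> (of length \<open>k\<close>)
  lists the first positions of the consecutive blocks, and \<open>block_cycle ns\<close> is the permutation
  that cycles each block, sending a position to the next one and the last one to the first.
\<close>

definition offsets :: "nat list \<Rightarrow> nat list" where
  "offsets ns = map (\<lambda>j. sum_list (take j ns)) [0..<length ns]"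

fun block_cycle :: "nat list \<Rightarrow> nat \<Rightarrow> nat" where
  "block_cycle [] i = i"
| "block_cycle (n # ns) i = (if i < n then Suc i mod n else n + block_cycle ns (i - n))"


section \<open>Tracial algebras\<close>

text \<open>Associative complex algebras, not necessarily with a unit.\<close>

locale complex_algebra = vector_space scale
  for scale :: "complex \<Rightarrow> 'a::ab_group_add \<Rightarrow> 'a" +
  fixes mul :: "'a \<Rightarrow> 'a \<Rightarrow> 'a"
  assumes mult_assoc: "mul (mul x y) z = mul x (mul y z)"
    and mult_add_left: "mul (x + y) z = mul x z + mul y z"
    and mult_add_right: "mul x (y + z) = mul x y + mul x z"
    and mult_scale_left: "mul (scale c x) y = scale c (mul x y)"
    and mult_scale_right: "mul x (scale c y) = scale c (mul x y)"

text \<open>Products of nonempty lists; the value on the empty list is irrelevant.\<close>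

fun list_mult :: "('a \<Rightarrow> 'a \<Rightarrow> 'a) \<Rightarrow> 'a list \<Rightarrow> 'a" where
  "list_mult mul [] = undefined"
| "list_mult mul [x] = x"
| "list_mult mul (x # y # xs) = mul x (list_mult mul (y # xs))"

definition subalgebra ::
    "(complex \<Rightarrow> 'a::ab_group_add \<Rightarrow> 'a) \<Rightarrow> ('a \<Rightarrow> 'a \<Rightarrow> 'a) \<Rightarrow> 'a set \<Rightarrow> bool" where
  "subalgebra scale mul B \<longleftrightarrow>
     module.subspace scale B \<and> (\<forall>x\<in>B. \<forall>y\<in>B. mul x y \<in> B)"

definition generated_algebra ::
    "(complex \<Rightarrow> 'a::ab_group_add \<Rightarrow> 'a) \<Rightarrow> ('a \<Rightarrow> 'a \<Rightarrow> 'a) \<Rightarrow> 'a set \<Rightarrow> 'a set" where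
  "generated_algebra scale mul S = subalgebra scale mul hull S"

definition multilinear_form ::
    "(complex \<Rightarrow> 'a::ab_group_add \<Rightarrow> 'a) \<Rightarrow> nat \<Rightarrow> ('a list \<Rightarrow> complex) \<Rightarrow> bool" where
  "multilinear_form scale k f \<longleftrightarrow>
     (\<forall>as i. length as = k \<and> i < k \<longrightarrow> Vector_Spaces.linear scale (*) (\<lambda>x. f (as[i := x])))"

text \<open>
  A family of forms is a function \<open>m\<close> of a diagram \<open>p \<in> diagrams k\<close> and of the list of the
  \<open>k\<close> arguments; its values on lists of other lengths are irrelevant.
\<close>

locale P_tracial_algebra = complex_algebra scale mul
  for scale :: "complex \<Rightarrow> 'a::ab_group_add \<Rightarrow> 'a" and mul :: "'a \<Rightarrow> 'a \<Rightarrow> 'a" +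
  fixes m :: "diagram \<Rightarrow> 'a list \<Rightarrow> complex"
  assumes m_multilinear: "p \<in> diagrams k \<Longrightarrow> multilinear_form scale k (m p)"
    and m_empty: "m {} [] = 1"
    and m_perm:
      "\<lbrakk>p \<in> diagrams k; length as = k; \<sigma> permutes {..<k}\<rbrakk> \<Longrightarrow>
         m p as =
         m (diagram_comp (perm_diagram k \<sigma>) (diagram_comp p (perm_diagram k (inv \<sigma>))))
           (map (\<lambda>i. as ! inv \<sigma> i) [0..<k])"
    and m_product:
      "\<lbrakk>p \<in> diagrams k; length ass = k; \<forall>xs\<in>set ass. xs \<noteq> [];
        ns = map length ass; n = sum_list ns\<rbrakk> \<Longrightarrow>
         m p (map (list_mult mul) ass) =
         m (diagram_comp (insertion n (offsets ns) p) (perm_diagram n (block_cycle ns)))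
           (concat ass)"

definition deterministic ::
    "(complex \<Rightarrow> 'a::ab_group_add \<Rightarrow> 'a) \<Rightarrow> ('a \<Rightarrow> 'a \<Rightarrow> 'a) \<Rightarrow>
     (diagram \<Rightarrow> 'a list \<Rightarrow> complex) \<Rightarrow> 'a set \<Rightarrow> bool" where
  "deterministic scale mul m S \<longleftrightarrow>
     (\<forall>k1 k2 p1 p2 as bs.
        p1 \<in> diagrams k1 \<and> p2 \<in> diagrams k2 \<and> length as = k1 \<and> length bs = k2 \<and>
        set as \<subseteq> generated_algebra scale mul S \<and> set bs \<subseteq> generated_algebra scale mul S \<longrightarrow>
        m (diagram_tensor k1 p1 p2) (as @ bs) = m p1 as * m p2 bs)"


section \<open>Cumulants and freeness\<close>

text \<open>
  The class \<open>\<C>\<close> is one of \<open>diagrams\<close>, \<open>perm_diagrams\<close>, \<open>brauer_diagrams\<close> and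
  \<open>rook_brauer_diagrams\<close>.
\<close>

definition is_cumulant_family ::
    "(complex \<Rightarrow> 'a::ab_group_add \<Rightarrow> 'a) \<Rightarrow> (diagram \<Rightarrow> 'a list \<Rightarrow> complex) \<Rightarrow>
     (nat \<Rightarrow> diagram set) \<Rightarrow> (diagram \<Rightarrow> 'a list \<Rightarrow> complex) \<Rightarrow> bool" where
  "is_cumulant_family scale m \<C> \<kappa> \<longleftrightarrow>
     (\<forall>k. \<forall>p\<in>\<C> k. multilinear_form scale k (\<kappa> p)) \<and>
     (\<forall>k. \<forall>p\<in>\<C> k. \<forall>as. length as = k \<longrightarrow>
        m p as = (\<Sum>p'\<in>{p' \<in> \<C> k. geodesic_le k p' p}. \<kappa> p' as))"

text \<open>
  The choice is harmless: see \<open>cumulant_is_cumulant_family\<close> and \<open>cumulant_unique\<close> below.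
\<close>

definition cumulant ::
    "(complex \<Rightarrow> 'a::ab_group_add \<Rightarrow> 'a) \<Rightarrow> (diagram \<Rightarrow> 'a list \<Rightarrow> complex) \<Rightarrow>
     (nat \<Rightarrow> diagram set) \<Rightarrow> diagram \<Rightarrow> 'a list \<Rightarrow> complex" where
  "cumulant scale m \<C> = (SOME \<kappa>. is_cumulant_family scale m \<C> \<kappa>)"

text \<open>
  The map \<open>\<epsilon>\<close> tells which of the two algebras an argument is taken from.  A cycle contains the
  top vertex \<open>Inl i\<close> iff it contains the bottom vertex \<open>Inr i\<close>.
\<close>

definition c_free ::
    "(nat \<Rightarrow> diagram set) \<Rightarrow> (complex \<Rightarrow> 'a::ab_group_add \<Rightarrow> 'a) \<Rightarrow> ('a \<Rightarrow> 'a \<Rightarrow> 'a) \<Rightarrow>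
     (diagram \<Rightarrow> 'a list \<Rightarrow> complex) \<Rightarrow> 'a set \<Rightarrow> 'a set \<Rightarrow> bool" where
  "c_free \<C> scale mul m A1 A2 \<longleftrightarrow>
     (let B1 = generated_algebra scale mul A1; B2 = generated_algebra scale mul A2;
          \<kappa> = cumulant scale m \<C>
      in (\<forall>k p as \<epsilon>.
            p \<in> \<C> k \<and> length as = k \<and> (\<forall>i<k. as ! i \<in> (if \<epsilon> i then B1 else B2)) \<and>
            (\<exists>c\<in>cycles k p. \<exists>i j. Inl i \<in> c \<and> Inl j \<in> c \<and> \<epsilon> i \<noteq> \<epsilon> j) \<longrightarrow>
            \<kappa> p as = 0) \<and>
         (\<forall>k1 k2 p1 p2 as bs.
            p1 \<in> \<C> k1 \<and> p2 \<in> \<C> k2 \<and> length as = k1 \<and> length bs = k2 \<and>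
            set as \<subseteq> B1 \<and> set bs \<subseteq> B2 \<longrightarrow>
            \<kappa> (diagram_tensor k1 p1 p2) (as @ bs) = \<kappa> p1 as * \<kappa> p2 bs))"

text \<open>
  Voiculescu's freeness concerns unital algebras and a linear form with value 1 at the unit.
  As no unit is assumed, it is stated in the algebra obtained by adjoining one: a pair
  \<open>(c, a)\<close> stands for $c 1 + a$.  If the algebra already has a unit on which the form takes the
  value 1, this is the usual notion for the unital subalgebras generated by the two families;
  see \<open>voiculescu_free_unital\<close> below.
\<close>

definition unitization_mult ::
    "(complex \<Rightarrow> 'a::ab_group_add \<Rightarrow> 'a) \<Rightarrow> ('a \<Rightarrow> 'a \<Rightarrow> 'a) \<Rightarrow>
     complex \<times> 'a \<Rightarrow> complex \<times> 'a \<Rightarrow> complex \<times> 'a" where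
  "unitization_mult scale mul x y =
     (fst x * fst y, scale (fst x) (snd y) + scale (fst y) (snd x) + mul (snd x) (snd y))"

definition unitization_form :: "('a \<Rightarrow> complex) \<Rightarrow> complex \<times> 'a \<Rightarrow> complex" where
  "unitization_form \<phi> x = fst x + \<phi> (snd x)"

definition voiculescu_free ::
    "(complex \<Rightarrow> 'a::ab_group_add \<Rightarrow> 'a) \<Rightarrow> ('a \<Rightarrow> 'a \<Rightarrow> 'a) \<Rightarrow> ('a \<Rightarrow> complex) \<Rightarrow>
     'a set \<Rightarrow> 'a set \<Rightarrow> bool" where
  "voiculescu_free scale mul \<phi> A1 A2 \<longleftrightarrow>
     (\<forall>xs \<epsilon>. xs \<noteq> [] \<and>
        (\<forall>i<length xs.
           snd (xs ! i) \<in> generated_algebra scale mul (if \<epsilon> i then A1 else A2) \<and>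
           unitization_form \<phi> (xs ! i) = 0) \<and>
        (\<forall>i. Suc i < length xs \<longrightarrow> \<epsilon> i \<noteq> \<epsilon> (Suc i)) \<longrightarrow>
        unitization_form \<phi> (list_mult (unitization_mult scale mul) xs) = 0)"


section \<open>The definitions have the expected properties\<close>

lemma equiv_trancl_blocks: "equiv (\<Union>F) ((\<Union>b\<in>F. b \<times> b)\<^sup>+)"
proof (rule equivI)
  show "(\<Union>b\<in>F. b \<times> b)\<^sup>+ \<subseteq> \<Union>F \<times> \<Union>F"
    by (rule trancl_subset_Sigma) blast
  show "refl_on (\<Union>F) ((\<Union>b\<in>F. b \<times> b)\<^sup>+)"
    by (rule refl_onI) blast
  show "sym ((\<Union>b\<in>F. b \<times> b)\<^sup>+)"
    by (rule sym_trancl) (auto simp: sym_def)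
  show "trans ((\<Union>b\<in>F. b \<times> b)\<^sup>+)" by simp
qed

lemma partition_on_merge: "partition_on (\<Union>F) (merge F)"
  unfolding merge_def by (rule partition_on_quotient[OF equiv_trancl_blocks])

lemma merge_upper:
  assumes "b \<in> F" "b \<noteq> {}"
  shows "\<exists>c\<in>merge F. b \<subseteq> c"
proof -
  obtain x where x: "x \<in> b" using assms by blast
  have "(\<Union>b\<in>F. b \<times> b)\<^sup>+ `` {x} \<in> merge F"
    unfolding merge_def by (rule quotientI) (use x assms in blast)
  moreover have "b \<subseteq> (\<Union>b\<in>F. b \<times> b)\<^sup>+ `` {x}" using x assms by blast
  ultimately show ?thesis by blast
qed

lemma merge_least:
  assumes r: "partition_on X r" and F: "\<And>b. b \<in> F \<Longrightarrow> \<exists>c\<in>r. b \<subseteq> c" and c: "c \<in> merge F"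
  shows "\<exists>d\<in>r. c \<subseteq> d"
proof -
  obtain x where x: "x \<in> \<Union>F" and cx: "c = (\<Union>b\<in>F. b \<times> b)\<^sup>+ `` {x}"
    using c unfolding merge_def by (rule quotientE)
  obtain d where d: "d \<in> r" "x \<in> d" using x F by blast
  have "y \<in> d" if "(x, y) \<in> (\<Union>b\<in>F. b \<times> b)\<^sup>+" for y
    using that
  proof (induction rule: trancl_induct)
    case (base y)
    then obtain b e where "b \<in> F" "x \<in> b" "y \<in> b" "e \<in> r" "b \<subseteq> e" using F by blast
    then show ?case using partition_onD2[OF r] d by (metis disjnt_iff pairwise_def subsetD)
  next
    case (step y z)
    then obtain b e where "b \<in> F" "y \<in> b" "z \<in> b" "e \<in> r" "b \<subseteq> e" using F by blast
    then show ?case using partition_onD2[OF r] d step by (metis disjnt_iff pairwise_def subsetD)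
  qed
  then show ?thesis using cx d by blast
qed

lemma join_is_finest:
  assumes p: "partition_on X p" and q: "partition_on X q"
  shows "refines X p (join p q)" "refines X q (join p q)"
    and "\<lbrakk>refines X p r; refines X q r\<rbrakk> \<Longrightarrow> refines X (join p q) r"
proof -
  have X: "\<Union>(p \<union> q) = X" using partition_onD1[OF p] partition_onD1[OF q] by blast
  have j: "partition_on X (join p q)"
    using partition_on_merge[of "p \<union> q"] unfolding join_def X .
  show "refines X p (join p q)" "refines X q (join p q)"
    using p q j partition_onD3[OF p] partition_onD3[OF q] unfolding refines_def join_def
    by (metis UnCI merge_upper)+
  show "refines X (join p q) r" if "refines X p r" "refines X q r"
  proof -
    have "partition_on X r" "\<And>b. b \<in> p \<union> q \<Longrightarrow> \<exists>c\<in>r. b \<subseteq> c"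
      using that unfolding refines_def by blast+
    then show ?thesis using j merge_least[of X r "p \<union> q"]
      unfolding refines_def join_def by blast
  qed
qed

lemma refines_card_le:
  assumes pq: "refines X p q" and fin: "finite X"
  shows "card q \<le> card p" and "card q = card p \<Longrightarrow> p = q"
proof -
  have p: "partition_on X p" and q: "partition_on X q" and ex: "\<forall>b\<in>p. \<exists>c\<in>q. b \<subseteq> c"
    using pq unfolding refines_def by blast+
  obtain f where f: "\<And>b. b \<in> p \<Longrightarrow> f b \<in> q \<and> b \<subseteq> f b" using ex by metis
  have block: "b \<subseteq> c \<Longrightarrow> f b = c" if "b \<in> p" "c \<in> q" for b c
  proof -
    assume "b \<subseteq> c"
    moreover have "b \<noteq> {}" using partition_onD3[OF p] that by blast
    ultimately show "f b = c"
      using f[OF that(1)] that(2) partition_onD2[OF q]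
      by (metis disjnt_iff equals0I pairwise_def subsetD)
  qed
  have img: "f ` p = q"
  proof
    show "f ` p \<subseteq> q" using f by blast
    show "q \<subseteq> f ` p"
    proof
      fix c assume c: "c \<in> q"
      then obtain x where x: "x \<in> c" using partition_onD3[OF q] by fastforce
      then obtain b where b: "b \<in> p" "x \<in> b"
        using c partition_onD1[OF p] partition_onD1[OF q] by blast
      then have "f b = c"
        using f[OF b(1)] x c partition_onD2[OF q] by (metis disjnt_iff pairwise_def subsetD)
      then show "c \<in> f ` p" using b by blast
    qed
  qed
  have finp: "finite p" by (rule finite_elements[OF fin p])
  show "card q \<le> card p" using card_image_le[OF finp, of f] img by simp
  show "p = q" if "card q = card p"
  proof -
    have inj: "inj_on f p" using finp img that by (simp add: eq_card_imp_inj_on)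
    have "f b = b" if b: "b \<in> p" for b
    proof
      show "b \<subseteq> f b" using f b by blast
      show "f b \<subseteq> b"
      proof
        fix x assume x: "x \<in> f b"
        then obtain b' where b': "b' \<in> p" "x \<in> b'"
          using f[OF b] partition_onD1[OF p] partition_onD1[OF q] by blast
        then have "f b' = f b"
          using f[OF b'(1)] f[OF b] x partition_onD2[OF q]
          by (metis disjnt_iff pairwise_def subsetD)
        then show "x \<in> b" using inj b b' by (metis inj_onD)
      qed
    qed
    then show "p = q" using img by force
  qed
qed

lemma finite_vertices: "finite (vertices k)"
  by (simp add: vertices_def)

lemma finite_diagrams: "finite (diagrams k)"
  unfolding diagrams_def by (rule finitely_many_partition_on[OF finite_vertices])

lemma geodesic_le_refl:
  assumes "p \<in> diagrams k"
  shows "geodesic_le k p p"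
proof -
  have p: "partition_on (vertices k) p" using assms by (simp add: diagrams_def)
  have "refines (vertices k) p (join p p)" "refines (vertices k) (join p p) p"
    using join_is_finest[OF p p] refines_refl[OF p] by blast+
  then have "join p p = p" by (metis refines_asym)
  then show ?thesis by (simp add: geodesic_le_def diagram_dist_def)
qed

lemma geodesic_le_dist_less:
  assumes p: "p \<in> diagrams k" and q: "q \<in> diagrams k" and le: "geodesic_le k p q" and "p \<noteq> q"
  shows "diagram_dist (id_diagram k) p < diagram_dist (id_diagram k) q"
proof -
  have pp: "partition_on (vertices k) p" "partition_on (vertices k) q"
    using p q by (simp_all add: diagrams_def)
  note r = join_is_finest(1,2)[OF pp]
  note c = refines_card_le[OF r(1) finite_vertices] refines_card_le[OF r(2) finite_vertices]
  have "card (join p q) \<noteq> card p \<or> card (join p q) \<noteq> card q" using c \<open>p \<noteq> q\<close> by metis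
  then have "diagram_dist p q > 0" using c(1,3) unfolding diagram_dist_def by (auto simp: field_simps)
  then show ?thesis using le unfolding geodesic_le_def by linarith
qed

lemma moebius_exists:
  fixes g :: "'i \<Rightarrow> 't \<Rightarrow> complex" and f :: "'i \<Rightarrow> real"
  assumes "finite S"
    and "\<And>x. x \<in> S \<Longrightarrow> le x x"
    and "\<And>x y. \<lbrakk>x \<in> S; y \<in> S; le x y; x \<noteq> y\<rbrakk> \<Longrightarrow> f x < f y"
    and Q0: "Q (\<lambda>_. 0)" and Qdiff: "\<And>u v. \<lbrakk>Q u; Q v\<rbrakk> \<Longrightarrow> Q (\<lambda>t. u t - v t)"
    and "\<And>x. x \<in> S \<Longrightarrow> Q (g x)"
  shows "\<exists>h. \<forall>x\<in>S. Q (h x) \<and> (\<forall>t. g x t = (\<Sum>y\<in>{y\<in>S. le y x}. h y t))"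
  using assms(1-3,6)
proof (induction S rule: finite_ranking_induct[where f = f])
  case empty
  then show ?case by simp
next
  case (insert x S)
  have Qsum: "Q (\<lambda>t. \<Sum>y\<in>T. u y t)" if "finite T" "\<forall>y\<in>T. Q (u y)" for T :: "'i set" and u
    using that
  proof (induction T rule: finite_induct)
    case empty
    then show ?case by (simp add: Q0)
  next
    case (insert y T)
    have "Q (\<lambda>t. u y t - (0 - (\<Sum>y\<in>T. u y t)))"
      by (intro Qdiff Q0) (use insert in auto)
    then show ?case using insert by (simp add: add.commute)
  qed
  obtain h where h: "\<forall>z\<in>S. Q (h z) \<and> (\<forall>t. g z t = (\<Sum>y\<in>{y\<in>S. le y z}. h y t))"
  proof -
    have "\<exists>h. \<forall>z\<in>S. Q (h z) \<and> (\<forall>t. g z t = (\<Sum>y\<in>{y\<in>S. le y z}. h y t))"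
    proof (rule insert.IH)
      show "le z z" if "z \<in> S" for z using that insert.prems(1) by simp
      show "f y < f z" if "y \<in> S" "z \<in> S" "le y z" "y \<noteq> z" for y z
        using that insert.prems(2) by simp
      show "Q (g z)" if "z \<in> S" for z using that insert.prems(3) by simp
    qed
    then show ?thesis using that by blast
  qed
  define k where "k = (\<lambda>t. g x t - (\<Sum>y\<in>{y\<in>S. le y x}. h y t))"
  have Qk: "Q k" unfolding k_def
    by (intro Qdiff Qsum insert.prems(3)) (use insert.hyps h in auto)
  show ?case
  proof (cases "x \<in> S")
    case True
    then have "insert x S = S" by blast
    then show ?thesis using h by (intro exI[of _ h]) simp
  next
    case False
    have old: "(h(x := k)) y = h y" if "y \<in> S" for y using that False by auto
    have "Q ((h(x := k)) z) \<and> (\<forall>t. g z t = (\<Sum>y\<in>{y\<in>insert x S. le y z}. (h(x := k)) y t))"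
      if z: "z \<in> insert x S" for z
    proof (cases "z = x")
      case True
      have eq: "{y \<in> insert x S. le y x} = insert x {y \<in> S. le y x}"
        using insert.prems(1) by auto
      have "(\<Sum>y\<in>{y\<in>insert x S. le y x}. (h(x := k)) y t) = g x t" for t
      proof -
        have "(\<Sum>y\<in>{y\<in>S. le y x}. (h(x := k)) y t) = (\<Sum>y\<in>{y\<in>S. le y x}. h y t)"
          by (rule sum.cong) (use old in auto)
        then show ?thesis unfolding eq using insert.hyps(1) False by (simp add: k_def)
      qed
      then show ?thesis using True Qk by simp
    next
      case F: False
      then have zS: "z \<in> S" using z by blast
      have "\<not> le x z" using insert.prems(2)[of x z] insert.hyps zS F
        by (metis insertCI linorder_not_less)
      then have eq: "{y \<in> insert x S. le y z} = {y \<in> S. le y z}" by auto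
      have "(\<Sum>y\<in>{y\<in>insert x S. le y z}. (h(x := k)) y t) = (\<Sum>y\<in>{y\<in>S. le y z}. h y t)" for t
        unfolding eq by (rule sum.cong) (use old in auto)
      then show ?thesis using h zS F by simp
    qed
    then show ?thesis by blast
  qed
qed

lemma moebius_unique:
  fixes h h' :: "'i \<Rightarrow> complex" and f :: "'i \<Rightarrow> real"
  assumes fin: "finite S"
    and refl: "\<And>x. x \<in> S \<Longrightarrow> le x x"
    and less: "\<And>x y. \<lbrakk>x \<in> S; y \<in> S; le x y; x \<noteq> y\<rbrakk> \<Longrightarrow> f x < f y"
    and eq: "\<And>x. x \<in> S \<Longrightarrow> (\<Sum>y\<in>{y\<in>S. le y x}. h y) = (\<Sum>y\<in>{y\<in>S. le y x}. h' y)"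
    and x: "x \<in> S"
  shows "h x = h' x"
  using x
proof (induction "card {y \<in> S. f y < f x}" arbitrary: x rule: less_induct)
  case less': less
  have IH: "h y = h' y" if y: "y \<in> S" "le y x" "y \<noteq> x" for y
  proof (rule less'.hyps)
    have "f y < f x" using less y less'.prems by blast
    then show "card {z \<in> S. f z < f y} < card {z \<in> S. f z < f x}"
      using fin y by (intro psubset_card_mono) auto
  qed (use y in auto)
  let ?T = "{y \<in> S. le y x}"
  have "x \<in> ?T" "finite ?T" using refl less'.prems fin by auto
  then have "h x + (\<Sum>y\<in>?T - {x}. h y) = h' x + (\<Sum>y\<in>?T - {x}. h' y)"
    using eq[OF less'.prems] by (metis (no_types, lifting) sum.remove)
  moreover have "(\<Sum>y\<in>?T - {x}. h y) = (\<Sum>y\<in>?T - {x}. h' y)"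
    by (rule sum.cong) (use IH in auto)
  ultimately show ?case by simp
qed

lemma vector_space_complex: "vector_space ((*) :: complex \<Rightarrow> complex \<Rightarrow> complex)"
  by unfold_locales (simp_all add: algebra_simps)

lemma multilinear_form_zero:
  assumes "vector_space scale"
  shows "multilinear_form scale k (\<lambda>_. 0)"
proof -
  interpret vector_space_pair scale "(*) :: complex \<Rightarrow> complex \<Rightarrow> complex"
    by (intro vector_space_pair.intro assms vector_space_complex)
  show ?thesis unfolding multilinear_form_def using linear_zero by blast
qed

lemma multilinear_form_diff:
  assumes vs: "vector_space scale"
    and u: "multilinear_form scale k u" and v: "multilinear_form scale k v"
  shows "multilinear_form scale k (\<lambda>as. u as - v as)"
proof -
  interpret vector_space_pair scale "(*) :: complex \<Rightarrow> complex \<Rightarrow> complex"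
    by (intro vector_space_pair.intro vs vector_space_complex)
  show ?thesis
    unfolding multilinear_form_def
  proof (intro allI impI)
    fix as :: "'a list" and i
    assume "length as = k \<and> i < k"
    then have "Vector_Spaces.linear scale (*) (\<lambda>x. u (as[i := x]))"
      "Vector_Spaces.linear scale (*) (\<lambda>x. v (as[i := x]))"
      using u v unfolding multilinear_form_def by blast+
    then show "Vector_Spaces.linear scale (*) (\<lambda>x. u (as[i := x]) - v (as[i := x]))"
      by (rule linear_compose_sub)
  qed
qed

lemma cumulant_is_cumulant_family:
  assumes "vector_space scale"
    and sub: "\<And>k. \<C> k \<subseteq> diagrams k"
    and ml: "\<And>k p. p \<in> \<C> k \<Longrightarrow> multilinear_form scale k (m p)"
  shows "is_cumulant_family scale m \<C> (cumulant scale m \<C>)"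
proof -
  have "\<exists>h. \<forall>p\<in>\<C> k. multilinear_form scale k (h p) \<and>
      (\<forall>as. m p as = (\<Sum>p'\<in>{p'\<in>\<C> k. geodesic_le k p' p}. h p' as))" for k
  proof (rule moebius_exists[where f = "diagram_dist (id_diagram k)"])
    show "finite (\<C> k)" using sub finite_diagrams finite_subset by blast
    show "geodesic_le k p p" if "p \<in> \<C> k" for p
      using that sub geodesic_le_refl by blast
    show "diagram_dist (id_diagram k) p < diagram_dist (id_diagram k) q"
      if "p \<in> \<C> k" "q \<in> \<C> k" "geodesic_le k p q" "p \<noteq> q" for p q
      using that sub[of k] geodesic_le_dist_less by blast
  qed (fact multilinear_form_zero[OF assms(1)], erule (1) multilinear_form_diff[OF assms(1)], erule ml)
  then obtain h where h: "\<And>k p. p \<in> \<C> k \<Longrightarrow> multilinear_form scale k (h k p) \<and>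
      (\<forall>as. m p as = (\<Sum>p'\<in>{p'\<in>\<C> k. geodesic_le k p' p}. h k p' as))"
    by metis
  have "is_cumulant_family scale m \<C> (\<lambda>p as. h (length as) p as)"
    using h by (auto simp: is_cumulant_family_def multilinear_form_def)
  then show ?thesis unfolding cumulant_def by (rule someI[where P = "is_cumulant_family scale m \<C>"])
qed

lemma cumulant_unique:
  assumes sub: "\<And>k. \<C> k \<subseteq> diagrams k"
    and "is_cumulant_family scale m \<C> \<kappa>" "is_cumulant_family scale m \<C> \<kappa>'"
    and "p \<in> \<C> k" "length as = k"
  shows "\<kappa> p as = \<kappa>' p as"
proof (rule moebius_unique[where S = "\<C> k" and le = "geodesic_le k"
        and f = "diagram_dist (id_diagram k)" and h = "\<lambda>p. \<kappa> p as" and h' = "\<lambda>p. \<kappa>' p as"])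
  show "finite (\<C> k)" using sub finite_diagrams finite_subset by blast
  show "(\<Sum>y\<in>{y \<in> \<C> k. geodesic_le k y x}. \<kappa> y as) = (\<Sum>y\<in>{y \<in> \<C> k. geodesic_le k y x}. \<kappa>' y as)"
    if "x \<in> \<C> k" for x
  proof -
    have "m x as = (\<Sum>y\<in>{y \<in> \<C> k. geodesic_le k y x}. \<kappa> y as)"
      "m x as = (\<Sum>y\<in>{y \<in> \<C> k. geodesic_le k y x}. \<kappa>' y as)"
      using assms(2,3,5) that unfolding is_cumulant_family_def by blast+
    then show ?thesis by simp
  qed
  show "geodesic_le k p p" if "p \<in> \<C> k" for p
    using that sub geodesic_le_refl by blast
  show "diagram_dist (id_diagram k) p < diagram_dist (id_diagram k) q"
    if "p \<in> \<C> k" "q \<in> \<C> k" "geodesic_le k p q" "p \<noteq> q" for p q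
    using that sub[of k] geodesic_le_dist_less by blast
qed (fact assms(4))

context complex_algebra
begin

lemma subalgebra_generated: "subalgebra scale mul (generated_algebra scale mul S)"
  unfolding generated_algebra_def
  by (rule hull_in) (auto simp: subalgebra_def subspace_def)

lemma generated_algebra_insert_unit:
  assumes e: "\<And>x. mul e x = x" "\<And>x. mul x e = x"
  shows "generated_algebra scale mul (insert e S) =
    {scale c e + a |c a. a \<in> generated_algebra scale mul S}" (is "?L = ?R")
proof
  let ?G = "generated_algebra scale mul S"
  have G: "0 \<in> ?G" "\<And>x y. \<lbrakk>x \<in> ?G; y \<in> ?G\<rbrakk> \<Longrightarrow> x + y \<in> ?G" "\<And>c x. x \<in> ?G \<Longrightarrow> scale c x \<in> ?G"
    "\<And>x y. \<lbrakk>x \<in> ?G; y \<in> ?G\<rbrakk> \<Longrightarrow> mul x y \<in> ?G"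
    using subalgebra_generated[of S] by (auto simp: subalgebra_def subspace_def)
  have R: "scale c e + a \<in> ?R" if "a \<in> ?G" for c a using that by blast
  have "0 \<in> ?R" using R[of 0 0] G(1) by simp
  moreover have "x + y \<in> ?R" "mul x y \<in> ?R" if xy: "x \<in> ?R" "y \<in> ?R" for x y
  proof -
    obtain c a c' a' where a: "x = scale c e + a" "y = scale c' e + a'" "a \<in> ?G" "a' \<in> ?G"
      using xy by blast
    have "x + y = scale (c + c') e + (a + a')"
      unfolding a by (simp add: scale_left_distrib algebra_simps)
    then show "x + y \<in> ?R" using R[of "a + a'" "c + c'"] G(2)[OF a(3,4)] by simp
    have "mul x y = scale (c * c') e + (scale c a' + (scale c' a + mul a a'))"
      unfolding a
      by (simp add: mult_add_left mult_add_right mult_scale_left mult_scale_right e add.assoc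
          scale_right_distrib mult.commute)
    moreover have "scale c a' + (scale c' a + mul a a') \<in> ?G" by (intro G a)
    ultimately show "mul x y \<in> ?R" using R by simp
  qed
  moreover have "scale d x \<in> ?R" if x: "x \<in> ?R" for x d
  proof -
    obtain c a where a: "x = scale c e + a" "a \<in> ?G" using x by blast
    have "scale d x = scale (d * c) e + scale d a"
      unfolding a by (simp add: scale_right_distrib)
    then show ?thesis using R[OF G(3)[OF a(2)]] by simp
  qed
  ultimately have "subalgebra scale mul ?R"
    unfolding subalgebra_def subspace_def by (intro conjI ballI allI)
  moreover have "insert e S \<subseteq> ?R"
  proof -
    have "e \<in> ?R" using R[of 0 1] G(1) by simp
    moreover have "x \<in> ?R" if "x \<in> S" for x
    proof -
      have "x \<in> ?G" using that unfolding generated_algebra_def by (rule hull_inc)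
      then show ?thesis using R[of x 0] by simp
    qed
    ultimately show ?thesis by blast
  qed
  ultimately show "?L \<subseteq> ?R"
    unfolding generated_algebra_def[of _ _ "insert e S"] by (intro hull_minimal)
  have "?G \<subseteq> ?L" unfolding generated_algebra_def by (rule hull_mono) blast
  moreover have "e \<in> ?L" unfolding generated_algebra_def by (rule hull_inc) blast
  moreover have "x + y \<in> ?L" if "x \<in> ?L" "y \<in> ?L" for x y
    using subalgebra_generated[of "insert e S"] that unfolding subalgebra_def subspace_def by blast
  moreover have "scale c x \<in> ?L" if "x \<in> ?L" for c x
    using subalgebra_generated[of "insert e S"] that unfolding subalgebra_def subspace_def by blast
  ultimately show "?R \<subseteq> ?L" by blast
qed

lemma voiculescu_free_unital:
  assumes e: "\<And>x. mul e x = x" "\<And>x. mul x e = x"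
    and lin: "Vector_Spaces.linear scale (*) \<phi>" and one: "\<phi> e = 1"
  shows "voiculescu_free scale mul \<phi> A1 A2 \<longleftrightarrow>
    (\<forall>xs \<epsilon>. xs \<noteq> [] \<and>
       (\<forall>i<length xs.
          xs ! i \<in> generated_algebra scale mul (insert e (if \<epsilon> i then A1 else A2)) \<and>
          \<phi> (xs ! i) = 0) \<and>
       (\<forall>i. Suc i < length xs \<longrightarrow> \<epsilon> i \<noteq> \<epsilon> (Suc i)) \<longrightarrow>
       \<phi> (list_mult mul xs) = 0)" (is "_ \<longleftrightarrow> ?R")
proof -
  define f where "f = (\<lambda>x :: complex \<times> 'a. scale (fst x) e + snd x)"
  have phi: "\<phi> (f x) = unitization_form \<phi> x" for x
  proof -
    interpret l: Vector_Spaces.linear scale "(*)" \<phi> by (rule lin)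
    show ?thesis by (simp add: f_def unitization_form_def l.add l.scale one)
  qed
  have hom: "f (unitization_mult scale mul x y) = mul (f x) (f y)" for x y
    by (simp add: f_def unitization_mult_def mult_add_left mult_add_right mult_scale_left
        mult_scale_right e scale_right_distrib mult.commute add.assoc)
  have prd: "f (list_mult (unitization_mult scale mul) xs) = list_mult mul (map f xs)"
    if "xs \<noteq> []" for xs
    using that
  proof (induction xs rule: induct_list012)
    case (3 x y zs)
    then show ?case by (simp add: hom)
  qed auto
  have gen: "generated_algebra scale mul (insert e S) =
      f ` {x. snd x \<in> generated_algebra scale mul S}" for S
  proof -
    have "f ` {x. snd x \<in> B} = {scale c e + a |c a. a \<in> B}" for B
    proof (intro equalityI subsetI)
      fix z
      assume "z \<in> {scale c e + a |c a. a \<in> B}"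
      then obtain c a where "z = f (c, a)" "a \<in> B" by (auto simp: f_def)
      then show "z \<in> f ` {x. snd x \<in> B}" by (intro image_eqI[of _ _ "(c, a)"]) auto
    qed (auto simp: f_def)
    then show ?thesis unfolding generated_algebra_insert_unit[OF e] by simp
  qed
  show ?thesis
  proof
    assume L: "voiculescu_free scale mul \<phi> A1 A2"
    show ?R
    proof (intro allI impI, elim conjE)
      fix xs \<epsilon>
      assume ne: "xs \<noteq> []"
        and xs: "\<forall>i<length xs. xs ! i \<in> generated_algebra scale mul
                    (insert e (if \<epsilon> i then A1 else A2)) \<and> \<phi> (xs ! i) = 0"
        and alt: "\<forall>i. Suc i < length xs \<longrightarrow> \<epsilon> i \<noteq> \<epsilon> (Suc i)"
      have "\<forall>i. \<exists>y. i < length xs \<longrightarrow>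
          snd y \<in> generated_algebra scale mul (if \<epsilon> i then A1 else A2) \<and> f y = xs ! i"
      proof
        fix i
        show "\<exists>y. i < length xs \<longrightarrow>
          snd y \<in> generated_algebra scale mul (if \<epsilon> i then A1 else A2) \<and> f y = xs ! i"
        proof (cases "i < length xs")
          case True
          then have "xs ! i \<in> f ` {x. snd x \<in> generated_algebra scale mul (if \<epsilon> i then A1 else A2)}"
            using xs unfolding gen by blast
          then obtain y where "xs ! i = f y"
            "y \<in> {x. snd x \<in> generated_algebra scale mul (if \<epsilon> i then A1 else A2)}"
            by (rule imageE)
          then show ?thesis by (intro exI[of _ y]) simp
        qed simp
      qed
      then obtain y where y: "\<And>i. i < length xs \<Longrightarrow>
          snd (y i) \<in> generated_algebra scale mul (if \<epsilon> i then A1 else A2) \<and> f (y i) = xs ! i"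
        by metis
      let ?ys = "map y [0..<length xs]"
      have fys: "map f ?ys = xs" by (rule nth_equalityI) (use y in auto)
      have "unitization_form \<phi> (list_mult (unitization_mult scale mul) ?ys) = 0"
      proof (rule L[unfolded voiculescu_free_def, rule_format], intro conjI allI impI)
        show "?ys \<noteq> []" using ne by simp
        fix i
        show "snd (?ys ! i) \<in> generated_algebra scale mul (if \<epsilon> i then A1 else A2)"
          "unitization_form \<phi> (?ys ! i) = 0" if "i < length ?ys"
          using that y[of i] xs phi[of "y i"] by simp_all
        show "\<epsilon> i \<noteq> \<epsilon> (Suc i)" if "Suc i < length ?ys" using that alt by simp
      qed
      then show "\<phi> (list_mult mul xs) = 0"
        using prd[of ?ys] ne fys by (simp add: phi[symmetric])
    qed
  next
    assume R: ?R
    show "voiculescu_free scale mul \<phi> A1 A2"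
      unfolding voiculescu_free_def
    proof (intro allI impI, elim conjE)
      fix xs :: "(complex \<times> 'a) list" and \<epsilon>
      assume ne: "xs \<noteq> []"
        and xs: "\<forall>i<length xs. snd (xs ! i) \<in> generated_algebra scale mul
                    (if \<epsilon> i then A1 else A2) \<and> unitization_form \<phi> (xs ! i) = 0"
        and alt: "\<forall>i. Suc i < length xs \<longrightarrow> \<epsilon> i \<noteq> \<epsilon> (Suc i)"
      have "\<phi> (list_mult mul (map f xs)) = 0"
      proof (rule R[rule_format], intro conjI allI impI)
        show "map f xs \<noteq> []" using ne by simp
        fix i
        show "map f xs ! i \<in> generated_algebra scale mul (insert e (if \<epsilon> i then A1 else A2))"
          "\<phi> (map f xs ! i) = 0" if "i < length (map f xs)"
          using that xs phi[of "xs ! i"] unfolding gen by auto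
        show "\<epsilon> i \<noteq> \<epsilon> (Suc i)" if "Suc i < length (map f xs)" using that alt by simp
      qed
      then show "unitization_form \<phi> (list_mult (unitization_mult scale mul) xs) = 0"
        using prd[OF ne] by (simp add: phi[symmetric])
    qed
  qed
qed

end

end

theory Submission
  imports Defs "HOL-Library.Product_Plus"
begin

text \<open>
  The geodesic order satisfies the triangle inequality because the partition lattice is
  semimodular, so cumulants exist by Moebius inversion, and they are multiplicative on tensor
  products as soon as the moments are.

  (1) For a deterministic family the moment of a permutation is the product over its cycles of
  traces of words.  Freeness for the permutations says that mixed moments are the sums over pairs
  \<open>(\<tau>, \<tau>\<^sup>-\<^sup>1 \<sigma>)\<close>, \<open>\<tau> \<le> \<sigma>\<close>, of the products of the cumulants of the two families.
  That Voiculescu freeness gives the same sums follows by merging neighbouring letters of the same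
  colour and centring: for centred alternating letters a term can only be nonzero if \<open>\<tau>\<close>
  moves all its points, and then it joins two neighbouring letters of distinct colours.

  (2) A Brauer or rook-Brauer diagram below a permutation is itself a permutation, so the cumulants
  of a permutation do not depend on the class.

  (a) In the mixed moment of \<open>a\<^sub>1, a\<^sub>2, b\<^sub>1, b\<^sub>2\<close> along the four-cycle which alternates
  between the \<open>a\<close> and the \<open>b\<close>, freeness for all partitions produces, besides the terms that
  freeness for the permutations gives, the product of the two one-block cumulants.

  The examples are two independent signs, as limits of diagonal matrices, and an algebra with zero
  product in which only the diagram \<open>{{1, 2}, {1', 2'}}\<close> has a nonzero moment.
\<close>

text \<open>No planar structure is used: intervals below a permutation are handled through
  \<open>perm_length\<close> alone, by removing a point from its cycle (\<open>cut\<close>) and by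
  factoring geodesically (\<open>perm_le_assoc\<close>). In (1) the number of positions stays fixed.
  A merge of two letters leaves a unit at the freed position, and a unit forces every contributing
  cumulant to fix its position, so merging, centring and splitting by colour all take place in one
  symmetric group. The algebra may have no unit, hence the passage to the unitization; the way back
  is that adding a multiple of the unit to a letter changes no cumulant of a permutation that moves
  this letter. In (2) the obstacle is that a Brauer diagram carries no orientation. The remedy is to
  replace the components of two pairings by the orbits of the rotation they generate: a cycle splits
  into two orbits, and this doubling is compared with two copies of the orbits of the permutation,
  one in each row. For (b), the two signs serve again: by (2), Brauer freeness would make them free
  for the permutations. For (c), the zero product reduces the product axiom to a check on words of
  two letters.\<close>

lemma refinesE:
  assumes "refines X p q" "b \<in> p"
  obtains c where "c \<in> q" "b \<subseteq> c"
  using assms by (auto simp: refines_def)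

lemma merge_eqI:
  assumes "partition_on (\<Union>F) r" "\<And>b. b \<in> F \<Longrightarrow> \<exists>c\<in>r. b \<subseteq> c"
    and "\<And>c. c \<in> r \<Longrightarrow> \<exists>d\<in>merge F. c \<subseteq> d"
  shows "merge F = r"
proof (rule refines_asym)
  show "refines (\<Union>F) (merge F) r"
    using assms(1) merge_least[OF assms(1,2)] by (auto simp: refines_def partition_on_merge)
  show "refines (\<Union>F) r (merge F)"
    using assms by (auto simp: refines_def partition_on_merge)
qed

lemma partition_on_block_eq:
  assumes "partition_on X p" "b \<in> p" "c \<in> p" "x \<in> b" "x \<in> c"
  shows "b = c"
  using disjointD[OF partition_onD2[OF assms(1)] assms(2,3)] assms(4,5) by blast

lemma merge_absorbs:
  assumes "d \<in> merge F" "b \<in> F" "x \<in> b" "x \<in> d"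
  shows "b \<subseteq> d"
proof -
  obtain c where c: "c \<in> merge F" "b \<subseteq> c" using merge_upper[of b F] assms by blast
  moreover have "c = d"
    by (rule partition_on_block_eq[OF partition_on_merge c(1) assms(1), of x]) (use c assms in auto)
  ultimately show ?thesis by simp
qed

section \<open>Joins of partitions and semimodularity\<close>

lemma partition_on_join:
  assumes "partition_on X p" "partition_on X q"
  shows "partition_on X (join p q)"
  using partition_on_merge[of "p \<union> q"] partition_onD1[OF assms(1)] partition_onD1[OF assms(2)]
  by (simp add: join_def)

lemma join_commute: "join p q = join q p"
  by (simp add: join_def Un_commute)

lemma join_absorbs:
  assumes "d \<in> join p q" "b \<in> p \<or> b \<in> q" "x \<in> b" "x \<in> d"
  shows "b \<subseteq> d"
  using assms unfolding join_def by (intro merge_absorbs[of d _ b x]) auto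

lemma join_eq_right:
  assumes "refines X p q"
  shows "join p q = q"
proof (rule refines_asym)
  have pq: "partition_on X p" "partition_on X q" using assms by (auto simp: refines_def)
  show "refines X (join p q) q"
    using join_is_finest(3)[OF pq] assms refines_refl[OF pq(2)] by blast
  show "refines X q (join p q)" using join_is_finest(2)[OF pq] .
qed

lemma join_mono_card:
  assumes "finite X" "partition_on X p" "refines X q r"
  shows "card (join p r) \<le> card (join p q)"
proof -
  have q: "partition_on X q" and r: "partition_on X r" using assms by (auto simp: refines_def)
  have "refines X (join p q) (join p r)"
    by (rule join_is_finest(3)[OF assms(2) q])
      (use join_is_finest(1,2)[OF assms(2) r] assms(3) refines_trans in blast)+
  then show ?thesis using refines_card_le(1) assms(1) by blast
qed

lemma partition_on_merge_two_blocks: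
  assumes p: "partition_on X p" and "b \<in> p" "c \<in> p"
  shows "refines X p (insert (b \<union> c) (p - {b, c}))"
proof -
  have "b \<noteq> {}" using p assms(2) partition_onD3 by blast
  have "partition_on X (insert (b \<union> c) (p - {b, c}))"
  proof (rule partition_onI)
    show "\<Union> (insert (b \<union> c) (p - {b, c})) = X" using assms partition_onD1[OF p] by auto
    show "{} \<notin> insert (b \<union> c) (p - {b, c})" using partition_onD3[OF p] \<open>b \<noteq> {}\<close> by auto
    show "disjnt q r" if "q \<in> insert (b \<union> c) (p - {b, c})" "r \<in> insert (b \<union> c) (p - {b, c})" "q \<noteq> r" for q r
      using that assms partition_on_block_eq[OF p] by (auto simp: disjnt_iff)
  qed
  then show ?thesis using p by (auto simp: refines_def)
qed

text \<open>An inequality because \<open>b\<close> and \<open>c\<close> may coincide; this happens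
  when two blocks of a fine partition lie in the same block of a coarser one.\<close>

lemma card_merge_two_blocks:
  assumes "partition_on X p" "finite p" "b \<in> p" "c \<in> p"
  shows "card p \<le> card (insert (b \<union> c) (p - {b, c})) + 1"
proof -
  have "b \<noteq> {}" "c \<noteq> {}" using assms partition_onD3 by blast+
  then have "b \<union> c \<notin> p - {b, c}"
    using partition_on_block_eq[OF assms(1)] assms(3,4) by blast
  then have "card (insert (b \<union> c) (p - {b, c})) = Suc (card (p - {b, c}))" using assms(2) by simp
  moreover have "card (p - {b, c}) \<ge> card p - card {b, c}" by (rule diff_card_le_card_Diff) simp
  moreover have "card {b, c} \<le> 2" by (simp add: card_insert_if)
  ultimately show ?thesis by linarith
qed

text \<open>The rank of a partition is the number of points minus the number of blocks, and this is
  its semimodularity, with any common refinement \<open>p\<close> in place of the meet. While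
  \<open>p\<close> differs from \<open>x\<close>, two blocks of \<open>p\<close> inside one block of
  \<open>x\<close> are merged, and so are the blocks of \<open>y\<close> around them.\<close>

lemma partition_semimodular:
  assumes X: "finite X"
  shows "refines X p x \<Longrightarrow> refines X p y \<Longrightarrow> card x + card y \<le> card p + card (join x y)"
proof (induction "card p" arbitrary: p y rule: less_induct)
  case less
  have p: "partition_on X p" and x: "partition_on X x" and y: "partition_on X y"
    using less.prems by (auto simp: refines_def)
  have finy: "finite y" using finite_elements[OF X] y by auto
  show ?case
  proof (cases "p = x")
    case True
    then show ?thesis using join_eq_right[OF less.prems(2)] by simp
  next
    case False
    then have "\<not> refines X x p" using refines_asym less.prems(1) by blast
    then obtain d where d: "d \<in> x" "\<And>b. b \<in> p \<Longrightarrow> \<not> d \<subseteq> b" using p x by (auto simp: refines_def)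
    obtain u where u: "u \<in> d" using d x partition_onD3 by fastforce
    obtain b where b: "b \<in> p" "u \<in> b" using u d(1) partition_onD1[OF p] partition_onD1[OF x] by blast
    obtain v where v: "v \<in> d" "v \<notin> b" using d(2)[OF b(1)] by blast
    obtain c where c: "c \<in> p" "v \<in> c" using v d(1) partition_onD1[OF p] partition_onD1[OF x] by blast
    have bd: "e \<subseteq> d" if e: "e \<in> p" "w \<in> e" "w \<in> d" for e w
    proof -
      obtain f where "f \<in> x" "e \<subseteq> f" by (rule refinesE[OF less.prems(1) e(1)])
      then show ?thesis using partition_on_block_eq[OF x _ d(1), of f w] e by blast
    qed
    obtain b' where b': "b' \<in> y" "b \<subseteq> b'" by (rule refinesE[OF less.prems(2) b(1)])
    obtain c' where c': "c' \<in> y" "c \<subseteq> c'" by (rule refinesE[OF less.prems(2) c(1)])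
    \<comment> \<open>\<open>p'\<close> still refines \<open>x\<close>, because \<open>b\<close> and
      \<open>c\<close> both lie in \<open>d\<close>. It has one block less than \<open>p\<close>,
      while \<open>y'\<close> has at most one block less than \<open>y\<close>, so the inequality
      for \<open>p'\<close> and \<open>y'\<close> implies the one for \<open>p\<close> and
      \<open>y\<close>.\<close>
    define p' where "p' = insert (b \<union> c) (p - {b, c})"
    define y' where "y' = insert (b' \<union> c') (y - {b', c'})"
    have pp': "refines X p p'" unfolding p'_def by (rule partition_on_merge_two_blocks[OF p b(1) c(1)])
    have yy': "refines X y y'" unfolding y'_def by (rule partition_on_merge_two_blocks[OF y b'(1) c'(1)])
    have "b \<union> c \<in> p'" by (simp add: p'_def)
    moreover have "b \<union> c \<notin> p"
      using partition_on_block_eq[OF p b(1), of "b \<union> c" u] b c v by blast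
    ultimately have "p \<noteq> p'" by blast
    then have card: "card p' < card p" using refines_card_le[OF pp' X] by force
    have p'x: "refines X p' x"
    proof -
      have "b \<union> c \<subseteq> d" using bd[OF b] bd[OF c] u v by blast
      then have "\<exists>Y\<in>x. Z \<subseteq> Y" if "Z \<in> p'" for Z
      proof (cases "Z = b \<union> c")
        case False
        then have "Z \<in> p" using that by (simp add: p'_def)
        then show ?thesis by (rule refinesE[OF less.prems(1)]) blast
      qed (use d(1) in blast)
      then show ?thesis using pp' x unfolding refines_def by blast
    qed
    have p'y': "refines X p' y'"
    proof -
      have "\<exists>Y\<in>y'. Z \<subseteq> Y" if "Z \<in> p'" for Z
      proof (cases "Z = b \<union> c")
        case True
        moreover have "b \<union> c \<subseteq> b' \<union> c'" using b' c' by blast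
        moreover have "b' \<union> c' \<in> y'" by (simp add: y'_def)
        ultimately show ?thesis by blast
      next
        case False
        then have "Z \<in> p" using that by (simp add: p'_def)
        then show ?thesis by (rule refinesE[OF refines_trans[OF less.prems(2) yy']]) blast
      qed
      then show ?thesis using pp' yy' unfolding refines_def by blast
    qed
    have "card x + card y' \<le> card p' + card (join x y')"
      by (rule less.hyps[OF card p'x p'y'])
    moreover have "card (join x y') \<le> card (join x y)" by (rule join_mono_card[OF X x yy'])
    moreover have "card y \<le> card y' + 1"
      unfolding y'_def by (rule card_merge_two_blocks[OF y finy b'(1) c'(1)])
    ultimately show ?thesis using card by linarith
  qed
qed


section \<open>Connected components under inclusions, injections and disjoint unions\<close>

lemma merge_block_induct:
  assumes c: "c \<in> merge F" and x: "x \<in> c" and y: "y \<in> c" and "P x"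
    and step: "\<And>b u v. \<lbrakk>b \<in> F; u \<in> b; v \<in> b; P u\<rbrakk> \<Longrightarrow> P v"
  shows "P y"
proof -
  have "(x, y) \<in> (\<Union>b\<in>F. b \<times> b)\<^sup>+"
    using quotient_eq_iff[OF equiv_trancl_blocks, of c F c x y] c x y unfolding merge_def by blast
  then show ?thesis
  proof (induction rule: trancl_induct)
    case (base y)
    then show ?case using step \<open>P x\<close> by blast
  next
    case (step y z)
    then show ?case using assms(5) by blast
  qed
qed

lemma merge_obtain_block:
  assumes "x \<in> \<Union>F"
  obtains c where "c \<in> merge F" "x \<in> c"
  using assms partition_onD1[OF partition_on_merge[of F]] by auto

lemma Union_merge: "\<Union>(merge F) = \<Union>F"
  using partition_onD1[OF partition_on_merge[of F]] by simp

lemma merge_image_block: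
  assumes "c \<in> merge F"
  shows "\<exists>d\<in>merge ((`) f ` F). f ` c \<subseteq> d"
proof -
  obtain x where x: "x \<in> c" using assms partition_onD3[OF partition_on_merge[of F]] by fastforce
  have "x \<in> \<Union>F" using x assms Union_merge[of F] by blast
  then have "f x \<in> \<Union>((`) f ` F)" by blast
  then obtain d where d: "d \<in> merge ((`) f ` F)" "f x \<in> d" by (rule merge_obtain_block)
  have "f y \<in> d" if "y \<in> c" for y
    using assms x that d(2)
  proof (rule merge_block_induct)
    fix b u v
    assume b: "b \<in> F" "u \<in> b" "v \<in> b" and u: "f u \<in> d"
    have "f ` b \<subseteq> d" by (rule merge_absorbs[OF d(1) imageI[OF b(1)] imageI[OF b(2)] u])
    then show "f v \<in> d" using b by blast
  qed
  then show ?thesis using d by blast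
qed

lemma partition_on_image_inj:
  assumes "partition_on X p" "inj_on f X"
  shows "partition_on (f ` X) ((`) f ` p)"
proof -
  have "(`) f ` p - {{}} = (`) f ` p" using partition_onD3[OF assms(1)] by auto
  then show ?thesis using partition_on_inj_image[OF assms] by simp
qed

lemma merge_image:
  assumes "inj_on f (\<Union>F)" "{} \<notin> F"
  shows "merge ((`) f ` F) = (`) f ` merge F"
proof (rule merge_eqI)
  show "partition_on (\<Union> ((`) f ` F)) ((`) f ` merge F)"
    using partition_on_image_inj[OF partition_on_merge assms(1)] by (simp add: image_Union)
  show "\<exists>c\<in>(`) f ` merge F. b \<subseteq> c" if b: "b \<in> (`) f ` F" for b
  proof -
    obtain b' where b': "b' \<in> F" "b = f ` b'" using b by blast
    then obtain c where "c \<in> merge F" "b' \<subseteq> c" using merge_upper[of b' F] assms(2) by metis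
    then show ?thesis using b' by blast
  qed
  show "\<exists>d\<in>merge ((`) f ` F). c \<subseteq> d" if "c \<in> (`) f ` merge F" for c
    using that merge_image_block[of _ F f] by blast
qed

lemma partition_on_Un:
  assumes p: "partition_on X p" and q: "partition_on Y q" and "X \<inter> Y = {}"
  shows "partition_on (X \<union> Y) (p \<union> q)"
proof (rule partition_onI)
  show "\<Union>(p \<union> q) = X \<union> Y" using partition_onD1[OF p] partition_onD1[OF q] by blast
  show "{} \<notin> p \<union> q" using partition_onD3[OF p] partition_onD3[OF q] by blast
  show "disjnt b c" if "b \<in> p \<union> q" "c \<in> p \<union> q" "b \<noteq> c" for b c
  proof -
    consider "b \<in> p" "c \<in> p" | "b \<in> q" "c \<in> q" | "b \<subseteq> X" "c \<subseteq> Y" | "b \<subseteq> Y" "c \<subseteq> X"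
      using \<open>b \<in> p \<union> q\<close> \<open>c \<in> p \<union> q\<close> partition_onD1[OF p] partition_onD1[OF q] by blast
    then show ?thesis
    proof cases
      case 1
      then show ?thesis using disjointD[OF partition_onD2[OF p]] \<open>b \<noteq> c\<close> by (simp add: disjnt_def)
    next
      case 2
      then show ?thesis using disjointD[OF partition_onD2[OF q]] \<open>b \<noteq> c\<close> by (simp add: disjnt_def)
    qed (use \<open>X \<inter> Y = {}\<close> in \<open>auto simp: disjnt_def\<close>)
  qed
qed

lemma merge_mono:
  assumes "F \<subseteq> G" "c \<in> merge F"
  shows "\<exists>d\<in>merge G. c \<subseteq> d"
proof -
  obtain x where x: "x \<in> c" using assms partition_onD3[OF partition_on_merge[of F]] by fastforce
  have "x \<in> \<Union>G" using x assms Union_merge[of F] by blast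
  then obtain d where d: "d \<in> merge G" "x \<in> d" by (rule merge_obtain_block)
  have "y \<in> d" if "y \<in> c" for y
    using assms(2) x that d(2)
  proof (rule merge_block_induct)
    fix b u v
    assume b: "b \<in> F" "u \<in> b" "v \<in> b" and u: "u \<in> d"
    have "b \<subseteq> d" by (rule merge_absorbs[OF d(1) _ b(2) u]) (use b assms in blast)
    then show "v \<in> d" using b by blast
  qed
  then show ?thesis using d by blast
qed

lemma merge_Un:
  assumes "\<Union>F \<inter> \<Union>G = {}" "{} \<notin> F" "{} \<notin> G"
  shows "merge (F \<union> G) = merge F \<union> merge G"
proof (rule merge_eqI)
  show "partition_on (\<Union> (F \<union> G)) (merge F \<union> merge G)"
    using partition_on_Un[OF partition_on_merge partition_on_merge assms(1)] by simp
  show "\<exists>c\<in>merge F \<union> merge G. b \<subseteq> c" if b: "b \<in> F \<union> G" for b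
    using that assms merge_upper[of b F] merge_upper[of b G] by auto
  show "\<exists>d\<in>merge (F \<union> G). c \<subseteq> d" if "c \<in> merge F \<union> merge G" for c
    using that merge_mono[of F "F \<union> G" c] merge_mono[of G "F \<union> G" c] by auto
qed

section \<open>Geodesic order and tensor products\<close>

lemma partition_on_id_diagram: "partition_on (vertices k) (id_diagram k)"
  by (auto simp: partition_on_def disjoint_def id_diagram_def vertices_def)

lemma id_diagram_in_diagrams [simp]: "id_diagram k \<in> diagrams k"
  using partition_on_id_diagram by (simp add: diagrams_def)

lemma diagramsD: "p \<in> diagrams k \<Longrightarrow> partition_on (vertices k) p"
  by (simp add: diagrams_def)

lemma join_in_diagrams: "p \<in> diagrams k \<Longrightarrow> q \<in> diagrams k \<Longrightarrow> join p q \<in> diagrams k"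
  by (simp add: diagrams_def partition_on_join)

lemma finite_diagram: "p \<in> diagrams k \<Longrightarrow> finite p"
  using finite_elements[OF finite_vertices diagramsD] .

text \<open>The block numbers of \<open>id_diagram k\<close> and of \<open>q\<close> cancel, so the
  order becomes an equation between natural numbers.\<close>

lemma geodesic_le_iff:
  "geodesic_le k p q \<longleftrightarrow>
     card (join p (id_diagram k)) + card (join p q) = card p + card (join (id_diagram k) q)"
  unfolding geodesic_le_def diagram_dist_def join_commute[of "id_diagram k" p]
  by (auto simp: field_simps)

text \<open>The triangle inequality for a path from \<open>a\<close> to \<open>q\<close> through
  \<open>p\<close>, with its equality case. Semimodularity over the common refinement
  \<open>p\<close> gives the first part, and the join of the two joins is coarser than
  \<open>join a q\<close>. If no block is lost there, the two are equal, and \<open>p\<close>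
  refines \<open>join a q\<close>.\<close>

lemma card_join_join:
  assumes X: "finite X" and a: "partition_on X a" and p: "partition_on X p" and q: "partition_on X q"
  shows "card (join p a) + card (join p q) \<le> card p + card (join (join p a) (join p q))"
    and "card (join (join p a) (join p q)) \<le> card (join a q)"
    and "card (join (join p a) (join p q)) = card (join a q) \<Longrightarrow> refines X p (join a q)"
proof -
  have r: "refines X p (join p a)" "refines X p (join p q)"
    "refines X a (join p a)" "refines X q (join p q)"
    using join_is_finest(1,2)[OF p a] join_is_finest(1,2)[OF p q] by blast+
  have j: "partition_on X (join p a)" "partition_on X (join p q)"
    using partition_on_join p a q by blast+
  note jj = join_is_finest(1,2)[OF j]
  show "card (join p a) + card (join p q) \<le> card p + card (join (join p a) (join p q))"
    by (rule partition_semimodular[OF X r(1,2)])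
  have le: "refines X (join a q) (join (join p a) (join p q))"
    by (rule join_is_finest(3)[OF a q]) (use refines_trans[OF r(3) jj(1)] refines_trans[OF r(4) jj(2)] in blast)+
  show "card (join (join p a) (join p q)) \<le> card (join a q)"
    using refines_card_le(1)[OF le X] .
  show "refines X p (join a q)" if "card (join (join p a) (join p q)) = card (join a q)"
    using refines_card_le(2)[OF le X that] refines_trans[OF r(1) jj(1)] by simp
qed

lemma diagram_dist_triangle:
  assumes "finite X" "partition_on X a" "partition_on X p" "partition_on X q"
  shows "diagram_dist a q \<le> diagram_dist a p + diagram_dist p q"
  using card_join_join(1,2)[OF assms] unfolding diagram_dist_def join_commute[of a p]
  by (simp add: field_simps)

lemma geodesic_le_refines:
  assumes p: "p \<in> diagrams k" and q: "q \<in> diagrams k" and le: "geodesic_le k p q"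
  shows "refines (vertices k) p (join (id_diagram k) q)"
proof -
  note j = card_join_join[OF finite_vertices partition_on_id_diagram diagramsD[OF p] diagramsD[OF q]]
  show ?thesis by (rule j(3)) (use j(1,2) le in \<open>simp add: geodesic_le_iff\<close>)
qed

lemma geodesic_le_trans:
  assumes "p \<in> diagrams k" "q \<in> diagrams k" "r \<in> diagrams k" "geodesic_le k p q" "geodesic_le k q r"
  shows "geodesic_le k p r"
proof -
  note tr = diagram_dist_triangle[OF finite_vertices]
  show ?thesis
    using tr[of k "id_diagram k" p r] tr[of k p q r] assms partition_on_id_diagram
    unfolding geodesic_le_def diagrams_def by fastforce
qed

definition shift :: "nat \<Rightarrow> nat + nat \<Rightarrow> nat + nat" where
  "shift k = map_sum ((+) k) ((+) k)"

lemma shift_simps [simp]: "shift k (Inl i) = Inl (k + i)" "shift k (Inr i) = Inr (k + i)"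
  by (simp_all add: shift_def)

lemma inj_shift: "inj_on (shift k) A"
  unfolding shift_def by (rule inj_on_subset[of _ UNIV]) (auto intro!: sum.inj_map)

lemma vertices_iff [simp]: "Inl i \<in> vertices k \<longleftrightarrow> i < k" "Inr i \<in> vertices k \<longleftrightarrow> i < k"
  by (auto simp: vertices_def)

lemma vertices_add: "vertices (k + l) = vertices k \<union> shift k ` vertices l"
proof (intro equalityI subsetI)
  fix v assume v: "v \<in> vertices (k + l)"
  show "v \<in> vertices k \<union> shift k ` vertices l"
  proof (cases v)
    case (Inl i)
    then show ?thesis using v image_eqI[of v "shift k" "Inl (i - k)" "vertices l"]
      by (cases "i < k") auto
  next
    case (Inr i)
    then show ?thesis using v image_eqI[of v "shift k" "Inr (i - k)" "vertices l"]
      by (cases "i < k") auto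
  qed
qed (auto simp: vertices_def)

lemma vertices_shift_disjoint: "vertices k \<inter> shift k ` A = {}"
proof -
  have "shift k v \<notin> vertices k" for v by (cases v) auto
  then show ?thesis by blast
qed

lemma diagram_tensor_alt: "diagram_tensor k p q = p \<union> (`) (shift k) ` q"
  by (simp add: diagram_tensor_def shift_def)

lemma diagram_tensor_in_diagrams:
  assumes "p \<in> diagrams k" "q \<in> diagrams l"
  shows "diagram_tensor k p q \<in> diagrams (k + l)"
  unfolding diagrams_def diagram_tensor_alt vertices_add
  using partition_on_Un[OF diagramsD[OF assms(1)]
      partition_on_image_inj[OF diagramsD[OF assms(2)] inj_shift] vertices_shift_disjoint] by simp

lemma diagram_tensor_disjoint:
  assumes "p \<in> diagrams k" "q \<in> diagrams l"
  shows "\<Union>p \<inter> \<Union>((`) (shift k) ` q) = {}"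
  using vertices_shift_disjoint[of k "\<Union>q"] partition_onD1[OF diagramsD[OF assms(1)]]
  by (simp add: image_Union)

lemma card_diagram_tensor:
  assumes p: "p \<in> diagrams k" and q: "q \<in> diagrams l"
  shows "card (diagram_tensor k p q) = card p + card q"
proof -
  have "p \<inter> (`) (shift k) ` q = {}"
  proof (rule equals0I)
    fix b assume b: "b \<in> p \<inter> (`) (shift k) ` q"
    then have "b \<subseteq> \<Union>p \<inter> \<Union>((`) (shift k) ` q)" by blast
    then show False using diagram_tensor_disjoint[OF p q] partition_onD3[OF diagramsD[OF p]] b by simp
  qed
  moreover have "card ((`) (shift k) ` q) = card q"
    by (rule card_image) (simp add: inj_on_def inj_image_eq_iff[OF inj_shift])
  ultimately show ?thesis
    unfolding diagram_tensor_alt using finite_diagram p q by (simp add: card_Un_disjoint)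
qed

lemma join_diagram_tensor:
  assumes p: "p \<in> diagrams k" "p' \<in> diagrams k" and q: "q \<in> diagrams l" "q' \<in> diagrams l"
  shows "join (diagram_tensor k p q) (diagram_tensor k p' q') = diagram_tensor k (join p p') (join q q')"
proof -
  have ne: "{} \<notin> p \<union> p'" "{} \<notin> q \<union> q'" using partition_onD3[OF diagramsD[OF p(1)]] partition_onD3[OF diagramsD[OF p(2)]]
      partition_onD3[OF diagramsD[OF q(1)]] partition_onD3[OF diagramsD[OF q(2)]] by auto
  have "\<Union>(p \<union> p') \<inter> \<Union>((`) (shift k) ` (q \<union> q')) = {}"
    using diagram_tensor_disjoint[OF p(1) q(1)] diagram_tensor_disjoint[OF p(2) q(1)]
      diagram_tensor_disjoint[OF p(1) q(2)] diagram_tensor_disjoint[OF p(2) q(2)]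
    by (simp add: Int_Un_distrib Int_Un_distrib2 image_Un)
  then have "merge ((p \<union> p') \<union> (`) (shift k) ` (q \<union> q')) =
      merge (p \<union> p') \<union> (`) (shift k) ` merge (q \<union> q')"
    using ne by (subst merge_Un) (auto simp: merge_image[OF inj_shift])
  moreover have "diagram_tensor k p q \<union> diagram_tensor k p' q' =
      (p \<union> p') \<union> (`) (shift k) ` (q \<union> q')"
    unfolding diagram_tensor_alt by blast
  ultimately show ?thesis by (simp add: join_def diagram_tensor_alt)
qed

lemma id_diagram_add: "id_diagram (k + l) = diagram_tensor k (id_diagram k) (id_diagram l)"
proof -
  have "{..<k + l} = {..<k} \<union> (+) k ` {..<l}"
  proof (intro equalityI subsetI)
    fix i assume "i \<in> {..<k + l}"
    then show "i \<in> {..<k} \<union> (+) k ` {..<l}"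
      using image_eqI[of i "(+) k" "i - k" "{..<l}"] by (cases "i < k") auto
  qed auto
  then show ?thesis by (simp add: id_diagram_def diagram_tensor_alt image_Un image_image)
qed

lemma diagram_dist_tensor:
  assumes p: "p \<in> diagrams k" "p' \<in> diagrams k" and q: "q \<in> diagrams l" "q' \<in> diagrams l"
  shows "diagram_dist (diagram_tensor k p q) (diagram_tensor k p' q') =
    diagram_dist p p' + diagram_dist q q'"
  unfolding diagram_dist_def join_diagram_tensor[OF assms]
    card_diagram_tensor[OF p(1) q(1)] card_diagram_tensor[OF p(2) q(2)]
    card_diagram_tensor[OF join_in_diagrams[OF p] join_in_diagrams[OF q]]
  by (simp add: field_simps)

text \<open>Distances add over tensor products. The triangle inequality makes the defect of each
  factor nonnegative, so the sum of the two defects vanishes only if both do.\<close>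

lemma geodesic_le_tensor_iff:
  assumes p: "p \<in> diagrams k" "p' \<in> diagrams k" and q: "q \<in> diagrams l" "q' \<in> diagrams l"
  shows "geodesic_le (k + l) (diagram_tensor k p q) (diagram_tensor k p' q') \<longleftrightarrow>
    geodesic_le k p p' \<and> geodesic_le l q q'"
proof -
  have "diagram_dist (id_diagram k) p' \<le> diagram_dist (id_diagram k) p + diagram_dist p p'"
    "diagram_dist (id_diagram l) q' \<le> diagram_dist (id_diagram l) q + diagram_dist q q'"
    using diagram_dist_triangle[OF finite_vertices partition_on_id_diagram] p q
    by (auto simp: diagrams_def)
  then show ?thesis
    unfolding geodesic_le_def id_diagram_add diagram_dist_tensor[OF p q]
      diagram_dist_tensor[OF id_diagram_in_diagrams p(1) id_diagram_in_diagrams q(1)]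
      diagram_dist_tensor[OF id_diagram_in_diagrams p(2) id_diagram_in_diagrams q(2)]
    by linarith
qed

lemma diagram_tensor_parts:
  assumes p: "p \<in> diagrams k" and q: "q \<in> diagrams l"
  shows "p = {b \<in> diagram_tensor k p q. b \<subseteq> vertices k}"
    and "q = {b. b \<noteq> {} \<and> shift k ` b \<in> diagram_tensor k p q}"
proof -
  have a: "b \<subseteq> vertices k \<and> b \<noteq> {}" if "b \<in> p" for b
    using that p partition_onD1[OF diagramsD[OF p]] partition_onD3[OF diagramsD[OF p]] by auto
  have b: "b \<noteq> {}" if "b \<in> q" for b using that partition_onD3[OF diagramsD[OF q]] by auto
  have c: "\<not> shift k ` b \<subseteq> vertices k" if "b \<noteq> {}" for b
    using that vertices_shift_disjoint[of k b] by blast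
  show "p = {b \<in> diagram_tensor k p q. b \<subseteq> vertices k}"
    unfolding diagram_tensor_alt using a b c by auto
  show "q = {b. b \<noteq> {} \<and> shift k ` b \<in> diagram_tensor k p q}"
  proof (intro equalityI subsetI)
    fix x assume x: "x \<in> {b. b \<noteq> {} \<and> shift k ` b \<in> diagram_tensor k p q}"
    then have "shift k ` x \<notin> p" using a c by blast
    then have "shift k ` x \<in> (`) (shift k) ` q" using x unfolding diagram_tensor_alt by blast
    then show "x \<in> q" by (auto simp: inj_image_eq_iff[OF inj_shift])
  qed (auto simp: diagram_tensor_alt b)
qed

lemma diagram_tensor_inject:
  assumes "p \<in> diagrams k" "q \<in> diagrams l" "p' \<in> diagrams k" "q' \<in> diagrams l"
  shows "diagram_tensor k p q = diagram_tensor k p' q' \<longleftrightarrow> p = p' \<and> q = q'"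
  using diagram_tensor_parts[OF assms(1,2)] diagram_tensor_parts[OF assms(3,4)] by metis

lemma diagram_tensor_decompose:
  assumes r: "r \<in> diagrams (k + l)" and sep: "\<And>b. b \<in> r \<Longrightarrow> b \<subseteq> vertices k \<or> b \<inter> vertices k = {}"
  obtains p q where "p \<in> diagrams k" "q \<in> diagrams l" "r = diagram_tensor k p q"
proof
  define p where "p = {b \<in> r. b \<subseteq> vertices k}"
  define q where "q = {b. shift k ` b \<in> r}"
  note part = diagramsD[OF r]
  have im: "\<exists>c. b = shift k ` c" if "b \<in> r" "b \<inter> vertices k = {}" for b
  proof -
    have "b \<subseteq> shift k ` vertices l" using that partition_onD1[OF part] vertices_add by blast
    then show ?thesis by (meson subset_imageE)
  qed
  show "r = diagram_tensor k p q"
  proof (intro equalityI subsetI)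
    fix x assume x: "x \<in> r"
    show "x \<in> diagram_tensor k p q"
    proof (cases "x \<subseteq> vertices k")
      case False
      then obtain c where "x = shift k ` c" using im[OF x] sep[OF x] by blast
      then show ?thesis using x by (auto simp: diagram_tensor_alt q_def)
    qed (use x in \<open>simp add: diagram_tensor_alt p_def\<close>)
  qed (auto simp: diagram_tensor_alt p_def q_def)
  have sub: "\<Union>p \<subseteq> vertices k" unfolding p_def by blast
  have "v \<in> \<Union>p" if "v \<in> vertices k" for v
  proof -
    have "v \<in> \<Union>r" using that partition_onD1[OF part] vertices_add by blast
    then show ?thesis using that sep unfolding p_def by blast
  qed
  then have Up: "\<Union>p = vertices k" using sub by blast
  have "partition_on (vertices k) p"
    using Up disjointD[OF partition_onD2[OF part]] partition_onD3[OF part]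
    by (intro partition_onI) (auto simp: p_def disjnt_def)
  then show "p \<in> diagrams k" by (simp add: diagrams_def)
  have sq: "shift k v \<in> \<Union>r \<longleftrightarrow> v \<in> vertices l" for v
    using partition_onD1[OF part, symmetric] vertices_add[of k l] vertices_shift_disjoint[of k "{v}"]
      inj_image_mem_iff[OF inj_shift, of k v "vertices l"] by auto
  have "\<Union>q = vertices l"
  proof (intro equalityI subsetI)
    fix v assume "v \<in> \<Union>q"
    then have "shift k v \<in> \<Union>r" unfolding q_def by blast
    then show "v \<in> vertices l" using sq by blast
  next
    fix v assume "v \<in> vertices l"
    then obtain b where b: "b \<in> r" "shift k v \<in> b" using sq by blast
    have "shift k v \<notin> vertices k" using vertices_shift_disjoint[of k "{v}"] by blast
    then obtain c where "b = shift k ` c" using im[OF b(1)] sep[OF b(1)] b(2) by blast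
    then show "v \<in> \<Union>q" using b inj_image_mem_iff[OF inj_shift] unfolding q_def by blast
  qed
  moreover have "disjnt b c" if "b \<in> q" "c \<in> q" "b \<noteq> c" for b c
  proof -
    have "shift k ` b \<inter> shift k ` c = {}"
      using that disjointD[OF partition_onD2[OF part]] inj_image_eq_iff[OF inj_shift]
      unfolding q_def by (metis mem_Collect_eq)
    then show ?thesis unfolding disjnt_def by blast
  qed
  ultimately have "partition_on (vertices l) q"
    using partition_onD3[OF part] by (intro partition_onI) (auto simp: q_def)
  then show "q \<in> diagrams l" by (simp add: diagrams_def)
qed

lemma diagram_tensor_separates:
  assumes "p \<in> diagrams k" "q \<in> diagrams l" "b \<in> diagram_tensor k p q"
  shows "b \<subseteq> vertices k \<or> b \<inter> vertices k = {}"
proof (cases "b \<in> p")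
  case True
  then show ?thesis using partition_onD1[OF diagramsD[OF assms(1)]] by blast
next
  case False
  then show ?thesis using assms(3) vertices_shift_disjoint[of k] unfolding diagram_tensor_alt by blast
qed

text \<open>A diagram below a tensor product refines its cycles, and none of these meets both
  sides.\<close>

lemma geodesic_le_tensor_decompose:
  assumes r: "r \<in> diagrams (k + l)" and p: "p \<in> diagrams k" and q: "q \<in> diagrams l"
    and le: "geodesic_le (k + l) r (diagram_tensor k p q)"
  obtains p' q' where "p' \<in> diagrams k" "q' \<in> diagrams l" "r = diagram_tensor k p' q'"
    "geodesic_le k p' p" "geodesic_le l q' q"
proof -
  have j: "join (id_diagram (k + l)) (diagram_tensor k p q) =
      diagram_tensor k (join (id_diagram k) p) (join (id_diagram l) q)"
    unfolding id_diagram_add by (rule join_diagram_tensor) (use p q in auto)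
  have ref: "refines (vertices (k + l)) r (diagram_tensor k (join (id_diagram k) p) (join (id_diagram l) q))"
    using geodesic_le_refines[OF r diagram_tensor_in_diagrams[OF p q] le] unfolding j .
  have jd: "join (id_diagram k) p \<in> diagrams k" "join (id_diagram l) q \<in> diagrams l"
    using p q join_in_diagrams by auto
  obtain p' q' where pq: "p' \<in> diagrams k" "q' \<in> diagrams l" "r = diagram_tensor k p' q'"
  proof (rule diagram_tensor_decompose[OF r])
    fix b assume "b \<in> r"
    then obtain c where "c \<in> diagram_tensor k (join (id_diagram k) p) (join (id_diagram l) q)" "b \<subseteq> c"
      using refinesE[OF ref] by blast
    then show "b \<subseteq> vertices k \<or> b \<inter> vertices k = {}"
      using diagram_tensor_separates[OF jd, of c] by blast
  qed
  then show ?thesis using that geodesic_le_tensor_iff[OF pq(1) p pq(2) q] le by blast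
qed

section \<open>Cumulants of tensor products\<close>

lemma sum_tensor_below:
  assumes sub: "\<And>k. \<C> k \<subseteq> diagrams k"
    and closed: "\<And>k l p q. \<lbrakk>p \<in> diagrams k; q \<in> diagrams l\<rbrakk> \<Longrightarrow>
        diagram_tensor k p q \<in> \<C> (k + l) \<longleftrightarrow> p \<in> \<C> k \<and> q \<in> \<C> l"
    and p: "p \<in> \<C> k" and q: "q \<in> \<C> l"
  shows "(\<Sum>r\<in>{r \<in> \<C> (k + l). geodesic_le (k + l) r (diagram_tensor k p q)}. h r) =
    (\<Sum>(p', q')\<in>{p' \<in> \<C> k. geodesic_le k p' p} \<times> {q' \<in> \<C> l. geodesic_le l q' q}.
       h (diagram_tensor k p' q'))" (is "sum _ ?R = sum _ (?P \<times> ?Q)")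
proof -
  have pd: "p \<in> diagrams k" "q \<in> diagrams l" using p q sub by blast+
  have inj: "inj_on (\<lambda>(p', q'). diagram_tensor k p' q') (?P \<times> ?Q)"
  proof (rule inj_onI)
    fix x y assume xy: "x \<in> ?P \<times> ?Q" "y \<in> ?P \<times> ?Q"
      "(\<lambda>(p', q'). diagram_tensor k p' q') x = (\<lambda>(p', q'). diagram_tensor k p' q') y"
    then have "fst x \<in> diagrams k" "snd x \<in> diagrams l" "fst y \<in> diagrams k" "snd y \<in> diagrams l"
      using subsetD[OF sub] xy(1,2) by (auto simp: mem_Times_iff)
    then show "x = y" using xy(3) by (simp add: case_prod_unfold prod_eq_iff diagram_tensor_inject)
  qed
  have "?R = (\<lambda>(p', q'). diagram_tensor k p' q') ` (?P \<times> ?Q)"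
  proof (intro equalityI subsetI)
    fix r assume r: "r \<in> ?R"
    then have rd: "r \<in> diagrams (k + l)" using sub by blast
    obtain p' q' where d: "p' \<in> diagrams k" "q' \<in> diagrams l" "r = diagram_tensor k p' q'"
      "geodesic_le k p' p" "geodesic_le l q' q"
      by (rule geodesic_le_tensor_decompose[OF rd pd]) (use r in auto)
    then have "(p', q') \<in> ?P \<times> ?Q" using r closed by auto
    then show "r \<in> (\<lambda>(p', q'). diagram_tensor k p' q') ` (?P \<times> ?Q)" using d(3) by force
  next
    fix r assume "r \<in> (\<lambda>(p', q'). diagram_tensor k p' q') ` (?P \<times> ?Q)"
    then obtain p' q' where d: "p' \<in> \<C> k" "q' \<in> \<C> l" "r = diagram_tensor k p' q'"
      "geodesic_le k p' p" "geodesic_le l q' q" by auto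
    then have "p' \<in> diagrams k" "q' \<in> diagrams l" using sub by blast+
    then show "r \<in> ?R" using d closed geodesic_le_tensor_iff pd by auto
  qed
  then show ?thesis using sum.reindex[OF inj, of h] by (simp add: case_prod_unfold o_def)
qed

text \<open>The lower set of a tensor product is the product of the lower sets of its factors. Hence
  the cumulants of tensor products and the products of cumulants solve the same system over the
  product order, with the same moments on the other side, and Moebius inversion has only one
  solution.\<close>

lemma cumulant_tensor_multiplicative:
  assumes sub: "\<And>k. \<C> k \<subseteq> diagrams k"
    and closed: "\<And>k l p q. \<lbrakk>p \<in> diagrams k; q \<in> diagrams l\<rbrakk> \<Longrightarrow>
        diagram_tensor k p q \<in> \<C> (k + l) \<longleftrightarrow> p \<in> \<C> k \<and> q \<in> \<C> l"
    and cum: "is_cumulant_family scale m \<C> \<kappa>"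
    and len: "length as = k" "length bs = l"
    and mult: "\<And>p q. \<lbrakk>p \<in> diagrams k; q \<in> diagrams l\<rbrakk> \<Longrightarrow>
        m (diagram_tensor k p q) (as @ bs) = m p as * m q bs"
    and p: "p \<in> \<C> k" and q: "q \<in> \<C> l"
  shows "\<kappa> (diagram_tensor k p q) (as @ bs) = \<kappa> p as * \<kappa> q bs"
proof -
  let ?le = "\<lambda>x y. geodesic_le k (fst x) (fst y) \<and> geodesic_le l (snd x) (snd y)"
  let ?f = "\<lambda>x. diagram_dist (id_diagram k) (fst x) + diagram_dist (id_diagram l) (snd x)"
  let ?S = "\<C> k \<times> \<C> l"
  have msum: "m r cs = (\<Sum>r'\<in>{r' \<in> \<C> j. geodesic_le j r' r}. \<kappa> r' cs)"
    if "r \<in> \<C> j" "length cs = j" for r cs j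
    using cum that unfolding is_cumulant_family_def by blast
  have "(\<lambda>x. \<kappa> (diagram_tensor k (fst x) (snd x)) (as @ bs)) (p, q) =
      (\<lambda>x. \<kappa> (fst x) as * \<kappa> (snd x) bs) (p, q)"
  proof (rule moebius_unique[where S = ?S and le = ?le and f = ?f])
    show "finite ?S" using sub finite_diagrams finite_subset by (metis finite_cartesian_product)
    show "?le x x" if "x \<in> ?S" for x
      using that sub geodesic_le_refl by (metis mem_Times_iff subsetD)
    show "?f x < ?f y" if xy: "x \<in> ?S" "y \<in> ?S" "?le x y" "x \<noteq> y" for x y
    proof -
      have d: "fst x \<in> diagrams k" "fst y \<in> diagrams k" "snd x \<in> diagrams l" "snd y \<in> diagrams l"
        using xy(1,2) subsetD[OF sub] by (auto simp: mem_Times_iff)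
      have "fst x \<noteq> fst y \<or> snd x \<noteq> snd y" using xy(4) by (simp add: prod_eq_iff)
      then show ?thesis
        using geodesic_le_dist_less[OF d(1,2)] geodesic_le_dist_less[OF d(3,4)] xy(3)
        by (cases "fst x = fst y"; cases "snd x = snd y") fastforce+
    qed
    show "(p, q) \<in> ?S" using p q by simp
    show "(\<Sum>y\<in>{y \<in> ?S. ?le y x}. \<kappa> (diagram_tensor k (fst y) (snd y)) (as @ bs)) =
      (\<Sum>y\<in>{y \<in> ?S. ?le y x}. \<kappa> (fst y) as * \<kappa> (snd y) bs)" if xS: "x \<in> ?S" for x
    proof -
      obtain p q where x: "x = (p, q)" "p \<in> \<C> k" "q \<in> \<C> l" using xS by (cases x) auto
      have pd: "p \<in> diagrams k" "q \<in> diagrams l" using x sub by auto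
      have eq: "{y \<in> ?S. ?le y x} =
          {p' \<in> \<C> k. geodesic_le k p' p} \<times> {q' \<in> \<C> l. geodesic_le l q' q}" using x by auto
      have t: "diagram_tensor k p q \<in> \<C> (k + l)" using closed[OF pd] x by simp
      have "(\<Sum>y\<in>{y \<in> ?S. ?le y x}. \<kappa> (diagram_tensor k (fst y) (snd y)) (as @ bs)) =
          m (diagram_tensor k p q) (as @ bs)"
        unfolding eq msum[OF t, of "as @ bs", simplified len length_append, OF refl]
        by (subst sum_tensor_below[OF sub closed x(2,3)]) (simp_all add: case_prod_unfold)
      also have "\<dots> = m p as * m q bs" using mult[OF pd] .
      also have "\<dots> = (\<Sum>y\<in>{y \<in> ?S. ?le y x}. \<kappa> (fst y) as * \<kappa> (snd y) bs)"
        unfolding eq msum[OF x(2) len(1)] msum[OF x(3) len(2)]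
        by (simp add: sum_product sum.cartesian_product case_prod_unfold)
      finally show ?thesis .
    qed
  qed
  then show ?thesis by simp
qed


section \<open>Permutations as diagrams\<close>

lemma perm_diagram_in_diagrams:
  assumes "\<sigma> permutes {..<k}"
  shows "perm_diagram k \<sigma> \<in> diagrams k"
proof -
  have inj: "\<sigma> i = \<sigma> j \<longleftrightarrow> i = j" for i j using permutes_inj[OF assms] by (auto dest: injD)
  have im: "\<sigma> ` {..<k} = {..<k}" using permutes_image[OF assms] .
  have "\<Union>(perm_diagram k \<sigma>) = Inl ` {..<k} \<union> Inr ` \<sigma> ` {..<k}"
    by (auto simp: perm_diagram_def)
  then have "\<Union>(perm_diagram k \<sigma>) = vertices k" unfolding im by (auto simp: vertices_def)
  moreover have "disjnt b c" if bc: "b \<in> perm_diagram k \<sigma>" "c \<in> perm_diagram k \<sigma>" "b \<noteq> c" for b c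
  proof -
    obtain i j where "b = {Inl i, Inr (\<sigma> i)}" "c = {Inl j, Inr (\<sigma> j)}"
      using bc unfolding perm_diagram_def by blast
    then show ?thesis using bc(3) inj by (cases "i = j") (auto simp: disjnt_def)
  qed
  moreover have "{} \<notin> perm_diagram k \<sigma>" by (auto simp: perm_diagram_def)
  ultimately have "partition_on (vertices k) (perm_diagram k \<sigma>)" by (rule partition_onI)
  then show ?thesis by (simp add: diagrams_def)
qed

lemma perm_diagram_id: "perm_diagram k id = id_diagram k" "perm_diagram k (\<lambda>x. x) = id_diagram k"
  by (auto simp: perm_diagram_def id_diagram_def)

lemma Inl_Inr_doubleton_eq: "{Inl i, Inr j} = {Inl i', Inr j'} \<longleftrightarrow> i = i' \<and> j = j'"
  by (simp add: doubleton_eq_iff)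

lemma perm_diagram_block_iff:
  assumes "i < k"
  shows "{Inl i, Inr j} \<in> perm_diagram k \<sigma> \<longleftrightarrow> \<sigma> i = j"
proof
  assume "{Inl i, Inr j} \<in> perm_diagram k \<sigma>"
  then obtain x where "{Inl i, Inr j} = {Inl x, Inr (\<sigma> x)}" unfolding perm_diagram_def by blast
  then show "\<sigma> i = j" unfolding Inl_Inr_doubleton_eq by simp
next
  assume "\<sigma> i = j"
  then show "{Inl i, Inr j} \<in> perm_diagram k \<sigma>" unfolding perm_diagram_def using assms by blast
qed

lemma perm_diagram_inject:
  assumes "\<sigma> permutes {..<k}" "\<tau> permutes {..<k}" "perm_diagram k \<sigma> = perm_diagram k \<tau>"
  shows "\<sigma> = \<tau>"
proof
  fix i
  show "\<sigma> i = \<tau> i"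
  proof (cases "i < k")
    case True
    then show ?thesis
      using perm_diagram_block_iff[OF True, of "\<sigma> i" \<sigma>] perm_diagram_block_iff[OF True, of "\<sigma> i" \<tau>] assms(3)
      by simp
  next
    case False
    then show ?thesis using assms(1,2) by (simp add: permutes_def)
  qed
qed

lemma card_perm_diagram [simp]: "card (perm_diagram k \<sigma>) = k"
  unfolding perm_diagram_def by (subst card_image) (auto simp: inj_on_def doubleton_eq_iff)

lemma card_id_diagram [simp]: "card (id_diagram k) = k"
  using card_perm_diagram[of k id] by (simp add: perm_diagram_id)

text \<open>Disjointness of the blocks makes the map from top vertices to their partners injective,
  and finiteness makes it bijective. Outside the \<open>k\<close> positions it is extended by the
  identity, as \<open>permutes\<close> requires.\<close>

lemma perm_diagramsI:
  assumes p: "p \<in> diagrams k" and b: "\<And>b. b \<in> p \<Longrightarrow> \<exists>i j. b = {Inl i, Inr j}"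
  shows "p \<in> perm_diagrams k"
proof -
  note part = diagramsD[OF p]
  have "\<exists>j. {Inl i, Inr j} \<in> p" if "i < k" for i
  proof -
    have "Inl i \<in> \<Union>p" using that partition_onD1[OF part] vertices_iff(1)[of i k] by blast
    then obtain c where c: "c \<in> p" "Inl i \<in> c" by blast
    then show ?thesis using b[OF c(1)] by auto
  qed
  then obtain s where s: "\<And>i. i < k \<Longrightarrow> {Inl i, Inr (s i)} \<in> p" by metis
  define \<sigma> where "\<sigma> i = (if i < k then s i else i)" for i
  have \<sigma>: "{Inl i, Inr (\<sigma> i)} \<in> p" if "i < k" for i using s that by (simp add: \<sigma>_def)
  have lt: "\<sigma> i < k" if "i < k" for i
    using \<sigma>[OF that] partition_onD1[OF part] vertices_iff(2)[of "\<sigma> i" k] by blast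
  have "inj_on \<sigma> {..<k}"
  proof (rule inj_onI)
    fix i j assume "i \<in> {..<k}" "j \<in> {..<k}" "\<sigma> i = \<sigma> j"
    then have "{Inl i, Inr (\<sigma> i)} = {Inl j, Inr (\<sigma> j)}"
      using partition_on_block_eq[OF part \<sigma> \<sigma>, of i j "Inr (\<sigma> i)"] by simp
    then show "i = j" by (auto simp: doubleton_eq_iff)
  qed
  then have "bij_betw \<sigma> {..<k} {..<k}"
    using lt endo_inj_surj[of "{..<k}" \<sigma>] by (auto simp: bij_betw_def)
  then have perm: "\<sigma> permutes {..<k}" by (rule bij_imp_permutes) (simp add: \<sigma>_def)
  have "perm_diagram k \<sigma> \<subseteq> p" using \<sigma> by (auto simp: perm_diagram_def)
  moreover have "c \<in> perm_diagram k \<sigma>" if c: "c \<in> p" for c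
  proof -
    obtain i j where ij: "c = {Inl i, Inr j}" using b[OF c] by blast
    have "i < k" using c ij partition_onD1[OF part] vertices_iff(1)[of i k] by blast
    then have "c = {Inl i, Inr (\<sigma> i)}"
      by (intro partition_on_block_eq[OF part c \<sigma>, of i "Inl i"]) (auto simp: ij)
    then show ?thesis using \<open>i < k\<close> by (auto simp: perm_diagram_def)
  qed
  ultimately have "p = perm_diagram k \<sigma>" by blast
  then show ?thesis using perm by (auto simp: perm_diagrams_def)
qed

lemma perm_diagramsE:
  assumes "p \<in> perm_diagrams k"
  obtains \<sigma> where "\<sigma> permutes {..<k}" "p = perm_diagram k \<sigma>"
  using assms by (auto simp: perm_diagrams_def)

lemma perm_diagrams_subset: "perm_diagrams k \<subseteq> diagrams k"
  using perm_diagram_in_diagrams by (auto simp: perm_diagrams_def)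

lemma perm_diagrams_block:
  assumes "p \<in> perm_diagrams k" "b \<in> p"
  shows "\<exists>i j. b = {Inl i, Inr j}"
  using assms by (auto simp: perm_diagrams_def perm_diagram_def)

lemma perm_diagrams_tensor_iff:
  assumes "p \<in> diagrams k" "q \<in> diagrams l"
  shows "diagram_tensor k p q \<in> perm_diagrams (k + l) \<longleftrightarrow> p \<in> perm_diagrams k \<and> q \<in> perm_diagrams l"
proof
  assume pq: "p \<in> perm_diagrams k \<and> q \<in> perm_diagrams l"
  show "diagram_tensor k p q \<in> perm_diagrams (k + l)"
  proof (rule perm_diagramsI[OF diagram_tensor_in_diagrams[OF assms]])
    fix b assume b: "b \<in> diagram_tensor k p q"
    show "\<exists>i j. b = {Inl i, Inr j}"
    proof (cases "b \<in> p")
      case False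
      then obtain c where c: "c \<in> q" "b = shift k ` c" using b by (auto simp: diagram_tensor_alt)
      then obtain i j where "c = {Inl i, Inr j}" using pq perm_diagrams_block by metis
      then show ?thesis using c by auto
    qed (use pq perm_diagrams_block in metis)
  qed
next
  assume t: "diagram_tensor k p q \<in> perm_diagrams (k + l)"
  have "\<exists>i j. b = {Inl i, Inr j}" if "b \<in> p" for b
    using perm_diagrams_block[OF t, of b] that by (simp add: diagram_tensor_alt)
  moreover have "\<exists>i j. b = {Inl i, Inr j}" if "b \<in> q" for b
  proof -
    have "shift k ` b \<in> diagram_tensor k p q" using that by (simp add: diagram_tensor_alt)
    then obtain i j where ij: "shift k ` b = {Inl i, Inr j}" using perm_diagrams_block[OF t] by blast
    then obtain u v where uv: "u \<in> b" "v \<in> b" "shift k u = Inl i" "shift k v = Inr j"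
      by (metis image_iff insertCI)
    obtain i' where u: "u = Inl i'" using uv(3) by (cases u) auto
    obtain j' where v: "v = Inr j'" using uv(4) by (cases v) auto
    have "shift k ` b = shift k ` {u, v}" using ij uv by simp
    then have "b = {u, v}" by (simp only: inj_image_eq_iff[OF inj_shift])
    then show ?thesis using u v by blast
  qed
  ultimately show "p \<in> perm_diagrams k \<and> q \<in> perm_diagrams l"
    using assms perm_diagramsI by blast
qed

subsection \<open>Composition with permutations\<close>

lemma partition_on_pullback:
  assumes "partition_on Y p" "g ` X = Y"
  shows "partition_on X ((\<lambda>b. X \<inter> g -` b) ` p)"
proof (rule partition_onI)
  note Y = partition_onD1[OF assms(1)]
  show "\<Union> ((\<lambda>b. X \<inter> g -` b) ` p) = X" using assms(2) Y by blast
  show "{} \<notin> (\<lambda>b. X \<inter> g -` b) ` p"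
  proof
    assume "{} \<in> (\<lambda>b. X \<inter> g -` b) ` p"
    then obtain b where b: "b \<in> p" "X \<inter> g -` b = {}" by blast
    then obtain y where "y \<in> b" using partition_onD3[OF assms(1)] by fastforce
    moreover have "b \<subseteq> g ` X" using b assms(2) Y by blast
    ultimately show False using b by blast
  qed
  fix c d assume cd: "c \<in> (\<lambda>b. X \<inter> g -` b) ` p" "d \<in> (\<lambda>b. X \<inter> g -` b) ` p" "c \<noteq> d"
  then obtain c' d' where "c' \<in> p" "d' \<in> p" "c = X \<inter> g -` c'" "d = X \<inter> g -` d'" by blast
  moreover from this cd(3) have "c' \<inter> d' = {}"
    using disjointD[OF partition_onD2[OF assms(1)]] by blast
  ultimately show "disjnt c d" unfolding disjnt_def by blast
qed

text \<open>A way to compute components by contraction: \<open>g\<close> identifies vertices that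
  are connected anyway, and the last hypothesis certifies that the preimage of a block of
  \<open>p\<close> really is connected.\<close>

lemma merge_eq_pullback:
  assumes "partition_on Y p" "g ` X = Y" "\<Union>F = X" "\<And>b. b \<in> F \<Longrightarrow> \<exists>c\<in>p. g ` b \<subseteq> c"
    and "\<And>c. c \<in> p \<Longrightarrow> \<exists>d\<in>merge F. X \<inter> g -` c \<subseteq> d"
  shows "merge F = (\<lambda>c. X \<inter> g -` c) ` p"
proof (rule merge_eqI)
  show "partition_on (\<Union>F) ((\<lambda>c. X \<inter> g -` c) ` p)"
    unfolding assms(3) by (rule partition_on_pullback[OF assms(1,2)])
  show "\<exists>c\<in>(\<lambda>c. X \<inter> g -` c) ` p. b \<subseteq> c" if b: "b \<in> F" for b
  proof -
    obtain c where "c \<in> p" "g ` b \<subseteq> c" using assms(4)[OF b] by blast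
    moreover have "b \<subseteq> X" using assms(3) b by blast
    ultimately show ?thesis by blast
  qed
  show "\<exists>d\<in>merge F. c \<subseteq> d" if "c \<in> (\<lambda>c. X \<inter> g -` c) ` p" for c
    using assms(5) that by blast
qed

text \<open>Each upper vertex is tied by \<sigma> to one middle vertex, so the three-row diagram is
  connected as \<open>p\<close> is, with every top vertex of \<open>p\<close> represented
  twice.\<close>

lemma diagram_comp_perm_right:
  assumes p: "p \<in> diagrams k" and \<sigma>: "\<sigma> permutes {..<k}"
  shows "diagram_comp p (perm_diagram k \<sigma>) = (`) (map_sum (inv \<sigma>) id) ` p"
proof -
  note part = diagramsD[OF p]
  define u where "u = (case_sum (Pair 0) (Pair 1) :: nat + nat \<Rightarrow> nat \<times> nat)"
  define d where "d = (case_sum (Pair 1) (Pair 2) :: nat + nat \<Rightarrow> nat \<times> nat)"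
  define w where "w = (case_sum (Pair 0) (Pair 2) :: nat + nat \<Rightarrow> nat \<times> nat)"
  have u: "u (Inl i) = (0, i)" "u (Inr i) = (1, i)" for i by (simp_all add: u_def)
  have d: "d (Inl i) = (1, i)" "d (Inr i) = (2, i)" for i by (simp_all add: d_def)
  have w: "w (Inl i) = (0, i)" "w (Inr i) = (2, i)" for i by (simp_all add: w_def)
  define X :: "(nat \<times> nat) set" where "X = {0, 1, 2} \<times> {..<k}"
  \<comment> \<open>\<open>g\<close> contracts the three rows to the two rows of \<open>p\<close>:
    the upper vertex \<open>i\<close> goes where the middle vertex \<open>\<sigma> i\<close> goes.
    Reading the labels of the upper row back therefore applies \<open>inv \<sigma>\<close>.\<close>
  define g where "g = (\<lambda>(a :: nat, i). if a = 2 then Inr i else if a = 1 then Inl i else Inl (\<sigma> i) :: nat + nat)"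
  define F where "F = (`) u ` perm_diagram k \<sigma> \<union> (`) d ` p"
  have g: "g (0, i) = Inl (\<sigma> i)" "g (1, i) = Inl i" "g (2, i) = Inr i" "g (Suc 0, i) = Inl i" for i
    by (simp_all add: g_def)
  have gd: "g (d v) = v" for v by (cases v) (simp_all add: d g)
  have lt: "\<sigma> i < k \<longleftrightarrow> i < k" for i using permutes_in_image[OF \<sigma>, of i] by simp
  have dX: "d v \<in> X \<longleftrightarrow> v \<in> vertices k" for v by (cases v) (simp_all add: d X_def)
  have vert: "v \<in> vertices k" if "b \<in> p" "v \<in> b" for b v using that partition_onD1[OF part] by blast
  have ex: "\<exists>b\<in>p. v \<in> b" if "v \<in> vertices k" for v using that partition_onD1[OF part] by blast
  have gX: "g ` X = vertices k"
  proof (intro equalityI subsetI)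
    fix v assume "v \<in> vertices k"
    then show "v \<in> g ` X" using gd[of v] dX[of v] by (metis imageI)
  qed (auto simp: X_def g lt)
  have UF: "\<Union>F = X"
  proof (intro equalityI subsetI)
    fix x assume "x \<in> \<Union>F"
    then consider i where "i < k" "x = (0, i) \<or> x = (1, \<sigma> i)" | v where "v \<in> vertices k" "x = d v"
      unfolding F_def perm_diagram_def using vert by (auto simp: u)
    then show "x \<in> X"
    proof cases
      case 1
      then show ?thesis by (auto simp: X_def lt)
    next
      case 2
      then show ?thesis by (simp add: dX)
    qed
  next
    fix x assume "x \<in> X"
    then obtain a i where x: "x = (a, i)" "a = 0 \<or> a = 1 \<or> a = 2" "i < k" by (auto simp: X_def)
    then consider "x = u (Inl i)" | v where "v \<in> vertices k" "x = d v"
      using u(1)[of i] d(1)[of i, symmetric] d(2)[of i, symmetric] vertices_iff[of i k] by metis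
    then show "x \<in> \<Union>F"
    proof cases
      case 1
      then have "x \<in> u ` {Inl i, Inr (\<sigma> i)}" by blast
      moreover have "u ` {Inl i, Inr (\<sigma> i)} \<in> F"
        unfolding F_def perm_diagram_def using x(3) by (intro UnI1 imageI) simp
      ultimately show ?thesis by (rule UnionI[rotated])
    next
      case 2
      then obtain b where "b \<in> p" "v \<in> b" using ex by blast
      then have "d ` b \<in> F" "x \<in> d ` b" using 2 by (simp_all add: F_def)
      then show ?thesis by (rule UnionI)
    qed
  qed
  have m: "merge F = (\<lambda>c. X \<inter> g -` c) ` p"
  proof (rule merge_eq_pullback[OF part gX UF])
    fix b assume "b \<in> F"
    then consider i where "i < k" "b = {(0, i), (1, \<sigma> i)}" | c where "c \<in> p" "b = d ` c"
      unfolding F_def perm_diagram_def by (auto simp: u)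
    then show "\<exists>c\<in>p. g ` b \<subseteq> c"
    proof cases
      case 1
      then obtain c where "c \<in> p" "Inl (\<sigma> i) \<in> c" using ex[of "Inl (\<sigma> i)"] lt by auto
      moreover have "g ` b = {Inl (\<sigma> i)}" using 1 by (simp add: g)
      ultimately show ?thesis by auto
    next
      case 2
      then show ?thesis by (auto simp: image_image gd)
    qed
  next
    fix b assume b: "b \<in> p"
    have "d ` b \<in> F" using b by (simp add: F_def)
    moreover have "d ` b \<noteq> {}" using b partition_onD3[OF part] by auto
    ultimately obtain e where e: "e \<in> merge F" "d ` b \<subseteq> e" using merge_upper by blast
    have "x \<in> e" if x: "x \<in> X" "g x \<in> b" for x
    proof -
      obtain a i where ai: "x = (a, i)" "a = 0 \<or> a = 1 \<or> a = 2" "i < k" using x(1) by (auto simp: X_def)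
      show ?thesis
      proof (cases "a = 0")
        case True
        then have "Inl (\<sigma> i) \<in> b" using x ai by (simp add: g)
        then have "(1, \<sigma> i) \<in> e" using e(2) d(1) by (metis imageI subsetD)
        moreover have "{(0, i), (1, \<sigma> i)} \<in> F"
        proof -
          have "u ` {Inl i, Inr (\<sigma> i)} \<in> F" unfolding F_def perm_diagram_def using ai by blast
          then show ?thesis by (simp add: u)
        qed
        ultimately have "{(0, i), (1, \<sigma> i)} \<subseteq> e"
          by (intro merge_absorbs[OF e(1), of _ "(1, \<sigma> i)"]) auto
        then show ?thesis using True ai by simp
      next
        case False
        then have "x = d (g x)" using ai by (auto simp: g d)
        then show ?thesis using x(2) e(2) by (metis imageI subsetD)
      qed
    qed
    then show "\<exists>e\<in>merge F. X \<inter> g -` b \<subseteq> e" using e(1) by blast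
  qed
  have tr: "w -` (X \<inter> g -` b) = map_sum (inv \<sigma>) id ` b" if b: "b \<in> p" for b
  proof (intro equalityI subsetI)
    fix v assume v: "v \<in> w -` (X \<inter> g -` b)"
    show "v \<in> map_sum (inv \<sigma>) id ` b"
    proof (cases v)
      case (Inl i)
      then have "Inl (\<sigma> i) \<in> b" using v by (simp add: w g)
      moreover have "v = map_sum (inv \<sigma>) id (Inl (\<sigma> i))" using Inl permutes_inverses[OF \<sigma>] by simp
      ultimately show ?thesis by blast
    next
      case (Inr i)
      then have "Inr i \<in> b" using v by (simp add: w g)
      moreover have "v = map_sum (inv \<sigma>) id (Inr i)" using Inr by simp
      ultimately show ?thesis by blast
    qed
  next
    fix v assume "v \<in> map_sum (inv \<sigma>) id ` b"
    then obtain y where y: "y \<in> b" "v = map_sum (inv \<sigma>) id y" by blast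
    have yk: "y \<in> vertices k" using vert[OF b y(1)] .
    show "v \<in> w -` (X \<inter> g -` b)"
    proof (cases y)
      case (Inl i)
      then have "inv \<sigma> i < k" using yk permutes_in_image[OF permutes_inv[OF \<sigma>], of i] by simp
      then show ?thesis using y Inl permutes_inverses[OF \<sigma>] by (simp add: w g X_def)
    next
      case (Inr i)
      then show ?thesis using y yk by (simp add: w g X_def)
    qed
  qed
  have "diagram_comp p (perm_diagram k \<sigma>) = (\<lambda>b. w -` b) ` merge F - {{}}"
    unfolding diagram_comp_def F_def w_def u_def d_def ..
  also have "(\<lambda>b. w -` b) ` merge F = (\<lambda>b. w -` (X \<inter> g -` b)) ` p" unfolding m image_image ..
  also have "\<dots> = (`) (map_sum (inv \<sigma>) id) ` p" by (rule image_cong[OF refl tr])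
  also have "\<dots> - {{}} = (`) (map_sum (inv \<sigma>) id) ` p" using partition_onD3[OF part] by auto
  finally show ?thesis .
qed

section \<open>Turning diagrams upside down\<close>

definition flip :: "'a + 'b \<Rightarrow> 'b + 'a" where
  "flip = case_sum Inr Inl"

lemma flip_simps [simp]: "flip (Inl i) = Inr i" "flip (Inr i) = Inl i"
  by (simp_all add: flip_def)

lemma flip_flip [simp]: "flip (flip v) = v"
  by (cases v) simp_all

lemma image_flip_flip: "(`) flip ` (`) flip ` p = p"
  by (simp add: image_image)

text \<open>Turning the stacked diagram upside down exchanges the outer rows and keeps the middle
  one, so it also exchanges the two factors.\<close>

lemma diagram_comp_flip:
  assumes "{} \<notin> p" "{} \<notin> q"
  shows "(`) flip ` diagram_comp p q = diagram_comp ((`) flip ` q) ((`) flip ` p)"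
proof -
  define u where "u = (case_sum (Pair 0) (Pair 1) :: nat + nat \<Rightarrow> nat \<times> nat)"
  define d where "d = (case_sum (Pair 1) (Pair 2) :: nat + nat \<Rightarrow> nat \<times> nat)"
  define w where "w = (case_sum (Pair 0) (Pair 2) :: nat + nat \<Rightarrow> nat \<times> nat)"
  \<comment> \<open>Row a becomes row 2 - a. As subtraction on naturals is truncated, this is an
    involution only on rows up to 2, hence the bounds on first components.\<close>
  define r where "r = map_prod ((-) (2::nat)) (id :: nat \<Rightarrow> nat)"
  have rud: "r (u v) = d (flip v)" "r (d v) = u (flip v)" "r (w v) = w (flip v)" for v
    by (cases v; simp add: r_def u_def d_def w_def)+
  have rr: "r x = y \<longleftrightarrow> x = r y" if "fst x \<le> 2" "fst y \<le> 2" for x y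
    using that by (cases x; cases y) (auto simp: r_def)
  have le: "fst (u v) \<le> 2" "fst (d v) \<le> 2" "fst (w v) \<le> 2" for v
    by (cases v; simp add: u_def d_def w_def)+
  let ?F = "(`) u ` q \<union> (`) d ` p"
  have U: "fst x \<le> 2" if "x \<in> \<Union>?F" for x using that le by auto
  have inj: "inj_on r (\<Union>?F)"
  proof (rule inj_onI)
    fix x y assume "x \<in> \<Union>?F" "y \<in> \<Union>?F" "r x = r y"
    then show "x = y" using U[of x] U[of y] by (cases x; cases y) (auto simp: r_def)
  qed
  have ne: "{} \<notin> ?F" using assms by auto
  have F': "(`) r ` ?F = (`) u ` (`) flip ` p \<union> (`) d ` (`) flip ` q"
    by (simp add: image_Un image_image rud Un_commute)
  have sub: "w -` (r ` c) = flip ` (w -` c)" if "c \<in> merge ?F" for c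
  proof (intro equalityI subsetI)
    have c: "fst x \<le> 2" if "x \<in> c" for x
      using U[of x] that \<open>c \<in> merge ?F\<close> Union_merge[of ?F] by blast
    fix v assume "v \<in> w -` (r ` c)"
    then obtain x where x: "x \<in> c" "w v = r x" by auto
    then have "x = r (w v)" using rr[OF le(3)[of v], of x] c rr[of x "w v"] le(3)[of v] by simp
    then have "w (flip v) = x" using rud(3) by simp
    then have "flip v \<in> w -` c" using x by simp
    then show "v \<in> flip ` (w -` c)" by (metis flip_flip imageI)
  next
    fix v assume "v \<in> flip ` (w -` c)"
    then obtain y where "w y \<in> c" "v = flip y" by blast
    then show "v \<in> w -` (r ` c)" using rud(3)[of y, symmetric] by simp
  qed
  have "diagram_comp ((`) flip ` q) ((`) flip ` p) = (\<lambda>b. w -` b) ` merge ((`) r ` ?F) - {{}}"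
    unfolding F' unfolding diagram_comp_def w_def u_def d_def ..
  also have "\<dots> = (\<lambda>b. flip ` (w -` b)) ` merge ?F - {{}}"
    unfolding merge_image[OF inj ne] image_image by (simp add: sub cong: image_cong)
  also have "\<dots> = (`) flip ` ((\<lambda>b. w -` b) ` merge ?F - {{}})" by auto
  also have "\<dots> = (`) flip ` diagram_comp p q"
    unfolding diagram_comp_def w_def u_def d_def ..
  finally show ?thesis ..
qed

lemma flip_perm_diagram:
  assumes "\<sigma> permutes {..<k}"
  shows "(`) flip ` perm_diagram k \<sigma> = perm_diagram k (inv \<sigma>)"
proof -
  have "perm_diagram k (inv \<sigma>) = (\<lambda>i. {Inl i, Inr (inv \<sigma> i)}) ` \<sigma> ` {..<k}"
    unfolding permutes_image[OF assms] by (simp add: perm_diagram_def)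
  then show ?thesis
    using permutes_inverses[OF assms] by (simp add: perm_diagram_def image_image insert_commute)
qed

lemma flip_vertices [simp]: "flip ` vertices k = vertices k"
proof -
  have "flip v \<in> vertices k \<longleftrightarrow> v \<in> vertices k" for v by (cases v) simp_all
  then have "flip ` vertices k \<subseteq> vertices k" "flip ` flip ` vertices k \<subseteq> flip ` vertices k" by auto
  then show ?thesis by (simp add: image_image subset_antisym)
qed

lemma flip_in_diagrams:
  assumes "p \<in> diagrams k"
  shows "(`) flip ` p \<in> diagrams k"
proof -
  have "inj_on flip (vertices k)" by (rule inj_on_inverseI[of _ flip]) simp
  then show ?thesis using partition_on_image_inj[OF diagramsD[OF assms], of flip] by (simp add: diagrams_def)
qed

text \<open>The mirror image of \<open>diagram_comp_perm_right\<close>.\<close>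

lemma diagram_comp_perm_left:
  assumes p: "p \<in> diagrams k" and \<sigma>: "\<sigma> permutes {..<k}"
  shows "diagram_comp (perm_diagram k \<sigma>) p = (`) (map_sum id \<sigma>) ` p"
proof -
  have ne: "{} \<notin> p" "{} \<notin> perm_diagram k \<sigma>"
    using partition_onD3[OF diagramsD[OF p]] partition_onD3[OF diagramsD[OF perm_diagram_in_diagrams[OF \<sigma>]]]
    by auto
  have "flip (map_sum \<sigma> id (flip v)) = map_sum id \<sigma> v" for v :: "nat + nat" by (cases v) simp_all
  then have eq: "(`) flip ` (`) (map_sum \<sigma> id) ` (`) flip ` p = (`) (map_sum id \<sigma>) ` p"
    by (simp add: image_image)
  have "diagram_comp (perm_diagram k \<sigma>) p = (`) flip ` (`) flip ` diagram_comp (perm_diagram k \<sigma>) p"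
    by (simp add: image_flip_flip)
  also have "\<dots> = (`) flip ` diagram_comp ((`) flip ` p) (perm_diagram k (inv \<sigma>))"
    unfolding diagram_comp_flip[OF ne(2,1)] flip_perm_diagram[OF \<sigma>] ..
  also have "\<dots> = (`) flip ` (`) (map_sum \<sigma> id) ` (`) flip ` p"
    unfolding diagram_comp_perm_right[OF flip_in_diagrams[OF p] permutes_inv[OF \<sigma>]]
      permutes_inv_inv[OF \<sigma>] ..
  finally show ?thesis unfolding eq .
qed

lemma relabel_in_diagrams:
  assumes p: "p \<in> diagrams k" and s: "\<sigma> permutes {..<k}" "\<tau> permutes {..<k}"
  shows "(`) (map_sum \<sigma> \<tau>) ` p \<in> diagrams k"
proof -
  have "inj (map_sum \<sigma> \<tau>)" using sum.inj_map permutes_inj s by blast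
  moreover have "map_sum \<sigma> \<tau> ` vertices k = vertices k"
    using permutes_image[OF s(1)] permutes_image[OF s(2)]
    by (simp add: vertices_def Plus_def image_Un image_image) (metis image_image)
  ultimately show ?thesis
    using partition_on_image_inj[OF diagramsD[OF p], of "map_sum \<sigma> \<tau>"]
    by (simp add: diagrams_def inj_on_def)
qed

text \<open>The form in which the invariance axiom \<open>m_perm\<close> is used and verified:
  conjugation relabels both rows by \<sigma>.\<close>

lemma diagram_conj_perm:
  assumes p: "p \<in> diagrams k" and \<sigma>: "\<sigma> permutes {..<k}"
  shows "diagram_comp (perm_diagram k \<sigma>) (diagram_comp p (perm_diagram k (inv \<sigma>))) =
    (`) (map_sum \<sigma> \<sigma>) ` p"
proof -
  have "diagram_comp p (perm_diagram k (inv \<sigma>)) = (`) (map_sum \<sigma> id) ` p"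
    using diagram_comp_perm_right[OF p permutes_inv[OF \<sigma>]] permutes_inv_inv[OF \<sigma>] by simp
  then show ?thesis
    using diagram_comp_perm_left[OF relabel_in_diagrams[OF p \<sigma> permutes_id] \<sigma>]
    by (simp add: image_image sum.map_comp)
qed

lemma perm_diagram_comp_left:
  "(`) (map_sum id \<pi>) ` perm_diagram k \<sigma> = perm_diagram k (\<pi> \<circ> \<sigma>)"
  by (simp add: perm_diagram_def image_image)

lemma perm_diagram_comp_right:
  assumes "\<pi> permutes {..<k}"
  shows "(`) (map_sum \<pi> id) ` perm_diagram k \<sigma> = perm_diagram k (\<sigma> \<circ> inv \<pi>)"
proof -
  have "perm_diagram k (\<sigma> \<circ> inv \<pi>) = (\<lambda>i. {Inl i, Inr ((\<sigma> \<circ> inv \<pi>) i)}) ` \<pi> ` {..<k}"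
    unfolding permutes_image[OF assms] by (simp add: perm_diagram_def)
  then show ?thesis
    using permutes_inverses[OF assms] by (simp add: perm_diagram_def image_image)
qed


subsection \<open>The length of a permutation\<close>

definition perm_cycles :: "nat \<Rightarrow> (nat \<Rightarrow> nat) \<Rightarrow> diagram" where
  "perm_cycles k \<sigma> = join (id_diagram k) (perm_diagram k \<sigma>)"

text \<open>The least number of transpositions with product \<open>\<sigma>\<close>.\<close>

definition perm_length :: "nat \<Rightarrow> (nat \<Rightarrow> nat) \<Rightarrow> real" where
  "perm_length k \<sigma> = real k - real (card (perm_cycles k \<sigma>))"

abbreviation perm_le :: "nat \<Rightarrow> (nat \<Rightarrow> nat) \<Rightarrow> (nat \<Rightarrow> nat) \<Rightarrow> bool" where
  "perm_le k \<tau> \<sigma> \<equiv> geodesic_le k (perm_diagram k \<tau>) (perm_diagram k \<sigma>)"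

lemma perm_length_dist: "perm_length k \<sigma> = diagram_dist (id_diagram k) (perm_diagram k \<sigma>)"
  by (simp add: perm_length_def perm_cycles_def diagram_dist_def)

lemma join_image:
  assumes "inj_on f X" "partition_on X p" "partition_on X q"
  shows "join ((`) f ` p) ((`) f ` q) = (`) f ` join p q"
proof -
  have "\<Union>(p \<union> q) = X" using partition_onD1[OF assms(2)] partition_onD1[OF assms(3)] by blast
  then show ?thesis
    using merge_image[of f "p \<union> q"] assms partition_onD3[OF assms(2)] partition_onD3[OF assms(3)]
    by (simp add: join_def image_Un)
qed

lemma diagram_dist_relabel:
  assumes "p \<in> diagrams k" "q \<in> diagrams k" "\<sigma> permutes {..<k}" "\<tau> permutes {..<k}"
  shows "diagram_dist ((`) (map_sum \<sigma> \<tau>) ` p) ((`) (map_sum \<sigma> \<tau>) ` q) = diagram_dist p q"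
proof -
  let ?f = "map_sum \<sigma> \<tau>"
  have inj: "inj ?f" using sum.inj_map permutes_inj assms by blast
  have card: "card ((`) ?f ` r) = card r" for r
    by (rule card_image) (simp add: inj_on_def inj_image_eq_iff[OF inj])
  have "join ((`) ?f ` p) ((`) ?f ` q) = (`) ?f ` join p q"
    using join_image[OF inj_on_subset[OF inj]] diagramsD[OF assms(1)] diagramsD[OF assms(2)] by blast
  then show ?thesis by (simp add: diagram_dist_def card)
qed

text \<open>Left invariance of the distance: relabelling the bottom row by \<tau> is an isometry
  taking the identity to \<tau>.\<close>

lemma diagram_dist_perm:
  assumes "\<sigma> permutes {..<k}" "\<tau> permutes {..<k}"
  shows "diagram_dist (perm_diagram k \<tau>) (perm_diagram k \<sigma>) = perm_length k (inv \<tau> \<circ> \<sigma>)"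
proof -
  have "diagram_dist ((`) (map_sum id \<tau>) ` id_diagram k)
      ((`) (map_sum id \<tau>) ` perm_diagram k (inv \<tau> \<circ> \<sigma>)) = perm_length k (inv \<tau> \<circ> \<sigma>)"
    unfolding perm_length_dist
    by (intro diagram_dist_relabel[where k = k] id_diagram_in_diagrams perm_diagram_in_diagrams permutes_id assms
        permutes_compose permutes_inv)
  moreover have "\<tau> \<circ> (inv \<tau> \<circ> \<sigma>) = \<sigma>" using permutes_inv_o(1)[OF assms(2)] by (simp add: comp_assoc[symmetric])
  ultimately show ?thesis
    unfolding perm_diagram_id(1)[symmetric] perm_diagram_comp_left by simp
qed

lemma perm_le_iff:
  assumes "\<sigma> permutes {..<k}" "\<tau> permutes {..<k}"
  shows "perm_le k \<tau> \<sigma> \<longleftrightarrow> perm_length k \<tau> + perm_length k (inv \<tau> \<circ> \<sigma>) = perm_length k \<sigma>"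
  by (simp add: geodesic_le_def diagram_dist_perm[OF assms] perm_length_dist[symmetric])

lemma perm_le_refl:
  assumes "\<sigma> permutes {..<k}"
  shows "perm_le k \<sigma> \<sigma>"
  using geodesic_le_refl[OF perm_diagram_in_diagrams[OF assms]] .

lemma perm_length_triangle:
  assumes "\<sigma> permutes {..<k}" "\<tau> permutes {..<k}"
  shows "perm_length k (\<sigma> \<circ> \<tau>) \<le> perm_length k \<sigma> + perm_length k \<tau>"
proof -
  have c: "(\<sigma> \<circ> \<tau>) permutes {..<k}" using assms by (simp add: permutes_compose)
  have "inv \<sigma> \<circ> (\<sigma> \<circ> \<tau>) = \<tau>" using permutes_inv_o(2)[OF assms(1)] by (simp add: comp_assoc[symmetric])
  then show ?thesis
    using diagram_dist_triangle[OF finite_vertices partition_on_id_diagram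
        diagramsD[OF perm_diagram_in_diagrams[OF assms(1)]] diagramsD[OF perm_diagram_in_diagrams[OF c]]]
      diagram_dist_perm[OF c assms(1)]
    by (simp add: perm_length_dist)
qed

lemma perm_le_trans:
  assumes "\<sigma> permutes {..<k}" "\<tau> permutes {..<k}" "\<rho> permutes {..<k}" "perm_le k \<sigma> \<tau>" "perm_le k \<tau> \<rho>"
  shows "perm_le k \<sigma> \<rho>"
  using geodesic_le_trans[of "perm_diagram k \<sigma>" k "perm_diagram k \<tau>" "perm_diagram k \<rho>"]
    perm_diagram_in_diagrams assms by blast

lemma perm_cycles_partition:
  assumes "\<sigma> permutes {..<k}"
  shows "partition_on (vertices k) (perm_cycles k \<sigma>)"
  unfolding perm_cycles_def
  by (rule partition_on_join[OF partition_on_id_diagram diagramsD[OF perm_diagram_in_diagrams[OF assms]]])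

lemma perm_cycles_absorb:
  assumes "c \<in> perm_cycles k \<sigma>" "i < k"
  shows "Inl i \<in> c \<longleftrightarrow> Inr i \<in> c" and "Inl i \<in> c \<longleftrightarrow> Inr (\<sigma> i) \<in> c"
proof -
  have "{Inl i, Inr i} \<in> id_diagram k" "{Inl i, Inr (\<sigma> i)} \<in> perm_diagram k \<sigma>"
    using assms(2) by (auto simp: id_diagram_def perm_diagram_def)
  then show "Inl i \<in> c \<longleftrightarrow> Inr i \<in> c" "Inl i \<in> c \<longleftrightarrow> Inr (\<sigma> i) \<in> c"
    using join_absorbs[OF assms(1)[unfolded perm_cycles_def]] by blast+
qed

lemma perm_cycles_fixed:
  assumes \<sigma>: "\<sigma> permutes {..<k}" and i: "\<sigma> i = i" "i < k"
  shows "{Inl i, Inr i} \<in> perm_cycles k \<sigma>"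
proof -
  note part = perm_cycles_partition[OF \<sigma>]
  have "Inl i \<in> \<Union>(perm_cycles k \<sigma>)" using partition_onD1[OF part] i vertices_iff by blast
  then obtain c where c: "c \<in> perm_cycles k \<sigma>" "Inl i \<in> c" by blast
  have "v \<in> {Inl i, Inr i}" if v: "v \<in> c" for v
    using c(1)[unfolded perm_cycles_def join_def] c(2) v
  proof (rule merge_block_induct)
    show "Inl i \<in> {Inl i, Inr i}" by simp
    fix b u v assume b: "b \<in> id_diagram k \<union> perm_diagram k \<sigma>" "u \<in> b" "v \<in> b" "u \<in> {Inl i, Inr i}"
    then obtain j where j: "b = {Inl j, Inr j} \<or> b = {Inl j, Inr (\<sigma> j)}"
      by (auto simp: id_diagram_def perm_diagram_def)
    have "\<sigma> j = i \<longleftrightarrow> j = i" using i(1) permutes_inj[OF \<sigma>] by (metis injD)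
    then show "v \<in> {Inl i, Inr i}" using b j i(1) by auto
  qed
  moreover have "Inr i \<in> c" using perm_cycles_absorb(1)[OF c(1) i(2)] c(2) by simp
  ultimately have "c = {Inl i, Inr i}" using c(2) by blast
  then show ?thesis using c(1) by simp
qed

lemma finite_perm_cycles: "\<sigma> permutes {..<k} \<Longrightarrow> finite (perm_cycles k \<sigma>)"
  using finite_elements[OF finite_vertices perm_cycles_partition] .

text \<open>Merging the blocks of \<open>h\<close> and \<open>i\<close> in the identity diagram
  gives a partition that is coarser than both the identity and the transposition and has lost at
  most one block.\<close>

lemma perm_length_transpose_le:
  assumes "h < k" "i < k" 
  shows "perm_length k (transpose h i) \<le> 1"
proof -
  let ?b = "{Inl h, Inr h} :: (nat + nat) set" and ?c = "{Inl i, Inr i} :: (nat + nat) set"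
  let ?r = "insert (?b \<union> ?c) (id_diagram k - {?b, ?c})"
  have t: "transpose h i permutes {..<k}" by (rule permutes_swap_id) (use assms in auto)
  have bc: "?b \<in> id_diagram k" "?c \<in> id_diagram k" using assms by (auto simp: id_diagram_def)
  have r: "refines (vertices k) (id_diagram k) ?r"
    by (rule partition_on_merge_two_blocks[OF partition_on_id_diagram bc])
  have "\<exists>c\<in>?r. b \<subseteq> c" if "b \<in> perm_diagram k (transpose h i)" for b
  proof -
    obtain j where j: "j < k" "b = {Inl j, Inr (transpose h i j)}"
      using \<open>b \<in> _\<close> by (auto simp: perm_diagram_def)
    show ?thesis
    proof (cases "j = h \<or> j = i")
      case True
      then have "b \<subseteq> ?b \<union> ?c" using j by auto
      then show ?thesis by blast
    next
      case False
      then have "b = {Inl j, Inr j}" using j by simp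
      moreover have "{Inl j, Inr j} \<noteq> ?b" "{Inl j, Inr j} \<noteq> ?c"
        using False by (simp_all add: Inl_Inr_doubleton_eq)
      ultimately have "b \<in> id_diagram k - {?b, ?c}" using j(1) by (auto simp: id_diagram_def)
      then show ?thesis by blast
    qed
  qed
  then have "refines (vertices k) (perm_diagram k (transpose h i)) ?r"
    using r diagramsD[OF perm_diagram_in_diagrams[OF t]] by (auto simp: refines_def)
  then have "refines (vertices k) (perm_cycles k (transpose h i)) ?r"
    unfolding perm_cycles_def
    by (intro join_is_finest(3)[OF partition_on_id_diagram diagramsD[OF perm_diagram_in_diagrams[OF t]]] r)
  then have "card ?r \<le> card (perm_cycles k (transpose h i))"
    by (rule refines_card_le(1)[OF _ finite_vertices])
  moreover have "card (id_diagram k) \<le> card ?r + 1"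
    by (rule card_merge_two_blocks[OF partition_on_id_diagram finite_diagram[OF id_diagram_in_diagrams] bc])
  ultimately show ?thesis by (simp add: perm_length_def)
qed

text \<open>Removing a point \<open>i\<close> from its cycle.\<close>

definition cut :: "nat \<Rightarrow> (nat \<Rightarrow> nat) \<Rightarrow> nat \<Rightarrow> nat" where
  "cut i \<sigma> = \<sigma> \<circ> transpose (inv \<sigma> i) i"

lemma cut_permutes:
  assumes \<sigma>: "\<sigma> permutes {..<k}" and "i < k"
  shows "cut i \<sigma> permutes {..<k}"
proof -
  have "inv \<sigma> i < k" using permutes_in_image[OF permutes_inv[OF \<sigma>], of i] assms(2) by simp
  then have "transpose (inv \<sigma> i) i permutes {..<k}" by (intro permutes_swap_id) (use assms in auto)
  then show ?thesis unfolding cut_def by (rule permutes_compose[OF _ \<sigma>])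
qed

lemma cut_fixes [simp]:
  assumes "\<sigma> permutes {..<k}"
  shows "cut i \<sigma> i = i"
  using permutes_inverses(1)[OF assms] by (simp add: cut_def)

lemma cut_eq_self:
  assumes "\<sigma> permutes {..<k}" "\<sigma> i = i"
  shows "cut i \<sigma> = \<sigma>"
  using permutes_inv_eq[OF assms(1), of i i] assms(2) by (simp add: cut_def)

text \<open>A transposition changes the length by at most one. Here the length does drop: the cycles
  after the cut refine those of \<sigma>, and \<open>i\<close> has become a cycle by itself.\<close>

lemma perm_length_cut:
  assumes \<sigma>: "\<sigma> permutes {..<k}" and i: "i < k" "\<sigma> i \<noteq> i"
  shows "perm_length k (cut i \<sigma>) = perm_length k \<sigma> - 1"
proof -
  define h where "h = inv \<sigma> i"
  have h: "\<sigma> h = i" "h < k" "h \<noteq> i"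
    using permutes_inverses(1)[OF \<sigma>, of i] permutes_in_image[OF permutes_inv[OF \<sigma>], of i] i
    by (auto simp: h_def)
  have \<sigma>': "cut i \<sigma> permutes {..<k}" by (rule cut_permutes[OF \<sigma> i(1)])
  have cut: "cut i \<sigma> = \<sigma> \<circ> transpose h i" by (simp add: cut_def h_def)
  have "cut i \<sigma> \<circ> transpose h i = \<sigma>" by (simp add: cut comp_assoc)
  then have "perm_length k \<sigma> \<le> perm_length k (cut i \<sigma>) + 1"
    using perm_length_triangle[OF \<sigma>' permutes_swap_id, of h i] perm_length_transpose_le[OF h(2) i(1)] h i
    by simp
  moreover have "card (perm_cycles k \<sigma>) < card (perm_cycles k (cut i \<sigma>))"
  proof -
    have "refines (vertices k) (perm_diagram k (cut i \<sigma>)) (perm_cycles k \<sigma>)"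
      unfolding refines_def
    proof (intro conjI ballI)
      show "partition_on (vertices k) (perm_diagram k (cut i \<sigma>))"
        by (rule diagramsD[OF perm_diagram_in_diagrams[OF \<sigma>']])
      show part: "partition_on (vertices k) (perm_cycles k \<sigma>)" by (rule perm_cycles_partition[OF \<sigma>])
      fix b assume "b \<in> perm_diagram k (cut i \<sigma>)"
      then obtain j where j: "j < k" "b = {Inl j, Inr (cut i \<sigma> j)}" by (auto simp: perm_diagram_def)
      have "Inl j \<in> \<Union>(perm_cycles k \<sigma>)" using partition_onD1[OF part] j(1) vertices_iff by blast
      then obtain c where c: "c \<in> perm_cycles k \<sigma>" "Inl j \<in> c" by blast
      note ab = perm_cycles_absorb[OF c(1)]
      have "Inr (cut i \<sigma> j) \<in> c"
      proof (cases "j = h")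
        case True
        then have "Inl i \<in> c" using ab(2)[of h] ab(1)[of i] h c(2) i(1) by simp
        then show ?thesis using ab(2)[of i] i(1) True by (simp add: cut)
      next
        case False
        then show ?thesis using ab[of j] c(2) j(1) h(1) by (cases "j = i") (auto simp: cut)
      qed
      then show "\<exists>c\<in>perm_cycles k \<sigma>. b \<subseteq> c" using c j(2) by blast
    qed
    moreover have "refines (vertices k) (id_diagram k) (perm_cycles k \<sigma>)"
      unfolding perm_cycles_def
      by (rule join_is_finest(1)[OF partition_on_id_diagram diagramsD[OF perm_diagram_in_diagrams[OF \<sigma>]]])
    ultimately have ref: "refines (vertices k) (perm_cycles k (cut i \<sigma>)) (perm_cycles k \<sigma>)"
      unfolding perm_cycles_def[of k "cut i \<sigma>"]
      by (intro join_is_finest(3)[OF partition_on_id_diagram diagramsD[OF perm_diagram_in_diagrams[OF \<sigma>']]])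
    have "{Inl i, Inr i} \<in> perm_cycles k (cut i \<sigma>)"
      by (rule perm_cycles_fixed[OF \<sigma>' cut_fixes[OF \<sigma>] i(1)])
    moreover have "{Inl i, Inr i} \<notin> perm_cycles k \<sigma>"
    proof
      assume c: "{Inl i, Inr i} \<in> perm_cycles k \<sigma>"
      then have "Inl h \<in> {Inl i, Inr i}" using perm_cycles_absorb[OF c h(2)] h(1) by simp
      then show False using h(3) by simp
    qed
    ultimately have "perm_cycles k (cut i \<sigma>) \<noteq> perm_cycles k \<sigma>" by blast
    then show ?thesis using refines_card_le[OF ref finite_vertices] by linarith
  qed
  ultimately show ?thesis by (simp add: perm_length_def)
qed

text \<open>The blocks of \<tau> lie inside the cycles of \<sigma>, and a fixed point of \<sigma> is
  a whole cycle.\<close>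

lemma perm_le_fixes:
  assumes \<sigma>: "\<sigma> permutes {..<k}" and \<tau>: "\<tau> permutes {..<k}" and le: "perm_le k \<tau> \<sigma>" and i: "\<sigma> i = i"
  shows "\<tau> i = i"
proof (cases "i < k")
  case True
  have ref: "refines (vertices k) (perm_diagram k \<tau>) (perm_cycles k \<sigma>)"
    unfolding perm_cycles_def
    by (rule geodesic_le_refines[OF perm_diagram_in_diagrams[OF \<tau>] perm_diagram_in_diagrams[OF \<sigma>] le])
  have "{Inl i, Inr (\<tau> i)} \<in> perm_diagram k \<tau>" using True by (auto simp: perm_diagram_def)
  then obtain c where c: "c \<in> perm_cycles k \<sigma>" "{Inl i, Inr (\<tau> i)} \<subseteq> c" by (rule refinesE[OF ref])
  have "c = {Inl i, Inr i}"
    by (rule partition_on_block_eq[OF perm_cycles_partition[OF \<sigma>] c(1) perm_cycles_fixed[OF \<sigma> i True], of "Inl i"])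
      (use c(2) in auto)
  then show ?thesis using c(2) by auto
next
  case False
  then show ?thesis using \<tau> by (simp add: permutes_def)
qed

lemma cut_inv_comp:
  assumes \<sigma>: "\<sigma> permutes {..<k}" and \<tau>: "\<tau> permutes {..<k}" and i: "\<tau> i = i"
  shows "cut i (inv \<tau> \<circ> \<sigma>) = inv \<tau> \<circ> cut i \<sigma>"
proof -
  have "inv (inv \<tau> \<circ> \<sigma>) = inv \<sigma> \<circ> \<tau>"
    using o_inv_distrib[of "inv \<tau>" \<sigma>] permutes_bij[OF \<sigma>] permutes_bij[OF permutes_inv[OF \<tau>]]
      permutes_inv_inv[OF \<tau>] by simp
  then show ?thesis using i by (simp add: cut_def comp_assoc)
qed

text \<open>The quotient of \<sigma> by its cut is a transposition, of length at most one, which is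
  exactly the length lost by the cut.\<close>

lemma perm_le_cut:
  assumes \<sigma>: "\<sigma> permutes {..<k}" and i: "i < k"
  shows "perm_le k (cut i \<sigma>) \<sigma>"
proof (cases "\<sigma> i = i")
  case True
  then show ?thesis using cut_eq_self[OF \<sigma> True] perm_le_refl[OF \<sigma>] by simp
next
  case False
  have h: "inv \<sigma> i < k" using permutes_in_image[OF permutes_inv[OF \<sigma>], of i] i by simp
  have \<sigma>': "cut i \<sigma> permutes {..<k}" by (rule cut_permutes[OF \<sigma> i])
  have t: "transpose (inv \<sigma> i) i permutes {..<k}" by (rule permutes_swap_id) (use h i in auto)
  have "inv (cut i \<sigma>) = transpose (inv \<sigma> i) i \<circ> inv \<sigma>"
    unfolding cut_def using o_inv_distrib[of \<sigma> "transpose (inv \<sigma> i) i"] permutes_bij[OF \<sigma>] permutes_bij[OF t]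
    by simp
  then have "inv (cut i \<sigma>) \<circ> \<sigma> = transpose (inv \<sigma> i) i"
    using permutes_inv_o(2)[OF \<sigma>] by (simp add: comp_assoc)
  then have "perm_length k (inv (cut i \<sigma>) \<circ> \<sigma>) \<le> 1" using perm_length_transpose_le[OF h i] by simp
  moreover have "cut i \<sigma> \<circ> (inv (cut i \<sigma>) \<circ> \<sigma>) = \<sigma>"
    using permutes_inv_o(1)[OF \<sigma>'] by (simp add: comp_assoc[symmetric])
  then have "perm_length k \<sigma> \<le> perm_length k (cut i \<sigma>) + perm_length k (inv (cut i \<sigma>) \<circ> \<sigma>)"
    using perm_length_triangle[OF \<sigma>' permutes_compose[OF \<sigma> permutes_inv[OF \<sigma>']]] by simp
  ultimately show ?thesis
    unfolding perm_le_iff[OF \<sigma> \<sigma>'] using perm_length_cut[OF \<sigma> i False] by linarith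
qed

text \<open>For the converse, let \<sigma> move \<open>i\<close> while \<tau> fixes it. Then
  \<open>inv \<tau> \<circ> \<sigma>\<close> moves \<open>i\<close> too, the cut shortens it and
  \<sigma> by one each, and the geodesic equation of \<tau> persists.\<close>

lemma perm_le_cut_iff:
  assumes \<sigma>: "\<sigma> permutes {..<k}" and \<tau>: "\<tau> permutes {..<k}" and i: "i < k"
  shows "perm_le k \<tau> (cut i \<sigma>) \<longleftrightarrow> perm_le k \<tau> \<sigma> \<and> \<tau> i = i"
proof
  note \<sigma>' = cut_permutes[OF \<sigma> i]
  assume "perm_le k \<tau> (cut i \<sigma>)"
  then show "perm_le k \<tau> \<sigma> \<and> \<tau> i = i"
    using perm_le_trans[OF \<tau> \<sigma>' \<sigma> _ perm_le_cut[OF \<sigma> i]] perm_le_fixes[OF \<sigma>' \<tau> _ cut_fixes[OF \<sigma>]] by blast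
next
  assume le: "perm_le k \<tau> \<sigma> \<and> \<tau> i = i"
  show "perm_le k \<tau> (cut i \<sigma>)"
  proof (cases "\<sigma> i = i")
    case True
    then show ?thesis using le cut_eq_self[OF \<sigma>] by simp
  next
    case False
    have \<rho>: "(inv \<tau> \<circ> \<sigma>) permutes {..<k}" by (rule permutes_compose[OF \<sigma> permutes_inv[OF \<tau>]])
    have "(inv \<tau> \<circ> \<sigma>) i \<noteq> i"
      using False le permutes_inv_eq[OF \<tau>, of "\<sigma> i" i] by auto
    then have "perm_length k (inv \<tau> \<circ> cut i \<sigma>) = perm_length k (inv \<tau> \<circ> \<sigma>) - 1"
      using perm_length_cut[OF \<rho> i] cut_inv_comp[OF \<sigma> \<tau>] le by simp
    then show ?thesis
      using le perm_length_cut[OF \<sigma> i False]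
      by (simp add: perm_le_iff[OF \<sigma> \<tau>] perm_le_iff[OF cut_permutes[OF \<sigma> i] \<tau>])
  qed
qed

text \<open>Write \<sigma> as the product of \<tau>, \<rho> and a remainder \<omega>. By the
  triangle inequality each side says that the lengths of the three factors add up to the length of
  \<sigma>.\<close>

lemma perm_le_assoc:
  assumes \<sigma>: "\<sigma> permutes {..<k}" and \<tau>: "\<tau> permutes {..<k}" and \<rho>: "\<rho> permutes {..<k}"
  shows "perm_le k \<tau> \<sigma> \<and> perm_le k \<rho> (inv \<tau> \<circ> \<sigma>) \<longleftrightarrow>
    perm_length k (\<tau> \<circ> \<rho>) = perm_length k \<tau> + perm_length k \<rho> \<and> perm_le k (\<tau> \<circ> \<rho>) \<sigma>"
proof -
  have tr: "(\<tau> \<circ> \<rho>) permutes {..<k}" and ts: "(inv \<tau> \<circ> \<sigma>) permutes {..<k}"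
    by (simp_all add: permutes_compose permutes_inv assms)
  have inv: "inv (\<tau> \<circ> \<rho>) \<circ> \<sigma> = inv \<rho> \<circ> (inv \<tau> \<circ> \<sigma>)"
    using o_inv_distrib[of \<tau> \<rho>] permutes_bij[OF \<tau>] permutes_bij[OF \<rho>] by (simp add: comp_assoc)
  define \<omega> where "\<omega> = inv \<rho> \<circ> (inv \<tau> \<circ> \<sigma>)"
  have \<omega>: "\<omega> permutes {..<k}" unfolding \<omega>_def by (rule permutes_compose[OF ts permutes_inv[OF \<rho>]])
  have "\<rho> \<circ> \<omega> = inv \<tau> \<circ> \<sigma>" unfolding \<omega>_def using permutes_inv_o(1)[OF \<rho>] by (simp add: comp_assoc[symmetric])
  moreover have "\<tau> \<circ> (inv \<tau> \<circ> \<sigma>) = \<sigma>" using permutes_inv_o(1)[OF \<tau>] by (simp add: comp_assoc[symmetric])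
  ultimately show ?thesis
    unfolding perm_le_iff[OF \<sigma> \<tau>] perm_le_iff[OF ts \<rho>] perm_le_iff[OF \<sigma> tr] inv \<omega>_def[symmetric]
    using perm_length_triangle[OF \<tau> ts] perm_length_triangle[OF \<rho> \<omega>] perm_length_triangle[OF \<tau> \<rho>]
      perm_length_triangle[OF tr \<omega>] by (auto simp: comp_assoc)
qed

text \<open>A cycle with t points contributes t - 1 to the length, which is at least t / 2 unless
  the cycle is a fixed point.\<close>

lemma perm_length_ge_moved:
  assumes \<sigma>: "\<sigma> permutes {..<k}"
  shows "real (card {i. i < k \<and> \<sigma> i \<noteq> i}) \<le> 2 * perm_length k \<sigma>"
proof -
  let ?J = "perm_cycles k \<sigma>"
  note part = perm_cycles_partition[OF \<sigma>]
  note fin = finite_perm_cycles[OF \<sigma>]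
  define tops where "tops c = {i. Inl i \<in> c}" for c :: "(nat + nat) set"
  have sub: "tops c \<subseteq> {..<k}" if "c \<in> ?J" for c
    using that partition_onD1[OF part] vertices_iff(1)[of _ k] unfolding tops_def by blast
  have ne: "tops c \<noteq> {}" if c: "c \<in> ?J" for c
  proof -
    obtain v where v: "v \<in> c" using c partition_onD3[OF part] by fastforce
    then have vk: "v \<in> vertices k" using c partition_onD1[OF part] by blast
    show ?thesis
    proof (cases v)
      case (Inl i)
      then show ?thesis using v by (auto simp: tops_def)
    next
      case (Inr i)
      then show ?thesis using v vk perm_cycles_absorb(1)[OF c, of i] by (auto simp: tops_def)
    qed
  qed
  have disj: "tops c \<inter> tops d = {}" if "c \<in> ?J" "d \<in> ?J" "c \<noteq> d" for c d
    using disjointD[OF partition_onD2[OF part] that] unfolding tops_def by blast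
  have U: "(\<Union>c\<in>?J. tops c) = {..<k}"
  proof (intro equalityI subsetI)
    fix i assume "i \<in> {..<k}"
    then have "Inl i \<in> \<Union>?J" using partition_onD1[OF part] vertices_iff(1)[of i k] by blast
    then show "i \<in> (\<Union>c\<in>?J. tops c)" by (auto simp: tops_def)
  qed (use sub in blast)
  have "(\<Sum>c\<in>?J. card (tops c)) = card (\<Union>c\<in>?J. tops c)"
  proof (rule card_UN_disjoint[symmetric, OF fin])
    show "\<forall>c\<in>?J. finite (tops c)" using finite_subset[OF sub] by simp
    show "\<forall>c\<in>?J. \<forall>d\<in>?J. c \<noteq> d \<longrightarrow> tops c \<inter> tops d = {}" using disj by simp
  qed
  then have sumk: "(\<Sum>c\<in>?J. card (tops c)) = k" using U by simp
  define J1 where "J1 = {c \<in> ?J. card (tops c) = 1}"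
  have "card J1 \<le> card {i. i < k \<and> \<sigma> i = i}"
  proof -
    have "\<exists>i. i < k \<and> \<sigma> i = i \<and> tops c = {i}" if "c \<in> J1" for c
    proof -
      have cJ: "c \<in> ?J" using \<open>c \<in> J1\<close> by (simp add: J1_def)
      obtain i where i: "tops c = {i}" using \<open>c \<in> J1\<close> by (auto simp: J1_def card_1_singleton_iff)
      then have "i < k" using sub[OF cJ] by blast
      moreover have "\<sigma> i < k" using permutes_in_image[OF \<sigma>, of i] \<open>i < k\<close> by simp
      moreover have "Inl i \<in> c" using i by (auto simp: tops_def)
      ultimately have "Inl (\<sigma> i) \<in> c" using perm_cycles_absorb[OF cJ] by blast
      then have "\<sigma> i \<in> tops c" by (simp add: tops_def)
      then show ?thesis using i \<open>i < k\<close> by auto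
    qed
    then obtain f where f: "\<And>c. c \<in> J1 \<Longrightarrow> f c < k \<and> \<sigma> (f c) = f c \<and> tops c = {f c}" by metis
    have "inj_on f J1"
    proof (rule inj_onI)
      fix c d assume cd: "c \<in> J1" "d \<in> J1" "f c = f d"
      then have "tops c \<inter> tops d \<noteq> {}" using f by auto
      then show "c = d" using disj cd by (auto simp: J1_def)
    qed
    then show ?thesis by (rule card_inj_on_le) (use f in auto)
  qed
  \<comment> \<open>Every cycle has two top vertices or belongs to \<open>J1\<close>, where the
    missing one is supplied by the summand 1.\<close>
  moreover have "2 * card ?J \<le> k + card J1"
  proof -
    have "2 \<le> card (tops c) + (if c \<in> J1 then 1 else 0)" if c: "c \<in> ?J" for c
    proof -
      have "card (tops c) \<noteq> 0" using ne[OF c] finite_subset[OF sub[OF c]] by simp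
      then show ?thesis using c by (auto simp: J1_def)
    qed
    then have "(\<Sum>c\<in>?J. 2) \<le> (\<Sum>c\<in>?J. card (tops c) + (if c \<in> J1 then 1 else 0))"
      by (intro sum_mono) auto
    also have "\<dots> = k + card J1"
    proof -
      have "?J \<inter> J1 = J1" by (auto simp: J1_def)
      then show ?thesis using fin sumk by (simp add: sum.distrib sum.If_cases)
    qed
    finally show ?thesis by simp
  qed
  moreover have "card {i. i < k \<and> \<sigma> i = i} + card {i. i < k \<and> \<sigma> i \<noteq> i} = k"
  proof -
    have "{i. i < k \<and> \<sigma> i = i} \<union> {i. i < k \<and> \<sigma> i \<noteq> i} = {..<k}" by auto
    moreover have "card ({i. i < k \<and> \<sigma> i = i} \<union> {i. i < k \<and> \<sigma> i \<noteq> i}) =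
        card {i. i < k \<and> \<sigma> i = i} + card {i. i < k \<and> \<sigma> i \<noteq> i}"
      by (rule card_Un_disjoint) auto
    ultimately show ?thesis by simp
  qed
  ultimately show ?thesis by (simp add: perm_length_def)
qed

text \<open>The points outside \<open>T\<close> are cycles by themselves, and a cycle through a
  point of \<open>T\<close> is one more.\<close>

lemma perm_length_le_support:
  assumes \<sigma>: "\<sigma> permutes {..<k}" and T: "T \<subseteq> {..<k}" "T \<noteq> {}" and fixed: "\<And>i. i \<notin> T \<Longrightarrow> \<sigma> i = i"
  shows "perm_length k \<sigma> \<le> real (card T) - 1"
proof -
  let ?J = "perm_cycles k \<sigma>"
  note part = perm_cycles_partition[OF \<sigma>]
  define f where "f i = ({Inl i, Inr i} :: (nat + nat) set)" for i
  obtain t where t: "t \<in> T" using T by blast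
  then have "Inl t \<in> \<Union>?J" using partition_onD1[OF part] T(1) vertices_iff(1)[of t k] by blast
  then obtain c where c: "c \<in> ?J" "Inl t \<in> c" by blast
  have inj: "inj_on f ({..<k} - T)" by (auto simp: inj_on_def f_def doubleton_eq_iff)
  have "c \<notin> f ` ({..<k} - T)" using c(2) t by (auto simp: f_def)
  then have "card (insert c (f ` ({..<k} - T))) = Suc (card ({..<k} - T))"
    using card_image[OF inj] by simp
  also have "card ({..<k} - T) = k - card T" using T(1) by (simp add: card_Diff_subset finite_subset)
  finally have "card (insert c (f ` ({..<k} - T))) = Suc (k - card T)" .
  moreover have "insert c (f ` ({..<k} - T)) \<subseteq> ?J"
    using c(1) perm_cycles_fixed[OF \<sigma> fixed] by (auto simp: f_def)
  ultimately have "Suc (k - card T) \<le> card ?J" using card_mono[OF finite_perm_cycles[OF \<sigma>]] by metis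
  moreover have "card T \<le> k" using card_mono[OF _ T(1)] by simp
  ultimately show ?thesis by (simp add: perm_length_def)
qed

text \<open>A noncrossing partition without singletons has at least two pairs of cyclically neighbouring
  points in the same block: both \<open>\<tau>\<close> and its complement have many cycles, hence fixed points.\<close>

lemma perm_le_coincidences:
  assumes \<sigma>: "\<sigma> permutes {..<k}" and \<tau>: "\<tau> permutes {..<k}" and le: "perm_le k \<tau> \<sigma>"
    and T: "T \<subseteq> {..<k}" "T \<noteq> {}" and fixed: "\<And>i. i \<notin> T \<Longrightarrow> \<sigma> i = i" and moved: "\<And>i. i \<in> T \<Longrightarrow> \<tau> i \<noteq> i"
  shows "2 \<le> card {i \<in> T. \<tau> i = \<sigma> i}"
proof -
  let ?\<rho> = "inv \<tau> \<circ> \<sigma>"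
  have finT: "finite T" using T(1) finite_subset by blast
  have \<rho>: "?\<rho> permutes {..<k}" by (rule permutes_compose[OF \<sigma> permutes_inv[OF \<tau>]])
  \<comment> \<open>Coincidences of \<tau> with \<sigma> are the fixed points of the complement
    \<open>inv \<tau> \<circ> \<sigma>\<close>.\<close>
  have eq: "?\<rho> i = i \<longleftrightarrow> \<tau> i = \<sigma> i" for i using permutes_inv_eq[OF \<tau>, of "\<sigma> i" i] by auto
  have "{i. i < k \<and> \<tau> i \<noteq> i} = T"
    using perm_le_fixes[OF \<sigma> \<tau> le] fixed moved T(1) by auto
  then have a: "real (card T) \<le> 2 * perm_length k \<tau>" using perm_length_ge_moved[OF \<tau>] by simp
  have "{i. i < k \<and> ?\<rho> i \<noteq> i} = {i \<in> T. \<tau> i \<noteq> \<sigma> i}"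
    using perm_le_fixes[OF \<sigma> \<tau> le fixed] fixed T(1) eq by (auto, metis)
  then have b: "real (card {i \<in> T. \<tau> i \<noteq> \<sigma> i}) \<le> 2 * perm_length k ?\<rho>"
    using perm_length_ge_moved[OF \<rho>] by simp
  have "card ({i \<in> T. \<tau> i = \<sigma> i} \<union> {i \<in> T. \<tau> i \<noteq> \<sigma> i}) =
      card {i \<in> T. \<tau> i = \<sigma> i} + card {i \<in> T. \<tau> i \<noteq> \<sigma> i}"
    by (rule card_Un_disjoint) (use finT in auto)
  moreover have "{i \<in> T. \<tau> i = \<sigma> i} \<union> {i \<in> T. \<tau> i \<noteq> \<sigma> i} = T" by auto
  ultimately have "card {i \<in> T. \<tau> i = \<sigma> i} + card {i \<in> T. \<tau> i \<noteq> \<sigma> i} = card T" by simp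
  \<comment> \<open>With c coincidences, the two bounds add up to |T| + (|T| - c) \<le> 2 (|T| -
    1).\<close>
  then show ?thesis
    using a b perm_length_le_support[OF \<sigma> T fixed] le unfolding perm_le_iff[OF \<sigma> \<tau>] by linarith
qed

text \<open>If no single step of \<sigma> changes the colour, the colour spreads unchanged along the
  edges that generate a cycle.\<close>

lemma mixed_cycle_iff:
  assumes \<sigma>: "\<sigma> permutes {..<k}"
  shows "(\<exists>c\<in>cycles k (perm_diagram k \<sigma>). \<exists>i j. Inl i \<in> c \<and> Inl j \<in> c \<and> \<epsilon> i \<noteq> \<epsilon> j) \<longleftrightarrow>
    (\<exists>i<k. \<epsilon> i \<noteq> \<epsilon> (\<sigma> i))"
proof -
  have cyc: "cycles k (perm_diagram k \<sigma>) = perm_cycles k \<sigma>"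
    by (simp add: cycles_def perm_cycles_def join_commute)
  note part = perm_cycles_partition[OF \<sigma>]
  show ?thesis unfolding cyc
  proof
    assume "\<exists>c\<in>perm_cycles k \<sigma>. \<exists>i j. Inl i \<in> c \<and> Inl j \<in> c \<and> \<epsilon> i \<noteq> \<epsilon> j"
    then obtain c i j where c: "c \<in> perm_cycles k \<sigma>" "Inl i \<in> c" "Inl j \<in> c" "\<epsilon> i \<noteq> \<epsilon> j" by blast
    show "\<exists>i<k. \<epsilon> i \<noteq> \<epsilon> (\<sigma> i)"
    proof (rule ccontr)
      assume "\<not> (\<exists>i<k. \<epsilon> i \<noteq> \<epsilon> (\<sigma> i))"
      then have same: "\<epsilon> (\<sigma> l) = \<epsilon> l" if "l < k" for l using that by metis
      let ?P = "\<lambda>v. case_sum \<epsilon> \<epsilon> v = \<epsilon> i"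
      have "?P (Inl j)"
        using c(1)[unfolded perm_cycles_def join_def] c(2,3)
      proof (rule merge_block_induct)
        show "?P (Inl i)" by simp
        fix b u v assume b: "b \<in> id_diagram k \<union> perm_diagram k \<sigma>" "u \<in> b" "v \<in> b" "?P u"
        then obtain l where "l < k" "b = {Inl l, Inr l} \<or> b = {Inl l, Inr (\<sigma> l)}"
          by (auto simp: id_diagram_def perm_diagram_def)
        then show "?P v" using b same by auto
      qed
      then show False using c(4) by simp
    qed
  next
    assume "\<exists>i<k. \<epsilon> i \<noteq> \<epsilon> (\<sigma> i)"
    then obtain i where i: "i < k" "\<epsilon> i \<noteq> \<epsilon> (\<sigma> i)" by blast
    then have "Inl i \<in> \<Union>(perm_cycles k \<sigma>)" using partition_onD1[OF part] vertices_iff(1)[of i k] by blast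
    then obtain c where c: "c \<in> perm_cycles k \<sigma>" "Inl i \<in> c" by blast
    moreover have "\<sigma> i < k" using permutes_in_image[OF \<sigma>, of i] i by simp
    ultimately have "Inl (\<sigma> i) \<in> c" using perm_cycles_absorb[OF c(1)] i(1) by blast
    then show "\<exists>c\<in>perm_cycles k \<sigma>. \<exists>i j. Inl i \<in> c \<and> Inl j \<in> c \<and> \<epsilon> i \<noteq> \<epsilon> j" using c i by blast
  qed
qed


section \<open>Moments and cumulants of a trace\<close>

lemma permutes_shrink:
  assumes "\<sigma> permutes {..<Suc n}" "\<sigma> n = n"
  shows "\<sigma> permutes {..<n}"
  using permutes_superset[OF assms(1), of "{..<n}"] assms(2) by (force simp: less_Suc_eq)

lemma cut_eq:
  assumes "\<sigma> permutes {..<n}" "\<sigma> h = i"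
  shows "cut i \<sigma> = \<sigma> \<circ> transpose h i"
  using permutes_inv_eq[OF assms(1), of i h] assms(2) by (simp add: cut_def)

definition perms_below :: "nat \<Rightarrow> (nat \<Rightarrow> nat) \<Rightarrow> (nat \<Rightarrow> nat) set" where
  "perms_below n \<sigma> = {\<tau>. \<tau> permutes {..<n} \<and> perm_le n \<tau> \<sigma>}"

lemma finite_perms_below [simp]: "finite (perms_below n \<sigma>)"
  using finite_permutations[of "{..<n}"] by (rule rev_finite_subset) (auto simp: perms_below_def)

lemma perm_length_less:
  assumes "\<tau> permutes {..<n}" "\<sigma> permutes {..<n}" "perm_le n \<tau> \<sigma>" "\<tau> \<noteq> \<sigma>"
  shows "perm_length n \<tau> < perm_length n \<sigma>"
  using geodesic_le_dist_less[OF perm_diagram_in_diagrams perm_diagram_in_diagrams] assms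
    perm_diagram_inject unfolding perm_length_dist by blast

text \<open>Inversion within the permutations that satisfy \<open>P\<close>. It is applied to all
  permutations and to those that fix a given point.\<close>

lemma perm_moebius_unique:
  fixes h h' :: "(nat \<Rightarrow> nat) \<Rightarrow> complex"
  assumes "\<And>\<sigma>. \<lbrakk>\<sigma> permutes {..<n}; P \<sigma>\<rbrakk> \<Longrightarrow>
      (\<Sum>\<tau>\<in>{\<tau> \<in> perms_below n \<sigma>. P \<tau>}. h \<tau>) = (\<Sum>\<tau>\<in>{\<tau> \<in> perms_below n \<sigma>. P \<tau>}. h' \<tau>)"
    and "\<sigma> permutes {..<n}" "P \<sigma>"
  shows "h \<sigma> = h' \<sigma>"
proof (rule moebius_unique[where S = "{\<sigma>. \<sigma> permutes {..<n} \<and> P \<sigma>}" and le = "perm_le n" and f = "perm_length n"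
      and h = h and h' = h'])
  show "finite {\<sigma>. \<sigma> permutes {..<n} \<and> P \<sigma>}"
    using finite_permutations[of "{..<n}"] by (rule rev_finite_subset) auto
  show "perm_le n x x" if "x \<in> {\<sigma>. \<sigma> permutes {..<n} \<and> P \<sigma>}" for x
    using that perm_le_refl by blast
  show "perm_length n x < perm_length n y"
    if "x \<in> {\<sigma>. \<sigma> permutes {..<n} \<and> P \<sigma>}" "y \<in> {\<sigma>. \<sigma> permutes {..<n} \<and> P \<sigma>}" "perm_le n x y" "x \<noteq> y" for x y
    using that perm_length_less by blast
  show "(\<Sum>y\<in>{y \<in> {\<sigma>. \<sigma> permutes {..<n} \<and> P \<sigma>}. perm_le n y x}. h y) =
      (\<Sum>y\<in>{y \<in> {\<sigma>. \<sigma> permutes {..<n} \<and> P \<sigma>}. perm_le n y x}. h' y)"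
    if "x \<in> {\<sigma>. \<sigma> permutes {..<n} \<and> P \<sigma>}" for x
  proof -
    have "{y \<in> {\<sigma>. \<sigma> permutes {..<n} \<and> P \<sigma>}. perm_le n y x} = {\<tau> \<in> perms_below n x. P \<tau>}"
      by (auto simp: perms_below_def)
    then show ?thesis using assms(1)[of x] that by simp
  qed
qed (use assms in auto)

lemma perms_below_cut:
  assumes "\<sigma> permutes {..<n}" "i < n"
  shows "perms_below n (cut i \<sigma>) = {\<tau> \<in> perms_below n \<sigma>. \<tau> i = i}"
  using perm_le_cut_iff[OF assms(1) _ assms(2)] by (auto simp: perms_below_def)

lemma perms_below_permutes: "\<tau> \<in> perms_below n \<sigma> \<Longrightarrow> \<tau> permutes {..<n}"
  by (simp add: perms_below_def)

text \<open>Letters are given as functions on positions rather than as lists, so that a letter is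
  replaced, or turned into a unit, by a function update.\<close>

definition multilinear_on ::
    "(complex \<Rightarrow> 'a::ab_group_add \<Rightarrow> 'a) \<Rightarrow> nat \<Rightarrow> ((nat \<Rightarrow> 'a) \<Rightarrow> complex) \<Rightarrow> bool" where
  "multilinear_on scale n u \<longleftrightarrow> (\<forall>j<n. \<forall>a x y c.
     u (a(j := x + y)) = u (a(j := x)) + u (a(j := y)) \<and> u (a(j := scale c x)) = c * u (a(j := x)))"

locale trace_algebra = complex_algebra scale mul
  for scale :: "complex \<Rightarrow> 'a::ab_group_add \<Rightarrow> 'a" and mul :: "'a \<Rightarrow> 'a \<Rightarrow> 'a" +
  fixes \<phi> :: "'a \<Rightarrow> complex" and e :: 'a
  assumes phi_add: "\<phi> (x + y) = \<phi> x + \<phi> y"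
    and phi_scale: "\<phi> (scale c x) = c * \<phi> x"
    and phi_trace: "\<phi> (mul x y) = \<phi> (mul y x)"
    and unit_left [simp]: "mul e x = x"
    and unit_right [simp]: "mul x e = x"
    and phi_unit [simp]: "\<phi> e = 1"
begin

text \<open>The product over the cycles of \<open>\<sigma>\<close> of the traces of the products of letters along the
  cycle, computed by successively absorbing the last point into its predecessor.\<close>

fun moment :: "nat \<Rightarrow> (nat \<Rightarrow> nat) \<Rightarrow> (nat \<Rightarrow> 'a) \<Rightarrow> complex" where
  "moment 0 \<sigma> a = 1"
| "moment (Suc n) \<sigma> a =
     (if \<sigma> n = n then \<phi> (a n) * moment n \<sigma> a
      else moment n (cut n \<sigma>) (a(inv \<sigma> n := mul (a (inv \<sigma> n)) (a n))))"

lemma moment_step: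
  assumes "\<sigma> permutes {..<Suc n}" "\<sigma> h = n" "h \<noteq> n"
  shows "moment (Suc n) \<sigma> a = moment n (\<sigma> \<circ> transpose h n) (a(h := mul (a h) (a n)))"
    and "(\<sigma> \<circ> transpose h n) permutes {..<n}" and "h < n"
proof -
  have inv: "inv \<sigma> n = h" using permutes_inv_eq[OF assms(1), of n h] assms(2) by simp
  have "\<sigma> n \<noteq> n" using assms permutes_inj[OF assms(1)] by (metis injD)
  then show "moment (Suc n) \<sigma> a = moment n (\<sigma> \<circ> transpose h n) (a(h := mul (a h) (a n)))"
    using cut_eq[OF assms(1,2)] inv by simp
  show "(\<sigma> \<circ> transpose h n) permutes {..<n}"
    using permutes_shrink[OF cut_permutes[OF assms(1), of n]] cut_fixes[OF assms(1), of n]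
      cut_eq[OF assms(1,2)] by simp
  show "h < n" using permutes_in_image[OF assms(1), of h] assms(2,3) by simp
qed

lemma obtain_preimage:
  assumes "\<sigma> permutes {..<Suc n}" "\<sigma> n \<noteq> n"
  obtains h where "\<sigma> h = n" "h \<noteq> n" "h < n"
proof
  show "\<sigma> (inv \<sigma> n) = n" using permutes_inverses(1)[OF assms(1)] .
  then show "inv \<sigma> n \<noteq> n" using assms(2) by metis
  then show "inv \<sigma> n < n" using permutes_in_image[OF permutes_inv[OF assms(1)], of n] by simp
qed

lemma moment_last:
  "\<sigma> n = n \<Longrightarrow> moment (Suc n) \<sigma> a = \<phi> (a n) * moment n \<sigma> a"
  by simp

declare moment.simps(2) [simp del]

lemma moment_cong:
  assumes "\<sigma> permutes {..<n}" "\<And>i. i < n \<Longrightarrow> a i = b i"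
  shows "moment n \<sigma> a = moment n \<sigma> b"
  using assms
proof (induction n arbitrary: \<sigma> a b)
  case (Suc n)
  show ?case
  proof (cases "\<sigma> n = n")
    case True
    then show ?thesis using Suc.IH[OF permutes_shrink[OF Suc.prems(1)], of a b] Suc.prems(2) by (simp add: moment_last)
  next
    case False
    then obtain h where h: "\<sigma> h = n" "h \<noteq> n" "h < n" using obtain_preimage[OF Suc.prems(1)] by blast
    show ?thesis
      unfolding moment_step(1)[OF Suc.prems(1) h(1,2)]
      by (rule Suc.IH[OF moment_step(2)[OF Suc.prems(1) h(1,2)]]) (use Suc.prems(2) h in simp)
  qed
qed simp

text \<open>The factor contributed by a cycle of length one. The unit left at \<open>j\<close> keeps
  the number of positions, which the later inductions rely on.\<close>

lemma moment_fixed: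
  assumes "\<sigma> permutes {..<n}" "j < n" "\<sigma> j = j"
  shows "moment n \<sigma> a = \<phi> (a j) * moment n \<sigma> (a(j := e))"
  supply fun_upd_apply [simp del] fun_upd_same [simp] fun_upd_other [simp] comp_apply [simp del]
  using assms
proof (induction n arbitrary: \<sigma> a)
  case (Suc n)
  consider "j = n" | "j < n" "\<sigma> n = n" | "j < n" "\<sigma> n \<noteq> n" using Suc.prems(2) by linarith
  then show ?case
  proof cases
    case 1
    then show ?thesis
      using moment_cong[OF permutes_shrink[OF Suc.prems(1)], of a "a(n := e)"] Suc.prems(3) by (simp add: moment_last)
  next
    case 2
    then show ?thesis using Suc.IH[OF permutes_shrink[OF Suc.prems(1)], of a] Suc.prems(3) by (simp add: moment_last)
  next
    case 3
    then obtain h where h: "\<sigma> h = n" "h \<noteq> n" "h < n" using obtain_preimage[OF Suc.prems(1)] by blast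
    then have "h \<noteq> j" using Suc.prems(3) 3 by auto
    then have "(\<sigma> \<circ> transpose h n) j = j" using Suc.prems(3) 3 by (simp add: comp_apply)
    moreover note \<open>h \<noteq> j\<close>
    ultimately show ?thesis
      unfolding moment_step(1)[OF Suc.prems(1) h(1,2)]
      using Suc.IH[OF moment_step(2)[OF Suc.prems(1) h(1,2)], of "a(h := mul (a h) (a n))"] 3 Suc.prems(3)
      by (simp add: fun_upd_twist)
  qed
qed simp

text \<open>The recursion for \<open>moment\<close> absorbs only the last point into its
  predecessor; here any point may be absorbed. The induction compares the two orders of absorbing
  \<open>j\<close> and the last point.\<close>

lemma moment_merge:
  assumes "\<sigma> permutes {..<n}" "i < n" "j < n" "\<sigma> i = j" "i \<noteq> j"
  shows "moment n \<sigma> a = moment n (\<sigma> \<circ> transpose i j) (a(i := mul (a i) (a j), j := e))"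
  supply fun_upd_apply [simp del] fun_upd_same [simp] fun_upd_other [simp] comp_apply [simp del]
  using assms
proof (induction n arbitrary: \<sigma> a i j)
  case (Suc n)
  note \<sigma> = Suc.prems(1)
  have inj: "\<sigma> x = \<sigma> y \<longleftrightarrow> x = y" for x y using permutes_inj[OF \<sigma>] by (auto dest: injD)
  have \<sigma>': "(\<sigma> \<circ> transpose i j) permutes {..<Suc n}"
    by (intro permutes_compose[OF permutes_swap_id \<sigma>]) (use Suc.prems in auto)
  consider (a) "j = n" | (b) "i = n" "j < n" | (c) "i < n" "j < n"
    using Suc.prems(2,3) by linarith
  then show ?case
  proof cases
    case a
    then have "i \<noteq> n" "\<sigma> i = n" using Suc.prems by auto
    note st = moment_step[OF \<sigma> this(2,1)]
    have "moment (Suc n) (\<sigma> \<circ> transpose i n) (a(i := mul (a i) (a n), n := e)) =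
        moment n (\<sigma> \<circ> transpose i n) (a(i := mul (a i) (a n), n := e))"
      using \<open>\<sigma> i = n\<close> by (simp add: comp_apply moment_last)
    also have "\<dots> = moment n (\<sigma> \<circ> transpose i n) (a(i := mul (a i) (a n)))"
      by (rule moment_cong[OF st(2)]) simp
    finally show ?thesis using a st(1) by simp
  next
    case b
    then have ne: "\<sigma> n \<noteq> n" using Suc.prems by auto
    then obtain h where h: "\<sigma> h = n" "h \<noteq> n" "h < n" using obtain_preimage[OF \<sigma>] by blast
    note st = moment_step[OF \<sigma> h(1,2)]
    show ?thesis
    proof (cases "h = j")
      case True
      \<comment> \<open>The cycle consists of \<open>j\<close> and \<open>n\<close> only. The
        recursion gives the trace of the product in one order, the merge into \<open>n\<close> gives
        it in the other: this is where the trace property enters.\<close>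
      have jfix: "(\<sigma> \<circ> transpose j n) j = j" using Suc.prems(4) b by (simp add: comp_apply)
      have "moment (Suc n) \<sigma> a = moment n (\<sigma> \<circ> transpose j n) (a(j := mul (a j) (a n)))"
        using st(1) True by simp
      also have "\<dots> = \<phi> (mul (a j) (a n)) * moment n (\<sigma> \<circ> transpose j n) (a(j := e))"
        using moment_fixed[of "\<sigma> \<circ> transpose j n" n j, OF _ b(2) jfix, of "a(j := mul (a j) (a n))"] st(2) True by simp
      also have "\<dots> = \<phi> (mul (a n) (a j)) *
          moment n (\<sigma> \<circ> transpose j n) (a(n := mul (a n) (a j), j := e))"
        using moment_cong[of "\<sigma> \<circ> transpose j n" n "a(n := mul (a n) (a j), j := e)" "a(j := e)"] st(2) True
        by (simp add: phi_trace[of "a j"] fun_upd_apply)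
      also have "\<dots> = moment (Suc n) (\<sigma> \<circ> transpose j n) (a(n := mul (a n) (a j), j := e))"
        using moment_last[of "\<sigma> \<circ> transpose j n" n] h(1) True b by (simp add: comp_apply)
      finally show ?thesis using b by (simp add: transpose_commute[of n j])
    next
      case False
      have "(\<sigma> \<circ> transpose h n) h = j" using Suc.prems(4) b by (simp add: comp_apply)
      then have "moment (Suc n) \<sigma> a =
          moment n (\<sigma> \<circ> transpose h n \<circ> transpose h j) (a(h := mul (mul (a h) (a n)) (a j), j := e))"
        using Suc.IH[OF st(2) h(3) b(2) _ False, of "a(h := mul (a h) (a n))"] st(1) False by simp
      \<comment> \<open>Absorbing \<open>n\<close> and then \<open>j\<close> into \<open>h\<close>,
        or \<open>j\<close> into \<open>n\<close> and the result into \<open>h\<close>, gives the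
        same permutation and, by associativity, the same letter.\<close>
      moreover have "\<sigma> \<circ> transpose h n \<circ> transpose h j = \<sigma> \<circ> transpose n j \<circ> transpose h n"
        using False h(2) b by (auto simp: fun_eq_iff comp_apply transpose_def)
      moreover have p: "(\<sigma> \<circ> transpose n j) permutes {..<Suc n}" using \<sigma>' b by simp
      have "(\<sigma> \<circ> transpose n j) h = n" using False h b by (simp add: comp_apply)
      note st' = moment_step[OF p this h(2)]
      let ?b = "a(n := mul (a n) (a j), j := e)"
      have "moment n (\<sigma> \<circ> transpose n j \<circ> transpose h n) (a(h := mul (mul (a h) (a n)) (a j), j := e)) =
          moment n (\<sigma> \<circ> transpose n j \<circ> transpose h n) (?b(h := mul (?b h) (?b n)))"
        by (rule moment_cong[OF st'(2)]) (use False h b in \<open>auto simp: fun_upd_apply mult_assoc\<close>)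
      ultimately show ?thesis unfolding b(1) st'(1) by simp
    qed
  next
    case c
    show ?thesis
    proof (cases "\<sigma> n = n")
      case True
      then show ?thesis
        using Suc.IH[OF permutes_shrink[OF \<sigma>] c, of a] Suc.prems(4,5) c by (simp add: moment_last comp_apply)
    next
      case False
      then obtain h where h: "\<sigma> h = n" "h \<noteq> n" "h < n" using obtain_preimage[OF \<sigma>] by blast
      note st = moment_step[OF \<sigma> h(1,2)]
      have hi: "h \<noteq> i" using h(1) Suc.prems(4) c by auto
      show ?thesis
      proof (cases "h = j")
        case True
        have "(\<sigma> \<circ> transpose h n) i = j" using Suc.prems(4) hi c by (simp add: comp_apply)
        then have "moment (Suc n) \<sigma> a = moment n (\<sigma> \<circ> transpose h n \<circ> transpose i j)
            (a(i := mul (a i) (mul (a j) (a n)), j := e))"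
          using Suc.IH[OF st(2) c _ Suc.prems(5), of "a(h := mul (a h) (a n))"] st(1) True Suc.prems(5)
          by (simp add: fun_upd_twist)
        moreover have "\<sigma> \<circ> transpose h n \<circ> transpose i j = \<sigma> \<circ> transpose i j \<circ> transpose i n"
          using True Suc.prems(5) c by (auto simp: fun_eq_iff comp_apply transpose_def)
        moreover have "(\<sigma> \<circ> transpose i j) i = n" "i \<noteq> n" using True h(1) c by (simp_all add: comp_apply)
        note st' = moment_step[OF \<sigma>' this]
        ultimately show ?thesis
          using st'(1)[of "a(i := mul (a i) (a j), j := e)"] c Suc.prems(5)
          by (simp add: fun_upd_twist mult_assoc)
      next
        case hj: False
        have "(\<sigma> \<circ> transpose h n) i = j" using Suc.prems(4) hi c by (simp add: comp_apply)
        then have "moment (Suc n) \<sigma> a = moment n (\<sigma> \<circ> transpose h n \<circ> transpose i j)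
            (a(h := mul (a h) (a n), i := mul (a i) (a j), j := e))"
          using Suc.IH[OF st(2) c _ Suc.prems(5), of "a(h := mul (a h) (a n))"] st(1) hj hi by simp
        moreover have "\<sigma> \<circ> transpose h n \<circ> transpose i j = \<sigma> \<circ> transpose i j \<circ> transpose h n"
          using hi hj h(2) Suc.prems(5) c by (auto simp: fun_eq_iff comp_apply transpose_def)
        moreover have "(\<sigma> \<circ> transpose i j) h = n" using hi hj h(1) by (simp add: comp_apply)
        note st' = moment_step[OF \<sigma>' this h(2)]
        let ?b = "a(i := mul (a i) (a j), j := e)"
        have "a(h := mul (a h) (a n), i := mul (a i) (a j), j := e) = ?b(h := mul (?b h) (?b n))"
          using hi hj c by (auto simp: fun_eq_iff fun_upd_apply)
        ultimately show ?thesis unfolding st'(1) by simp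
      qed
    qed
  qed
qed simp

text \<open>Merging a unit into its predecessor changes no letter, only the permutation.\<close>

lemma moment_unit:
  assumes \<sigma>: "\<sigma> permutes {..<n}" and j: "j < n" "a j = e"
  shows "moment n \<sigma> a = moment n (cut j \<sigma>) a"
proof (cases "\<sigma> j = j")
  case True
  then show ?thesis using cut_eq_self[OF \<sigma>] by simp
next
  case False
  define h where "h = inv \<sigma> j"
  have h: "\<sigma> h = j" using permutes_inverses(1)[OF \<sigma>] by (simp add: h_def)
  then have "h < n" "h \<noteq> j" using permutes_in_image[OF \<sigma>, of h] j(1) False by auto
  then have "moment n \<sigma> a = moment n (\<sigma> \<circ> transpose h j) (a(h := mul (a h) (a j), j := e))"
    using moment_merge[OF \<sigma> _ j(1) h] by blast
  also have "a(h := mul (a h) (a j), j := e) = a" using j(2) by auto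
  finally show ?thesis unfolding cut_eq[OF \<sigma> h] .
qed

lemma moment_all_unit:
  assumes "\<sigma> permutes {..<n}" "\<And>i. i < n \<Longrightarrow> a i = e"
  shows "moment n \<sigma> a = 1"
  using assms
proof (induction n arbitrary: \<sigma> a)
  case (Suc n)
  show ?case
  proof (cases "\<sigma> n = n")
    case True
    then show ?thesis using Suc.IH[OF permutes_shrink[OF Suc.prems(1)], of a] Suc.prems(2) by (simp add: moment_last)
  next
    case False
    then obtain h where h: "\<sigma> h = n" "h \<noteq> n" "h < n" using obtain_preimage[OF Suc.prems(1)] by blast
    show ?thesis
      unfolding moment_step(1)[OF Suc.prems(1) h(1,2)]
      by (rule Suc.IH[OF moment_step(2)[OF Suc.prems(1) h(1,2)]]) (use Suc.prems(2) h in simp)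
  qed
qed simp

lemma moment_multilinear:
  assumes "\<sigma> permutes {..<n}"
  shows "multilinear_on scale n (moment n \<sigma>)"
  using assms
proof (induction n arbitrary: \<sigma>)
  case (Suc n)
  note \<sigma> = Suc.prems
  show ?case
  proof (cases "\<sigma> n = n")
    case True
    note IH = Suc.IH[OF permutes_shrink[OF \<sigma> True], unfolded multilinear_on_def]
    have n: "moment n \<sigma> (a(n := x)) = moment n \<sigma> a" for a x
      by (rule moment_cong[OF permutes_shrink[OF \<sigma> True]]) simp
    show ?thesis unfolding multilinear_on_def
    proof (intro allI impI)
      fix j a x y c assume "j < Suc n"
      then consider "j = n" | "j < n" by linarith
      then show "moment (Suc n) \<sigma> (a(j := x + y)) = moment (Suc n) \<sigma> (a(j := x)) + moment (Suc n) \<sigma> (a(j := y)) \<and>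
          moment (Suc n) \<sigma> (a(j := scale c x)) = c * moment (Suc n) \<sigma> (a(j := x))"
        by cases (use True IH in \<open>simp_all add: moment_last n phi_add phi_scale algebra_simps\<close>)
    qed
  next
    case False
    then obtain h where h: "\<sigma> h = n" "h \<noteq> n" "h < n" using obtain_preimage[OF \<sigma>] by blast
    note st = moment_step[OF \<sigma> h(1,2)]
    note IH = Suc.IH[OF st(2), unfolded multilinear_on_def, rule_format]
    have n: "moment n (\<sigma> \<circ> transpose h n) (a(n := x, h := y)) = moment n (\<sigma> \<circ> transpose h n) (a(h := y))" for a x y
      by (rule moment_cong[OF st(2)]) simp
    show ?thesis unfolding multilinear_on_def
    proof (intro allI impI)
      fix j a x y c assume "j < Suc n"
      then consider "j = n" | "j = h" | "j < n" "j \<noteq> h" by linarith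
      then show "moment (Suc n) \<sigma> (a(j := x + y)) = moment (Suc n) \<sigma> (a(j := x)) + moment (Suc n) \<sigma> (a(j := y)) \<and>
          moment (Suc n) \<sigma> (a(j := scale c x)) = c * moment (Suc n) \<sigma> (a(j := x))"
      proof cases
        case 1
        then show ?thesis
          unfolding st(1) using h IH[OF h(3), of a]
          by (simp add: n mult_add_right mult_scale_right)
      next
        case 2
        then show ?thesis
          unfolding st(1) using h IH[OF h(3), of a]
          by (simp add: mult_add_left mult_scale_left)
      next
        case 3
        then show ?thesis
          unfolding st(1) using h IH[OF 3(1), of "a(h := mul (a h) (a n))"]
          by (simp add: fun_upd_twist)
      qed
    qed
  qed
qed (simp add: multilinear_on_def)

text \<open>The Moebius inverse of \<open>moment\<close>. The size \<open>n\<close> is an argument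
  because a permutation, as a function, does not determine the number of positions.\<close>

definition cumul :: "nat \<Rightarrow> (nat \<Rightarrow> nat) \<Rightarrow> (nat \<Rightarrow> 'a) \<Rightarrow> complex" where
  "cumul n = (SOME h. \<forall>\<sigma>. \<sigma> permutes {..<n} \<longrightarrow>
     multilinear_on scale n (h \<sigma>) \<and> (\<forall>a. moment n \<sigma> a = (\<Sum>\<tau>\<in>perms_below n \<sigma>. h \<tau> a)))"

lemma cumul_spec:
  assumes "\<sigma> permutes {..<n}"
  shows "multilinear_on scale n (cumul n \<sigma>)" "moment n \<sigma> a = (\<Sum>\<tau>\<in>perms_below n \<sigma>. cumul n \<tau> a)"
proof -
  let ?S = "{\<sigma>. \<sigma> permutes {..<n}}"
  have "\<exists>h. \<forall>x\<in>?S. multilinear_on scale n (h x) \<and>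
      (\<forall>t. moment n x t = (\<Sum>y\<in>{y \<in> ?S. perm_le n y x}. h y t))"
  proof (rule moebius_exists[where f = "perm_length n"])
    show "finite ?S" using finite_permutations[of "{..<n}"] by simp
    show "perm_le n x x" if "x \<in> ?S" for x using that perm_le_refl by simp
    show "perm_length n x < perm_length n y" if "x \<in> ?S" "y \<in> ?S" "perm_le n x y" "x \<noteq> y" for x y
      using that perm_length_less by blast
    show "multilinear_on scale n (\<lambda>t. u t - v t)"
      if "multilinear_on scale n u" "multilinear_on scale n v" for u v :: "(nat \<Rightarrow> 'a) \<Rightarrow> complex"
      using that by (simp add: multilinear_on_def algebra_simps)
    show "multilinear_on scale n (moment n x)" if "x \<in> ?S" for x using that moment_multilinear by simp
  qed (simp add: multilinear_on_def)
  then have "\<exists>h. \<forall>\<sigma>. \<sigma> permutes {..<n} \<longrightarrow>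
     multilinear_on scale n (h \<sigma>) \<and> (\<forall>a. moment n \<sigma> a = (\<Sum>\<tau>\<in>perms_below n \<sigma>. h \<tau> a))"
    by (simp add: perms_below_def)
  from someI_ex[OF this] show "multilinear_on scale n (cumul n \<sigma>)"
    "moment n \<sigma> a = (\<Sum>\<tau>\<in>perms_below n \<sigma>. cumul n \<tau> a)"
    unfolding cumul_def[symmetric] using assms by blast+
qed

lemma cumul_unique:
  assumes "\<And>\<sigma>. \<sigma> permutes {..<n} \<Longrightarrow> (\<Sum>\<tau>\<in>perms_below n \<sigma>. h \<tau>) = moment n \<sigma> a"
    and "\<sigma> permutes {..<n}"
  shows "cumul n \<sigma> a = h \<sigma>"
  by (rule perm_moebius_unique[where P = "\<lambda>_. True" and n = n and h = "\<lambda>\<sigma>. cumul n \<sigma> a"])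
    (use assms cumul_spec(2)[symmetric] in auto)

text \<open>A unit may be cut out of its cycle, and the permutations below the cut are those below
  \<sigma> that fix \<open>i\<close>. So the moments are already the sums of the cumulants of
  permutations fixing \<open>i\<close>, and uniqueness makes the others zero.\<close>

lemma cumul_unit:
  assumes \<sigma>: "\<sigma> permutes {..<n}" and i: "i < n" "a i = e" "\<sigma> i \<noteq> i"
  shows "cumul n \<sigma> a = 0"
proof -
  have "cumul n \<sigma> a = (if \<sigma> i = i then cumul n \<sigma> a else 0)"
  proof (rule cumul_unique[OF _ \<sigma>])
    fix \<sigma> assume \<sigma>: "\<sigma> permutes {..<n}"
    have "(\<Sum>\<tau>\<in>perms_below n \<sigma>. if \<tau> i = i then cumul n \<tau> a else 0) =
        (\<Sum>\<tau>\<in>perms_below n (cut i \<sigma>). cumul n \<tau> a)"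
      unfolding perms_below_cut[OF \<sigma> i(1)] by (simp add: sum.inter_filter)
    then show "(\<Sum>\<tau>\<in>perms_below n \<sigma>. if \<tau> i = i then cumul n \<tau> a else 0) = moment n \<sigma> a"
      using cumul_spec(2)[OF cut_permutes[OF \<sigma> i(1)]] moment_unit[of \<sigma> n i a] \<sigma> i by simp
  qed
  then show ?thesis using i(3) by simp
qed

text \<open>All moments of permutations fixing \<open>i\<close> contain the factor
  \<open>\<phi> (a i) = 0\<close>, and everything below such a permutation fixes \<open>i\<close>
  too. Inversion within this set gives zero.\<close>

lemma cumul_centred:
  assumes \<sigma>: "\<sigma> permutes {..<n}" and i: "i < n" "\<phi> (a i) = 0" "\<sigma> i = i"
  shows "cumul n \<sigma> a = 0"
proof (rule perm_moebius_unique[where P = "\<lambda>\<sigma>. \<sigma> i = i" and n = n and h' = "\<lambda>_. 0" and h = "\<lambda>\<sigma>. cumul n \<sigma> a"])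
  fix \<sigma> assume \<sigma>: "\<sigma> permutes {..<n}" "\<sigma> i = i"
  have "{\<tau> \<in> perms_below n \<sigma>. \<tau> i = i} = perms_below n \<sigma>"
    using perm_le_fixes[OF \<sigma>(1) _ _ \<sigma>(2)] by (auto simp: perms_below_def)
  then show "(\<Sum>\<tau>\<in>{\<tau> \<in> perms_below n \<sigma>. \<tau> i = i}. cumul n \<tau> a) = (\<Sum>\<tau>\<in>{\<tau> \<in> perms_below n \<sigma>. \<tau> i = i}. 0)"
    using cumul_spec(2)[OF \<sigma>(1), of a] moment_fixed[OF \<sigma>(1) i(1) \<sigma>(2), of a] i(2) by simp
qed (use \<sigma> i in auto)

end


section \<open>Mixed moments of two free families\<close>

context trace_algebra
begin

text \<open>By \<open>perm_le_assoc\<close> these are the pairs with \<tau> below \<sigma> and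
  \<rho> below \<open>inv \<tau> \<circ> \<sigma>\<close>. In this form only the order of the
  product distinguishes \<tau> from \<rho>.\<close>

definition geodesic_pairs :: "nat \<Rightarrow> (nat \<Rightarrow> nat) \<Rightarrow> ((nat \<Rightarrow> nat) \<times> (nat \<Rightarrow> nat)) set" where
  "geodesic_pairs n \<sigma> = {(\<tau>, \<rho>). \<tau> permutes {..<n} \<and> \<rho> permutes {..<n} \<and>
     perm_length n (\<tau> \<circ> \<rho>) = perm_length n \<tau> + perm_length n \<rho> \<and> perm_le n (\<tau> \<circ> \<rho>) \<sigma>}"

lemma finite_geodesic_pairs [simp]: "finite (geodesic_pairs n \<sigma>)"
proof (rule finite_subset)
  show "geodesic_pairs n \<sigma> \<subseteq> {\<sigma>. \<sigma> permutes {..<n}} \<times> {\<sigma>. \<sigma> permutes {..<n}}"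
    by (auto simp: geodesic_pairs_def)
qed (simp add: finite_permutations)

text \<open>The mixed moments of two free families whose letters are \<open>a\<close> and \<open>b\<close>, each of them
  completed by units at the positions occupied by the other.\<close>

definition free_moment :: "nat \<Rightarrow> (nat \<Rightarrow> nat) \<Rightarrow> (nat \<Rightarrow> 'a) \<Rightarrow> (nat \<Rightarrow> 'a) \<Rightarrow> complex" where
  "free_moment n \<sigma> a b = (\<Sum>\<tau>\<in>perms_below n \<sigma>. cumul n \<tau> b * moment n (inv \<tau> \<circ> \<sigma>) a)"

lemma free_moment_pairs:
  assumes \<sigma>: "\<sigma> permutes {..<n}"
  shows "free_moment n \<sigma> a b = (\<Sum>(\<tau>, \<rho>)\<in>geodesic_pairs n \<sigma>. cumul n \<tau> b * cumul n \<rho> a)"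
proof -
  have "free_moment n \<sigma> a b =
      (\<Sum>\<tau>\<in>perms_below n \<sigma>. \<Sum>\<rho>\<in>perms_below n (inv \<tau> \<circ> \<sigma>). cumul n \<tau> b * cumul n \<rho> a)"
    unfolding free_moment_def
  proof (rule sum.cong[OF refl])
    fix \<tau> assume "\<tau> \<in> perms_below n \<sigma>"
    then have "(inv \<tau> \<circ> \<sigma>) permutes {..<n}"
      using permutes_compose[OF \<sigma> permutes_inv] by (simp add: perms_below_def)
    then show "cumul n \<tau> b * moment n (inv \<tau> \<circ> \<sigma>) a =
        (\<Sum>\<rho>\<in>perms_below n (inv \<tau> \<circ> \<sigma>). cumul n \<tau> b * cumul n \<rho> a)"
      using cumul_spec(2) by (simp add: sum_distrib_left)
  qed
  also have "\<dots> = (\<Sum>(\<tau>, \<rho>)\<in>Sigma (perms_below n \<sigma>) (\<lambda>\<tau>. perms_below n (inv \<tau> \<circ> \<sigma>)).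
      cumul n \<tau> b * cumul n \<rho> a)"
    by (rule sum.Sigma) simp_all
  also have "Sigma (perms_below n \<sigma>) (\<lambda>\<tau>. perms_below n (inv \<tau> \<circ> \<sigma>)) = geodesic_pairs n \<sigma>"
    using perm_le_assoc[OF \<sigma>] unfolding perms_below_def geodesic_pairs_def by blast
  finally show ?thesis .
qed

lemma cumul_support:
  assumes "\<tau> permutes {..<n}" "cumul n \<tau> a \<noteq> 0" "a i = e \<or> \<not> i < n"
  shows "\<tau> i = i"
  using cumul_unit[OF assms(1), of i a] assms by (cases "i < n") (auto simp: permutes_def)

lemma permutes_commute_disjoint:
  assumes \<tau>: "\<tau> permutes S" and \<rho>: "\<rho> permutes S" and disj: "\<And>i. \<tau> i = i \<or> \<rho> i = i"
  shows "\<tau> \<circ> \<rho> = \<rho> \<circ> \<tau>"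
proof
  fix i
  have inj: "\<tau> x = \<tau> y \<longleftrightarrow> x = y" "\<rho> x = \<rho> y \<longleftrightarrow> x = y" for x y
    using permutes_inj[OF \<tau>] permutes_inj[OF \<rho>] by (auto dest: injD)
  show "(\<tau> \<circ> \<rho>) i = (\<rho> \<circ> \<tau>) i"
    using disj[of i] disj[of "\<rho> i"] disj[of "\<tau> i"] inj by (metis comp_apply)
qed

text \<open>At each position one of the families carries a unit, so in a nonzero term \<tau> and
  \<rho> move disjoint sets, commute and may be exchanged. This makes up for the asymmetry of
  \<open>free_moment\<close>, in which \<open>a\<close> enters through moments and \<open>b\<close>
  through cumulants.\<close>

lemma free_moment_sym:
  assumes \<sigma>: "\<sigma> permutes {..<n}" and ab: "\<And>i. i < n \<Longrightarrow> a i = e \<or> b i = e"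
  shows "free_moment n \<sigma> a b = free_moment n \<sigma> b a"
proof -
  have comm: "\<tau> \<circ> \<rho> = \<rho> \<circ> \<tau>" if "\<tau> permutes {..<n}" "\<rho> permutes {..<n}" "cumul n \<tau> b * cumul n \<rho> a \<noteq> 0" for \<tau> \<rho>
  proof (rule permutes_commute_disjoint[OF that(1,2)])
    fix i show "\<tau> i = i \<or> \<rho> i = i"
      using cumul_support[OF that(1), of b i] cumul_support[OF that(2), of a i] that(3) ab by (metis mult_eq_0_iff)
  qed
  have "free_moment n \<sigma> a b =
      (\<Sum>x\<in>{x \<in> geodesic_pairs n \<sigma>. cumul n (fst x) b * cumul n (snd x) a \<noteq> 0}. cumul n (fst x) b * cumul n (snd x) a)"
    unfolding free_moment_pairs[OF \<sigma>] case_prod_unfold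
    by (rule sum.mono_neutral_right) auto
  also have "\<dots> = (\<Sum>x\<in>{x \<in> geodesic_pairs n \<sigma>. cumul n (fst x) a * cumul n (snd x) b \<noteq> 0}. cumul n (fst x) a * cumul n (snd x) b)"
  proof (rule sum.reindex_bij_witness[of _ prod.swap prod.swap])
    fix x assume x: "x \<in> {x \<in> geodesic_pairs n \<sigma>. cumul n (fst x) b * cumul n (snd x) a \<noteq> 0}"
    then have "fst x \<circ> snd x = snd x \<circ> fst x"
      by (intro comm) (auto simp: geodesic_pairs_def)
    then show "prod.swap x \<in> {x \<in> geodesic_pairs n \<sigma>. cumul n (fst x) a * cumul n (snd x) b \<noteq> 0}"
      using x by (auto simp: geodesic_pairs_def)
  next
    fix x assume x: "x \<in> {x \<in> geodesic_pairs n \<sigma>. cumul n (fst x) a * cumul n (snd x) b \<noteq> 0}"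
    then have "snd x \<circ> fst x = fst x \<circ> snd x" by (intro comm) (auto simp: geodesic_pairs_def)
    then show "prod.swap x \<in> {x \<in> geodesic_pairs n \<sigma>. cumul n (fst x) b * cumul n (snd x) a \<noteq> 0}"
      using x by (auto simp: geodesic_pairs_def)
  qed auto
  also have "\<dots> = free_moment n \<sigma> b a"
    unfolding free_moment_pairs[OF \<sigma>] case_prod_unfold
    by (rule sum.mono_neutral_left) auto
  finally show ?thesis .
qed

lemma free_moment_unit:
  assumes \<sigma>: "\<sigma> permutes {..<n}" and i: "i < n" "a i = e" "b i = e"
  shows "free_moment n \<sigma> a b = free_moment n (cut i \<sigma>) a b"
proof -
  have "free_moment n \<sigma> a b =
      (\<Sum>\<tau>\<in>perms_below n (cut i \<sigma>). cumul n \<tau> b * moment n (inv \<tau> \<circ> \<sigma>) a)"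
    unfolding free_moment_def
  proof (rule sum.mono_neutral_right)
    show "perms_below n (cut i \<sigma>) \<subseteq> perms_below n \<sigma>" unfolding perms_below_cut[OF \<sigma> i(1)] by blast
    show "\<forall>\<tau>\<in>perms_below n \<sigma> - perms_below n (cut i \<sigma>). cumul n \<tau> b * moment n (inv \<tau> \<circ> \<sigma>) a = 0"
      unfolding perms_below_cut[OF \<sigma> i(1)] using cumul_unit[of _ n i b] i by (auto simp: perms_below_def)
  qed simp
  also have "\<dots> = free_moment n (cut i \<sigma>) a b"
    unfolding free_moment_def
  proof (rule sum.cong[OF refl])
    fix \<tau> assume "\<tau> \<in> perms_below n (cut i \<sigma>)"
    then have \<tau>: "\<tau> permutes {..<n}" "\<tau> i = i" unfolding perms_below_cut[OF \<sigma> i(1)] by (auto simp: perms_below_def)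
    have "(inv \<tau> \<circ> \<sigma>) permutes {..<n}" by (rule permutes_compose[OF \<sigma> permutes_inv[OF \<tau>(1)]])
    then have "moment n (inv \<tau> \<circ> \<sigma>) a = moment n (inv \<tau> \<circ> cut i \<sigma>) a"
      unfolding cut_inv_comp[OF \<sigma> \<tau>, symmetric] by (rule moment_unit[where j = i and a = a, OF _ i(1,2)])
    then show "cumul n \<tau> b * moment n (inv \<tau> \<circ> \<sigma>) a = cumul n \<tau> b * moment n (inv \<tau> \<circ> cut i \<sigma>) a"
      by simp
  qed
  finally show ?thesis .
qed

text \<open>The unit of \<open>b\<close> at \<open>j\<close> kills the terms in which \<tau> moves
  \<open>j\<close>. In the remaining ones \<open>inv \<tau> \<circ> \<sigma>\<close> still sends
  \<open>i\<close> to \<open>j\<close>, so the merge can be made inside a moment of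
  \<open>a\<close>. This is why one family enters through its moments.\<close>

lemma free_moment_merge:
  assumes \<sigma>: "\<sigma> permutes {..<n}" and ij: "i < n" "j < n" "\<sigma> i = j" "i \<noteq> j" and b: "b i = e" "b j = e"
  shows "free_moment n \<sigma> a b = free_moment n (cut j \<sigma>) (a(i := mul (a i) (a j), j := e)) b"
proof -
  let ?a = "a(i := mul (a i) (a j), j := e)"
  have "free_moment n \<sigma> a b =
      (\<Sum>\<tau>\<in>perms_below n (cut j \<sigma>). cumul n \<tau> b * moment n (inv \<tau> \<circ> \<sigma>) a)"
    unfolding free_moment_def
  proof (rule sum.mono_neutral_right)
    show "perms_below n (cut j \<sigma>) \<subseteq> perms_below n \<sigma>" unfolding perms_below_cut[OF \<sigma> ij(2)] by blast
    show "\<forall>\<tau>\<in>perms_below n \<sigma> - perms_below n (cut j \<sigma>). cumul n \<tau> b * moment n (inv \<tau> \<circ> \<sigma>) a = 0"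
      unfolding perms_below_cut[OF \<sigma> ij(2)] using cumul_unit[of _ n j b] ij b by (auto simp: perms_below_def)
  qed simp
  also have "\<dots> = free_moment n (cut j \<sigma>) ?a b"
    unfolding free_moment_def
  proof (rule sum.cong[OF refl])
    fix \<tau> assume "\<tau> \<in> perms_below n (cut j \<sigma>)"
    then have \<tau>: "\<tau> permutes {..<n}" "\<tau> j = j" unfolding perms_below_cut[OF \<sigma> ij(2)] by (auto simp: perms_below_def)
    have \<rho>: "(inv \<tau> \<circ> \<sigma>) permutes {..<n}" by (rule permutes_compose[OF \<sigma> permutes_inv[OF \<tau>(1)]])
    have \<rho>i: "(inv \<tau> \<circ> \<sigma>) i = j" using ij(3) permutes_inv_eq[OF \<tau>(1), of j j] \<tau>(2) by simp
    have "moment n (inv \<tau> \<circ> \<sigma>) a = moment n (cut j (inv \<tau> \<circ> \<sigma>)) ?a"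
      unfolding cut_eq[OF \<rho> \<rho>i] by (rule moment_merge[OF \<rho> ij(1,2) \<rho>i ij(4)])
    then show "cumul n \<tau> b * moment n (inv \<tau> \<circ> \<sigma>) a = cumul n \<tau> b * moment n (inv \<tau> \<circ> cut j \<sigma>) ?a"
      unfolding cut_inv_comp[OF \<sigma> \<tau>] by simp
  qed
  finally show ?thesis .
qed

definition colour :: "(nat \<Rightarrow> bool) \<Rightarrow> bool \<Rightarrow> (nat \<Rightarrow> 'a) \<Rightarrow> nat \<Rightarrow> 'a" where
  "colour \<epsilon> c a = (\<lambda>i. if \<epsilon> i = c then a i else e)"

definition coloured_moment :: "nat \<Rightarrow> (nat \<Rightarrow> bool) \<Rightarrow> (nat \<Rightarrow> nat) \<Rightarrow> (nat \<Rightarrow> 'a) \<Rightarrow> complex" where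
  "coloured_moment n \<epsilon> \<sigma> a = free_moment n \<sigma> (colour \<epsilon> True a) (colour \<epsilon> False a)"

text \<open>Lets the colour of a given letter be the one that enters through moments.\<close>

lemma coloured_moment_eq:
  assumes "\<sigma> permutes {..<n}"
  shows "coloured_moment n \<epsilon> \<sigma> a = free_moment n \<sigma> (colour \<epsilon> c a) (colour \<epsilon> (\<not> c) a)"
  using free_moment_sym[OF assms, of "colour \<epsilon> True a" "colour \<epsilon> False a"]
  by (cases c) (auto simp: coloured_moment_def colour_def)

lemma colour_update: "colour \<epsilon> c (a(j := x)) = (if \<epsilon> j = c then (colour \<epsilon> c a)(j := x) else colour \<epsilon> c a)"
  by (auto simp: colour_def)

lemma coloured_moment_unit:
  assumes \<sigma>: "\<sigma> permutes {..<n}" and i: "i < n" "a i = e"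
  shows "coloured_moment n \<epsilon> \<sigma> a = coloured_moment n \<epsilon> (cut i \<sigma>) a"
  unfolding coloured_moment_def by (rule free_moment_unit[OF \<sigma> i(1)]) (auto simp: colour_def i(2))

lemma coloured_moment_merge:
  assumes \<sigma>: "\<sigma> permutes {..<n}" and ij: "i < n" "j < n" "\<sigma> i = j" "i \<noteq> j" and eps: "\<epsilon> i = \<epsilon> j"
  shows "coloured_moment n \<epsilon> \<sigma> a = coloured_moment n \<epsilon> (cut j \<sigma>) (a(i := mul (a i) (a j), j := e))"
proof -
  have "colour \<epsilon> (\<epsilon> i) (a(i := mul (a i) (a j), j := e)) =
      (colour \<epsilon> (\<epsilon> i) a)(i := mul (colour \<epsilon> (\<epsilon> i) a i) (colour \<epsilon> (\<epsilon> i) a j), j := e)"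
    "colour \<epsilon> (\<not> \<epsilon> i) (a(i := mul (a i) (a j), j := e)) = colour \<epsilon> (\<not> \<epsilon> i) a"
    using eps by (auto simp: colour_def)
  moreover have "colour \<epsilon> (\<not> \<epsilon> i) a i = e" "colour \<epsilon> (\<not> \<epsilon> i) a j = e"
    using eps by (auto simp: colour_def)
  ultimately show ?thesis
    unfolding coloured_moment_eq[OF \<sigma>, of _ _ "\<epsilon> i"] coloured_moment_eq[OF cut_permutes[OF \<sigma> ij(2)], of _ _ "\<epsilon> i"]
    using free_moment_merge[OF \<sigma> ij, of "colour \<epsilon> (\<not> \<epsilon> i) a" "colour \<epsilon> (\<epsilon> i) a"] by simp
qed

lemma coloured_moment_multilinear:
  assumes \<sigma>: "\<sigma> permutes {..<n}"
  shows "multilinear_on scale n (coloured_moment n \<epsilon> \<sigma>)"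
  unfolding multilinear_on_def
proof (intro allI impI)
  fix j a x y c assume j: "j < n"
  have M: "moment n (inv \<tau> \<circ> \<sigma>) (a(j := x + y)) = moment n (inv \<tau> \<circ> \<sigma>) (a(j := x)) + moment n (inv \<tau> \<circ> \<sigma>) (a(j := y))"
    "moment n (inv \<tau> \<circ> \<sigma>) (a(j := scale c x)) = c * moment n (inv \<tau> \<circ> \<sigma>) (a(j := x))"
    if "\<tau> \<in> perms_below n \<sigma>" for \<tau> a
    using moment_multilinear[OF permutes_compose[OF \<sigma> permutes_inv[OF perms_below_permutes[OF that]]]] j
    unfolding multilinear_on_def by blast+
  have lin: "free_moment n \<sigma> (a(j := x + y)) b = free_moment n \<sigma> (a(j := x)) b + free_moment n \<sigma> (a(j := y)) b"
    "free_moment n \<sigma> (a(j := scale c x)) b = c * free_moment n \<sigma> (a(j := x)) b" for a b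
    unfolding free_moment_def
    by (simp_all add: M sum.distrib sum_distrib_left algebra_simps cong: sum.cong)
  show "coloured_moment n \<epsilon> \<sigma> (a(j := x + y)) =
      coloured_moment n \<epsilon> \<sigma> (a(j := x)) + coloured_moment n \<epsilon> \<sigma> (a(j := y)) \<and>
      coloured_moment n \<epsilon> \<sigma> (a(j := scale c x)) = c * coloured_moment n \<epsilon> \<sigma> (a(j := x))"
    unfolding coloured_moment_eq[OF \<sigma>, of _ _ "\<epsilon> j"] colour_update using lin by simp
qed

text \<open>A permutation maps the points it moves to points it moves, so each factor acts within
  one colour.\<close>

lemma unmixed_of_supports:
  assumes \<tau>: "\<tau> permutes {..<n}" and \<rho>: "\<rho> permutes {..<n}"
    and s: "\<And>i. i < n \<Longrightarrow> \<epsilon> i \<Longrightarrow> \<tau> i = i" "\<And>i. i < n \<Longrightarrow> \<not> \<epsilon> i \<Longrightarrow> \<rho> i = i" and i: "i < n"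
  shows "\<epsilon> ((\<tau> \<circ> \<rho>) i) = \<epsilon> i"
proof (cases "\<epsilon> i")
  case True
  have "\<epsilon> (\<rho> i)"
  proof (rule ccontr)
    assume "\<not> \<epsilon> (\<rho> i)"
    then have "\<rho> (\<rho> i) = \<rho> i" using s(2) permutes_in_image[OF \<rho>, of i] i by simp
    then have "\<rho> i = i" using permutes_inj[OF \<rho>] by (metis injD)
    then show False using True \<open>\<not> \<epsilon> (\<rho> i)\<close> by simp
  qed
  then show ?thesis using s(1) permutes_in_image[OF \<rho>, of i] i True by simp
next
  case False
  have "\<not> \<epsilon> (\<tau> i)"
  proof
    assume "\<epsilon> (\<tau> i)"
    then have "\<tau> (\<tau> i) = \<tau> i" using s(1) permutes_in_image[OF \<tau>, of i] i by simp
    then have "\<tau> i = i" using permutes_inj[OF \<tau>] by (metis injD)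
    then show False using False \<open>\<epsilon> (\<tau> i)\<close> by simp
  qed
  then show ?thesis using s(2) i False by simp
qed

lemma coloured_pair_supports:
  assumes "\<tau> permutes {..<n}" "\<rho> permutes {..<n}"
    and "cumul n \<tau> (colour \<epsilon> False a) * cumul n \<rho> (colour \<epsilon> True a) \<noteq> 0"
  shows "i < n \<Longrightarrow> \<epsilon> i \<Longrightarrow> \<tau> i = i" "i < n \<Longrightarrow> \<not> \<epsilon> i \<Longrightarrow> \<rho> i = i"
  using cumul_support[OF assms(1), of "colour \<epsilon> False a" i]
    cumul_support[OF assms(2), of "colour \<epsilon> True a" i] assms(3)
  by (auto simp: colour_def)

text \<open>Grouped by their product \<omega>, the pairs in the coloured moment give numbers whose
  sums below \<sigma> are the moments, so these numbers are the cumulants. If \<sigma> changes a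
  colour, its group contains no nonzero term, since the products of contributing pairs preserve
  colours.\<close>

lemma cumul_mixed_zero:
  assumes eq: "\<And>\<sigma>. \<sigma> permutes {..<n} \<Longrightarrow> moment n \<sigma> a = coloured_moment n \<epsilon> \<sigma> a"
    and \<sigma>: "\<sigma> permutes {..<n}" and i: "i < n" "\<epsilon> i \<noteq> \<epsilon> (\<sigma> i)"
  shows "cumul n \<sigma> a = 0"
proof -
  let ?F = "\<lambda>x. cumul n (fst x) (colour \<epsilon> False a) * cumul n (snd x) (colour \<epsilon> True a)"
  let ?P = "\<lambda>\<omega>. {x \<in> geodesic_pairs n \<omega>. fst x \<circ> snd x = \<omega>}"
  have "cumul n \<sigma> a = (\<Sum>x\<in>?P \<sigma>. ?F x)"
  proof (rule cumul_unique[OF _ \<sigma>])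
    fix \<sigma> assume \<sigma>: "\<sigma> permutes {..<n}"
    have "?P \<omega> = {x \<in> geodesic_pairs n \<sigma>. fst x \<circ> snd x = \<omega>}" if "\<omega> \<in> perms_below n \<sigma>" for \<omega>
      using that perm_le_refl by (auto simp: geodesic_pairs_def perms_below_def)
    then have "(\<Sum>\<omega>\<in>perms_below n \<sigma>. \<Sum>x\<in>?P \<omega>. ?F x) =
        (\<Sum>\<omega>\<in>perms_below n \<sigma>. \<Sum>x\<in>{x \<in> geodesic_pairs n \<sigma>. fst x \<circ> snd x = \<omega>}. ?F x)"
      by simp
    also have "\<dots> = (\<Sum>x\<in>geodesic_pairs n \<sigma>. ?F x)"
      by (rule sum.group[OF finite_geodesic_pairs finite_perms_below])
        (auto simp: geodesic_pairs_def perms_below_def permutes_compose)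
    also have "\<dots> = moment n \<sigma> a"
      unfolding eq[OF \<sigma>] coloured_moment_def free_moment_pairs[OF \<sigma>] by (simp add: case_prod_unfold)
    finally show "(\<Sum>\<omega>\<in>perms_below n \<sigma>. \<Sum>x\<in>?P \<omega>. ?F x) = moment n \<sigma> a" .
  qed
  also have "\<dots> = 0"
  proof (rule sum.neutral, rule ballI, rule ccontr)
    fix x assume x: "x \<in> ?P \<sigma>" and nz: "?F x \<noteq> 0"
    then have p: "fst x permutes {..<n}" "snd x permutes {..<n}" "fst x \<circ> snd x = \<sigma>"
      by (auto simp: geodesic_pairs_def)
    have "\<epsilon> ((fst x \<circ> snd x) i) = \<epsilon> i"
      by (rule unmixed_of_supports[OF p(1,2) _ _ i(1)]) (use coloured_pair_supports[OF p(1,2) nz] in blast)+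
    then show False using p(3) i(2) by simp
  qed
  finally show ?thesis .
qed

text \<open>A fixed point of \<open>\<tau> \<circ> \<rho>\<close> in \<open>T\<close> is fixed by
  both factors, and the cumulant of its colour vanishes by centring. Without such a point there is a
  coincidence with \<sigma>, which is absurd: \<sigma> changes the colour there while
  \<open>\<tau> \<circ> \<rho>\<close> preserves it.\<close>

lemma coloured_moment_zero:
  assumes \<sigma>: "\<sigma> permutes {..<n}" and T: "T \<subseteq> {..<n}" "T \<noteq> {}" and fixed: "\<And>i. i \<notin> T \<Longrightarrow> \<sigma> i = i"
    and centred: "\<And>i. i \<in> T \<Longrightarrow> \<phi> (a i) = 0" and alt: "\<And>i. \<lbrakk>i \<in> T; \<sigma> i \<noteq> i\<rbrakk> \<Longrightarrow> \<epsilon> i \<noteq> \<epsilon> (\<sigma> i)"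
  shows "coloured_moment n \<epsilon> \<sigma> a = 0"
  unfolding coloured_moment_def free_moment_pairs[OF \<sigma>]
proof (rule sum.neutral, clarify, rule ccontr)
  fix \<tau> \<rho>
  assume x: "(\<tau>, \<rho>) \<in> geodesic_pairs n \<sigma>" and nz: "cumul n \<tau> (colour \<epsilon> False a) * cumul n \<rho> (colour \<epsilon> True a) \<noteq> 0"
  have p: "\<tau> permutes {..<n}" "\<rho> permutes {..<n}" "perm_le n (\<tau> \<circ> \<rho>) \<sigma>"
    using x by (auto simp: geodesic_pairs_def)
  note s = coloured_pair_supports[OF p(1,2) nz]
  have tr: "(\<tau> \<circ> \<rho>) permutes {..<n}" using p(1,2) by (simp add: permutes_compose)
  have unm: "\<epsilon> ((\<tau> \<circ> \<rho>) i) = \<epsilon> i" if "i < n" for i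
    by (rule unmixed_of_supports[OF p(1,2) _ _ that]) (use s in blast)+
  show False
  proof (cases "\<exists>i\<in>T. (\<tau> \<circ> \<rho>) i = i")
    case True
    then obtain i where i: "i \<in> T" "\<tau> (\<rho> i) = i" by auto
    have "i < n" using i T by blast
    show False
    proof (cases "\<epsilon> i")
      case True
      then have "\<tau> i = i" using s(1) \<open>i < n\<close> by simp
      then have "\<rho> i = i" using i(2) permutes_inj[OF p(1)] by (metis injD)
      then have "cumul n \<rho> (colour \<epsilon> True a) = 0"
        using cumul_centred[OF p(2) \<open>i < n\<close>] centred[OF i(1)] True by (simp add: colour_def)
      then show False using nz by simp
    next
      case False
      then have "\<rho> i = i" using s(2) \<open>i < n\<close> by simp
      then have "cumul n \<tau> (colour \<epsilon> False a) = 0"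
        using cumul_centred[OF p(1) \<open>i < n\<close>] centred[OF i(1)] i(2) False by (simp add: colour_def)
      then show False using nz by simp
    qed
  next
    case False
    then have "2 \<le> card {i \<in> T. (\<tau> \<circ> \<rho>) i = \<sigma> i}"
      by (intro perm_le_coincidences[OF \<sigma> tr p(3) T fixed]) auto
    then have "{i \<in> T. (\<tau> \<circ> \<rho>) i = \<sigma> i} \<noteq> {}" by (metis card.empty not_numeral_le_zero)
    then obtain i where i: "i \<in> T" "(\<tau> \<circ> \<rho>) i = \<sigma> i" by blast
    then have "\<sigma> i \<noteq> i" using False by metis
    then show False using alt[OF i(1)] unm[of i] i T by auto
  qed
qed

section \<open>Collapsing a cycle to a product of letters\<close>

lemma list_mult_snoc: "xs \<noteq> [] \<Longrightarrow> list_mult mul (xs @ [y]) = mul (list_mult mul xs) y"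
proof (induction xs rule: induct_list012)
  case (3 x y zs)
  then show ?case by (simp add: mult_assoc)
qed auto

text \<open>The successors of \<open>i\<close> are merged into \<open>i\<close> one after another.
  As \<open>i\<close> does not recur before step \<open>r\<close>, each successor is still untouched
  when its turn comes.\<close>

lemma moment_collapse:
  assumes \<sigma>: "\<sigma> permutes {..<n}" and i: "i < n" and "r \<ge> 1" "\<And>t. 0 < t \<Longrightarrow> t < r \<Longrightarrow> (\<sigma> ^^ t) i \<noteq> i"
  shows "\<exists>\<sigma>' a'. moment n \<sigma> a = moment n \<sigma>' a' \<and> \<sigma>' permutes {..<n} \<and> \<sigma>' i = (\<sigma> ^^ r) i \<and>
    a' i = list_mult mul (map (\<lambda>t. a ((\<sigma> ^^ t) i)) [0..<r]) \<and>
    (\<forall>t. 0 < t \<and> t < r \<longrightarrow> a' ((\<sigma> ^^ t) i) = e) \<and>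
    (\<forall>j. j \<notin> (\<lambda>t. (\<sigma> ^^ t) i) ` {..<r} \<longrightarrow> \<sigma>' j = \<sigma> j \<and> a' j = a j)"
  using assms(3,4)
proof (induction r rule: nat_induct_at_least)
  case base
  show ?case by (rule exI[of _ \<sigma>], rule exI[of _ a]) (use \<sigma> in auto)
next
  case (Suc r)
  let ?o = "\<lambda>t. (\<sigma> ^^ t) i"
  obtain \<sigma>' a' where IH: "moment n \<sigma> a = moment n \<sigma>' a'" "\<sigma>' permutes {..<n}" "\<sigma>' i = ?o r"
    "a' i = list_mult mul (map (\<lambda>t. a (?o t)) [0..<r])"
    "\<And>t. 0 < t \<Longrightarrow> t < r \<Longrightarrow> a' (?o t) = e"
    "\<And>j. j \<notin> ?o ` {..<r} \<Longrightarrow> \<sigma>' j = \<sigma> j \<and> a' j = a j"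
    using Suc.IH Suc.prems by auto
  \<comment> \<open>By injectivity of \<sigma>, equal orbit points would mean an earlier return to
    \<open>i\<close>.\<close>
  have "?o r \<noteq> ?o t" if "t < r" for t
  proof
    assume "?o r = ?o t"
    then have "(\<sigma> ^^ t) ((\<sigma> ^^ (r - t)) i) = (\<sigma> ^^ t) i"
      using that funpow_add[of t "r - t" \<sigma>] by simp
    moreover have "inj (\<sigma> ^^ t)" using inj_fn[OF permutes_inj[OF \<sigma>]] .
    ultimately have "(\<sigma> ^^ (r - t)) i = i" by (metis injD)
    then show False using Suc.prems[of "r - t"] that Suc.hyps by auto
  qed
  then have new: "?o r \<notin> ?o ` {..<r}" by blast
  have "i \<in> ?o ` {..<r}" using Suc.hyps by (intro image_eqI[of _ _ 0]) auto
  with new have j: "?o r \<noteq> i" "\<sigma>' (?o r) = ?o (Suc r)" "a' (?o r) = a (?o r)"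
    using IH(6)[OF new] by auto
  have "?o r < n" using permutes_in_image[OF IH(2), of i] IH(3) i by simp
  let ?s = "\<sigma>' \<circ> transpose i (?o r)" and ?a = "a'(i := mul (a' i) (a' (?o r)), ?o r := e)"
  show ?case
  proof (rule exI[of _ ?s], rule exI[of _ ?a], intro conjI allI impI)
    show "moment n \<sigma> a = moment n ?s ?a"
      unfolding IH(1) by (rule moment_merge[OF IH(2) i \<open>?o r < n\<close> IH(3)]) (use j in simp)
    show "?s permutes {..<n}"
      by (intro permutes_compose[OF permutes_swap_id IH(2)]) (use i \<open>?o r < n\<close> in auto)
    show "?s i = ?o (Suc r)" using j(2) by simp
    show "?a i = list_mult mul (map (\<lambda>t. a (?o t)) [0..<Suc r])"
      using j IH(4) Suc.hyps list_mult_snoc[of "map (\<lambda>t. a (?o t)) [0..<r]" "a (?o r)"] by simp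
    show "?a (?o t) = e" if "0 < t \<and> t < Suc r" for t
    proof (cases "t = r")
      case False
      then have "?o t \<noteq> i" using Suc.prems[of t] that by simp
      then show ?thesis using IH(5)[of t] that False by simp
    qed simp
    fix j assume "j \<notin> ?o ` {..<Suc r}"
    with \<open>i \<in> ?o ` {..<r}\<close> have "j \<noteq> i" "j \<noteq> ?o r" "j \<notin> ?o ` {..<r}"
      using Suc.hyps by (auto simp: lessThan_Suc)
    then show "?s j = \<sigma> j" "?a j = a j" using IH(6)[of j] by simp_all
  qed
qed

text \<open>Voiculescu's condition; \<open>V True\<close> and \<open>V False\<close> will be the two
  generated algebras with the unit adjoined.\<close>

definition alternating_free :: "(bool \<Rightarrow> 'a set) \<Rightarrow> bool" where
  "alternating_free V \<longleftrightarrow> (\<forall>xs \<epsilon>. xs \<noteq> [] \<and>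
     (\<forall>i<length xs. xs ! i \<in> V (\<epsilon> i) \<and> \<phi> (xs ! i) = 0) \<and>
     (\<forall>i. Suc i < length xs \<longrightarrow> \<epsilon> i \<noteq> \<epsilon> (Suc i)) \<longrightarrow> \<phi> (list_mult mul xs) = 0)"

text \<open>\<open>T\<close> contains the whole cycle of each of its points. Collapsing one cycle
  leaves a fixed point whose letter is an alternating product of centred letters, and the trace of
  that letter is a factor of the moment.\<close>

lemma moment_alternating_zero:
  assumes free: "alternating_free V"
    and \<sigma>: "\<sigma> permutes {..<n}" and T: "T \<subseteq> {..<n}" "T \<noteq> {}" and fixed: "\<And>i. i \<notin> T \<Longrightarrow> \<sigma> i = i"
    and a: "\<And>i. i \<in> T \<Longrightarrow> a i \<in> V (\<epsilon> i) \<and> \<phi> (a i) = 0"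
    and alt: "\<And>i. \<lbrakk>i \<in> T; \<sigma> i \<noteq> i\<rbrakk> \<Longrightarrow> \<epsilon> i \<noteq> \<epsilon> (\<sigma> i)"
  shows "moment n \<sigma> a = 0"
proof -
  obtain i where i: "i \<in> T" using T by blast
  let ?o = "\<lambda>t. (\<sigma> ^^ t) i"
  have on: "?o t < n" for t
    by (induction t) (use i T permutes_in_image[OF \<sigma>] in auto)
  have "finite {y. \<exists>t. y = ?o t}" by (rule finite_subset[of _ "{..<n}"]) (use on in auto)
  then obtain p where "p > 0 \<and> ?o p = i" using funpow_inj_finite[OF permutes_inj[OF \<sigma>]] by blast
  then obtain r where r: "r > 0 \<and> ?o r = i" "\<And>t. t < r \<Longrightarrow> \<not> (t > 0 \<and> ?o t = i)"
    using exists_least_iff[of "\<lambda>p. p > 0 \<and> ?o p = i"] by blast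
  have oT: "?o t \<in> T" for t
  proof (induction t)
    case (Suc t)
    show ?case
    proof (rule ccontr)
      assume "?o (Suc t) \<notin> T"
      then have "\<sigma> (\<sigma> (?o t)) = \<sigma> (?o t)" using fixed by simp
      then have "\<sigma> (?o t) = ?o t" using permutes_inj[OF \<sigma>] by (metis injD)
      then show False using Suc \<open>?o (Suc t) \<notin> T\<close> by simp
    qed
  qed (use i in simp)
  obtain \<sigma>' a' where c: "moment n \<sigma> a = moment n \<sigma>' a'" "\<sigma>' permutes {..<n}" "\<sigma>' i = ?o r"
    "a' i = list_mult mul (map (\<lambda>t. a (?o t)) [0..<r])"
    using moment_collapse[OF \<sigma>, of i r a] i T r by fastforce
  have "\<phi> (list_mult mul (map (\<lambda>t. a (?o t)) [0..<r])) = 0"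
  proof (rule free[unfolded alternating_free_def, rule_format, where \<epsilon> = "\<lambda>t. \<epsilon> (?o t)"], intro conjI allI impI)
    show "map (\<lambda>t. a (?o t)) [0..<r] \<noteq> []" using r(1) by simp
    show "map (\<lambda>t. a (?o t)) [0..<r] ! t \<in> V (\<epsilon> (?o t))" "\<phi> (map (\<lambda>t. a (?o t)) [0..<r] ! t) = 0"
      if "t < length (map (\<lambda>t. a (?o t)) [0..<r])" for t
      using that a[OF oT[of t]] by simp_all
    show "\<epsilon> (?o t) \<noteq> \<epsilon> (?o (Suc t))" if t: "Suc t < length (map (\<lambda>t. a (?o t)) [0..<r])" for t
    proof -
      \<comment> \<open>A fixed orbit point would make \<open>i\<close> fixed, against the
        minimality of \<open>r\<close>, which exceeds 1 here.\<close>
      have "\<sigma> (?o t) \<noteq> ?o t"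
      proof
        assume "\<sigma> (?o t) = ?o t"
        then have "(\<sigma> ^^ t) (\<sigma> i) = (\<sigma> ^^ t) i" by (metis comp_apply funpow_Suc_right funpow.simps(2))
        then have "\<sigma> i = i" using inj_fn[OF permutes_inj[OF \<sigma>], of t] by (metis injD)
        then show False using r(2)[of 1] t by simp
      qed
      then show ?thesis using alt[OF oT] by simp
    qed
  qed
  moreover have "i < n" using i T by blast
  moreover have "\<sigma>' i = i" using c(3) r(1) by simp
  ultimately show ?thesis using moment_fixed[OF c(2) _ , of i a'] c(1,4) by simp
qed

lemma multilinear_on_diff:
  assumes "multilinear_on scale n u" "multilinear_on scale n v"
  shows "multilinear_on scale n (\<lambda>a. u a - v a)"
  using assms by (simp add: multilinear_on_def algebra_simps)

text \<open>Both sides are multilinear, insensitive to units, compatible with products of neighbouring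
  letters of the same colour, and vanish on alternating centred letters; \<open>T\<close> contains the
  positions not yet occupied by a unit.\<close>

lemma moment_eq_coloured_moment:
  assumes free: "alternating_free V"
    and V: "\<And>c. e \<in> V c" "\<And>c x y. \<lbrakk>x \<in> V c; y \<in> V c\<rbrakk> \<Longrightarrow> mul x y \<in> V c"
      "\<And>c x. x \<in> V c \<Longrightarrow> x - scale (\<phi> x) e \<in> V c"
    and "T \<subseteq> {..<n}" "\<sigma> permutes {..<n}" "\<And>i. i \<notin> T \<Longrightarrow> \<sigma> i = i"
      "\<And>i. i < n \<Longrightarrow> i \<notin> T \<Longrightarrow> a i = e" "\<And>i. i < n \<Longrightarrow> a i \<in> V (\<epsilon> i)"
  shows "moment n \<sigma> a = coloured_moment n \<epsilon> \<sigma> a"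
  using assms(5-9)
proof (induction "card T" arbitrary: T \<sigma> a rule: less_induct)
  case less
  note T = less.prems(1) and \<sigma> = less.prems(2) and fixed = less.prems(3) and unit = less.prems(4)
    and aV = less.prems(5)
  have finT: "finite T" using T finite_subset by blast
  \<comment> \<open>The induction hypothesis, once position \<open>j\<close> carries a unit and has
    been cut out of its cycle.\<close>
  have remove: "moment n (cut j \<sigma>) b = coloured_moment n \<epsilon> (cut j \<sigma>) b"
    if j: "j \<in> T" and b: "b j = e" "\<And>i. i < n \<Longrightarrow> i \<notin> T \<Longrightarrow> b i = e" "\<And>i. i < n \<Longrightarrow> b i \<in> V (\<epsilon> i)" for j b
  proof (rule less.hyps[of "T - {j}"])
    have jn: "j < n" using j T by blast
    show "card (T - {j}) < card T" using finT j by (rule card_Diff1_less)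
    show "cut j \<sigma> permutes {..<n}" by (rule cut_permutes[OF \<sigma> jn])
    show "cut j \<sigma> i = i" if "i \<notin> T - {j}" for i
    proof -
      have "cut j \<sigma> i = i" if "\<sigma> i = i"
        using perm_le_fixes[OF \<sigma> cut_permutes[OF \<sigma> jn] perm_le_cut[OF \<sigma> jn] that] .
      then show ?thesis using fixed that cut_fixes[OF \<sigma>] by (cases "i = j") auto
    qed
  qed (use T b in auto)
  show ?case
  proof (cases "T = {}")
    case True
    then have "\<sigma> = id" using fixed by auto
    have "perms_below n id = {id}"
      using perm_le_fixes[OF permutes_id] perm_le_refl[OF permutes_id] permutes_id
      by (auto simp: perms_below_def fun_eq_iff)
    then have sp: "moment n id b = cumul n id b" for b using cumul_spec(2)[OF permutes_id, of n b] by simp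
    have all: "moment n id (colour \<epsilon> c a) = 1" for c
      by (rule moment_all_unit[OF permutes_id]) (use unit True in \<open>simp add: colour_def\<close>)
    have "moment n id a = 1" by (rule moment_all_unit[OF permutes_id]) (use unit True in simp)
    then show ?thesis
      unfolding \<open>\<sigma> = id\<close> coloured_moment_def free_moment_def \<open>perms_below n id = {id}\<close>
      using all by (simp add: sp[symmetric] id_def[symmetric])
  next
    case ne: False
    show ?thesis
    proof (cases "\<exists>i\<in>T. \<sigma> i \<noteq> i \<and> \<epsilon> i = \<epsilon> (\<sigma> i)")
      case True
      then obtain i where i: "i \<in> T" "\<sigma> i \<noteq> i" "\<epsilon> i = \<epsilon> (\<sigma> i)" by blast
      let ?j = "\<sigma> i" and ?a = "a(i := mul (a i) (a (\<sigma> i)), \<sigma> i := e)"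
      \<comment> \<open>\<open>\<sigma> i\<close> is moved because \<open>i\<close> is, and
        \<open>T\<close> contains all moved points.\<close>
      have jT: "?j \<in> T" using i fixed permutes_inj[OF \<sigma>] by (metis injD)
      then have n: "i < n" "?j < n" using i T by auto
      have "moment n \<sigma> a = moment n (cut ?j \<sigma>) ?a"
        unfolding cut_eq[OF \<sigma> refl] by (rule moment_merge[OF \<sigma> n refl]) (use i in auto)
      also have "\<dots> = coloured_moment n \<epsilon> (cut ?j \<sigma>) ?a"
      proof (rule remove[OF jT])
        have "mul (a i) (a ?j) \<in> V (\<epsilon> i)" by (rule V(2)) (use aV[OF n(1)] aV[OF n(2)] i(3) in auto)
        then show "?a k \<in> V (\<epsilon> k)" if "k < n" for k using aV[OF that] V(1) by simp
      qed (use unit i jT in auto)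
      also have "\<dots> = coloured_moment n \<epsilon> \<sigma> a"
        by (rule coloured_moment_merge[OF \<sigma> n refl, symmetric]) (use i in auto)
      finally show ?thesis .
    next
      case alt: False
      \<comment> \<open>No neighbours of equal colour are left. The difference \<open>D\<close> is
        multilinear and vanishes as soon as a position of \<open>T\<close> carries a unit, so
        centring the letters one by one does not change it.\<close>
      define D where "D b = moment n \<sigma> b - coloured_moment n \<epsilon> \<sigma> b" for b
      have Dlin: "multilinear_on scale n D" unfolding D_def
        by (rule multilinear_on_diff[OF moment_multilinear[OF \<sigma>] coloured_moment_multilinear[OF \<sigma>]])
      have D0: "D b = 0"
        if "j \<in> T" "b j = e" "\<And>i. i < n \<Longrightarrow> i \<notin> T \<Longrightarrow> b i = e" "\<And>i. i < n \<Longrightarrow> b i \<in> V (\<epsilon> i)" for j b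
        using remove[OF that] moment_unit[OF \<sigma>, of j b] coloured_moment_unit[OF \<sigma>, of j b \<epsilon>] that(1,2) T
        by (auto simp: D_def)
      define cen where "cen U i = (if i \<in> U then a i - scale (\<phi> (a i)) e else a i)" for U i
      have "D a = D (cen U)" if "U \<subseteq> T" for U
        using finite_subset[OF that finT] that
      proof (induction U rule: finite_induct)
        case empty
        then show ?case by (simp add: cen_def)
      next
        case (insert j U)
        have jn: "j < n" using insert.prems T by blast
        let ?x = "a j - scale (\<phi> (a j)) e"
        have "cen U = (cen U)(j := ?x + scale (\<phi> (a j)) e)" using insert.hyps by (auto simp: cen_def)
        then have "D (cen U) = D ((cen U)(j := ?x)) + \<phi> (a j) * D ((cen U)(j := e))"
          using Dlin jn unfolding multilinear_on_def by metis
        moreover have "(cen U)(j := ?x) = cen (insert j U)" by (auto simp: cen_def)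
        moreover have "D ((cen U)(j := e)) = 0"
        proof (rule D0[of j])
          show "j \<in> T" using insert.prems by simp
          show "((cen U)(j := e)) i = e" if "i < n" "i \<notin> T" for i
            using that unit insert.prems by (auto simp: cen_def)
          show "((cen U)(j := e)) i \<in> V (\<epsilon> i)" if "i < n" for i
            using that aV V by (auto simp: cen_def)
        qed simp
        ultimately show ?case using insert.IH insert.prems by simp
      qed
      then have "D a = D (cen T)" by simp
      also have "\<dots> = 0"
      proof -
        have ph: "\<phi> (cen T i) = 0" if "i \<in> T" for i
        proof -
          have "\<phi> (cen T i) + \<phi> (scale (\<phi> (a i)) e) = \<phi> (a i)"
            unfolding phi_add[symmetric] using that by (simp add: cen_def)
          then show ?thesis by (simp add: phi_scale)
        qed
        have al: "\<epsilon> i \<noteq> \<epsilon> (\<sigma> i)" if "i \<in> T" "\<sigma> i \<noteq> i" for i using alt that by blast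
        have "moment n \<sigma> (cen T) = 0"
        proof (rule moment_alternating_zero[where \<epsilon> = \<epsilon> and \<sigma> = \<sigma>, OF free \<sigma> T ne fixed _ al])
          show "cen T i \<in> V (\<epsilon> i) \<and> \<phi> (cen T i) = 0" if "i \<in> T" for i
            using ph[OF that] aV[of i] V(3) that T by (auto simp: cen_def)
        qed
        moreover have "coloured_moment n \<epsilon> \<sigma> (cen T) = 0"
          by (rule coloured_moment_zero[where \<sigma> = \<sigma> and \<epsilon> = \<epsilon> and a = "cen T" and T = T and n = n, OF \<sigma> T ne fixed ph al])
        ultimately show ?thesis by (simp add: D_def)
      qed
      finally show ?thesis by (simp add: D_def)
    qed
  qed
qed

section \<open>From cumulants back to alternating products\<close>

definition full_cycle :: "nat \<Rightarrow> nat \<Rightarrow> nat" where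
  "full_cycle n i = (if i < n then Suc i mod n else i)"

lemma full_cycle_permutes: "full_cycle n permutes {..<n}"
proof (rule bij_imp_permutes)
  have "inj_on (full_cycle n) {..<n}"
  proof (rule inj_onI)
    fix i j assume "i \<in> {..<n}" "j \<in> {..<n}" "full_cycle n i = full_cycle n j"
    then have ij: "i < n" "j < n" "Suc i mod n = Suc j mod n" by (simp_all add: full_cycle_def)
    show "i = j"
    proof (cases "Suc i = n \<or> Suc j = n")
      case True
      then show ?thesis using ij by (metis Suc_inject Suc_lessI mod_less mod_self nat.distinct(1))
    next
      case False
      then show ?thesis using ij by simp
    qed
  qed
  moreover have "full_cycle n ` {..<n} \<subseteq> {..<n}" by (auto simp: full_cycle_def)
  ultimately show "bij_betw (full_cycle n) {..<n} {..<n}"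
    using endo_inj_surj[of "{..<n}" "full_cycle n"] by (simp add: bij_betw_def)
qed (simp add: full_cycle_def)

lemma full_cycle_funpow:
  assumes "t < n"
  shows "(full_cycle n ^^ t) 0 = t"
  using assms by (induction t) (auto simp: full_cycle_def)

lemma moment_full_cycle:
  assumes "n > 0"
  shows "moment n (full_cycle n) a = \<phi> (list_mult mul (map a [0..<n]))"
proof -
  let ?c = "full_cycle n"
  have ne: "(?c ^^ t) 0 \<noteq> 0" if "0 < t" "t < n" for t using full_cycle_funpow[of t n] that by simp
  obtain \<sigma>' a' where c: "moment n ?c a = moment n \<sigma>' a'" "\<sigma>' permutes {..<n}" "\<sigma>' 0 = (?c ^^ n) 0"
    "a' 0 = list_mult mul (map (\<lambda>t. a ((?c ^^ t) 0)) [0..<n])"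
    "\<And>t. 0 < t \<and> t < n \<Longrightarrow> a' ((?c ^^ t) 0) = e"
    using moment_collapse[OF full_cycle_permutes, of 0 n n a] ne assms by fastforce
  have "(?c ^^ n) 0 = 0"
  proof -
    obtain m where m: "n = Suc m" using assms by (cases n) auto
    then have "(?c ^^ n) 0 = ?c m" using full_cycle_funpow[of m n] by simp
    then show ?thesis using m by (simp add: full_cycle_def)
  qed
  then have "moment n \<sigma>' a' = \<phi> (a' 0) * moment n \<sigma>' (a'(0 := e))"
    by (intro moment_fixed[OF c(2) assms]) (simp add: c(3))
  moreover have "moment n \<sigma>' (a'(0 := e)) = 1"
  proof (rule moment_all_unit[OF c(2)])
    fix i assume "i < n"
    then show "(a'(0 := e)) i = e" using c(5)[of i] full_cycle_funpow[of i n] by auto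
  qed
  moreover have "map (\<lambda>t. a ((?c ^^ t) 0)) [0..<n] = map a [0..<n]"
    using full_cycle_funpow by auto
  ultimately show ?thesis using c(1,4) by simp
qed

text \<open>The trace of the word is a sum of cumulants below the full cycle. Those with a fixed
  point vanish by centring, and the others turn out to be mixed.\<close>

lemma alternating_zero_of_cumul:
  assumes "n > 0" and centred: "\<And>i. i < n \<Longrightarrow> \<phi> (x i) = 0"
    and alt: "\<And>i. Suc i < n \<Longrightarrow> \<epsilon> i \<noteq> \<epsilon> (Suc i)"
    and zero: "\<And>\<tau>. \<lbrakk>\<tau> permutes {..<n}; \<And>i. i < n \<Longrightarrow> \<tau> i \<noteq> i; \<exists>i<n. \<epsilon> i \<noteq> \<epsilon> (\<tau> i)\<rbrakk> \<Longrightarrow> cumul n \<tau> x = 0"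
  shows "\<phi> (list_mult mul (map x [0..<n])) = 0"
proof -
  have "cumul n \<tau> x = 0" if "\<tau> \<in> perms_below n (full_cycle n)" for \<tau>
  proof (cases "\<exists>i<n. \<tau> i = i")
    case True
    then show ?thesis using cumul_centred[OF perms_below_permutes[OF that]] centred by blast
  next
    case False
    have \<tau>: "\<tau> permutes {..<n}" "perm_le n \<tau> (full_cycle n)" using that by (auto simp: perms_below_def)
    \<comment> \<open>Two coincidences are asked for because the word alternates only linearly: the
      step from the last letter back to the first may join equal colours. At least one coincidence
      is not this step.\<close>
    have two: "2 \<le> card {i \<in> {..<n}. \<tau> i = full_cycle n i}"
      by (rule perm_le_coincidences[OF full_cycle_permutes \<tau>])
        (use assms(1) False in \<open>auto simp: full_cycle_def\<close>)
    have "\<exists>i. Suc i < n \<and> \<tau> i = Suc i"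
    proof (rule ccontr)
      assume no: "\<nexists>i. Suc i < n \<and> \<tau> i = Suc i"
      have "{i \<in> {..<n}. \<tau> i = full_cycle n i} \<subseteq> {n - 1}"
      proof
        fix i assume i: "i \<in> {i \<in> {..<n}. \<tau> i = full_cycle n i}"
        then have "\<not> Suc i < n" using no by (auto simp: full_cycle_def)
        then show "i \<in> {n - 1}" using i by auto
      qed
      then have "card {i \<in> {..<n}. \<tau> i = full_cycle n i} \<le> card {n - 1}" by (rule card_mono[rotated]) simp
      then show False using two by simp
    qed
    then obtain i where "Suc i < n" "\<tau> i = Suc i" by blast
    then have "\<exists>i<n. \<epsilon> i \<noteq> \<epsilon> (\<tau> i)" using alt[of i] by (intro exI[of _ i]) auto
    then show ?thesis using zero[OF \<tau>(1)] False by blast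
  qed
  then show ?thesis
    unfolding moment_full_cycle[OF assms(1), symmetric] cumul_spec(2)[OF full_cycle_permutes] by simp
qed

text \<open>A unit at a moved position kills the cumulant, so by multilinearity the scalar parts of
  the letters do not count. This leads from letters of the unitization back to elements of the
  algebra.\<close>

lemma cumul_shift_units:
  assumes \<tau>: "\<tau> permutes {..<n}" "\<And>i. i < n \<Longrightarrow> \<tau> i \<noteq> i"
    and x: "\<And>i. i < n \<Longrightarrow> x i = scale (c i) e + a i" "\<And>i. i \<ge> n \<Longrightarrow> x i = a i"
  shows "cumul n \<tau> x = cumul n \<tau> a"
proof -
  note lin = cumul_spec(1)[OF \<tau>(1), unfolded multilinear_on_def, rule_format]
  \<comment> \<open>The first \<open>m\<close> letters have already lost their scalar parts.\<close>
  define f where "f m i = (if i < m then a i else x i)" for m i :: nat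
  have "cumul n \<tau> (f m) = cumul n \<tau> x" if "m \<le> n" for m
    using that
  proof (induction m)
    case 0
    then show ?case by (simp add: f_def)
  next
    case (Suc m)
    have f: "f m = (f m)(m := scale (c m) e + a m)" "f (Suc m) = (f m)(m := a m)"
      using x(1)[of m] Suc.prems by (auto simp: f_def)
    have "cumul n \<tau> ((f m)(m := e)) = 0" using cumul_unit[OF \<tau>(1), of m] \<tau>(2)[of m] Suc.prems by simp
    then have "cumul n \<tau> ((f m)(m := scale (c m) e + a m)) = cumul n \<tau> ((f m)(m := a m))"
      using lin[of m "f m"] Suc.prems by simp
    then have "cumul n \<tau> (f m) = cumul n \<tau> (f (Suc m))"
      unfolding f(1)[symmetric] f(2)[symmetric] .
    then show ?case using Suc by simp
  qed
  from this[of n] have "cumul n \<tau> (f n) = cumul n \<tau> x" by simp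
  moreover have "f n = a" using x(2) by (auto simp: f_def)
  ultimately show ?thesis by simp
qed

end


section \<open>Freeness with respect to the permutations\<close>

lemma cumulant_family:
  assumes "P_tracial_algebra scale mul m" and "\<And>k. \<C> k \<subseteq> diagrams k"
  shows "is_cumulant_family scale m \<C> (cumulant scale m \<C>)"
proof -
  interpret P_tracial_algebra scale mul m by fact
  show ?thesis
    by (rule cumulant_is_cumulant_family[OF vector_space_axioms assms(2)])
      (use assms(2) m_multilinear in blast)
qed

lemma moment_cumulant_sum:
  assumes "is_cumulant_family scale m \<C> \<kappa>" "p \<in> \<C> k" "length as = k"
  shows "m p as = (\<Sum>p'\<in>{p' \<in> \<C> k. geodesic_le k p' p}. \<kappa> p' as)"
  using assms unfolding is_cumulant_family_def by blast

lemma sum_perm_diagrams_below: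
  "(\<Sum>p\<in>{p \<in> perm_diagrams n. geodesic_le n p (perm_diagram n \<sigma>)}. f p) =
    (\<Sum>\<tau>\<in>perms_below n \<sigma>. f (perm_diagram n \<tau>))"
proof -
  have "inj_on (perm_diagram n) (perms_below n \<sigma>)"
    using perm_diagram_inject by (auto simp: inj_on_def perms_below_def)
  moreover have "{p \<in> perm_diagrams n. geodesic_le n p (perm_diagram n \<sigma>)} = perm_diagram n ` perms_below n \<sigma>"
    by (auto simp: perm_diagrams_def perms_below_def)
  ultimately show ?thesis by (simp add: sum.reindex)
qed

lemma c_free_mixed:
  assumes "c_free \<C> scale mul m A1 A2" "p \<in> \<C> k" "length as = k"
    and "\<And>i. i < k \<Longrightarrow> as ! i \<in> generated_algebra scale mul (if \<epsilon> i then A1 else A2)"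
    and "\<exists>c\<in>cycles k p. \<exists>i j. Inl i \<in> c \<and> Inl j \<in> c \<and> \<epsilon> i \<noteq> \<epsilon> j"
  shows "cumulant scale m \<C> p as = 0"
proof -
  have "\<forall>i<k. as ! i \<in> (if \<epsilon> i then generated_algebra scale mul A1 else generated_algebra scale mul A2)"
  proof (intro allI impI)
    fix i assume "i < k"
    then show "as ! i \<in> (if \<epsilon> i then generated_algebra scale mul A1 else generated_algebra scale mul A2)"
      using assms(4)[of i] by (cases "\<epsilon> i") simp_all
  qed
  then show ?thesis
    using assms(1)[unfolded c_free_def Let_def, THEN conjunct1, rule_format, of p k as \<epsilon>] assms(2,3,5)
    by blast
qed

lemma c_free_tensor:
  assumes "c_free \<C> scale mul m A1 A2" "p1 \<in> \<C> k1" "p2 \<in> \<C> k2" "length as = k1" "length bs = k2"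
    and "set as \<subseteq> generated_algebra scale mul A1" "set bs \<subseteq> generated_algebra scale mul A2"
  shows "cumulant scale m \<C> (diagram_tensor k1 p1 p2) (as @ bs) =
    cumulant scale m \<C> p1 as * cumulant scale m \<C> p2 bs"
  using assms(1)[unfolded c_free_def Let_def, THEN conjunct2, rule_format, of p1 k1 p2 k2 as bs] assms(2-)
  by blast

lemma c_freeI:
  assumes "\<And>k p as \<epsilon>. \<lbrakk>p \<in> \<C> k; length as = k;
      \<And>i. i < k \<Longrightarrow> as ! i \<in> generated_algebra scale mul (if \<epsilon> i then A1 else A2);
      \<exists>c\<in>cycles k p. \<exists>i j. Inl i \<in> c \<and> Inl j \<in> c \<and> \<epsilon> i \<noteq> \<epsilon> j\<rbrakk> \<Longrightarrow> cumulant scale m \<C> p as = 0"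
    and "\<And>k1 k2 p1 p2 as bs. \<lbrakk>p1 \<in> \<C> k1; p2 \<in> \<C> k2; length as = k1; length bs = k2;
      set as \<subseteq> generated_algebra scale mul A1; set bs \<subseteq> generated_algebra scale mul A2\<rbrakk> \<Longrightarrow>
      cumulant scale m \<C> (diagram_tensor k1 p1 p2) (as @ bs) =
      cumulant scale m \<C> p1 as * cumulant scale m \<C> p2 bs"
  shows "c_free \<C> scale mul m A1 A2"
  unfolding c_free_def Let_def
proof (intro conjI allI impI; elim conjE)
  fix k p as \<epsilon>
  assume "p \<in> \<C> k" "length as = k"
    and as: "\<forall>i<k. as ! i \<in> (if \<epsilon> i then generated_algebra scale mul A1 else generated_algebra scale mul A2)"
    and "\<exists>c\<in>cycles k p. \<exists>i j. Inl i \<in> c \<and> Inl j \<in> c \<and> \<epsilon> i \<noteq> \<epsilon> j"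
  moreover have "as ! i \<in> generated_algebra scale mul (if \<epsilon> i then A1 else A2)" if "i < k" for i
    using as that by (auto split: if_splits)
  ultimately show "cumulant scale m \<C> p as = 0" by (intro assms(1))
qed (rule assms(2))

section \<open>The trace of a tracial algebra and its unitization\<close>

definition unitization_scale ::
    "(complex \<Rightarrow> 'a \<Rightarrow> 'a) \<Rightarrow> complex \<Rightarrow> complex \<times> 'a \<Rightarrow> complex \<times> 'a" where
  "unitization_scale scale c x = (c * fst x, scale c (snd x))"

context P_tracial_algebra
begin

definition trace :: "'a \<Rightarrow> complex" where
  "trace a = m (id_diagram 1) [a]"

lemma trace_linear: "trace (x + y) = trace x + trace y" "trace (scale c x) = c * trace x"
proof -
  have "Vector_Spaces.linear scale (*) (\<lambda>x. m (id_diagram 1) ([0][0 := x]))"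
    using m_multilinear[OF id_diagram_in_diagrams, of 1, unfolded multilinear_form_def, rule_format, of "[0]" 0]
    by simp
  then have lin: "Vector_Spaces.linear scale (*) trace" by (simp add: trace_def[abs_def])
  interpret l: Vector_Spaces.linear scale "(*)" trace by (rule lin)
  show "trace (x + y) = trace x + trace y" "trace (scale c x) = c * trace x"
    by (simp_all add: l.add l.scale)
qed

text \<open>The block sizes 1, ..., 1, 2 multiply the last two letters; together with conjugation,
  this instance of the product axiom yields all merges along permutations.\<close>

lemma block_cycle_last: "block_cycle (replicate k 1 @ [2]) = transpose k (Suc k)"
proof (induction k)
  case 0
  show ?case by (auto simp: fun_eq_iff transpose_def less_2_cases_iff)
next
  case (Suc k)
  show ?case
  proof
    fix i
    have "block_cycle (replicate (Suc k) 1 @ [2]) i = (if i < 1 then 0 else 1 + transpose k (Suc k) (i - 1))"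
      using Suc by simp
    then show "block_cycle (replicate (Suc k) 1 @ [2]) i = transpose (Suc k) (Suc (Suc k)) i"
      by (auto simp: transpose_def)
  qed
qed

lemma offsets_last: "offsets (replicate k 1 @ [2]) = [0..<Suc k]"
proof -
  have "sum_list (take j (replicate k 1 @ [2])) = j" if "j < Suc k" for j
    using that by (simp add: sum_list_replicate min_def)
  then have "map (\<lambda>j. sum_list (take j (replicate k 1 @ [2]))) [0..<Suc k] = map (\<lambda>j. j) [0..<Suc k]"
    by (intro map_cong) auto
  then show ?thesis by (simp add: offsets_def)
qed

text \<open>The insertion appends a fixed point to \<rho>, and the transposition turns it into the
  successor of position \<open>k\<close>.\<close>

lemma m_perm_merge_last:
  assumes \<rho>: "\<rho> permutes {..<Suc k}" and "length bs = k"
  shows "m (perm_diagram (Suc k) \<rho>) (bs @ [mul x y]) =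
    m (perm_diagram (Suc (Suc k)) (\<rho> \<circ> transpose k (Suc k))) (bs @ [x, y])"
proof -
  let ?ass = "map (\<lambda>b. [b]) bs @ [[x, y]]" and ?ns = "replicate k 1 @ [2::nat]"
  let ?t = "transpose k (Suc k)"
  have ns: "?ns = map length ?ass"
    using assms(2) by (simp add: comp_def map_replicate_const)
  have \<rho>': "\<rho> permutes {..<Suc (Suc k)}" by (rule permutes_subset[OF \<rho>]) auto
  have t: "?t permutes {..<Suc (Suc k)}" by (rule permutes_swap_id) auto
  have ins: "insertion (Suc (Suc k)) [0..<Suc k] (perm_diagram (Suc k) \<rho>) = perm_diagram (Suc (Suc k)) \<rho>"
  proof -
    have "\<rho> i < Suc k" if "i < Suc k" for i using permutes_in_image[OF \<rho>, of i] that by simp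
    then have "(`) (map_sum ((!) [0..<Suc k]) ((!) [0..<Suc k])) ` perm_diagram (Suc k) \<rho> = perm_diagram (Suc k) \<rho>"
      unfolding perm_diagram_def image_image by (intro image_cong) (auto simp del: upt_Suc)
    moreover have "{{Inl i, Inr i} |i. i < Suc (Suc k) \<and> i \<notin> set [0..<Suc k]} = {{Inl (Suc k), Inr (Suc k)}}"
      by (auto simp: less_Suc_eq)
    moreover have "\<rho> (Suc k) = Suc k" using \<rho> by (simp add: permutes_def)
    ultimately show ?thesis
      unfolding insertion_def by (simp add: perm_diagram_def lessThan_Suc)
  qed
  have "m (perm_diagram (Suc k) \<rho>) (map (list_mult mul) ?ass) =
      m (diagram_comp (insertion (Suc (Suc k)) (offsets ?ns) (perm_diagram (Suc k) \<rho>))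
          (perm_diagram (Suc (Suc k)) (block_cycle ?ns))) (concat ?ass)"
    by (rule m_product[OF perm_diagram_in_diagrams[OF \<rho>] _ _ ns])
      (use assms(2) in \<open>auto simp: sum_list_replicate\<close>)
  also have "map (list_mult mul) ?ass = bs @ [mul x y]" by (simp add: comp_def)
  also have "concat ?ass = bs @ [x, y]" by simp
  also have "diagram_comp (insertion (Suc (Suc k)) (offsets ?ns) (perm_diagram (Suc k) \<rho>))
      (perm_diagram (Suc (Suc k)) (block_cycle ?ns)) = perm_diagram (Suc (Suc k)) (\<rho> \<circ> ?t)"
    unfolding offsets_last block_cycle_last ins
      diagram_comp_perm_right[OF perm_diagram_in_diagrams[OF \<rho>'] t]
      perm_diagram_comp_right[OF permutes_inv[OF t]] permutes_inv_inv[OF t] ..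
  finally show ?thesis .
qed

lemma m_perm_conj:
  assumes \<tau>: "\<tau> permutes {..<k}" and \<sigma>: "\<sigma> permutes {..<k}"
  shows "m (perm_diagram k \<tau>) (map a [0..<k]) = m (perm_diagram k (\<sigma> \<circ> \<tau> \<circ> inv \<sigma>)) (map (a \<circ> inv \<sigma>) [0..<k])"
proof -
  have "(`) (map_sum \<sigma> \<sigma>) ` perm_diagram k \<tau> = perm_diagram k (\<sigma> \<circ> \<tau> \<circ> inv \<sigma>)"
    using perm_diagram_comp_right[OF \<sigma>, of "\<sigma> \<circ> \<tau>"] by (simp add: perm_diagram_def image_image)
  moreover have "map (\<lambda>i. map a [0..<k] ! inv \<sigma> i) [0..<k] = map (a \<circ> inv \<sigma>) [0..<k]"
    using permutes_in_image[OF permutes_inv[OF \<sigma>]] by (intro map_cong) auto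
  moreover have "m (perm_diagram k \<tau>) (map a [0..<k]) =
      m (diagram_comp (perm_diagram k \<sigma>) (diagram_comp (perm_diagram k \<tau>) (perm_diagram k (inv \<sigma>))))
        (map (\<lambda>i. map a [0..<k] ! inv \<sigma> i) [0..<k])"
    by (rule m_perm[OF perm_diagram_in_diagrams[OF \<tau>] _ \<sigma>]) simp
  ultimately show ?thesis
    unfolding diagram_conj_perm[OF perm_diagram_in_diagrams[OF \<tau>] \<sigma>] by (simp only:)
qed

text \<open>Both sides are moments of the transposition, and conjugating it by itself exchanges the
  two arguments.\<close>

lemma trace_commute: "trace (mul x y) = trace (mul y x)"
proof -
  let ?t = "transpose 0 (Suc 0)"
  have t: "?t permutes {..<2}" by (rule permutes_swap_id) auto
  have eq: "trace (mul x y) = m (perm_diagram 2 ?t) [x, y]" for x y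
    using m_perm_merge_last[OF permutes_id, of "[]" 0 x y] by (simp add: trace_def perm_diagram_id numeral_2_eq_2)
  have "map (\<lambda>i. if i = 0 then x else y) [0..<2] = [x, y]"
    "map ((\<lambda>i. if i = 0 then x else y) \<circ> inv ?t) [0..<2] = [y, x]"
    by (simp_all add: numeral_2_eq_2)
  then show ?thesis
    using m_perm_conj[OF t t, of "\<lambda>i. if i = 0 then x else y"] unfolding eq by (simp add: comp_assoc)
qed

lemma trace_algebra_unitization:
  "trace_algebra (unitization_scale scale) (unitization_mult scale mul) (unitization_form trace) (1, 0)"
proof unfold_locales
  fix x y z :: "complex \<times> 'a" and c :: complex
  note m = mult_add_left mult_add_right mult_scale_left mult_scale_right mult_assoc scale_right_distrib
    scale_left_distrib
  have m0: "mul 0 a = 0" "mul a 0 = 0" for a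
    using mult_scale_left[of 0 0 a] mult_scale_right[of a 0 0] by simp_all
  show "unitization_mult scale mul (unitization_mult scale mul x y) z =
      unitization_mult scale mul x (unitization_mult scale mul y z)"
    by (simp add: unitization_mult_def m algebra_simps)
  show "unitization_mult scale mul (x + y) z = unitization_mult scale mul x z + unitization_mult scale mul y z"
    "unitization_mult scale mul x (y + z) = unitization_mult scale mul x y + unitization_mult scale mul x z"
    "unitization_mult scale mul (unitization_scale scale c x) y = unitization_scale scale c (unitization_mult scale mul x y)"
    "unitization_mult scale mul x (unitization_scale scale c y) = unitization_scale scale c (unitization_mult scale mul x y)"
    by (simp_all add: unitization_mult_def unitization_scale_def m algebra_simps prod_eq_iff)
  show "unitization_mult scale mul (1, 0) x = x" "unitization_mult scale mul x (1, 0) = x"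
    by (simp_all add: unitization_mult_def m0)
  have comm: "scale a y + scale b x = scale b x + scale a y" for a b and x y :: 'a by simp
  show "unitization_form trace (unitization_mult scale mul x y) = unitization_form trace (unitization_mult scale mul y x)"
    using trace_commute[of "snd x" "snd y"]
    by (simp add: unitization_mult_def unitization_form_def trace_linear algebra_simps)
qed (use trace_linear(2)[of 0 0] in \<open>simp_all add: unitization_scale_def unitization_form_def trace_linear
    scale_right_distrib scale_left_distrib algebra_simps prod_eq_iff\<close>)

sublocale unital: trace_algebra "unitization_scale scale" "unitization_mult scale mul"
  "unitization_form trace" "(1, 0)"
  by (rule trace_algebra_unitization)

lemma unitization_mult_embedded: "unitization_mult scale mul (0, x) (0, y) = (0, mul x y)"
  by (simp add: unitization_mult_def)

lemma unitization_form_embedded: "unitization_form \<phi> (0, x) = \<phi> x"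
  by (simp add: unitization_form_def)

text \<open>The recursion of \<open>moment\<close> holds for \<open>m\<close>: a fixed last point
  splits off because the family is deterministic, and otherwise the last letter is multiplied into
  its predecessor.\<close>

lemma m_eq_moment:
  assumes det: "deterministic scale mul m S"
  shows "\<sigma> permutes {..<n} \<Longrightarrow> (\<And>i. i < n \<Longrightarrow> a i \<in> generated_algebra scale mul S) \<Longrightarrow>
    m (perm_diagram n \<sigma>) (map a [0..<n]) = unital.moment n \<sigma> (\<lambda>i. (0, a i))"
proof (induction n arbitrary: \<sigma> a)
  case 0
  then show ?case by (simp add: perm_diagram_def m_empty)
next
  case (Suc n)
  note \<sigma> = Suc.prems(1)
  let ?G = "generated_algebra scale mul S"
  show ?case
  proof (cases "\<sigma> n = n")
    case True
    have \<sigma>': "\<sigma> permutes {..<n}" by (rule permutes_shrink[OF \<sigma> True])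
    have "perm_diagram (Suc n) \<sigma> = diagram_tensor n (perm_diagram n \<sigma>) (id_diagram 1)"
      using True by (simp add: diagram_tensor_alt perm_diagram_def id_diagram_def lessThan_Suc)
    moreover have "m (diagram_tensor n (perm_diagram n \<sigma>) (id_diagram 1)) (map a [0..<n] @ [a n]) =
        m (perm_diagram n \<sigma>) (map a [0..<n]) * trace (a n)"
      unfolding trace_def
      by (rule det[unfolded deterministic_def, rule_format, of "perm_diagram n \<sigma>" n "id_diagram 1" 1
          "map a [0..<n]" "[a n]"]) (use perm_diagram_in_diagrams[OF \<sigma>'] Suc.prems(2) in auto)
    ultimately show ?thesis
      using Suc.IH[OF \<sigma>', of a] Suc.prems(2)
      by (simp add: unital.moment_last[of \<sigma> n, OF True] unitization_form_embedded)
  next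
    case False
    then obtain h where h: "\<sigma> h = n" "h \<noteq> n" "h < n" using unital.obtain_preimage[OF \<sigma>] by blast
    then obtain k where k: "n = Suc k" by (cases n) auto
    \<comment> \<open>The product rule concerns the last two positions, but the predecessor
      \<open>h\<close> of \<open>n\<close> may be anywhere. Conjugation by \<open>s\<close> moves it
      to the last but one position \<open>k\<close>, and a second conjugation moves it back.\<close>
    define s where "s = transpose h k"
    have s: "s permutes {..<Suc n}" "s permutes {..<n}"
      unfolding s_def by (rule permutes_swap_id; use h k in auto)+
    have inv_s: "inv s = s" by (simp add: s_def)
    have ss: "s \<circ> s = id" by (simp add: s_def)
    have sk: "s k = h" "s n = n" "s h = k" using h(3) k by (simp_all add: s_def)
    define \<rho> where "\<rho> = s \<circ> \<sigma> \<circ> transpose h n \<circ> s"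
    have \<rho>: "\<rho> permutes {..<n}"
      unfolding \<rho>_def
      using permutes_compose[OF s(2) permutes_compose[OF unital.moment_step(2)[OF \<sigma> h(1,2)] s(2)]]
      by (simp add: comp_assoc)
    have tr: "transpose h n \<circ> s = s \<circ> transpose k n"
      using h k by (auto simp: s_def fun_eq_iff transpose_def)
    have eq: "s \<circ> \<sigma> \<circ> s = \<rho> \<circ> transpose k n"
    proof -
      have "\<rho> \<circ> transpose k n = s \<circ> \<sigma> \<circ> (transpose h n \<circ> s) \<circ> transpose k n"
        by (simp add: \<rho>_def comp_assoc)
      also have "\<dots> = s \<circ> \<sigma> \<circ> s" unfolding tr by (simp add: comp_assoc)
      finally show ?thesis ..
    qed
    define b where "b = (a \<circ> s)(k := mul (a h) (a n))"
    have "m (perm_diagram (Suc n) \<sigma>) (map a [0..<Suc n]) =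
        m (perm_diagram (Suc n) (\<rho> \<circ> transpose k n)) (map (a \<circ> s) [0..<Suc n])"
      using m_perm_conj[OF \<sigma> s(1), of a] unfolding inv_s eq .
    also have "map (a \<circ> s) [0..<Suc n] = map (a \<circ> s) [0..<k] @ [a h, a n]" using k sk by simp
    also have "m (perm_diagram (Suc n) (\<rho> \<circ> transpose k n)) (map (a \<circ> s) [0..<k] @ [a h, a n]) =
        m (perm_diagram n \<rho>) (map (a \<circ> s) [0..<k] @ [mul (a h) (a n)])"
      using m_perm_merge_last[of \<rho> k "map (a \<circ> s) [0..<k]" "a h" "a n"] \<rho> k by simp
    also have "map (a \<circ> s) [0..<k] @ [mul (a h) (a n)] = map b [0..<n]" using k by (simp add: b_def)
    also have "m (perm_diagram n \<rho>) (map b [0..<n]) = m (perm_diagram n (s \<circ> \<rho> \<circ> inv s)) (map (b \<circ> inv s) [0..<n])"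
      by (rule m_perm_conj[OF \<rho> s(2)])
    also have "s \<circ> \<rho> \<circ> inv s = \<sigma> \<circ> transpose h n"
    proof -
      have "s \<circ> \<rho> \<circ> inv s = (s \<circ> s) \<circ> \<sigma> \<circ> transpose h n \<circ> (s \<circ> s)"
        unfolding inv_s \<rho>_def by (simp only: comp_assoc)
      then show ?thesis by (simp add: ss)
    qed
    also have "map (b \<circ> inv s) [0..<n] = map (a(h := mul (a h) (a n))) [0..<n]"
    proof (rule map_cong[OF refl])
      fix i
      show "(b \<circ> inv s) i = (a(h := mul (a h) (a n))) i"
        using inv_s sk by (auto simp: b_def s_def transpose_def)
    qed
    also have "m (perm_diagram n (\<sigma> \<circ> transpose h n)) (map (a(h := mul (a h) (a n))) [0..<n]) =
        unital.moment n (\<sigma> \<circ> transpose h n) (\<lambda>i. (0, (a(h := mul (a h) (a n))) i))"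
    proof (rule Suc.IH[OF unital.moment_step(2)[OF \<sigma> h(1,2)]])
      have "mul (a h) (a n) \<in> ?G"
        using subalgebra_generated[of S] Suc.prems(2) h(3) by (auto simp: subalgebra_def)
      then show "(a(h := mul (a h) (a n))) i \<in> ?G" if "i < n" for i using Suc.prems(2) that by simp
    qed
    also have "(\<lambda>i. (0, (a(h := mul (a h) (a n))) i)) =
        (\<lambda>i. (0, a i))(h := unitization_mult scale mul (0, a h) (0, a n))"
      by (auto simp: unitization_mult_embedded)
    also have "unital.moment n (\<sigma> \<circ> transpose h n) \<dots> = unital.moment (Suc n) \<sigma> (\<lambda>i. (0, a i))"
      using unital.moment_step(1)[OF \<sigma> h(1,2), of "\<lambda>i. (0, a i)"] by simp
    finally show ?thesis .
  qed
qed

lemma cumulant_eq_cumul: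
  assumes det: "deterministic scale mul m S" and \<sigma>: "\<sigma> permutes {..<n}"
    and a: "\<And>i. i < n \<Longrightarrow> a i \<in> generated_algebra scale mul S"
  shows "cumulant scale m perm_diagrams (perm_diagram n \<sigma>) (map a [0..<n]) = unital.cumul n \<sigma> (\<lambda>i. (0, a i))"
proof (rule unital.cumul_unique[symmetric, OF _ \<sigma>])
  fix \<sigma> assume \<sigma>: "\<sigma> permutes {..<n}"
  have "m (perm_diagram n \<sigma>) (map a [0..<n]) =
      (\<Sum>p\<in>{p \<in> perm_diagrams n. geodesic_le n p (perm_diagram n \<sigma>)}.
         cumulant scale m perm_diagrams p (map a [0..<n]))"
    by (rule moment_cumulant_sum[OF cumulant_family[OF P_tracial_algebra_axioms perm_diagrams_subset]])
      (use \<sigma> in \<open>auto simp: perm_diagrams_def\<close>)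
  then show "(\<Sum>\<tau>\<in>perms_below n \<sigma>. cumulant scale m perm_diagrams (perm_diagram n \<tau>) (map a [0..<n])) =
      unital.moment n \<sigma> (\<lambda>i. (0, a i))"
    using m_eq_moment[OF det \<sigma>, of a] a by (simp add: sum_perm_diagrams_below)
qed

lemma generated_algebra_closed:
  shows "0 \<in> generated_algebra scale mul S"
    and "\<lbrakk>x \<in> generated_algebra scale mul S; y \<in> generated_algebra scale mul S\<rbrakk> \<Longrightarrow>
      x + y \<in> generated_algebra scale mul S"
    and "x \<in> generated_algebra scale mul S \<Longrightarrow> scale c x \<in> generated_algebra scale mul S"
    and "\<lbrakk>x \<in> generated_algebra scale mul S; y \<in> generated_algebra scale mul S\<rbrakk> \<Longrightarrow>
      mul x y \<in> generated_algebra scale mul S"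
  using subalgebra_generated[of S] by (auto simp: subalgebra_def subspace_def)

lemma generated_algebra_mono: "S \<subseteq> T \<Longrightarrow> generated_algebra scale mul S \<subseteq> generated_algebra scale mul T"
  unfolding generated_algebra_def by (rule hull_mono)

text \<open>In both directions the words live in the unitization, while the cumulants of the
  definition are those of letters \<open>(0, a)\<close>. Condition (ii) of freeness is automatic
  here: moments of a deterministic family factor, hence so do its cumulants.\<close>

lemma perm_free_iff_voiculescu_free:
  assumes det: "deterministic scale mul m (A1 \<union> A2)"
  shows "c_free perm_diagrams scale mul m A1 A2 \<longleftrightarrow> voiculescu_free scale mul trace A1 A2"
proof
  let ?B = "\<lambda>c. generated_algebra scale mul (if c then A1 else A2)"
  have sub: "?B c \<subseteq> generated_algebra scale mul (A1 \<union> A2)" for c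
    by (rule generated_algebra_mono) auto
  {
    assume free: "c_free perm_diagrams scale mul m A1 A2"
    show "voiculescu_free scale mul trace A1 A2"
      unfolding voiculescu_free_def
    proof (intro allI impI, elim conjE)
      fix xs :: "(complex \<times> 'a) list" and \<epsilon>
      assume ne: "xs \<noteq> []"
        and xs: "\<forall>i<length xs. snd (xs ! i) \<in> ?B (\<epsilon> i) \<and> unitization_form trace (xs ! i) = 0"
        and alt: "\<forall>i. Suc i < length xs \<longrightarrow> \<epsilon> i \<noteq> \<epsilon> (Suc i)"
      let ?n = "length xs"
      define b where "b i = (if i < ?n then snd (xs ! i) else 0)" for i
      define x where "x i = (if i < ?n then xs ! i else 0)" for i
      have zero: "unital.cumul ?n \<tau> x = 0"
        if \<tau>: "\<tau> permutes {..<?n}" "\<And>i. i < ?n \<Longrightarrow> \<tau> i \<noteq> i" "\<exists>i<?n. \<epsilon> i \<noteq> \<epsilon> (\<tau> i)" for \<tau>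
      proof -
        have "unital.cumul ?n \<tau> x = unital.cumul ?n \<tau> (\<lambda>i. (0, b i))"
          by (rule unital.cumul_shift_units[OF \<tau>(1,2), of _ "\<lambda>i. fst (x i)"])
            (auto simp: x_def b_def unitization_scale_def prod_eq_iff)
        also have "\<dots> = cumulant scale m perm_diagrams (perm_diagram ?n \<tau>) (map b [0..<?n])"
          by (rule cumulant_eq_cumul[OF det \<tau>(1), symmetric]) (use xs sub in \<open>auto simp: b_def\<close>)
        also have "\<dots> = 0"
        proof -
          show ?thesis
          proof (rule c_free_mixed[OF free, of _ ?n _ \<epsilon>])
            show "perm_diagram ?n \<tau> \<in> perm_diagrams ?n" using \<tau>(1) by (simp add: perm_diagrams_def)
            show "map b [0..<?n] ! i \<in> ?B (\<epsilon> i)" if "i < ?n" for i using xs that by (simp add: b_def)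
            show "\<exists>c\<in>cycles ?n (perm_diagram ?n \<tau>). \<exists>i j. Inl i \<in> c \<and> Inl j \<in> c \<and> \<epsilon> i \<noteq> \<epsilon> j"
              unfolding mixed_cycle_iff[OF \<tau>(1)] by (rule \<tau>(3))
          qed simp
        qed
        finally show ?thesis .
      qed
      have "unitization_form trace (list_mult (unitization_mult scale mul) (map x [0..<?n])) = 0"
        by (rule unital.alternating_zero_of_cumul[where \<epsilon> = \<epsilon>, OF _ _ _ zero])
          (use ne xs alt in \<open>auto simp: x_def\<close>)
      moreover have "map x [0..<?n] = xs" by (rule nth_equalityI) (auto simp: x_def)
      ultimately show "unitization_form trace (list_mult (unitization_mult scale mul) xs) = 0" by simp
    qed
  next
    assume free: "voiculescu_free scale mul trace A1 A2"
    let ?V = "\<lambda>c. {x :: complex \<times> 'a. snd x \<in> ?B c}"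
    have afree: "unital.alternating_free ?V"
      using free unfolding unital.alternating_free_def voiculescu_free_def by simp
    have V: "(1, 0) \<in> ?V c" "x \<in> ?V c \<Longrightarrow> y \<in> ?V c \<Longrightarrow> unitization_mult scale mul x y \<in> ?V c"
      "x \<in> ?V c \<Longrightarrow> x - unitization_scale scale (unitization_form trace x) (1, 0) \<in> ?V c" for c x y
      by (auto simp: unitization_mult_def unitization_scale_def generated_algebra_closed)
    show "c_free perm_diagrams scale mul m A1 A2"
    proof (rule c_freeI)
      fix k p as \<epsilon>
      assume p: "p \<in> perm_diagrams k" and len: "length as = k"
        and asB: "\<And>i. i < k \<Longrightarrow> as ! i \<in> ?B (\<epsilon> i)"
        and mixed: "\<exists>c\<in>cycles k p. \<exists>i j. Inl i \<in> c \<and> Inl j \<in> c \<and> \<epsilon> i \<noteq> \<epsilon> j"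
      obtain \<sigma> where \<sigma>: "\<sigma> permutes {..<k}" "p = perm_diagram k \<sigma>" using p by (rule perm_diagramsE)
      obtain i where i: "i < k" "\<epsilon> i \<noteq> \<epsilon> (\<sigma> i)"
        using mixed unfolding \<sigma>(2) mixed_cycle_iff[OF \<sigma>(1)] by auto
      let ?a = "\<lambda>i. (0, as ! i)"
      have "unital.moment k \<tau> ?a = unital.coloured_moment k \<epsilon> \<tau> ?a" if "\<tau> permutes {..<k}" for \<tau>
        by (rule unital.moment_eq_coloured_moment[OF afree V, of "{..<k}"])
          (use that asB in \<open>auto simp: permutes_def\<close>)
      then have "unital.cumul k \<sigma> ?a = 0" using unital.cumul_mixed_zero[OF _ \<sigma>(1) i] by blast
      moreover have "map ((!) as) [0..<k] = as" using len by (auto intro: nth_equalityI)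
      moreover have "as ! i \<in> generated_algebra scale mul (A1 \<union> A2)" if "i < k" for i
        using asB[OF that] sub by blast
      ultimately show "cumulant scale m perm_diagrams p as = 0"
        using cumulant_eq_cumul[OF det \<sigma>(1), of "(!) as"] unfolding \<sigma>(2) by simp
    next
      fix k1 k2 p1 p2 as bs
      assume p: "p1 \<in> perm_diagrams k1" "p2 \<in> perm_diagrams k2" and len: "length as = k1" "length bs = k2"
        and as: "set as \<subseteq> generated_algebra scale mul A1" "set bs \<subseteq> generated_algebra scale mul A2"
      show "cumulant scale m perm_diagrams (diagram_tensor k1 p1 p2) (as @ bs) =
          cumulant scale m perm_diagrams p1 as * cumulant scale m perm_diagrams p2 bs"
      proof (rule cumulant_tensor_multiplicative[OF perm_diagrams_subset perm_diagrams_tensor_iff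
            cumulant_family[OF P_tracial_algebra_axioms perm_diagrams_subset] len _ p])
        fix p q assume "p \<in> diagrams k1" "q \<in> diagrams k2"
        then show "m (diagram_tensor k1 p q) (as @ bs) = m p as * m q bs"
          using det[unfolded deterministic_def, rule_format, of p k1 q k2 as bs] len as
            sub[of True] sub[of False] by auto
      qed
    qed
  }
qed

end


section \<open>Brauer diagrams below a permutation\<close>

lemma even_card_involution:
  assumes "finite c" "\<And>v. v \<in> c \<Longrightarrow> f v \<in> c \<and> f (f v) = v \<and> f v \<noteq> v"
  shows "even (card c)"
proof -
  let ?C = "(\<lambda>v. {v, f v}) ` c"
  have "card (\<Union>?C) = (\<Sum>b\<in>?C. card b)"
  proof (rule card_Union_disjoint)
    show "pairwise disjnt ?C"
      unfolding pairwise_def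
    proof (intro ballI impI)
      fix b d assume "b \<in> ?C" "d \<in> ?C" "b \<noteq> d"
      then obtain u v where uv: "u \<in> c" "v \<in> c" "b = {u, f u}" "d = {v, f v}" by blast
      show "disjnt b d"
      proof (rule ccontr)
        assume "\<not> disjnt b d"
        then have "u = v \<or> u = f v \<or> f u = v \<or> f u = f v" unfolding uv(3,4) disjnt_def by blast
        then have "u = v \<or> u = f v" using assms(2) uv(1,2) by metis
        then have "b = d" using assms(2)[OF uv(2)] unfolding uv(3,4) by auto
        then show False using \<open>b \<noteq> d\<close> by simp
      qed
    qed
  qed auto
  moreover have "\<Union>?C = c" using assms(2) by auto
  moreover have "(\<Sum>b\<in>?C. card b) = (\<Sum>b\<in>?C. 2)"
  proof (rule sum.cong[OF refl])
    fix b assume "b \<in> ?C"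
    then obtain v where "v \<in> c" "b = {v, f v}" by blast
    then show "card b = 2" using assms(2)[of v] by (metis card_2_iff)
  qed
  ultimately show ?thesis by simp
qed

text \<open>In the application \<beta> is the partner map of a rook-Brauer diagram, fixing its
  singletons, and \<alpha> the partner map of the identity or of a permutation, which exchanges the
  rows. \<open>components\<close> is then the join of the two diagrams.\<close>

locale involutions =
  fixes V :: "'v set" and \<alpha> \<beta> :: "'v \<Rightarrow> 'v"
  assumes finite_V: "finite V"
    and \<alpha>: "\<alpha> (\<alpha> v) = v" "\<alpha> v \<noteq> v" "\<alpha> v \<in> V \<longleftrightarrow> v \<in> V"
    and \<beta>: "\<beta> (\<beta> v) = v" "\<beta> v \<in> V \<longleftrightarrow> v \<in> V"
begin

definition orbits :: "'v set set" where
  "orbits = merge ((\<lambda>v. {v, \<alpha> (\<beta> v)}) ` V)"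

definition components :: "'v set set" where
  "components = merge ((\<lambda>v. {v, \<alpha> v}) ` V \<union> (\<lambda>v. {v, \<beta> v}) ` V)"

lemma orbits_partition: "partition_on V orbits"
proof -
  have "\<Union>((\<lambda>v. {v, \<alpha> (\<beta> v)}) ` V) = V" using \<alpha> \<beta> by auto
  then show ?thesis using partition_on_merge unfolding orbits_def by metis
qed

lemma components_partition: "partition_on V components"
proof -
  have "\<Union>((\<lambda>v. {v, \<alpha> v}) ` V \<union> (\<lambda>v. {v, \<beta> v}) ` V) = V" using \<alpha> \<beta> by auto
  then show ?thesis using partition_on_merge unfolding components_def by metis
qed

lemma components_closed:
  assumes "c \<in> components" "v \<in> c"
  shows "\<alpha> v \<in> c" "\<beta> v \<in> c"
proof -
  have "v \<in> V" using assms partition_onD1[OF components_partition] by blast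
  then have "{v, \<alpha> v} \<subseteq> c"
    by (intro merge_absorbs[OF assms(1)[unfolded components_def] _ _ assms(2)]) auto
  moreover have "{v, \<beta> v} \<subseteq> c"
    using \<open>v \<in> V\<close> by (intro merge_absorbs[OF assms(1)[unfolded components_def] _ _ assms(2)]) auto
  ultimately show "\<alpha> v \<in> c" "\<beta> v \<in> c" by auto
qed

lemma orbits_refine: "refines V orbits components"
  unfolding refines_def
proof (intro conjI ballI orbits_partition components_partition)
  fix d assume d: "d \<in> orbits"
  show "\<exists>c\<in>components. d \<subseteq> c"
  proof (rule merge_least[OF components_partition _ d[unfolded orbits_def]])
    fix b assume "b \<in> (\<lambda>v. {v, \<alpha> (\<beta> v)}) ` V"
    then obtain v where v: "v \<in> V" "b = {v, \<alpha> (\<beta> v)}" by blast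
    then obtain c where "c \<in> components" "v \<in> c" using partition_onD1[OF components_partition] by blast
    then show "\<exists>c\<in>components. b \<subseteq> c" using v components_closed by blast
  qed
qed

text \<open>The disjunction stands for integer powers of the rotation: one of the two vertices is
  reached from the other by going forwards.\<close>

lemma same_orbit:
  assumes "d \<in> orbits" "v \<in> d" "u \<in> d"
  shows "\<exists>n. ((\<alpha> \<circ> \<beta>) ^^ n) v = u \<or> ((\<alpha> \<circ> \<beta>) ^^ n) u = v"
  using assms[unfolded orbits_def]
proof (rule merge_block_induct)
  let ?\<rho> = "\<alpha> \<circ> \<beta>"
  have inj: "?\<rho> x = ?\<rho> y \<Longrightarrow> x = y" for x y using \<alpha>(1) \<beta>(1) by (metis comp_apply)
  show "\<exists>n. (?\<rho> ^^ n) v = v \<or> (?\<rho> ^^ n) v = v" by (rule exI[of _ 0]) simp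
  fix b x y assume b: "b \<in> (\<lambda>v. {v, \<alpha> (\<beta> v)}) ` V" "x \<in> b" "y \<in> b"
    and "\<exists>n. (?\<rho> ^^ n) v = x \<or> (?\<rho> ^^ n) x = v"
  then obtain n where n: "(?\<rho> ^^ n) v = x \<or> (?\<rho> ^^ n) x = v" by blast
  obtain w where "b = {w, ?\<rho> w}" using b(1) by auto
  then consider "x = y" | "y = ?\<rho> x" | "x = ?\<rho> y" using b(2,3) by auto
  then show "\<exists>n. (?\<rho> ^^ n) v = y \<or> (?\<rho> ^^ n) y = v"
  proof cases
    case 1
    then show ?thesis using n by blast
  next
    case 2
    show ?thesis
    proof (cases "(?\<rho> ^^ n) v = x")
      case True
      then show ?thesis using 2 by (intro exI[of _ "Suc n"]) simp
    next
      case False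
      then have nx: "(?\<rho> ^^ n) x = v" using n by blast
      show ?thesis
      proof (cases n)
        case 0
        then show ?thesis using nx 2 by (intro exI[of _ 1]) simp
      next
        case (Suc k)
        then show ?thesis using nx 2 by (intro exI[of _ k]) (simp add: funpow_swap1)
      qed
    qed
  next
    case 3
    show ?thesis
    proof (cases "(?\<rho> ^^ n) v = x")
      case True
      show ?thesis
      proof (cases n)
        case 0
        then show ?thesis using True 3 by (intro exI[of _ 1]) simp
      next
        case (Suc k)
        then have "?\<rho> ((?\<rho> ^^ k) v) = ?\<rho> y" using True 3 by simp
        then show ?thesis using inj by blast
      qed
    next
      case False
      then have "(?\<rho> ^^ n) x = v" using n by blast
      then show ?thesis using 3 by (intro exI[of _ "Suc n"]) (simp add: funpow_swap1)
    qed
  qed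
qed

text \<open>A dihedral argument: \<beta> conjugates the rotation into its inverse. If n rotations
  take \<open>v\<close> to \<open>\<beta> v\<close>, the midpoint of this path is fixed by \<beta>
  when n is even; for odd n it would be fixed by \<alpha>, which fixes nothing.\<close>

lemma reflected_funpow:
  assumes "((\<alpha> \<circ> \<beta>) ^^ n) v = \<beta> v"
  shows "\<exists>m. \<beta> (((\<alpha> \<circ> \<beta>) ^^ m) v) = ((\<alpha> \<circ> \<beta>) ^^ m) v"
proof -
  define r where "r = \<alpha> \<circ> \<beta>"
  define r' where "r' = \<beta> \<circ> \<alpha>"
  have r: "\<alpha> (r u) = \<beta> u" "r' (r u) = u" "\<beta> (r u) = r' (\<beta> u)" for u
    by (simp_all add: r_def r'_def \<alpha>(1) \<beta>(1))
  have conj: "\<beta> ((r ^^ m) u) = (r' ^^ m) (\<beta> u)" for m u by (induction m) (simp_all add: r)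
  have inv: "(r' ^^ m) ((r ^^ m) u) = u" for m u
    by (induction m) (simp_all add: funpow_swap1[of r'] r)
  have nv: "(r ^^ n) v = \<beta> v" using assms by (simp add: r_def)
  define m where "m = n div 2"
  have "\<exists>m. \<beta> ((r ^^ m) v) = (r ^^ m) v"
  proof (cases "even n")
    case True
    then have "n = m + m" by (auto simp: m_def)
    then have "\<beta> v = (r ^^ m) ((r ^^ m) v)" using nv by (simp add: funpow_add)
    then have "\<beta> ((r ^^ m) v) = (r ^^ m) v" using conj inv by metis
    then show ?thesis by blast
  next
    case False
    then have "n = m + Suc m" by (auto simp: m_def elim!: oddE)
    then have "(r ^^ n) v = (r ^^ m) ((r ^^ Suc m) v)" by (simp only: funpow_add comp_apply)
    then have "\<beta> v = (r ^^ m) ((r ^^ Suc m) v)" using nv by simp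
    then have "\<beta> ((r ^^ m) v) = (r ^^ Suc m) v" using conj inv by metis
    then have "\<alpha> ((r ^^ Suc m) v) = (r ^^ Suc m) v" using r(1)[of "(r ^^ m) v"] by simp
    then show ?thesis using \<alpha>(2) by metis
  qed
  then show ?thesis by (simp add: r_def)
qed

text \<open>A component is a cycle, which splits into two orbits, or a path, whose two ends are
  fixed by \<open>\<beta>\<close>.\<close>

lemma component_bound:
  assumes c: "c \<in> components"
  shows "4 \<le> 2 * card {d \<in> orbits. d \<subseteq> c} + card {v \<in> c. \<beta> v = v}"
proof -
  have cV: "c \<subseteq> V" using c partition_onD1[OF components_partition] by blast
  then have fin: "finite c" using finite_V finite_subset by blast
  obtain v where v: "v \<in> c" using c partition_onD3[OF components_partition] by fastforce
  note part = refines_obtains_subset[OF orbits_refine c]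
  have finO: "finite {d \<in> orbits. d \<subseteq> c}" by (rule finite_elements[OF fin part])
  have ex: "\<exists>d. d \<in> {d \<in> orbits. d \<subseteq> c} \<and> u \<in> d" if "u \<in> c" for u
    using that partition_onD1[OF part] by blast
  show ?thesis
  proof (cases "{v \<in> c. \<beta> v = v} = {}")
    \<comment> \<open>A cycle: if \<open>v\<close> and \<open>\<beta> v\<close> had the same orbit,
      \<beta> would have a fixed point in \<open>c\<close>.\<close>
    case True
    obtain d where d: "d \<in> {d \<in> orbits. d \<subseteq> c}" "v \<in> d" using ex[OF v] by blast
    obtain d' where d': "d' \<in> {d \<in> orbits. d \<subseteq> c}" "\<beta> v \<in> d'"
      using ex[OF components_closed(2)[OF c v]] by blast
    have "d \<noteq> d'"
    proof
      assume "d = d'"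
      then have "\<exists>n. ((\<alpha> \<circ> \<beta>) ^^ n) v = \<beta> v \<or> ((\<alpha> \<circ> \<beta>) ^^ n) (\<beta> v) = v"
        using same_orbit[of d v "\<beta> v"] d d' by simp
      then obtain u n where u: "u \<in> c" "((\<alpha> \<circ> \<beta>) ^^ n) u = \<beta> u"
        using v components_closed(2)[OF c v] \<beta>(1) by metis
      obtain m where m: "\<beta> (((\<alpha> \<circ> \<beta>) ^^ m) u) = ((\<alpha> \<circ> \<beta>) ^^ m) u"
        using reflected_funpow[OF u(2)] by blast
      have "((\<alpha> \<circ> \<beta>) ^^ m) u \<in> c"
        by (induction m) (use u(1) components_closed[OF c] in simp_all)
      then show False using m True by blast
    qed
    then have "card {d, d'} \<le> card {d \<in> orbits. d \<subseteq> c}" using d d' finO by (intro card_mono) auto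
    then show ?thesis using \<open>d \<noteq> d'\<close> by simp
  next
    case False
    \<comment> \<open>A path: \<alpha> pairs off all vertices and \<beta> those it moves, so the
      number of fixed points of \<beta> is even, and at least 2.\<close>
    have "even (card c)"
      by (rule even_card_involution[OF fin, of \<alpha>]) (use components_closed[OF c] \<alpha> in auto)
    moreover have "even (card (c - {v \<in> c. \<beta> v = v}))"
    proof (rule even_card_involution[of _ \<beta>])
      fix u assume "u \<in> c - {v \<in> c. \<beta> v = v}"
      then show "\<beta> u \<in> c - {v \<in> c. \<beta> v = v} \<and> \<beta> (\<beta> u) = u \<and> \<beta> u \<noteq> u"
        using components_closed(2)[OF c] \<beta>(1)[of u] by auto
    qed (use fin in simp)
    moreover have "card c = card (c - {v \<in> c. \<beta> v = v}) + card {v \<in> c. \<beta> v = v}"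
    proof -
      have "card (c - {v \<in> c. \<beta> v = v}) = card c - card {v \<in> c. \<beta> v = v}"
        by (rule card_Diff_subset) (use fin in auto)
      moreover have "card {v \<in> c. \<beta> v = v} \<le> card c" by (rule card_mono[OF fin]) auto
      ultimately show ?thesis by simp
    qed
    ultimately have "even (card {v \<in> c. \<beta> v = v})" by simp
    moreover have "card {v \<in> c. \<beta> v = v} \<noteq> 0" using False fin by simp
    ultimately have "card {v \<in> c. \<beta> v = v} \<ge> 2" by (auto elim!: evenE)
    moreover have "card {d \<in> orbits. d \<subseteq> c} \<noteq> 0" using ex[OF v] finO by auto
    ultimately show ?thesis by linarith
  qed
qed

lemma components_bound: "4 * card components \<le> 2 * card orbits + card {v \<in> V. \<beta> v = v}"
proof -
  have finC: "finite components" by (rule finite_elements[OF finite_V components_partition])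
  have finO: "finite orbits" by (rule finite_elements[OF finite_V orbits_partition])
  have disj: "c \<inter> d = {}" if "c \<in> components" "d \<in> components" "c \<noteq> d" for c d
    using disjointD[OF partition_onD2[OF components_partition] that] .
  have ne: "d \<noteq> {}" if "d \<in> orbits" for d using that partition_onD3[OF orbits_partition] by auto
  have "(\<Sum>c\<in>components. card {d \<in> orbits. d \<subseteq> c}) = card (\<Union>c\<in>components. {d \<in> orbits. d \<subseteq> c})"
  proof (rule card_UN_disjoint[symmetric, OF finC])
    show "\<forall>c\<in>components. finite {d \<in> orbits. d \<subseteq> c}" using finO by simp
    show "\<forall>c\<in>components. \<forall>c'\<in>components. c \<noteq> c' \<longrightarrow> {d \<in> orbits. d \<subseteq> c} \<inter> {d \<in> orbits. d \<subseteq> c'} = {}"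
    proof (intro ballI impI equals0I)
      fix c c' d assume c: "c \<in> components" "c' \<in> components" "c \<noteq> c'"
        and d: "d \<in> {d \<in> orbits. d \<subseteq> c} \<inter> {d \<in> orbits. d \<subseteq> c'}"
      then have "d \<subseteq> c \<inter> c'" by blast
      then show False using disj[OF c] ne d by blast
    qed
  qed
  also have "(\<Union>c\<in>components. {d \<in> orbits. d \<subseteq> c}) = orbits"
    using orbits_refine by (auto elim: refinesE)
  finally have o: "(\<Sum>c\<in>components. card {d \<in> orbits. d \<subseteq> c}) = card orbits" .
  have "(\<Sum>c\<in>components. card {v \<in> c. \<beta> v = v}) = card (\<Union>c\<in>components. {v \<in> c. \<beta> v = v})"
  proof (rule card_UN_disjoint[symmetric, OF finC])
    show "\<forall>c\<in>components. finite {v \<in> c. \<beta> v = v}"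
    proof
      fix c assume "c \<in> components"
      then have "c \<subseteq> V" using partition_onD1[OF components_partition] by blast
      then show "finite {v \<in> c. \<beta> v = v}" using finite_subset[OF _ finite_V] by simp
    qed
    show "\<forall>c\<in>components. \<forall>d\<in>components. c \<noteq> d \<longrightarrow> {v \<in> c. \<beta> v = v} \<inter> {v \<in> d. \<beta> v = v} = {}"
      using disj by blast
  qed
  also have "(\<Union>c\<in>components. {v \<in> c. \<beta> v = v}) = {v \<in> V. \<beta> v = v}"
    using partition_onD1[OF components_partition] by blast
  finally have f: "(\<Sum>c\<in>components. card {v \<in> c. \<beta> v = v}) = card {v \<in> V. \<beta> v = v}" .
  have "(\<Sum>c\<in>components. 4) \<le> (\<Sum>c\<in>components. 2 * card {d \<in> orbits. d \<subseteq> c} + card {v \<in> c. \<beta> v = v})"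
    by (rule sum_mono) (rule component_bound)
  also have "\<dots> = 2 * card orbits + card {v \<in> V. \<beta> v = v}"
    by (simp add: sum.distrib o f flip: sum_distrib_left)
  finally show ?thesis by simp
qed

end

section \<open>Rook-Brauer diagrams as involutions of the vertices\<close>

lemma rook_brauer_partner:
  assumes p: "p \<in> rook_brauer_diagrams k"
  obtains \<pi> where "\<And>v. \<pi> (\<pi> v) = v" "\<And>v. \<pi> v \<in> vertices k \<longleftrightarrow> v \<in> vertices k"
    "p = (\<lambda>v. {v, \<pi> v}) ` vertices k"
proof -
  have part: "partition_on (vertices k) p" and two: "\<And>b. b \<in> p \<Longrightarrow> card b \<le> 2"
    using p by (auto simp: rook_brauer_diagrams_def diagrams_def)
  have ex: "\<exists>w. {v, w} \<in> p" if v: "v \<in> vertices k" for v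
  proof -
    obtain b where b: "b \<in> p" "v \<in> b" using v partition_onD1[OF part] by blast
    have "finite b" using b partition_onD1[OF part] finite_vertices[of k] by (metis Union_upper finite_subset)
    have "\<exists>w. b = {v, w}"
    proof (cases "b = {v}")
      case False
      then obtain w where w: "w \<in> b" "w \<noteq> v" using b(2) by blast
      have "{v, w} = b"
        by (rule card_seteq[OF \<open>finite b\<close>]) (use b w two[OF b(1)] in auto)
      then show ?thesis by blast
    qed (use b in auto)
    then show ?thesis using b(1) by blast
  qed
  define \<pi> where "\<pi> v = (if v \<in> vertices k then SOME w. {v, w} \<in> p else v)" for v
  have blk: "{v, \<pi> v} \<in> p" if "v \<in> vertices k" for v
    using someI_ex[OF ex[OF that]] that by (simp add: \<pi>_def)
  have in_V: "\<pi> v \<in> vertices k" if "v \<in> vertices k" for v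
    using blk[OF that] partition_onD1[OF part] by blast
  have inv: "\<pi> (\<pi> v) = v" for v
  proof (cases "v \<in> vertices k")
    case True
    have "{v, \<pi> v} = {\<pi> v, \<pi> (\<pi> v)}"
      by (rule partition_on_block_eq[OF part blk[OF True] blk[OF in_V[OF True]], of "\<pi> v"]) auto
    then show ?thesis by (auto simp: doubleton_eq_iff)
  qed (simp add: \<pi>_def)
  have "p = (\<lambda>v. {v, \<pi> v}) ` vertices k"
  proof (intro equalityI subsetI)
    fix b assume b: "b \<in> p"
    then obtain v where v: "v \<in> b" using partition_onD3[OF part] by fastforce
    then have "v \<in> vertices k" using b partition_onD1[OF part] by blast
    then have "b = {v, \<pi> v}" using partition_on_block_eq[OF part b blk, of v v] v by simp
    then show "b \<in> (\<lambda>v. {v, \<pi> v}) ` vertices k" using \<open>v \<in> vertices k\<close> by blast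
  qed (use blk in blast)
  moreover have "\<pi> v \<in> vertices k \<longleftrightarrow> v \<in> vertices k" for v
    using in_V inv by (metis \<pi>_def)
  ultimately show ?thesis using inv that by blast
qed

lemma card_pairing:
  assumes "finite V" "\<And>v. \<pi> (\<pi> v) = v" "\<And>v. \<pi> v \<in> V \<longleftrightarrow> v \<in> V"
  shows "2 * card ((\<lambda>v. {v, \<pi> v}) ` V) = card V + card {v \<in> V. \<pi> v = v}"
proof -
  let ?p = "(\<lambda>v. {v, \<pi> v}) ` V"
  have fin: "finite ?p" using assms(1) by simp
  have "card (\<Union>?p) = (\<Sum>b\<in>?p. card b)"
  proof (rule card_Union_disjoint)
    show "pairwise disjnt ?p"
      unfolding pairwise_def
    proof (intro ballI impI)
      fix b c assume "b \<in> ?p" "c \<in> ?p" "b \<noteq> c"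
      then obtain u v where uv: "b = {u, \<pi> u}" "c = {v, \<pi> v}" by blast
      show "disjnt b c"
      proof (rule ccontr)
        assume "\<not> disjnt b c"
        then have "u = v \<or> u = \<pi> v \<or> \<pi> u = v \<or> \<pi> u = \<pi> v" unfolding uv disjnt_def by blast
        then have "u = v \<or> u = \<pi> v" using assms(2) by metis
        then have "b = c" unfolding uv using assms(2) by auto
        then show False using \<open>b \<noteq> c\<close> by simp
      qed
    qed
  qed auto
  moreover have "\<Union>?p = V" using assms(3) by auto
  ultimately have "card V = (\<Sum>b\<in>?p. card b)" by simp
  moreover have "(\<Sum>b\<in>?p. card b) + (\<Sum>b\<in>?p. if card b = 1 then 1 else 0) = (\<Sum>b\<in>?p. 2)"
    unfolding sum.distrib[symmetric] by (rule sum.cong[OF refl]) (auto simp: card_insert_if)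
  moreover have "(\<Sum>b\<in>?p. if card b = 1 then 1 else 0) = card {b \<in> ?p. card b = 1}"
    using fin by (simp add: sum.If_cases Int_def)
  moreover have "card {b \<in> ?p. card b = 1} = card {v \<in> V. \<pi> v = v}"
  proof -
    have "{b \<in> ?p. card b = 1} = (\<lambda>v. {v}) ` {v \<in> V. \<pi> v = v}"
      by (auto simp: card_insert_if split: if_splits)
    then show ?thesis by (simp add: card_image)
  qed
  ultimately show ?thesis by simp
qed

text \<open>The bounds for the components of \<open>p\<close> with the identity and with \<sigma>,
  semimodularity for the two orbit partitions and the geodesic equation show that the join of the
  orbit partitions has at least twice as many blocks as \<sigma> has cycles. But this join is
  coarser than \<open>z\<close>, two copies of the orbits of \<sigma>, one in each row. So it equals
  \<open>z\<close>, rotations stay within a row, and partners in \<open>p\<close> lie in opposite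
  rows.\<close>

lemma rook_brauer_below_perm:
  assumes p: "p \<in> rook_brauer_diagrams k" and \<sigma>: "\<sigma> permutes {..<k}"
    and le: "geodesic_le k p (perm_diagram k \<sigma>)"
  shows "p \<in> perm_diagrams k"
proof -
  let ?V = "vertices k"
  obtain \<pi> where \<pi>: "\<And>v. \<pi> (\<pi> v) = v" "\<And>v. \<pi> v \<in> ?V \<longleftrightarrow> v \<in> ?V" and p_eq: "p = (\<lambda>v. {v, \<pi> v}) ` ?V"
    using rook_brauer_partner[OF p] by blast
  have pd: "p \<in> diagrams k" using p by (simp add: rook_brauer_diagrams_def)
  have lt: "\<sigma> i < k \<longleftrightarrow> i < k" "inv \<sigma> i < k \<longleftrightarrow> i < k" for i
    using permutes_in_image[OF \<sigma>, of i] permutes_in_image[OF permutes_inv[OF \<sigma>], of i] by auto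
  note \<sigma>_inv = permutes_inverses[OF \<sigma>]
  define s where "s = case_sum (\<lambda>i. Inr (\<sigma> i) :: nat + nat) (\<lambda>j. Inl (inv \<sigma> j) :: nat + nat)"
  have s: "s (Inl i) = Inr (\<sigma> i)" "s (Inr j) = Inl (inv \<sigma> j)" for i j by (simp_all add: s_def)
  have ss: "s (s v) = v" "s v \<noteq> v" "s v \<in> ?V \<longleftrightarrow> v \<in> ?V" for v
    by (cases v; simp add: s \<sigma>_inv lt)+
  have ff: "flip v \<noteq> v" "flip v \<in> ?V \<longleftrightarrow> v \<in> ?V" for v :: "nat + nat" by (cases v; simp)+
  interpret I: involutions ?V flip \<pi>
    by unfold_locales (simp_all add: finite_vertices \<pi> ff)
  interpret S: involutions ?V s \<pi>
    by unfold_locales (simp_all add: finite_vertices \<pi> ss)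
  have id_eq: "id_diagram k = (\<lambda>v. {v, flip v}) ` ?V"
  proof -
    have "(\<lambda>v. {v, flip v}) ` ?V = (\<lambda>i. {Inl i, Inr i}) ` {..<k} \<union> (\<lambda>i. {Inr i, Inl i}) ` {..<k}"
      by (simp add: vertices_def Plus_def image_Un image_image)
    then show ?thesis by (simp add: id_diagram_def insert_commute)
  qed
  have perm_eq: "perm_diagram k \<sigma> = (\<lambda>v. {v, s v}) ` ?V"
  proof -
    have "(\<lambda>v. {v, s v}) ` ?V = (\<lambda>i. {Inl i, Inr (\<sigma> i)}) ` {..<k} \<union> (\<lambda>j. {Inr j, Inl (inv \<sigma> j)}) ` \<sigma> ` {..<k}"
      unfolding permutes_image[OF \<sigma>] by (simp add: vertices_def Plus_def image_Un image_image s)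
    then show ?thesis by (simp add: perm_diagram_def insert_commute image_image \<sigma>_inv)
  qed
  have comp: "I.components = join p (id_diagram k)" "S.components = join p (perm_diagram k \<sigma>)"
    unfolding I.components_def S.components_def id_eq perm_eq p_eq join_def by (simp_all add: Un_commute)
  define fx where "fx = card {v \<in> ?V. \<pi> v = v}"
  have card_V: "card ?V = 2 * k" by (simp add: vertices_def card_Plus)
  have card_p: "2 * card p = 2 * k + fx"
    using card_pairing[OF finite_vertices[of k] \<pi>] unfolding fx_def p_eq card_V by simp
  have cyc: "card (join p (id_diagram k)) + card (join p (perm_diagram k \<sigma>)) = card p + card (perm_cycles k \<sigma>)"
    using le unfolding geodesic_le_iff perm_cycles_def .
  let ?j = "join I.orbits S.orbits"
  let ?X = "(\<lambda>v. {v}) ` ?V"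
  have sing: "partition_on ?V ?X" by (rule partition_on_singletons)
  have ref: "refines ?V ?X q" if "partition_on ?V q" for q
    using that sing partition_onD1[OF that] unfolding refines_def by blast
  have "card I.orbits + card S.orbits \<le> card ?X + card ?j"
    by (rule partition_semimodular[OF finite_vertices]) (rule ref, rule I.orbits_partition S.orbits_partition)+
  also have "card ?X = 2 * k" using card_V by (simp add: card_image)
  finally have semi: "card I.orbits + card S.orbits \<le> 2 * k + card ?j" .
  \<comment> \<open>The singletons of \<open>p\<close> cancel: \<open>fx\<close> enters once in each
    of the two bounds and once in \<open>2 * card p\<close>.\<close>
  have lower: "2 * card (perm_cycles k \<sigma>) \<le> card ?j"
    using I.components_bound S.components_bound semi card_p cyc unfolding comp fx_def[symmetric] by linarith
  have jpart: "partition_on ?V ?j" by (rule partition_on_join[OF I.orbits_partition S.orbits_partition])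
  define F where "F = (\<lambda>i. {i, \<sigma> i}) ` {..<k}"
  define orb where "orb = merge F"
  have UF: "\<Union>F = {..<k}" using lt by (auto simp: F_def)
  have orb_part: "partition_on {..<k} orb" using partition_on_merge[of F] unfolding UF orb_def .
  have neF: "{} \<notin> F" by (auto simp: F_def)
  define z where "z = (`) Inl ` orb \<union> (`) Inr ` orb"
  have z_merge: "z = merge ((`) Inl ` F \<union> (`) Inr ` F)"
  proof -
    have "merge ((`) Inl ` F \<union> (`) Inr ` F) = merge ((`) Inl ` F) \<union> merge ((`) Inr ` F)"
      by (rule merge_Un) (use neF in auto)
    also have "\<dots> = z"
      unfolding z_def orb_def
      using merge_image[where f = "Inl :: nat \<Rightarrow> nat + nat", OF inj_on_subset[OF inj_Inl subset_UNIV] neF]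
        merge_image[where f = "Inr :: nat \<Rightarrow> nat + nat", OF inj_on_subset[OF inj_Inr subset_UNIV] neF] by simp
    finally show ?thesis ..
  qed
  have Vplus: "Inl ` {..<k} \<union> Inr ` {..<k} = ?V" by (auto simp: vertices_def)
  have z_part: "partition_on ?V z"
    unfolding z_def Vplus[symmetric]
    by (intro partition_on_Un partition_on_image_inj orb_part) auto
  \<comment> \<open>One rotation takes \<open>\<pi> u\<close> to \<open>flip u\<close>, the other
    takes it to \<open>s u\<close>. These two lie in the same row, one step of \<sigma> or of its
    inverse apart.\<close>
  have "\<exists>c\<in>?j. {flip u, s u} \<subseteq> c" if u: "u \<in> ?V" for u
  proof -
    have "\<pi> u \<in> ?V" using \<pi>(2) u by simp
    then obtain c where c: "c \<in> ?j" "\<pi> u \<in> c" using partition_onD1[OF jpart] by blast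
    have "\<exists>d\<in>I.orbits. {\<pi> u, flip (\<pi> (\<pi> u))} \<subseteq> d"
      unfolding I.orbits_def by (rule merge_upper) (use \<open>\<pi> u \<in> ?V\<close> in auto)
    then obtain d where d: "d \<in> I.orbits" "\<pi> u \<in> d" "flip u \<in> d" by (auto simp: \<pi>(1))
    have "\<exists>d\<in>S.orbits. {\<pi> u, s (\<pi> (\<pi> u))} \<subseteq> d"
      unfolding S.orbits_def by (rule merge_upper) (use \<open>\<pi> u \<in> ?V\<close> in auto)
    then obtain d' where d': "d' \<in> S.orbits" "\<pi> u \<in> d'" "s u \<in> d'" by (auto simp: \<pi>(1))
    have "d \<subseteq> c" "d' \<subseteq> c" using join_absorbs[OF c(1) _ _ c(2)] d d' by blast+
    then show ?thesis using c(1) d d' by blast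
  qed
  then have edge: "\<exists>c\<in>?j. {flip u, s u} \<subseteq> c" if "u \<in> ?V" for u using that by blast
  have "refines ?V z ?j"
    unfolding refines_def
  proof (intro conjI ballI z_part jpart)
    fix d assume d: "d \<in> z"
    show "\<exists>c\<in>?j. d \<subseteq> c"
    proof (rule merge_least[OF jpart _ d[unfolded z_merge]])
      fix b assume "b \<in> (`) Inl ` F \<union> (`) Inr ` F"
      then obtain i where i: "i < k" "b = {Inl i, Inl (\<sigma> i)} \<or> b = {Inr i, Inr (\<sigma> i)}"
        by (auto simp: F_def)
      then show "\<exists>c\<in>?j. b \<subseteq> c"
      proof (elim disjE)
        assume "b = {Inl i, Inl (\<sigma> i)}"
        then show ?thesis using edge[of "Inr (\<sigma> i)"] i lt by (auto simp: s \<sigma>_inv)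
      next
        assume "b = {Inr i, Inr (\<sigma> i)}"
        then show ?thesis using edge[of "Inl i"] i by (auto simp: s)
      qed
    qed
  qed
  note zj = refines_card_le[OF this finite_vertices]
  have fin_orb: "finite orb" by (rule finite_elements[OF _ orb_part]) simp
  have card_z: "card z = 2 * card orb"
  proof -
    have "card z = card ((`) Inl ` orb :: (nat + nat) set set) + card ((`) Inr ` orb :: (nat + nat) set set)"
      unfolding z_def
    proof (rule card_Un_disjoint)
      show "(`) Inl ` orb \<inter> (`) Inr ` orb = ({} :: (nat + nat) set set)"
      proof (rule equals0I)
        fix b :: "(nat + nat) set" assume "b \<in> (`) Inl ` orb \<inter> (`) Inr ` orb"
        then obtain d d' where "d \<in> orb" "b = Inl ` d" "b = Inr ` d'" by blast
        then have "d = {}" by auto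
        then show False using \<open>d \<in> orb\<close> partition_onD3[OF orb_part] by simp
      qed
    qed (use fin_orb in auto)
    also have "card ((`) Inl ` orb :: (nat + nat) set set) = card orb"
      by (rule card_image) (simp add: inj_on_def inj_image_eq_iff)
    also have "card ((`) Inr ` orb :: (nat + nat) set set) = card orb"
      by (rule card_image) (simp add: inj_on_def inj_image_eq_iff)
    finally show ?thesis by simp
  qed
  \<comment> \<open>Forgetting the row pulls the orbits back to a partition that is coarser than the
    identity and \<sigma>, hence coarser than the cycles.\<close>
  have "card orb \<le> card (perm_cycles k \<sigma>)"
  proof -
    define g where "g = case_sum (\<lambda>i::nat. i) (\<lambda>i. i)"
    define r where "r = (\<lambda>d. ?V \<inter> g -` d) ` orb"
    have gV: "g ` ?V = {..<k}" by (auto simp: g_def vertices_def image_Un Plus_def image_image)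
    have rpart: "partition_on ?V r" unfolding r_def by (rule partition_on_pullback[OF orb_part gV])
    have "inj_on (\<lambda>d. ?V \<inter> g -` d) orb"
    proof (rule inj_on_inverseI[of _ "\<lambda>b. g ` b"])
      fix d assume "d \<in> orb"
      then have "d \<subseteq> g ` ?V" using gV partition_onD1[OF orb_part] by blast
      then show "g ` (?V \<inter> g -` d) = d" by blast
    qed
    then have card_r: "card r = card orb" unfolding r_def by (rule card_image)
    have in_r: "\<exists>c\<in>r. {Inl i, Inr j} \<subseteq> c" if "d \<in> orb" "i \<in> d" "j \<in> d" for d i j
      using that partition_onD1[OF orb_part] unfolding r_def by (auto simp: g_def)
    have "refines ?V (id_diagram k) r" unfolding refines_def
    proof (intro conjI ballI partition_on_id_diagram rpart)
      fix b assume "b \<in> id_diagram k"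
      then obtain i where i: "i < k" "b = {Inl i, Inr i}" by (auto simp: id_diagram_def)
      obtain d where "d \<in> orb" "i \<in> d" using i(1) partition_onD1[OF orb_part] by blast
      then show "\<exists>c\<in>r. b \<subseteq> c" using in_r i(2) by blast
    qed
    moreover have "refines ?V (perm_diagram k \<sigma>) r" unfolding refines_def
    proof (intro conjI ballI diagramsD[OF perm_diagram_in_diagrams[OF \<sigma>]] rpart)
      fix b assume "b \<in> perm_diagram k \<sigma>"
      then obtain i where i: "i < k" "b = {Inl i, Inr (\<sigma> i)}" by (auto simp: perm_diagram_def)
      then have "{i, \<sigma> i} \<in> F" by (auto simp: F_def)
      then obtain d where "d \<in> orb" "{i, \<sigma> i} \<subseteq> d" using merge_upper[of "{i, \<sigma> i}" F] unfolding orb_def by blast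
      then show "\<exists>c\<in>r. b \<subseteq> c" using in_r[of d i "\<sigma> i"] i(2) by simp
    qed
    ultimately have "refines ?V (perm_cycles k \<sigma>) r"
      unfolding perm_cycles_def
      by (rule join_is_finest(3)[OF partition_on_id_diagram diagramsD[OF perm_diagram_in_diagrams[OF \<sigma>]]])
    then show ?thesis using refines_card_le(1)[OF _ finite_vertices] card_r by metis
  qed
  then have "card ?j = card z" using zj(1) card_z lower by linarith
  then have "z = ?j" by (rule zj(2))
  then have xz: "refines ?V I.orbits z" using join_is_finest(1)[OF I.orbits_partition S.orbits_partition] by simp
  show ?thesis
  proof (rule perm_diagramsI[OF pd])
    fix b assume "b \<in> p"
    then obtain v where v: "v \<in> ?V" "b = {v, \<pi> v}" unfolding p_eq by blast
    \<comment> \<open>The orbit of \<open>v\<close> contains \<open>flip (\<pi> v)\<close>; as it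
      stays in one row, \<open>\<pi> v\<close> lies in the other.\<close>
    have "\<exists>d\<in>I.orbits. {v, flip (\<pi> v)} \<subseteq> d"
      unfolding I.orbits_def by (rule merge_upper) (use v in auto)
    then obtain d where "d \<in> I.orbits" "{v, flip (\<pi> v)} \<subseteq> d" by blast
    then obtain c where c: "c \<in> z" "{v, flip (\<pi> v)} \<subseteq> c" by (metis refinesE[OF xz] order_trans)
    then obtain e where e: "c = Inl ` e \<or> c = Inr ` e" by (auto simp: z_def)
    then show "\<exists>i j. b = {Inl i, Inr j}"
      unfolding v(2) using c(2) by (cases v; cases "\<pi> v") auto
  qed
qed

section \<open>Freeness with respect to the Brauer diagrams\<close>

lemma perm_diagrams_subset_brauer: "perm_diagrams k \<subseteq> brauer_diagrams k"
  using perm_diagrams_subset perm_diagrams_block by (fastforce simp: brauer_diagrams_def)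

lemma brauer_subset_rook_brauer: "brauer_diagrams k \<subseteq> rook_brauer_diagrams k"
  by (auto simp: brauer_diagrams_def rook_brauer_diagrams_def)

lemma cumulant_eq_perm_cumulant:
  assumes P: "P_tracial_algebra scale mul m"
    and perm: "\<And>k. perm_diagrams k \<subseteq> \<C> k" and rook: "\<And>k. \<C> k \<subseteq> rook_brauer_diagrams k"
    and p: "p \<in> perm_diagrams k" and len: "length as = k"
  shows "cumulant scale m \<C> p as = cumulant scale m perm_diagrams p as"
proof (rule moebius_unique[where S = "perm_diagrams k" and le = "geodesic_le k"
        and f = "diagram_dist (id_diagram k)" and h = "\<lambda>p. cumulant scale m \<C> p as"
        and h' = "\<lambda>p. cumulant scale m perm_diagrams p as"])
  have sub: "\<C> k \<subseteq> diagrams k" for k using rook[of k] by (auto simp: rook_brauer_diagrams_def)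
  show "finite (perm_diagrams k)" using perm_diagrams_subset finite_diagrams finite_subset by blast
  show "geodesic_le k q q" if "q \<in> perm_diagrams k" for q
    using that perm_diagrams_subset geodesic_le_refl by blast
  show "diagram_dist (id_diagram k) q < diagram_dist (id_diagram k) r"
    if "q \<in> perm_diagrams k" "r \<in> perm_diagrams k" "geodesic_le k q r" "q \<noteq> r" for q r
    using that perm_diagrams_subset[of k] geodesic_le_dist_less by blast
  fix q assume q: "q \<in> perm_diagrams k"
  then obtain \<sigma> where \<sigma>: "\<sigma> permutes {..<k}" "q = perm_diagram k \<sigma>" by (rule perm_diagramsE)
  have "{r \<in> \<C> k. geodesic_le k r q} = {r \<in> perm_diagrams k. geodesic_le k r q}"
    using rook_brauer_below_perm[OF _ \<sigma>(1)] perm rook unfolding \<sigma>(2) by blast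
  then show "(\<Sum>r\<in>{r \<in> perm_diagrams k. geodesic_le k r q}. cumulant scale m \<C> r as) =
      (\<Sum>r\<in>{r \<in> perm_diagrams k. geodesic_le k r q}. cumulant scale m perm_diagrams r as)"
    using moment_cumulant_sum[OF cumulant_family[OF P sub], of q k as]
      moment_cumulant_sum[OF cumulant_family[OF P perm_diagrams_subset] q len] subsetD[OF perm q] len by simp
qed (rule p)

lemma perm_free_of_larger_class:
  assumes P: "P_tracial_algebra scale mul m"
    and perm: "\<And>k. perm_diagrams k \<subseteq> \<C> k" and rook: "\<And>k. \<C> k \<subseteq> rook_brauer_diagrams k"
    and free: "c_free \<C> scale mul m A1 A2"
  shows "c_free perm_diagrams scale mul m A1 A2"
proof (rule c_freeI)
  fix k p as \<epsilon>
  assume p: "p \<in> perm_diagrams k" and len: "length as = k"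
    and "\<And>i. i < k \<Longrightarrow> as ! i \<in> generated_algebra scale mul (if \<epsilon> i then A1 else A2)"
    and "\<exists>c\<in>cycles k p. \<exists>i j. Inl i \<in> c \<and> Inl j \<in> c \<and> \<epsilon> i \<noteq> \<epsilon> j"
  then have "cumulant scale m \<C> p as = 0" using perm by (intro c_free_mixed[OF free, of p k as \<epsilon>]) auto
  then show "cumulant scale m perm_diagrams p as = 0"
    using cumulant_eq_perm_cumulant[OF P perm rook p len] by simp
next
  fix k1 k2 p1 p2 as bs
  assume p: "p1 \<in> perm_diagrams k1" "p2 \<in> perm_diagrams k2" and len: "length as = k1" "length bs = k2"
    and as: "set as \<subseteq> generated_algebra scale mul A1" "set bs \<subseteq> generated_algebra scale mul A2"
  have "p1 \<in> diagrams k1" "p2 \<in> diagrams k2" using p perm_diagrams_subset by blast+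
  then have t: "diagram_tensor k1 p1 p2 \<in> perm_diagrams (k1 + k2)" using p by (simp add: perm_diagrams_tensor_iff)
  have "cumulant scale m \<C> (diagram_tensor k1 p1 p2) (as @ bs) = cumulant scale m \<C> p1 as * cumulant scale m \<C> p2 bs"
    using perm p by (intro c_free_tensor[OF free _ _ len as]) auto
  then show "cumulant scale m perm_diagrams (diagram_tensor k1 p1 p2) (as @ bs) =
      cumulant scale m perm_diagrams p1 as * cumulant scale m perm_diagrams p2 bs"
    using cumulant_eq_perm_cumulant[OF P perm rook p(1) len(1)] cumulant_eq_perm_cumulant[OF P perm rook p(2) len(2)]
      cumulant_eq_perm_cumulant[OF P perm rook t, of "as @ bs"] len by simp
qed


section \<open>Freeness with respect to all partitions\<close>

lemma partition_on_single:
  assumes "partition_on X p" "c \<in> p" "X \<subseteq> c"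
  shows "p = {X}"
proof -
  have "c = X" using assms partition_onD1 by blast
  moreover have "d = c" if d: "d \<in> p" for d
  proof -
    obtain x where x: "x \<in> d" using d partition_onD3[OF assms(1)] by fastforce
    then have "x \<in> c" using assms(3) d partition_onD1[OF assms(1)] by blast
    then show ?thesis using partition_on_block_eq[OF assms(1) d assms(2) x] by blast
  qed
  ultimately show ?thesis using assms(2) by blast
qed

text \<open>A block that meets both sides lies in a cycle, and a cycle contains the top vertex of
  each position it meets, so it has top vertices on both sides.\<close>

lemma mixed_cycle_of_indecomposable:
  assumes p: "p \<in> diagrams (k + l)" and no: "\<And>p1 p2. \<lbrakk>p1 \<in> diagrams k; p2 \<in> diagrams l\<rbrakk> \<Longrightarrow> p \<noteq> diagram_tensor k p1 p2"
  shows "\<exists>c\<in>cycles (k + l) p. \<exists>i j. Inl i \<in> c \<and> Inl j \<in> c \<and> (i < k) \<noteq> (j < k)"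
proof (rule ccontr)
  assume unmixed: "\<not> ?thesis"
  note part = diagramsD[OF p]
  have ref: "refines (vertices (k + l)) p (cycles (k + l) p)"
    unfolding cycles_def by (rule join_is_finest(1)[OF part partition_on_id_diagram])
  have cpart: "partition_on (vertices (k + l)) (cycles (k + l) p)" using ref by (simp add: refines_def)
  have top: "\<exists>i. Inl i \<in> c \<and> (i < k \<longleftrightarrow> v \<in> vertices k)" if c: "c \<in> cycles (k + l) p" and v: "v \<in> c" for c v
  proof (cases v)
    case (Inl i)
    then show ?thesis using v by auto
  next
    case (Inr i)
    then have "i < k + l" using v c partition_onD1[OF cpart] vertices_iff(2)[of i "k + l"] by blast
    then have "{Inl i, Inr i} \<in> id_diagram (k + l)" by (auto simp: id_diagram_def)
    then have "{Inl i, Inr i} \<subseteq> c"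
      using join_absorbs[OF c[unfolded cycles_def], of "{Inl i, Inr i}" v] v Inr by blast
    then show ?thesis using Inr by auto
  qed
  have "b \<subseteq> vertices k \<or> b \<inter> vertices k = {}" if b: "b \<in> p" for b
  proof (rule ccontr)
    assume "\<not> (b \<subseteq> vertices k \<or> b \<inter> vertices k = {})"
    then obtain u v where uv: "u \<in> b" "u \<notin> vertices k" "v \<in> b" "v \<in> vertices k" by blast
    obtain c where c: "c \<in> cycles (k + l) p" "b \<subseteq> c" using refinesE[OF ref b] by blast
    obtain i j where "Inl i \<in> c" "\<not> i < k" "Inl j \<in> c" "j < k"
      using top[OF c(1), of u] top[OF c(1), of v] uv c(2) by blast
    then show False using unmixed c(1) by metis
  qed
  then obtain p1 p2 where "p1 \<in> diagrams k" "p2 \<in> diagrams l" "p = diagram_tensor k p1 p2"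
    using diagram_tensor_decompose[OF p] by metis
  then show False using no by blast
qed

text \<open>Diagrams that are not tensor products have a mixed cycle and drop out of the moment; the
  cumulants of the others factor. The colouring separates the first \<open>k\<close> positions from
  the rest.\<close>

lemma c_free_moment:
  assumes cum: "is_cumulant_family scale m \<C> (cumulant scale m \<C>)"
    and sub: "\<And>k. \<C> k \<subseteq> diagrams k"
    and closed: "\<And>k l p q. \<lbrakk>p \<in> diagrams k; q \<in> diagrams l\<rbrakk> \<Longrightarrow>
        diagram_tensor k p q \<in> \<C> (k + l) \<longleftrightarrow> p \<in> \<C> k \<and> q \<in> \<C> l"
    and free: "c_free \<C> scale mul m A1 A2"
    and len: "length as = k" "length bs = l"
    and as: "set as \<subseteq> generated_algebra scale mul A1" and bs: "set bs \<subseteq> generated_algebra scale mul A2"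
    and q: "q \<in> \<C> (k + l)"
  shows "m q (as @ bs) = (\<Sum>x\<in>{x \<in> \<C> k \<times> \<C> l. geodesic_le (k + l) (diagram_tensor k (fst x) (snd x)) q}.
    cumulant scale m \<C> (fst x) as * cumulant scale m \<C> (snd x) bs)"
proof -
  let ?\<kappa> = "cumulant scale m \<C>"
  let ?t = "\<lambda>x. diagram_tensor k (fst x) (snd x)"
  let ?T = "{x \<in> \<C> k \<times> \<C> l. geodesic_le (k + l) (?t x) q}"
  have inj: "inj_on ?t ?T"
  proof (rule inj_onI)
    fix x y assume xy: "x \<in> ?T" "y \<in> ?T" "?t x = ?t y"
    then have "fst x \<in> diagrams k" "snd x \<in> diagrams l" "fst y \<in> diagrams k" "snd y \<in> diagrams l"
      using subsetD[OF sub] by (auto simp: mem_Times_iff)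
    then show "x = y" using xy(3) by (simp add: prod_eq_iff diagram_tensor_inject)
  qed
  have "m q (as @ bs) = (\<Sum>p\<in>{p \<in> \<C> (k + l). geodesic_le (k + l) p q}. ?\<kappa> p (as @ bs))"
    by (rule moment_cumulant_sum[OF cum q]) (simp add: len)
  also have "\<dots> = (\<Sum>p\<in>?t ` ?T. ?\<kappa> p (as @ bs))"
  proof (rule sum.mono_neutral_right)
    show "finite {p \<in> \<C> (k + l). geodesic_le (k + l) p q}"
      using finite_subset[OF sub finite_diagrams] by simp
    show "?t ` ?T \<subseteq> {p \<in> \<C> (k + l). geodesic_le (k + l) p q}"
      using subsetD[OF sub] closed by (auto simp: mem_Times_iff)
    show "\<forall>p\<in>{p \<in> \<C> (k + l). geodesic_le (k + l) p q} - ?t ` ?T. ?\<kappa> p (as @ bs) = 0"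
    proof
      fix p assume p: "p \<in> {p \<in> \<C> (k + l). geodesic_le (k + l) p q} - ?t ` ?T"
      have pd: "p \<in> diagrams (k + l)" using p sub by blast
      have "p \<noteq> diagram_tensor k p1 p2" if "p1 \<in> diagrams k" "p2 \<in> diagrams l" for p1 p2
      proof
        assume eq: "p = diagram_tensor k p1 p2"
        then have "(p1, p2) \<in> ?T" using p closed[OF that] by simp
        then show False using p eq by force
      qed
      then have mix: "\<exists>c\<in>cycles (k + l) p. \<exists>i j. Inl i \<in> c \<and> Inl j \<in> c \<and> (i < k) \<noteq> (j < k)"
        by (rule mixed_cycle_of_indecomposable[OF pd])
      show "?\<kappa> p (as @ bs) = 0"
      proof (rule c_free_mixed[OF free _ _ _ mix])
        show "p \<in> \<C> (k + l)" using p by simp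
        show "(as @ bs) ! i \<in> generated_algebra scale mul (if i < k then A1 else A2)" if "i < k + l" for i
          using that as bs len by (auto simp: nth_append)
      qed (simp add: len)
    qed
  qed
  also have "\<dots> = (\<Sum>x\<in>?T. ?\<kappa> (?t x) (as @ bs))" by (simp add: sum.reindex[OF inj])
  also have "\<dots> = (\<Sum>x\<in>?T. ?\<kappa> (fst x) as * ?\<kappa> (snd x) bs)"
    by (rule sum.cong[OF refl]) (use c_free_tensor[OF free _ _ len as bs] in \<open>auto simp: mem_Times_iff\<close>)
  finally show ?thesis .
qed

text \<open>A diagram coarser than the identity is its own cycle partition, so the geodesic equation
  only compares \<open>join p q\<close> with the cycles of \<open>q\<close>.\<close>

lemma saturated_geodesic_le_iff:
  assumes p: "p \<in> diagrams k" and q: "q \<in> diagrams k" and sat: "join p (id_diagram k) = p"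
  shows "geodesic_le k p q \<longleftrightarrow> refines (vertices k) p (join (id_diagram k) q)"
proof
  assume "geodesic_le k p q"
  then show "refines (vertices k) p (join (id_diagram k) q)" by (rule geodesic_le_refines[OF p q])
next
  assume ref: "refines (vertices k) p (join (id_diagram k) q)"
  note P = diagramsD[OF p] and Q = diagramsD[OF q] and I = partition_on_id_diagram[of k]
  have "refines (vertices k) (id_diagram k) p" using join_is_finest(2)[OF P I] sat by simp
  then have "refines (vertices k) (join (id_diagram k) q) (join p q)"
    using join_is_finest(3)[OF I Q] refines_trans join_is_finest(1,2)[OF P Q] by blast
  moreover have "refines (vertices k) (join p q) (join (id_diagram k) q)"
    using join_is_finest(3)[OF P Q ref] join_is_finest(2)[OF I Q] by blast
  ultimately have "join p q = join (id_diagram k) q" by (rule refines_asym[symmetric])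
  then show "geodesic_le k p q" unfolding geodesic_le_iff sat by simp
qed

subsection \<open>The four-cycle\<close>

definition swap2 :: diagram where "swap2 = perm_diagram 2 (transpose 0 1)"
definition one_block2 :: diagram where "one_block2 = {{Inl 0, Inl 1, Inr 0, Inr 1}}"

lemma card_swap2 [simp]: "card swap2 = 2" and card_one_block2 [simp]: "card one_block2 = 1"
  by (simp_all add: swap2_def one_block2_def)

text \<open>The cycle 0, 2, 1, 3. It alternates between {0, 1} and {2, 3}, so the letters of the two
  families can be listed one family after the other, as tensor products require.\<close>

definition interlace :: "nat \<Rightarrow> nat" where
  "interlace i = (if i = 0 then 2 else if i = 1 then 3 else if i = 2 then 1 else if i = 3 then 0 else i)"

lemma lessThan_4: "{..<4} = {0, 1, 2, 3::nat}" and lessThan_2: "{..<2} = {0, 1::nat}"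
  by auto

lemma vertices_2: "vertices 2 = {Inl 0, Inl 1, Inr 0, Inr 1}"
  and vertices_4: "vertices 4 = {Inl 0, Inl 1, Inl 2, Inl 3, Inr 0, Inr 1, Inr 2, Inr 3}"
  unfolding vertices_def lessThan_2 lessThan_4 by auto

lemma interlace_permutes: "interlace permutes {..<4}"
  unfolding lessThan_4
  by (rule bij_imp_permutes) (auto simp: interlace_def bij_betw_def inj_on_def)

lemma swap2_permutes: "transpose 0 1 permutes {..<2::nat}"
  by (rule permutes_swap_id) auto

lemma swap2_eq: "swap2 = {{Inl 0, Inr 1}, {Inl 1, Inr 0}}"
  and id2_eq: "id_diagram 2 = {{Inl 0, Inr 0}, {Inl 1, Inr 1}}"
  and interlace_eq: "perm_diagram 4 interlace =
    {{Inl 0, Inr 2}, {Inl 1, Inr 3}, {Inl 2, Inr 1}, {Inl 3, Inr 0}}"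
  unfolding swap2_def perm_diagram_def id_diagram_def lessThan_4 lessThan_2 by (simp_all add: interlace_def)

lemma diagrams2: "swap2 \<in> diagrams 2" "one_block2 \<in> diagrams 2"
  using perm_diagram_in_diagrams[OF swap2_permutes]
  by (auto simp: swap2_def one_block2_def diagrams_def vertices_2 intro: partition_on_space)

lemma distinct2: "id_diagram 2 \<noteq> one_block2" "swap2 \<noteq> one_block2" "id_diagram 2 \<noteq> swap2"
proof -
  have "card (id_diagram 2) \<noteq> card one_block2" "card swap2 \<noteq> card one_block2" by simp_all
  then show "id_diagram 2 \<noteq> one_block2" "swap2 \<noteq> one_block2" by metis+
  show "id_diagram 2 \<noteq> swap2"
    using perm_diagram_inject[OF permutes_id swap2_permutes] perm_diagram_id(1)[of 2]
    unfolding swap2_def by (metis id_apply transpose_apply_first zero_neq_one)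
qed

lemma refines_one_block2: "p \<in> diagrams 2 \<Longrightarrow> refines (vertices 2) p one_block2"
proof -
  assume p: "p \<in> diagrams 2"
  have "one_block2 = {vertices 2}" by (simp add: one_block2_def vertices_2)
  then show ?thesis
    using diagramsD[OF p] diagramsD[OF diagrams2(2)] partition_onD1[OF diagramsD[OF p]]
    unfolding refines_def by blast
qed

lemma join_one_block2:
  assumes "p \<in> diagrams 2"
  shows "join p one_block2 = one_block2" "join one_block2 p = one_block2"
  using join_eq_right[OF refines_one_block2[OF assms]] by (simp_all add: join_commute)

lemma join_self: "p \<in> diagrams k \<Longrightarrow> join p p = p"
  by (rule join_eq_right[OF refines_refl[OF diagramsD]])

lemma join_id_id [simp]: "join (id_diagram k) (id_diagram k) = id_diagram k"
  by (rule join_self[OF id_diagram_in_diagrams])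

lemma join_id_swap2: "join (id_diagram 2) swap2 = one_block2"
proof -
  have part: "partition_on (vertices 2) (join (id_diagram 2) swap2)"
    using diagramsD[OF join_in_diagrams[OF id_diagram_in_diagrams diagrams2(1)]] .
  obtain c where c: "c \<in> join (id_diagram 2) swap2" "Inl 0 \<in> c"
    using partition_onD1[OF part] vertices_2 by blast
  note ab = join_absorbs[OF c(1)]
  have "Inr 0 \<in> c" "Inr 1 \<in> c" 
    using ab[of "{Inl 0, Inr 0}" "Inl 0"] ab[of "{Inl 0, Inr 1}" "Inl 0"] c(2) by (simp_all add: id2_eq swap2_eq)
  moreover from this have "Inl 1 \<in> c" using ab[of "{Inl 1, Inr 1}" "Inr 1"] by (simp add: id2_eq)
  ultimately have "vertices 2 \<subseteq> c" using c(2) by (simp add: vertices_2)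
  then show ?thesis using partition_on_single[OF part c(1)] by (simp add: one_block2_def vertices_2)
qed

lemma coarser_than_pairing:
  assumes q: "q \<in> diagrams k" and p: "p \<in> diagrams k" and card: "card (join p q) = card q"
  shows "refines (vertices k) p q"
  using refines_card_le(2)[OF join_is_finest(2)[OF diagramsD[OF p] diagramsD[OF q]] finite_vertices] card
    join_is_finest(1)[OF diagramsD[OF p] diagramsD[OF q]] by simp

lemma card_join_pos:
  assumes "p \<in> diagrams (Suc k)" "q \<in> diagrams (Suc k)"
  shows "1 \<le> card (join p q)"
proof -
  note j = join_in_diagrams[OF assms]
  have "Inl 0 \<in> \<Union>(join p q)" using partition_onD1[OF diagramsD[OF j]] vertices_iff(1)[of 0 "Suc k"] by simp
  then have "join p q \<noteq> {}" by blast
  then have "card (join p q) \<noteq> 0" using finite_diagram[OF j] by simp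
  then show ?thesis by simp
qed

text \<open>The joins of \<open>p\<close> with the identity and with the transposition have one or
  two blocks each, and \<open>card p + 1\<close> together; two blocks mean that \<open>p\<close>
  refines the diagram in question. This leaves the three diagrams. If both joins had two blocks,
  \<open>p\<close> would consist of four singletons and the sum would have to be 5.\<close>

lemma below_swap2_iff:
  assumes p: "p \<in> diagrams 2"
  shows "geodesic_le 2 p swap2 \<longleftrightarrow> p \<in> {id_diagram 2, one_block2, swap2}"
proof
  assume "geodesic_le 2 p swap2"
  then have eq: "card (join p (id_diagram 2)) + card (join p swap2) = card p + 1"
    unfolding geodesic_le_iff join_id_swap2 by simp
  have c2: "card (join p q) = 1 \<or> (card (join p q) = 2 \<and> refines (vertices 2) p q)"
    if q: "q \<in> diagrams 2" "card q = 2" for q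
  proof -
    have "card (join p q) \<le> 2"
      using refines_card_le(1)[OF join_is_finest(2)[OF diagramsD[OF p] diagramsD[OF q(1)]] finite_vertices] q(2) by simp
    moreover have "1 \<le> card (join p q)" using card_join_pos[of p 1 q] p q(1) by (simp add: numeral_2_eq_2)
    ultimately show ?thesis using coarser_than_pairing[OF q(1) p] q(2) by force
  qed
  note a = c2[OF id_diagram_in_diagrams card_id_diagram] and b = c2[OF diagrams2(1) card_swap2]
  have fin: "finite (vertices 2)" by (rule finite_vertices)
  show "p \<in> {id_diagram 2, one_block2, swap2}"
  proof (cases "card (join p (id_diagram 2)) = 1")
    case True
    show ?thesis
    proof (cases "card (join p swap2) = 1")
      case True2: True
      then have "card p = card one_block2" using eq True by simp
      then show ?thesis using refines_card_le(2)[OF refines_one_block2[OF p] fin] by simp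
    next
      case False
      then have "card p = card swap2" "refines (vertices 2) p swap2" using b eq True by auto
      then show ?thesis using refines_card_le(2)[OF _ fin] by force
    qed
  next
    case False
    then have A: "card (join p (id_diagram 2)) = 2" "refines (vertices 2) p (id_diagram 2)" using a by auto
    show ?thesis
    proof (cases "card (join p swap2) = 1")
      case True
      then have "card p = card (id_diagram 2)" using A eq by simp
      then show ?thesis using refines_card_le(2)[OF A(2) fin] by simp
    next
      case F2: False
      then have B: "card (join p swap2) = 2" "refines (vertices 2) p swap2" using b by auto
      have "\<exists>v. b = {v}" if b: "b \<in> p" for b
      proof -
        obtain c where c: "c \<in> id_diagram 2" "b \<subseteq> c" using refinesE[OF A(2) b] by blast
        obtain d where d: "d \<in> swap2" "b \<subseteq> d" using refinesE[OF B(2) b] by blast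
        obtain v where "v \<in> b" using b partition_onD3[OF diagramsD[OF p]] by fastforce
        moreover have "b \<subseteq> c \<inter> d" using c d by blast
        moreover have "\<exists>w. c \<inter> d \<subseteq> {w}" using c(1) d(1) unfolding id2_eq swap2_eq by auto
        ultimately show ?thesis by blast
      qed
      then have "\<And>b. b \<in> p \<Longrightarrow> card b = 1" by force
      then have "card (\<Union>p) = (\<Sum>b\<in>p. 1)"
        using card_Union_disjoint[of p] partition_onD2[OF diagramsD[OF p]] by (metis (no_types, lifting) card.infinite one_neq_zero sum.cong)
      moreover have "card (vertices 2) = 4" by (simp add: vertices_2)
      ultimately have "card p = 4" using partition_onD1[OF diagramsD[OF p]] by simp
      then show ?thesis using A(1) B(1) eq by simp
    qed
  qed
next
  assume "p \<in> {id_diagram 2, one_block2, swap2}"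
  then consider "p = id_diagram 2" | "p = one_block2" | "p = swap2" by blast
  then show "geodesic_le 2 p swap2"
  proof cases
    case 1
    then show ?thesis by (simp add: geodesic_le_iff join_self)
  next
    case 2
    then show ?thesis by (simp add: geodesic_le_iff join_one_block2 diagrams2 join_id_swap2)
  next
    case 3
    then show ?thesis by (simp add: geodesic_le_refl diagrams2)
  qed
qed

lemma id_geodesic_le: "q \<in> diagrams k \<Longrightarrow> geodesic_le k (id_diagram k) q"
  by (simp add: geodesic_le_iff join_self)

lemma below_id_iff:
  assumes p: "p \<in> diagrams k"
  shows "geodesic_le k p (id_diagram k) \<longleftrightarrow> p = id_diagram k"
proof
  assume le: "geodesic_le k p (id_diagram k)"
  have ref: "refines (vertices k) p (id_diagram k)"
    using geodesic_le_refines[OF p id_diagram_in_diagrams le] by (simp add: join_self)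
  have "card (id_diagram k) = card p"
    using le unfolding geodesic_le_iff join_eq_right[OF ref] by (simp add: join_self)
  then show "p = id_diagram k" by (rule refines_card_le(2)[OF ref finite_vertices])
qed (simp add: id_geodesic_le)

text \<open>If \<open>J\<close> connects everything to the image of \<open>vertices 2\<close>, on which it contains \<open>p\<close> and
  the transposition, then it has at most as many blocks as the join of the two.\<close>

lemma card_contract:
  assumes J: "partition_on X J" and p: "p \<in> diagrams 2"
    and pJ: "\<And>b. b \<in> p \<Longrightarrow> \<exists>c\<in>J. f ` b \<subseteq> c"
    and sJ: "\<exists>c\<in>J. {f (Inl 0), f (Inr 1)} \<subseteq> c" "\<exists>c\<in>J. {f (Inl 1), f (Inr 0)} \<subseteq> c"
    and meet: "\<And>c. c \<in> J \<Longrightarrow> \<exists>v\<in>vertices 2. f v \<in> c"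
  shows "card J \<le> card (join p swap2)"
proof -
  note jd = join_in_diagrams[OF p diagrams2(1)]
  have edge: "\<exists>c\<in>J. f ` b \<subseteq> c" if "b \<in> p \<union> swap2" for b
    using that pJ sJ unfolding swap2_eq by auto
  have "\<exists>c\<in>J. f ` d \<subseteq> c" if d: "d \<in> join p swap2" for d
  proof -
    obtain x where x: "x \<in> d" using d partition_onD3[OF diagramsD[OF jd]] by fastforce
    then have "x \<in> vertices 2" using d partition_onD1[OF diagramsD[OF jd]] by blast
    then obtain b where "b \<in> p" "x \<in> b" using partition_onD1[OF diagramsD[OF p]] by blast
    then obtain c where c: "c \<in> J" "f x \<in> c" using pJ by blast
    have "f y \<in> c" if y: "y \<in> d" for y
      using d[unfolded join_def] x y c(2)
    proof (rule merge_block_induct)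
      fix b u v assume b: "b \<in> p \<union> swap2" "u \<in> b" "v \<in> b" "f u \<in> c"
      obtain c' where c': "c' \<in> J" "f ` b \<subseteq> c'" using edge[OF b(1)] by blast
      then have "c' = c" using partition_on_block_eq[OF J c'(1) c(1), of "f u"] b by blast
      then show "f v \<in> c" using c'(2) b(3) by blast
    qed
    then show ?thesis using c(1) by blast
  qed
  \<comment> \<open>Each block of the join is carried into one block of \<open>J\<close>, and every
    block of \<open>J\<close> is reached, since it meets the image of
    \<open>vertices 2\<close>.\<close>
  then obtain h where h: "\<And>d. d \<in> join p swap2 \<Longrightarrow> h d \<in> J \<and> f ` d \<subseteq> h d" by metis
  have "J \<subseteq> h ` join p swap2"
  proof
    fix c assume c: "c \<in> J"
    then obtain v where v: "v \<in> vertices 2" "f v \<in> c" using meet by blast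
    then obtain d where d: "d \<in> join p swap2" "v \<in> d" using partition_onD1[OF diagramsD[OF jd]] by blast
    then have "h d = c" using partition_on_block_eq[OF J _ c, of "h d" "f v"] h[OF d(1)] v(2) by blast
    then show "c \<in> h ` join p swap2" using d(1) by blast
  qed
  then show ?thesis using surj_card_le[OF finite_diagram[OF jd]] by blast
qed

definition interlaced :: diagram where "interlaced = perm_diagram 4 interlace"

lemma interlaced_in: "interlaced \<in> perm_diagrams 4" "interlaced \<in> diagrams 4"
  using interlace_permutes perm_diagram_in_diagrams by (auto simp: interlaced_def perm_diagrams_def)

lemma tensor2_in_diagrams: "p \<in> diagrams 2 \<Longrightarrow> q \<in> diagrams 2 \<Longrightarrow> diagram_tensor 2 p q \<in> diagrams 4"
  using diagram_tensor_in_diagrams[of p 2 q 2] by simp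

lemma interlaced_absorb:
  assumes "c \<in> join r interlaced"
  shows "Inl 0 \<in> c \<longleftrightarrow> Inr 2 \<in> c" "Inl 1 \<in> c \<longleftrightarrow> Inr 3 \<in> c" "Inl 2 \<in> c \<longleftrightarrow> Inr 1 \<in> c" "Inl 3 \<in> c \<longleftrightarrow> Inr 0 \<in> c"
proof -
  have "u \<in> c \<longleftrightarrow> v \<in> c" if "{u, v} \<in> interlaced" for u v
    using join_absorbs[OF assms, of "{u, v}" u] join_absorbs[OF assms, of "{u, v}" v] that by auto
  then show "Inl 0 \<in> c \<longleftrightarrow> Inr 2 \<in> c" "Inl 1 \<in> c \<longleftrightarrow> Inr 3 \<in> c" "Inl 2 \<in> c \<longleftrightarrow> Inr 1 \<in> c" "Inl 3 \<in> c \<longleftrightarrow> Inr 0 \<in> c"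
    by (simp_all add: interlaced_def interlace_eq)
qed

lemma join_id_interlaced: "join (id_diagram 4) interlaced = {vertices 4}"
proof -
  have part: "partition_on (vertices 4) (join (id_diagram 4) interlaced)"
    using diagramsD[OF join_in_diagrams[OF id_diagram_in_diagrams interlaced_in(2)]] .
  obtain c where c: "c \<in> join (id_diagram 4) interlaced" "Inl 0 \<in> c"
    using partition_onD1[OF part] vertices_4 by blast
  have i: "Inl i \<in> c \<longleftrightarrow> Inr i \<in> c" if "i < 4" for i
  proof -
    have "{Inl i, Inr i} \<in> id_diagram 4" using that by (auto simp: id_diagram_def)
    then show ?thesis using join_absorbs[OF c(1), of "{Inl i, Inr i}"] by blast
  qed
  have "vertices 4 \<subseteq> c"
    using c(2) interlaced_absorb[OF c(1)] i[of 0] i[of 1] i[of 2] i[of 3] by (simp add: vertices_4)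
  then show ?thesis by (rule partition_on_single[OF part c(1)])
qed

lemma tensor_le_interlaced_iff:
  assumes p: "p \<in> diagrams 2" and q: "q \<in> diagrams 2"
  shows "geodesic_le 4 (diagram_tensor 2 p q) interlaced \<longleftrightarrow>
    card (join p (id_diagram 2)) + card (join q (id_diagram 2)) + card (join (diagram_tensor 2 p q) interlaced) =
    card p + card q + 1"
proof -
  have "id_diagram 4 = diagram_tensor 2 (id_diagram 2) (id_diagram 2)"
    using id_diagram_add[of 2 2] by simp
  then have "card (join (diagram_tensor 2 p q) (id_diagram 4)) = card (join p (id_diagram 2)) + card (join q (id_diagram 2))"
    using join_diagram_tensor[OF p id_diagram_in_diagrams q id_diagram_in_diagrams]
      card_diagram_tensor[OF join_in_diagrams[OF p id_diagram_in_diagrams] join_in_diagrams[OF q id_diagram_in_diagrams]]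
    by simp
  then show ?thesis
    unfolding geodesic_le_iff join_id_interlaced card_diagram_tensor[OF p q] by simp
qed

text \<open>As the four-cycle alternates, every block of the join meets either half. On the chosen
  half the join contains \<open>r\<close> and also the edges of the transposition: if the other
  factor is the identity, the four-cycle passes through it from one letter to the other, and
  otherwise \<open>r\<close> has these connections itself. So \<open>card_contract\<close>
  applies.\<close>

lemma card_join_interlaced_le:
  assumes p: "p \<in> diagrams 2" and q: "q \<in> diagrams 2" and r: "r \<in> diagrams 2"
  shows "\<lbrakk>\<And>b. b \<in> r \<Longrightarrow> \<exists>c\<in>p. b \<subseteq> c; q = id_diagram 2 \<or> r \<in> {swap2, one_block2}\<rbrakk> \<Longrightarrow>
      card (join (diagram_tensor 2 p q) interlaced) \<le> card (join r swap2)"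
    and "\<lbrakk>\<And>b. b \<in> r \<Longrightarrow> \<exists>c\<in>q. b \<subseteq> c; p = id_diagram 2 \<or> r \<in> {swap2, one_block2}\<rbrakk> \<Longrightarrow>
      card (join (diagram_tensor 2 p q) interlaced) \<le> card (join r swap2)"
proof -
  let ?J = "join (diagram_tensor 2 p q) interlaced"
  note td = tensor2_in_diagrams[OF p q]
  have J: "partition_on (vertices 4) ?J" by (rule diagramsD[OF join_in_diagrams[OF td interlaced_in(2)]])
  have ref: "refines (vertices 4) (diagram_tensor 2 p q) ?J"
    by (rule join_is_finest(1)[OF diagramsD[OF td] diagramsD[OF interlaced_in(2)]])
  have edge: "\<exists>c\<in>?J. b \<subseteq> c" if "b \<in> diagram_tensor 2 p q" for b
    using refinesE[OF ref that] by metis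
  have blk: "\<exists>c\<in>?J. v \<in> c" if "v \<in> vertices 4" for v using that partition_onD1[OF J] by blast
  have ab: "b \<subseteq> c" if "c \<in> ?J" "b \<in> diagram_tensor 2 p q" "v \<in> b" "v \<in> c" for b c v
    using join_absorbs[OF that(1)] that(2-4) by blast
  have ne: "\<exists>v\<in>vertices 4. v \<in> c" if c: "c \<in> ?J" for c
  proof -
    obtain v where "v \<in> c" using c partition_onD3[OF J] by fastforce
    then show ?thesis using c partition_onD1[OF J] by blast
  qed
  have two: "\<exists>c\<in>p. {Inl 0, Inr 1} \<subseteq> c" "\<exists>c\<in>p. {Inl 1, Inr 0} \<subseteq> c"
    if r: "\<And>b. b \<in> r \<Longrightarrow> \<exists>c\<in>p. b \<subseteq> c" "r \<in> {swap2, one_block2}" for p :: diagram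
    using r(2) r(1)[of "{Inl 0, Inr 1}"] r(1)[of "{Inl 1, Inr 0}"] r(1)[of "{Inl 0, Inl 1, Inr 0, Inr 1}"]
    by (auto simp: swap2_eq one_block2_def)
  {
    assume rp: "\<And>b. b \<in> r \<Longrightarrow> \<exists>c\<in>p. b \<subseteq> c" and or: "q = id_diagram 2 \<or> r \<in> {swap2, one_block2}"
    have sub: "\<exists>c\<in>?J. b \<subseteq> c" if "b \<subseteq> d" "d \<in> p" for b d
      using edge[of d] that by (auto simp: diagram_tensor_alt)
    have "\<exists>c\<in>?J. {Inl 0, Inr 1} \<subseteq> c \<and> True" "\<exists>c\<in>?J. {Inl 1, Inr 0} \<subseteq> c"
    proof -
      show "\<exists>c\<in>?J. {Inl 0, Inr 1} \<subseteq> c \<and> True"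
        using or
      proof
        assume "q = id_diagram 2"
        then have "{Inl 2, Inr 2} \<in> diagram_tensor 2 p q" by (simp add: diagram_tensor_alt id2_eq)
        moreover obtain c where c: "c \<in> ?J" "Inl 0 \<in> c" using blk[of "Inl 0"] by auto
        moreover have "Inr 2 \<in> c" using c interlaced_absorb[OF c(1)] by simp
        ultimately have "Inl 2 \<in> c" using ab[of c "{Inl 2, Inr 2}" "Inr 2"] by simp
        then have "Inr 1 \<in> c" using interlaced_absorb[OF c(1)] by simp
        then show ?thesis using c by blast
      next
        assume "r \<in> {swap2, one_block2}"
        then show ?thesis using two[OF rp] sub by metis
      qed
      show "\<exists>c\<in>?J. {Inl 1, Inr 0} \<subseteq> c"
        using or
      proof
        assume "q = id_diagram 2"
        then have "{Inl 3, Inr 3} \<in> diagram_tensor 2 p q" by (simp add: diagram_tensor_alt id2_eq)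
        moreover obtain c where c: "c \<in> ?J" "Inl 1 \<in> c" using blk[of "Inl 1"] by auto
        moreover have "Inr 3 \<in> c" using c interlaced_absorb[OF c(1)] by simp
        ultimately have "Inl 3 \<in> c" using ab[of c "{Inl 3, Inr 3}" "Inr 3"] by simp
        then have "Inr 0 \<in> c" using interlaced_absorb[OF c(1)] by simp
        then show ?thesis using c by blast
      next
        assume "r \<in> {swap2, one_block2}"
        then show ?thesis using two[OF rp] sub by metis
      qed
    qed
    then have s: "\<exists>c\<in>?J. {id (Inl 0), id (Inr 1)} \<subseteq> c" "\<exists>c\<in>?J. {id (Inl 1), id (Inr 0)} \<subseteq> c" by auto
    show "card ?J \<le> card (join r swap2)"
    proof (rule card_contract[OF J r _ s])
      show "\<exists>c\<in>?J. id ` b \<subseteq> c" if "b \<in> r" for b using rp[OF that] sub by auto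
      show "\<exists>v\<in>vertices 2. id v \<in> c" if c: "c \<in> ?J" for c
        using ne[OF c] interlaced_absorb[OF c] unfolding vertices_4 vertices_2 by auto
    qed
  }
  {
    assume rq: "\<And>b. b \<in> r \<Longrightarrow> \<exists>c\<in>q. b \<subseteq> c" and or: "p = id_diagram 2 \<or> r \<in> {swap2, one_block2}"
    have sub: "\<exists>c\<in>?J. shift 2 ` b \<subseteq> c" if "b \<subseteq> d" "d \<in> q" for b d
    proof -
      obtain c where "c \<in> ?J" "shift 2 ` d \<subseteq> c" using edge[of "shift 2 ` d"] \<open>d \<in> q\<close> by (auto simp: diagram_tensor_alt)
      then show ?thesis using \<open>b \<subseteq> d\<close> by blast
    qed
    have "\<exists>c\<in>?J. {Inl 2, Inr 3} \<subseteq> c" "\<exists>c\<in>?J. {Inl 3, Inr 2} \<subseteq> c"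
    proof -
      show "\<exists>c\<in>?J. {Inl 2, Inr 3} \<subseteq> c"
        using or
      proof
        assume "p = id_diagram 2"
        then have "{Inl 1, Inr 1} \<in> diagram_tensor 2 p q" by (simp add: diagram_tensor_alt id2_eq)
        moreover obtain c where c: "c \<in> ?J" "Inl 2 \<in> c" using blk[of "Inl 2"] by auto
        moreover have "Inr 1 \<in> c" using c interlaced_absorb[OF c(1)] by simp
        ultimately have "Inl 1 \<in> c" using ab[of c "{Inl 1, Inr 1}" "Inr 1"] by simp
        then have "Inr 3 \<in> c" using interlaced_absorb[OF c(1)] by simp
        then show ?thesis using c by blast
      next
        assume "r \<in> {swap2, one_block2}"
        then obtain d where "d \<in> q" "{Inl 0, Inr 1} \<subseteq> d" using two[OF rq] by metis
        then show ?thesis using sub[of "{Inl 0, Inr 1}" d] by simp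
      qed
      show "\<exists>c\<in>?J. {Inl 3, Inr 2} \<subseteq> c"
        using or
      proof
        assume "p = id_diagram 2"
        then have "{Inl 0, Inr 0} \<in> diagram_tensor 2 p q" by (simp add: diagram_tensor_alt id2_eq)
        moreover obtain c where c: "c \<in> ?J" "Inl 3 \<in> c" using blk[of "Inl 3"] by auto
        moreover have "Inr 0 \<in> c" using c interlaced_absorb[OF c(1)] by simp
        ultimately have "Inl 0 \<in> c" using ab[of c "{Inl 0, Inr 0}" "Inr 0"] by simp
        then have "Inr 2 \<in> c" using interlaced_absorb[OF c(1)] by simp
        then show ?thesis using c by blast
      next
        assume "r \<in> {swap2, one_block2}"
        then obtain d where "d \<in> q" "{Inl 1, Inr 0} \<subseteq> d" using two[OF rq] by metis
        then show ?thesis using sub[of "{Inl 1, Inr 0}" d] by simp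
      qed
    qed
    then have s: "\<exists>c\<in>?J. {shift 2 (Inl 0), shift 2 (Inr 1)} \<subseteq> c" "\<exists>c\<in>?J. {shift 2 (Inl 1), shift 2 (Inr 0)} \<subseteq> c"
      by simp_all
    show "card ?J \<le> card (join r swap2)"
    proof (rule card_contract[OF J r _ s])
      show "\<exists>c\<in>?J. shift 2 ` b \<subseteq> c" if "b \<in> r" for b using rq[OF that] sub by blast
      show "\<exists>v\<in>vertices 2. shift 2 v \<in> c" if c: "c \<in> ?J" for c
        using ne[OF c] interlaced_absorb[OF c] unfolding vertices_4 vertices_2 by auto
    qed
  }
qed

lemma two_le_card_join:
  assumes "finite X" "partition_on X p" "partition_on X q"
    and B: "B \<union> C = X" "B \<inter> C = {}" "B \<noteq> {}" "C \<noteq> {}"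
    and sub: "\<And>b. b \<in> p \<Longrightarrow> b \<subseteq> B \<or> b \<subseteq> C" "\<And>b. b \<in> q \<Longrightarrow> b \<subseteq> B \<or> b \<subseteq> C"
  shows "2 \<le> card (join p q)"
proof -
  have part: "partition_on X {B, C}"
    by (rule partition_onI) (use B in \<open>auto simp: disjnt_def\<close>)
  have "B \<noteq> C" using B by blast
  have "refines X p {B, C}" "refines X q {B, C}"
    unfolding refines_def using part assms(2,3) sub by auto
  then have "refines X (join p q) {B, C}" by (rule join_is_finest(3)[OF assms(2,3)])
  then show ?thesis using refines_card_le(1)[OF _ assms(1), of "join p q" "{B, C}"] \<open>B \<noteq> C\<close> by simp
qed

text \<open>The separating classes are found by following the edges that start at
  \<open>Inl 0\<close>.\<close>

lemma card_join_interlaced_swap_ge: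
  "2 \<le> card (join (diagram_tensor 2 swap2 (id_diagram 2)) interlaced)" (is "2 \<le> card (join ?p _)")
  "2 \<le> card (join (diagram_tensor 2 (id_diagram 2) swap2) interlaced)" (is "2 \<le> card (join ?q _)")
proof -
  note td = diagramsD[OF tensor2_in_diagrams[OF diagrams2(1) id_diagram_in_diagrams]]
    diagramsD[OF tensor2_in_diagrams[OF id_diagram_in_diagrams diagrams2(1)]]
  have p: "?p = {{Inl 0, Inr 1}, {Inl 1, Inr 0}, {Inl 2, Inr 2}, {Inl 3, Inr 3}}"
    "?q = {{Inl 0, Inr 0}, {Inl 1, Inr 1}, {Inl 2, Inr 3}, {Inl 3, Inr 2}}"
    by (simp_all add: diagram_tensor_alt swap2_eq id2_eq insert_commute)
  have i: "b = {Inl 0, Inr 2} \<or> b = {Inl 1, Inr 3} \<or> b = {Inl 2, Inr 1} \<or> b = {Inl 3, Inr 0}"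
    if "b \<in> interlaced" for b using that by (simp add: interlaced_def interlace_eq)
  show "2 \<le> card (join ?p interlaced)"
  proof (rule two_le_card_join[OF finite_vertices td(1) diagramsD[OF interlaced_in(2)]])
    show "{Inl 0, Inr 2, Inl 2, Inr 1} \<union> {Inl 1, Inr 3, Inl 3, Inr 0} = vertices 4"
      unfolding vertices_4 by blast
    fix b :: "(nat + nat) set"
    show "b \<subseteq> {Inl 0, Inr 2, Inl 2, Inr 1} \<or> b \<subseteq> {Inl 1, Inr 3, Inl 3, Inr 0}" if "b \<in> ?p"
      using that unfolding p by (elim insertE emptyE) simp_all
    show "b \<subseteq> {Inl 0, Inr 2, Inl 2, Inr 1} \<or> b \<subseteq> {Inl 1, Inr 3, Inl 3, Inr 0}" if "b \<in> interlaced"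
      using i[OF that] by (elim disjE) simp_all
  qed simp_all
  show "2 \<le> card (join ?q interlaced)"
  proof (rule two_le_card_join[OF finite_vertices td(2) diagramsD[OF interlaced_in(2)]])
    show "{Inl 0, Inr 2, Inl 3, Inr 0} \<union> {Inl 1, Inr 3, Inl 2, Inr 1} = vertices 4"
      unfolding vertices_4 by blast
    fix b :: "(nat + nat) set"
    show "b \<subseteq> {Inl 0, Inr 2, Inl 3, Inr 0} \<or> b \<subseteq> {Inl 1, Inr 3, Inl 2, Inr 1}" if "b \<in> ?q"
      using that unfolding p by (elim insertE emptyE) simp_all
    show "b \<subseteq> {Inl 0, Inr 2, Inl 3, Inr 0} \<or> b \<subseteq> {Inl 1, Inr 3, Inl 2, Inr 1}" if "b \<in> interlaced"
      using i[OF that] by (elim disjE) simp_all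
  qed simp_all
qed

text \<open>Replacing a factor by the identity goes down in the order, so both factors are below the
  transposition, which leaves nine pairs. Counting blocks excludes the transposition paired with
  itself or with one block. Saturated pairs are below because the four-cycle has a single
  cycle.\<close>

lemma tensor_below_interlaced:
  assumes p: "p \<in> diagrams 2" and q: "q \<in> diagrams 2"
  shows "geodesic_le 4 (diagram_tensor 2 p q) interlaced \<longleftrightarrow>
    (p, q) \<in> {(id_diagram 2, id_diagram 2), (one_block2, id_diagram 2), (swap2, id_diagram 2),
      (id_diagram 2, one_block2), (id_diagram 2, swap2), (one_block2, one_block2)}"
    (is "_ \<longleftrightarrow> _ \<in> ?T")
proof
  let ?I = "id_diagram 2"
  note I = id_diagram_in_diagrams[of 2]
  note td = tensor2_in_diagrams
  have self: "\<exists>c\<in>r. b \<subseteq> c" if "b \<in> r" for b and r :: diagram using that by blast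
  have semi: "card (join p ?I) + card (join p swap2) \<le> card p + 1" if "p \<in> diagrams 2" for p
    using card_join_join(1,2)[OF finite_vertices diagramsD[OF I] diagramsD[OF that] diagramsD[OF diagrams2(1)]]
    by (simp add: join_id_swap2)
  have js: "card (join swap2 ?I) = 1" "card (join one_block2 ?I) = 1" "card (join swap2 swap2) = 2"
    "card (join one_block2 swap2) = 1"
    using join_id_swap2 join_commute[of swap2 ?I] join_one_block2(2)[OF I] join_self[OF diagrams2(1)]
      join_one_block2(2)[OF diagrams2(1)] by simp_all
  {
    assume le: "geodesic_le 4 (diagram_tensor 2 p q) interlaced"
    have tens: "geodesic_le 4 (diagram_tensor 2 p ?I) (diagram_tensor 2 p q)"
      "geodesic_le 4 (diagram_tensor 2 ?I q) (diagram_tensor 2 p q)"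
      using geodesic_le_tensor_iff[OF p p I q] geodesic_le_tensor_iff[OF I p q q]
        geodesic_le_refl p q id_geodesic_le by auto
    have l: "geodesic_le 4 (diagram_tensor 2 p ?I) interlaced" "geodesic_le 4 (diagram_tensor 2 ?I q) interlaced"
      using geodesic_le_trans[OF td[OF p I] td[OF p q] interlaced_in(2) tens(1) le]
        geodesic_le_trans[OF td[OF I q] td[OF p q] interlaced_in(2) tens(2) le] by auto
    have "card (join (diagram_tensor 2 p ?I) interlaced) \<le> card (join p swap2)"
      by (rule card_join_interlaced_le(1)[OF p I p]) (auto intro: self)
    then have "geodesic_le 2 p swap2"
      using l(1)[unfolded tensor_le_interlaced_iff[OF p I]] semi[OF p] unfolding geodesic_le_iff
      by (simp add: join_id_swap2)
    then have p3: "p \<in> {?I, one_block2, swap2}" using below_swap2_iff[OF p] by simp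
    have "card (join (diagram_tensor 2 ?I q) interlaced) \<le> card (join q swap2)"
      by (rule card_join_interlaced_le(2)[OF I q q]) (auto intro: self)
    then have "geodesic_le 2 q swap2"
      using l(2)[unfolded tensor_le_interlaced_iff[OF I q]] semi[OF q] unfolding geodesic_le_iff
      by (simp add: join_id_swap2)
    then have q3: "q \<in> {?I, one_block2, swap2}" using below_swap2_iff[OF q] by simp
    have "\<not> (p = swap2 \<and> q = one_block2)"
    proof
      assume pq: "p = swap2 \<and> q = one_block2"
      have "card (join (diagram_tensor 2 p q) interlaced) \<le> card (join one_block2 swap2)"
        by (rule card_join_interlaced_le(2)[OF p q diagrams2(2)]) (use pq in \<open>auto intro: self\<close>)
      then show False using le unfolding tensor_le_interlaced_iff[OF p q] using pq js by simp
    qed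
    moreover have "\<not> (p = one_block2 \<and> q = swap2)"
    proof
      assume pq: "p = one_block2 \<and> q = swap2"
      have "card (join (diagram_tensor 2 p q) interlaced) \<le> card (join one_block2 swap2)"
        by (rule card_join_interlaced_le(1)[OF p q diagrams2(2)]) (use pq in \<open>auto intro: self\<close>)
      then show False using le unfolding tensor_le_interlaced_iff[OF p q] using pq js by simp
    qed
    moreover have "\<not> (p = swap2 \<and> q = swap2)"
    proof
      assume pq: "p = swap2 \<and> q = swap2"
      have "card (join (diagram_tensor 2 p q) interlaced) \<le> card (join swap2 swap2)"
        by (rule card_join_interlaced_le(1)[OF p q diagrams2(1)]) (use pq in \<open>auto intro: self\<close>)
      then show False using le unfolding tensor_le_interlaced_iff[OF p q] using pq js by simp
    qed
    ultimately show "(p, q) \<in> ?T" using p3 q3 by auto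
  }
  {
    assume T: "(p, q) \<in> ?T"
    have sat: "geodesic_le 4 (diagram_tensor 2 p q) interlaced"
      if "join p ?I = p" "join q ?I = q"
    proof -
      have "join (diagram_tensor 2 p q) (id_diagram 4) = diagram_tensor 2 p q"
        using join_diagram_tensor[OF p I q I] that id_diagram_add[of 2 2] by simp
      moreover have "refines (vertices 4) (diagram_tensor 2 p q) {vertices 4}"
        using diagramsD[OF td[OF p q]] partition_onD1[OF diagramsD[OF td[OF p q]]] partition_on_space[of "vertices 4"]
        by (auto simp: refines_def vertices_4)
      ultimately show ?thesis
        using saturated_geodesic_le_iff[OF td[OF p q] interlaced_in(2)] by (simp add: join_id_interlaced)
    qed
    have so: "join one_block2 ?I = one_block2" by (simp add: join_one_block2 I)
    consider "p \<in> {?I, one_block2}" "q \<in> {?I, one_block2}" | "p = swap2" "q = ?I" | "p = ?I" "q = swap2"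
      using T by blast
    then show "geodesic_le 4 (diagram_tensor 2 p q) interlaced"
    proof cases
      case 1
      then show ?thesis using sat so by auto
    next
      case 2
      have "card (join (diagram_tensor 2 p q) interlaced) \<le> card (join swap2 swap2)"
        by (rule card_join_interlaced_le(1)[OF p q diagrams2(1)]) (use 2 in \<open>auto intro: self\<close>)
      then show ?thesis
        unfolding tensor_le_interlaced_iff[OF p q]
        using 2 js card_join_interlaced_swap_ge by simp
    next
      case 3
      have "card (join (diagram_tensor 2 p q) interlaced) \<le> card (join swap2 swap2)"
        by (rule card_join_interlaced_le(2)[OF p q diagrams2(1)]) (use 3 in \<open>auto intro: self\<close>)
      then show ?thesis
        unfolding tensor_le_interlaced_iff[OF p q]
        using 3 js card_join_interlaced_swap_ge by simp
    qed
  }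
qed

text \<open>For both notions of freeness the mixed moment along the four-cycle is a sum over pairs of
  diagrams; the sum for the partitions has one more term.\<close>

lemma partition_free_not_perm_free:
  assumes P: "P_tracial_algebra scale mul m"
    and free: "c_free diagrams scale mul m A1 A2"
    and a: "a1 \<in> A1" "a2 \<in> A1" and b: "b1 \<in> A2" "b2 \<in> A2"
    and nz: "cumulant scale m diagrams one_block2 [a1, a2] * cumulant scale m diagrams one_block2 [b1, b2] \<noteq> 0"
  shows "\<not> c_free perm_diagrams scale mul m A1 A2"
proof
  assume sfree: "c_free perm_diagrams scale mul m A1 A2"
  let ?I = "id_diagram 2" and ?as = "[a1, a2]" and ?bs = "[b1, b2]"
  define \<kappa> where "\<kappa> = cumulant scale m diagrams"
  define \<mu> where "\<mu> = cumulant scale m perm_diagrams"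
  have A: "set ?as \<subseteq> generated_algebra scale mul A1" "set ?bs \<subseteq> generated_algebra scale mul A2"
    using a b by (auto simp: generated_algebra_def intro: hull_inc)
  have cum: "is_cumulant_family scale m diagrams \<kappa>" "is_cumulant_family scale m perm_diagrams \<mu>"
    unfolding \<kappa>_def \<mu>_def
    by (rule cumulant_family[OF P], simp) (rule cumulant_family[OF P perm_diagrams_subset])
  have in_perm: "?I \<in> perm_diagrams 2" "swap2 \<in> perm_diagrams 2"
    unfolding perm_diagrams_def swap2_def perm_diagram_id(1)[symmetric]
    using permutes_id[of "{..<2}"] swap2_permutes by blast+
  have not_perm: "one_block2 \<notin> perm_diagrams 2"
  proof
    assume "one_block2 \<in> perm_diagrams 2"
    then obtain i j where "{Inl 0, Inl 1, Inr 0, Inr 1} = {Inl i, Inr j :: nat + nat}"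
      using perm_diagrams_block[of one_block2 2] by (auto simp: one_block2_def)
    then have "Inl 0 \<in> {Inl i, Inr j :: nat + nat}" "Inl 1 \<in> {Inl i, Inr j :: nat + nat}" by blast+
    then show False by simp
  qed
  note d = id_diagram_in_diagrams[of 2] diagrams2
  have id_eq: "m ?I xs = \<kappa> ?I xs" "m ?I xs = \<mu> ?I xs" if "length xs = 2" for xs
  proof -
    have "{p \<in> diagrams 2. geodesic_le 2 p ?I} = {?I}" "{p \<in> perm_diagrams 2. geodesic_le 2 p ?I} = {?I}"
      using below_id_iff d in_perm perm_diagrams_subset[of 2] by auto
    then show "m ?I xs = \<kappa> ?I xs" "m ?I xs = \<mu> ?I xs"
      using moment_cumulant_sum[OF cum(1) d(1) that] moment_cumulant_sum[OF cum(2) in_perm(1) that] by simp_all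
  qed
  \<comment> \<open>Among all partitions the one-block diagram lies between the identity and the
    transposition; the permutation cumulant of the transposition has to absorb its
    contribution.\<close>
  have swap_eq: "\<mu> swap2 xs = \<kappa> one_block2 xs + \<kappa> swap2 xs" if "length xs = 2" for xs
  proof -
    have "{p \<in> diagrams 2. geodesic_le 2 p swap2} = {?I, one_block2, swap2}"
      using below_swap2_iff d by auto
    moreover have "{p \<in> perm_diagrams 2. geodesic_le 2 p swap2} = {?I, swap2}"
      using below_swap2_iff in_perm not_perm perm_diagrams_subset[of 2] by auto
    ultimately have "\<mu> ?I xs + \<mu> swap2 xs = \<kappa> ?I xs + (\<kappa> one_block2 xs + \<kappa> swap2 xs)"
      using moment_cumulant_sum[OF cum(1) d(2) that] moment_cumulant_sum[OF cum(2) in_perm(2) that] distinct2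
      by simp
    then show ?thesis using id_eq[OF that] by simp
  qed
  define T where "T = {(?I, ?I), (one_block2, ?I), (swap2, ?I), (?I, one_block2), (?I, swap2), (one_block2, one_block2)}"
  have T_iff: "geodesic_le 4 (diagram_tensor 2 (fst x) (snd x)) interlaced \<longleftrightarrow> x \<in> T"
    if "x \<in> diagrams 2 \<times> diagrams 2" for x
    using tensor_below_interlaced[of "fst x" "snd x"] that unfolding T_def by (simp add: mem_Times_iff)
  have "T \<subseteq> diagrams 2 \<times> diagrams 2" using d by (simp add: T_def)
  then have T: "{x \<in> diagrams 2 \<times> diagrams 2. geodesic_le 4 (diagram_tensor 2 (fst x) (snd x)) interlaced} = T"
    using T_iff by blast
  have T': "{x \<in> perm_diagrams 2 \<times> perm_diagrams 2. geodesic_le 4 (diagram_tensor 2 (fst x) (snd x)) interlaced} =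
      {(?I, ?I), (swap2, ?I), (?I, swap2)}"
  proof -
    have "{x \<in> perm_diagrams 2 \<times> perm_diagrams 2. geodesic_le 4 (diagram_tensor 2 (fst x) (snd x)) interlaced} =
        T \<inter> perm_diagrams 2 \<times> perm_diagrams 2"
      using T_iff perm_diagrams_subset[of 2] by blast
    also have "\<dots> = {(?I, ?I), (swap2, ?I), (?I, swap2)}"
      using in_perm not_perm by (simp add: T_def Int_insert_left)
    finally show ?thesis .
  qed
  have "m interlaced (?as @ ?bs) = (\<Sum>x\<in>{x \<in> diagrams 2 \<times> diagrams 2.
      geodesic_le (2 + 2) (diagram_tensor 2 (fst x) (snd x)) interlaced}. \<kappa> (fst x) ?as * \<kappa> (snd x) ?bs)"
    unfolding \<kappa>_def
    by (rule c_free_moment[OF cum(1)[unfolded \<kappa>_def] _ _ free _ _ A])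
      (use interlaced_in diagram_tensor_in_diagrams in auto)
  then have 1: "m interlaced (?as @ ?bs) = \<kappa> ?I ?as * \<kappa> ?I ?bs + \<kappa> one_block2 ?as * \<kappa> ?I ?bs + \<kappa> swap2 ?as * \<kappa> ?I ?bs +
      \<kappa> ?I ?as * \<kappa> one_block2 ?bs + \<kappa> ?I ?as * \<kappa> swap2 ?bs + \<kappa> one_block2 ?as * \<kappa> one_block2 ?bs"
    using distinct2 by (simp add: T T_def add.assoc)
  have "m interlaced (?as @ ?bs) = (\<Sum>x\<in>{x \<in> perm_diagrams 2 \<times> perm_diagrams 2.
      geodesic_le (2 + 2) (diagram_tensor 2 (fst x) (snd x)) interlaced}. \<mu> (fst x) ?as * \<mu> (snd x) ?bs)"
    unfolding \<mu>_def
    by (rule c_free_moment[OF cum(2)[unfolded \<mu>_def] perm_diagrams_subset perm_diagrams_tensor_iff sfree _ _ A])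
      (use interlaced_in in auto)
  then have 2: "m interlaced (?as @ ?bs) = \<mu> ?I ?as * \<mu> ?I ?bs + \<mu> swap2 ?as * \<mu> ?I ?bs + \<mu> ?I ?as * \<mu> swap2 ?bs"
    using distinct2 by (simp add: T' add.assoc)
  \<comment> \<open>Through \<open>swap_eq\<close> the terms with an identity factor match in the
    two expansions, and this product alone is left over.\<close>
  have "\<kappa> one_block2 ?as * \<kappa> one_block2 ?bs = 0"
    using 1 2 by (simp add: swap_eq id_eq(1)[symmetric] id_eq(2)[symmetric] algebra_simps)
  then show False using nz by (simp add: \<kappa>_def)
qed


section \<open>Block structure of insertions\<close>

fun block_index :: "nat list \<Rightarrow> nat \<Rightarrow> nat" where
  "block_index [] t = 0"
| "block_index (n # ns) t = (if t < n then 0 else Suc (block_index ns (t - n)))"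

lemma offsets_Cons: "offsets (n # ns) = 0 # map ((+) n) (offsets ns)"
  unfolding offsets_def length_Cons map_upt_Suc by simp

lemma length_offsets [simp]: "length (offsets ns) = length ns"
  by (simp add: offsets_def)

lemma block_index_less: "t < sum_list ns \<Longrightarrow> block_index ns t < length ns"
  by (induction ns t rule: block_index.induct) auto

lemma offsets_less: "0 \<notin> set ns \<Longrightarrow> j < length ns \<Longrightarrow> offsets ns ! j < sum_list ns"
proof (induction ns arbitrary: j)
  case (Cons n ns)
  then show ?case by (cases j) (auto simp: offsets_Cons)
qed simp

lemma block_index_offsets: "0 \<notin> set ns \<Longrightarrow> j < length ns \<Longrightarrow> block_index ns (offsets ns ! j) = j"
proof (induction ns arbitrary: j)
  case (Cons n ns)
  then show ?case by (cases j) (auto simp: offsets_Cons)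
qed simp

lemma block_cycle_less: "t < sum_list ns \<Longrightarrow> block_cycle ns t < sum_list ns"
proof (induction ns t rule: block_cycle.induct)
  case (2 n ns i)
  then show ?case
    by (cases "i < n") (auto intro: less_le_trans[OF mod_less_divisor])
qed simp

lemma block_cycle_ge: "t \<ge> sum_list ns \<Longrightarrow> block_cycle ns t = t"
  by (induction ns t rule: block_cycle.induct) auto

lemma Suc_mod_inject: "i < n \<Longrightarrow> j < n \<Longrightarrow> Suc i mod n = Suc j mod n \<Longrightarrow> i = j"
  by (cases "Suc i = n"; cases "Suc j = n") auto

lemma block_cycle_inject: "block_cycle ns t = block_cycle ns u \<Longrightarrow> t = u"
proof (induction ns arbitrary: t u)
  case (Cons n ns)
  have lt: "Suc i mod n < n" if "i < n" for i using that by (intro mod_less_divisor) simp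
  show ?case
  proof (cases "t < n \<longleftrightarrow> u < n")
    case True
    then show ?thesis
      using Cons.prems Cons.IH[of "t - n" "u - n"] Suc_mod_inject[of t n u] by (cases "t < n") auto
  next
    case False
    then consider "t < n" "\<not> u < n" | "\<not> t < n" "u < n" by blast
    then show ?thesis
    proof cases
      case 1
      then have "Suc t mod n = n + block_cycle ns (u - n)" using Cons.prems by simp
      then show ?thesis using lt[OF 1(1)] by linarith
    next
      case 2
      then have "n + block_cycle ns (t - n) = Suc u mod n" using Cons.prems by simp
      then show ?thesis using lt[OF 2(2)] by linarith
    qed
  qed
qed simp

lemma block_cycle_permutes: "block_cycle ns permutes {..<sum_list ns}"
proof (rule bij_imp_permutes)
  have inj: "inj_on (block_cycle ns) {..<sum_list ns}" using block_cycle_inject by (blast intro: inj_onI)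
  moreover have "block_cycle ns ` {..<sum_list ns} \<subseteq> {..<sum_list ns}" using block_cycle_less by auto
  ultimately show "bij_betw (block_cycle ns) {..<sum_list ns} {..<sum_list ns}"
    using endo_inj_surj[of "{..<sum_list ns}"] by (simp add: bij_betw_def)
qed (simp add: block_cycle_ge)

lemma block_index_cycle: "t < sum_list ns \<Longrightarrow> block_index ns (block_cycle ns t) = block_index ns t"
proof (induction ns t rule: block_cycle.induct)
  case (2 n ns i)
  then show ?case by (cases "i < n") auto
qed simp

text \<open>The form in which positions of a block are linked: walking back along the cycle
  decreases the position until the first one is reached.\<close>

lemma block_predecessor:
  "0 \<notin> set ns \<Longrightarrow> t < sum_list ns \<Longrightarrow> t = offsets ns ! block_index ns t \<or>
    (\<exists>u<t. block_cycle ns u = t \<and> block_index ns u = block_index ns t)"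
proof (induction ns arbitrary: t)
  case (Cons n ns)
  show ?case
  proof (cases "t < n")
    case True
    show ?thesis
    proof (cases t)
      case 0
      then show ?thesis using True by (simp add: offsets_Cons)
    next
      case (Suc u)
      then have "block_cycle (n # ns) u = t \<and> block_index (n # ns) u = block_index (n # ns) t"
        using True by simp
      then show ?thesis using Suc by (intro disjI2 exI[of _ u]) simp
    qed
  next
    case False
    then have "t - n < sum_list ns" using Cons.prems by auto
    then consider "t - n = offsets ns ! block_index ns (t - n)"
      | u where "u < t - n" "block_cycle ns u = t - n" "block_index ns u = block_index ns (t - n)"
      using Cons.IH[of "t - n"] Cons.prems by auto
    then show ?thesis
    proof cases
      case 1
      then show ?thesis
        using False block_index_less[OF \<open>t - n < sum_list ns\<close>] by (simp add: offsets_Cons)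
    next
      case 2
      then show ?thesis using False by (intro disjI2 exI[of _ "n + u"]) simp
    qed
  qed
qed simp

lemma insertion_in_diagrams:
  assumes p: "p \<in> diagrams (length ns)" and pos: "0 \<notin> set ns"
  shows "insertion (sum_list ns) (offsets ns) p \<in> diagrams (sum_list ns)"
proof -
  let ?n = "sum_list ns" and ?o = "(!) (offsets ns)" and ?k = "length ns"
  let ?f = "map_sum ?o ?o"
  let ?R = "{i. i < ?n \<and> i \<notin> set (offsets ns)}"
  have inj: "inj_on ?o {..<?k}"
    by (rule inj_on_inverseI[of _ "block_index ns"]) (simp add: block_index_offsets[OF pos])
  have injf: "inj_on ?f (vertices ?k)"
  proof (rule inj_onI)
    fix u v assume "u \<in> vertices ?k" "v \<in> vertices ?k" "?f u = ?f v"
    then show "u = v" using inj by (cases u; cases v) (auto simp: inj_on_def)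
  qed
  have set_o: "set (offsets ns) = ?o ` {..<?k}" by (auto simp: set_conv_nth)
  have fV: "?f ` vertices ?k = set (offsets ns) <+> set (offsets ns)"
    unfolding set_o vertices_def by (simp add: Plus_def image_Un image_image)
  have rest: "partition_on (?R <+> ?R) {{Inl i, Inr i} |i. i < ?n \<and> i \<notin> set (offsets ns)}"
    by (rule partition_onI) (auto simp: disjnt_def)
  have disj: "(set (offsets ns) <+> set (offsets ns)) \<inter> (?R <+> ?R) = {}" by auto
  have "set (offsets ns) \<subseteq> {..<?n}" using offsets_less[OF pos] unfolding set_o by auto
  then have "(set (offsets ns) <+> set (offsets ns)) \<union> (?R <+> ?R) = vertices ?n"
    by (auto simp: vertices_def)
  then show ?thesis
    using partition_on_Un[OF partition_on_image_inj[OF diagramsD[OF p] injf, unfolded fV] rest disj]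
    by (simp add: insertion_def diagrams_def)
qed

text \<open>After composition with the block cycle, the inserted blocks link each position to its
  predecessor, so all positions of a block lie in one cycle. Contracting them along
  \<open>block_index\<close> gives back the cycles of \<open>p\<close>.\<close>

lemma cycles_insertion:
  assumes p: "p \<in> diagrams (length ns)" and pos: "0 \<notin> set ns"
  defines "n \<equiv> sum_list ns" and "g \<equiv> map_sum (block_index ns) (block_index ns)"
  shows "cycles n (diagram_comp (insertion n (offsets ns) p) (perm_diagram n (block_cycle ns))) =
    (\<lambda>c. vertices n \<inter> g -` c) ` cycles (length ns) p"
proof -
  let ?k = "length ns" and ?bc = "block_cycle ns" and ?h = "block_index ns" and ?o = "offsets ns"
  let ?ins = "insertion n ?o p"
  let ?f = "map_sum (inv ?bc) id"
  let ?q = "(`) ?f ` ?ins"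
  have bc: "?bc permutes {..<n}" unfolding n_def by (rule block_cycle_permutes)
  have ins: "?ins \<in> diagrams n" unfolding n_def by (rule insertion_in_diagrams[OF p pos])
  have q_eq: "diagram_comp ?ins (perm_diagram n ?bc) = ?q"
    by (rule diagram_comp_perm_right[OF ins bc])
  have qd: "?q \<in> diagrams n" using relabel_in_diagrams[OF ins permutes_inv[OF bc] permutes_id] by simp
  have invlt: "inv ?bc t < n \<longleftrightarrow> t < n" for t using permutes_in_image[OF permutes_inv[OF bc], of t] by simp
  have hinv: "?h (inv ?bc t) = ?h t" if "t < n" for t
    using block_index_cycle[of "inv ?bc t" ns] invlt[of t] that permutes_inverses(1)[OF bc] by (simp add: n_def)
  have cpart: "partition_on (vertices ?k) (cycles ?k p)"
    unfolding cycles_def by (rule partition_on_join[OF diagramsD[OF p] partition_on_id_diagram])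
  have cref: "refines (vertices ?k) p (cycles ?k p)" "refines (vertices ?k) (id_diagram ?k) (cycles ?k p)"
    unfolding cycles_def using join_is_finest(1,2)[OF diagramsD[OF p] partition_on_id_diagram] by auto
  have ht: "?h t < ?k" if "t < n" for t using block_index_less that by (simp add: n_def)
  have ot: "?o ! j < n" "?h (?o ! j) = j" if "j < ?k" for j
    using offsets_less[OF pos that] block_index_offsets[OF pos that] by (simp_all add: n_def)
  have gV: "g ` vertices n = vertices ?k"
  proof (intro equalityI subsetI)
    fix v assume "v \<in> g ` vertices n"
    then obtain u where "u \<in> vertices n" "v = g u" by blast
    then show "v \<in> vertices ?k" using ht by (cases u) (auto simp: g_def)
  next
    fix v assume v: "v \<in> vertices ?k"
    have "g (map_sum ((!) ?o) ((!) ?o) v) = v" "map_sum ((!) ?o) ((!) ?o) v \<in> vertices n"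
      using v ot by (cases v; simp add: g_def)+
    then show "v \<in> g ` vertices n" by (metis imageI)
  qed
  let ?F = "?q \<union> id_diagram n"
  have UF: "\<Union>?F = vertices n"
    using partition_onD1[OF diagramsD[OF qd]] partition_onD1[OF partition_on_id_diagram[of n]] by simp
  have idc: "\<exists>c\<in>cycles ?k p. {Inl j, Inr j} \<subseteq> c" if "j < ?k" for j
    using refinesE[OF cref(2), of "{Inl j, Inr j}"] that by (auto simp: id_diagram_def)
  have "merge ?F = (\<lambda>c. vertices n \<inter> g -` c) ` cycles ?k p"
  proof (rule merge_eq_pullback[OF cpart gV UF])
    fix b assume "b \<in> ?F"
    then consider (a) d where "d \<in> p" "b = ?f ` map_sum ((!) ?o) ((!) ?o) ` d"
      | (b) i where "i < n" "b = {Inl (inv ?bc i), Inr i}" | (c) i where "i < n" "b = {Inl i, Inr i}"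
      unfolding insertion_def id_diagram_def by auto
    then show "\<exists>c\<in>cycles ?k p. g ` b \<subseteq> c"
    proof cases
      case a
      have "g ` b = d"
      proof -
        have "g (?f (map_sum ((!) ?o) ((!) ?o) v)) = v" if "v \<in> d" for v
        proof -
          have "v \<in> vertices ?k" using a(1) that partition_onD1[OF diagramsD[OF p]] by blast
          then show ?thesis using ot hinv by (cases v) (simp_all add: g_def)
        qed
        then show ?thesis unfolding a(2) by (simp add: image_image)
      qed
      then show ?thesis using refinesE[OF cref(1) a(1)] by metis
    next
      case b
      then show ?thesis using idc[OF ht[OF b(1)]] hinv[OF b(1)] by (simp add: g_def)
    next
      case c
      then show ?thesis using idc[OF ht[OF c(1)]] by (simp add: g_def)
    qed
  next
    fix c assume c: "c \<in> cycles ?k p"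
    have idF: "Inl t \<in> d \<longleftrightarrow> Inr t \<in> d" if "d \<in> merge ?F" "t < n" for d t
    proof -
      have "{Inl t, Inr t} \<in> ?F" using that(2) by (simp add: id_diagram_def)
      then show ?thesis using merge_absorbs[OF that(1), of "{Inl t, Inr t}"] by blast
    qed
    \<comment> \<open>Well-founded induction back to the first position of the block, through one
      inserted block at each step.\<close>
    have base: "Inl t \<in> d \<longleftrightarrow> Inl (?o ! ?h t) \<in> d" if d: "d \<in> merge ?F" and t: "t < n" for d t
      using t
    proof (induction t rule: less_induct)
      case (less t)
      show ?case
      proof (cases "t = ?o ! ?h t")
        case False
        then obtain u where u: "u < t" "?bc u = t" "?h u = ?h t"
          using block_predecessor[OF pos, of t] less.prems by (auto simp: n_def)
        have "t \<notin> set ?o"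
        proof
          assume "t \<in> set ?o"
          then obtain j where "j < ?k" "t = ?o ! j" by (auto simp: set_conv_nth)
          then show False using ot(2) False by simp
        qed
        then have "{Inl t, Inr t} \<in> ?ins" using less.prems by (auto simp: insertion_def)
        then have "?f ` {Inl t, Inr t} \<in> ?F" by blast
        moreover have "inv ?bc t = u" using permutes_inv_eq[OF bc] u(2) by simp
        ultimately have "{Inl u, Inr t} \<in> ?F" by simp
        then have "Inl u \<in> d \<longleftrightarrow> Inr t \<in> d" using merge_absorbs[OF d, of "{Inl u, Inr t}"] by blast
        then show ?thesis using less.IH[OF u(1)] u less.prems idF[OF d] by simp
      qed simp
    qed
    obtain x where x: "x \<in> c" using c partition_onD3[OF cpart] by fastforce
    then have "x \<in> vertices ?k" using c partition_onD1[OF cpart] by blast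
    then obtain j where j: "j < ?k" "x = Inl j \<or> x = Inr j" by (cases x) auto
    have "Inl (?o ! j) \<in> \<Union>?F" unfolding UF using ot(1)[OF j(1)] by simp
    then obtain d where d: "d \<in> merge ?F" "Inl (?o ! j) \<in> d" by (rule merge_obtain_block)
    \<comment> \<open>A vertex of \<open>p\<close> is represented by the first position of its block
      of letters; \<open>P\<close> says that this position lies in \<open>d\<close>.\<close>
    define P where "P v \<longleftrightarrow> (Inl (?o ! case_sum id id v)) \<in> d" for v :: "nat + nat"
    have "P y" if y: "y \<in> c" for y
      using c[unfolded cycles_def join_def] x y
    proof (rule merge_block_induct)
      show "P x" using d(2) j(2) by (auto simp: P_def)
      fix b u v assume b: "b \<in> p \<union> id_diagram ?k" "u \<in> b" "v \<in> b" "P u"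
      have uv: "u \<in> vertices ?k" "v \<in> vertices ?k"
        using b partition_onD1[OF diagramsD[OF p]] partition_onD1[OF partition_on_id_diagram[of ?k]] by blast+
      show "P v"
      proof (cases "b \<in> p")
        case True
        let ?b = "?f ` map_sum ((!) ?o) ((!) ?o) ` b"
        have bF: "?b \<in> ?F" using True by (auto simp: insertion_def)
        have key: "?f (map_sum ((!) ?o) ((!) ?o) w) \<in> d \<longleftrightarrow> P w" if w: "w \<in> vertices ?k" for w
        proof (cases w)
          case (Inl i)
          then have "i < ?k" using w by simp
          then have "inv ?bc (?o ! i) < n" "?h (inv ?bc (?o ! i)) = i" using ot hinv invlt by simp_all
          then show ?thesis using base[OF d(1), of "inv ?bc (?o ! i)"] Inl by (simp add: P_def)
        next
          case (Inr i)
          then have "?o ! i < n" using w ot(1) by simp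
          then show ?thesis using idF[OF d(1)] Inr by (simp add: P_def)
        qed
        have "?b \<subseteq> d"
          by (rule merge_absorbs[OF d(1) bF, of "?f (map_sum ((!) ?o) ((!) ?o) u)"])
            (use b(2,4) key[OF uv(1)] in auto)
        then have "?f (map_sum ((!) ?o) ((!) ?o) v) \<in> d" using b(3) by blast
        then show ?thesis using key[OF uv(2)] by simp
      next
        case False
        then obtain i where "b = {Inl i, Inr i}" using b(1) by (auto simp: id_diagram_def)
        then show ?thesis using b(2-4) by (auto simp: P_def)
      qed
    qed
    moreover have "v \<in> d" if v: "v \<in> vertices n" "P (g v)" for v
    proof (cases v)
      case (Inl t)
      then show ?thesis using v base[OF d(1), of t] by (simp add: P_def g_def)
    next
      case (Inr t)
      then show ?thesis using v base[OF d(1), of t] idF[OF d(1), of t] by (simp add: P_def g_def)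
    qed
    ultimately show "\<exists>d\<in>merge ?F. vertices n \<inter> g -` c \<subseteq> d" using d(1) by blast
  qed
  then show ?thesis unfolding q_eq cycles_def[of n] join_def .
qed


section \<open>The algebra of functions on the natural numbers\<close>

definition fscale :: "complex \<Rightarrow> (nat \<Rightarrow> complex) \<Rightarrow> nat \<Rightarrow> complex" where
  "fscale c f = (\<lambda>\<omega>. c * f \<omega>)"

definition fmul :: "(nat \<Rightarrow> complex) \<Rightarrow> (nat \<Rightarrow> complex) \<Rightarrow> nat \<Rightarrow> complex" where
  "fmul f g = (\<lambda>\<omega>. f \<omega> * g \<omega>)"

lemma fscale_vector_space: "vector_space fscale"
  by unfold_locales (auto simp: fscale_def fun_eq_iff algebra_simps)

lemma fmul_complex_algebra: "complex_algebra fscale fmul"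
  by (intro complex_algebra.intro complex_algebra_axioms.intro fscale_vector_space)
    (auto simp: fscale_def fmul_def fun_eq_iff algebra_simps)

lemma linear_fscaleI:
  assumes "\<And>f g. F (\<lambda>\<omega>. f \<omega> + g \<omega>) = F f + F g" "\<And>c f. F (fscale c f) = c * F f"
  shows "Vector_Spaces.linear fscale (*) F"
  unfolding Vector_Spaces.linear_iff
  using fscale_vector_space vector_space_complex assms by (auto simp: plus_fun_def)

lemma list_mult_fmul:
  "xs \<noteq> [] \<Longrightarrow> list_mult fmul xs \<omega> = prod_list (map (\<lambda>x. x \<omega>) xs)"
  by (induction xs rule: induct_list012) (auto simp: fmul_def)

subsection \<open>Commuting random variables\<close>

definition mean :: "(nat \<Rightarrow> complex) \<Rightarrow> complex" where
  "mean f = (f 0 + f 1 + f 2 + f 3) / 4"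

text \<open>A cycle contains the top vertex of a position exactly if it contains the bottom one, so
  counting top vertices counts each letter once.\<close>

definition letter_product :: "(nat \<Rightarrow> complex) list \<Rightarrow> (nat + nat) set \<Rightarrow> nat \<Rightarrow> complex" where
  "letter_product as c \<omega> = (\<Prod>j | j < length as \<and> Inl j \<in> c. (as ! j) \<omega>)"

text \<open>These are the limits of the normalised moments of random diagonal matrices.\<close>

definition diag_moment :: "diagram \<Rightarrow> (nat \<Rightarrow> complex) list \<Rightarrow> complex" where
  "diag_moment p as = (\<Prod>c\<in>cycles (length as) p. mean (letter_product as c))"

lemma letter_product_update:
  assumes "i < length as"
  shows "letter_product (as[i := x]) c =
    (if Inl i \<in> c then fmul x (\<lambda>\<omega>. \<Prod>j | j < length as \<and> j \<noteq> i \<and> Inl j \<in> c. (as ! j) \<omega>)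
     else letter_product as c)"
proof (cases "Inl i \<in> c")
  case True
  have "{j. j < length as \<and> Inl j \<in> c} = insert i {j. j < length as \<and> j \<noteq> i \<and> Inl j \<in> c}"
    using True assms by auto
  moreover have "(\<Prod>j | j < length as \<and> j \<noteq> i \<and> Inl j \<in> c. (as[i := x] ! j) \<omega>) =
      (\<Prod>j | j < length as \<and> j \<noteq> i \<and> Inl j \<in> c. (as ! j) \<omega>)" for \<omega>
    by (rule prod.cong) auto
  ultimately show ?thesis
    using True assms by (auto simp: letter_product_def fmul_def fun_eq_iff)
next
  case False
  have "letter_product (as[i := x]) c \<omega> = letter_product as c \<omega>" for \<omega>
    unfolding letter_product_def
  proof (rule prod.cong)
    fix j assume "j \<in> {j. j < length as \<and> Inl j \<in> c}"
    then have "i \<noteq> j" using False by auto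
    then show "(as[i := x] ! j) \<omega> = (as ! j) \<omega>" by simp
  qed simp
  then show ?thesis using False by auto
qed

lemma cycles_in_diagrams: "p \<in> diagrams k \<Longrightarrow> cycles k p \<in> diagrams k"
  unfolding cycles_def by (rule join_in_diagrams[OF _ id_diagram_in_diagrams])

lemma cycles_tensor:
  assumes "p \<in> diagrams k" "q \<in> diagrams l"
  shows "cycles (k + l) (diagram_tensor k p q) = diagram_tensor k (cycles k p) (cycles l q)"
  unfolding cycles_def id_diagram_add
  by (rule join_diagram_tensor[OF assms(1) id_diagram_in_diagrams assms(2) id_diagram_in_diagrams])

lemma diag_moment_multilinear:
  assumes p: "p \<in> diagrams k"
  shows "multilinear_form fscale k (diag_moment p)"
  unfolding multilinear_form_def
proof (intro allI impI, elim conjE)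
  fix as :: "(nat \<Rightarrow> complex) list" and i
  assume len: "length as = k" and i: "i < k"
  let ?C = "cycles k p"
  note cd = cycles_in_diagrams[OF p]
  have "Inl i \<in> \<Union>?C" using i partition_onD1[OF diagramsD[OF cd]] vertices_iff(1)[of i k] by simp
  then obtain c where c: "c \<in> ?C" "Inl i \<in> c" by blast
  define r where "r = (\<lambda>\<omega>. \<Prod>j | j < length as \<and> j \<noteq> i \<and> Inl j \<in> c. (as ! j) \<omega>)"
  \<comment> \<open>Only the cycle \<open>c\<close> contains position \<open>i\<close>; the others
    contribute the constant factor \<open>R\<close>.\<close>
  define R where "R = (\<Prod>d\<in>?C - {c}. mean (letter_product as d))"
  have "diag_moment p (as[i := x]) = mean (fmul x r) * R" for x
  proof -
    have "diag_moment p (as[i := x]) = mean (letter_product (as[i := x]) c) *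
        (\<Prod>d\<in>?C - {c}. mean (letter_product (as[i := x]) d))"
      unfolding diag_moment_def using prod.remove[OF finite_diagram[OF cd] c(1)] by (simp add: len)
    also have "(\<Prod>d\<in>?C - {c}. mean (letter_product (as[i := x]) d)) = R"
      unfolding R_def
    proof (rule prod.cong[OF refl])
      fix d assume d: "d \<in> ?C - {c}"
      then have "Inl i \<notin> d" using partition_on_block_eq[OF diagramsD[OF cd] c(1), of d "Inl i"] c(2) by blast
      then show "mean (letter_product (as[i := x]) d) = mean (letter_product as d)"
        using letter_product_update[of i as x d] i len by simp
    qed
    also have "letter_product (as[i := x]) c = fmul x r"
      using letter_product_update[of i as x c] i len c(2) by (simp add: r_def)
    finally show ?thesis .
  qed
  then show "Vector_Spaces.linear fscale (*) (\<lambda>x. diag_moment p (as[i := x]))"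
    by (intro linear_fscaleI) (simp_all add: mean_def fmul_def fscale_def algebra_simps add_divide_distrib)
qed

lemma diag_moment_perm:
  assumes p: "p \<in> diagrams k" and len: "length as = k" and \<sigma>: "\<sigma> permutes {..<k}"
  shows "diag_moment p as =
    diag_moment (diagram_comp (perm_diagram k \<sigma>) (diagram_comp p (perm_diagram k (inv \<sigma>))))
      (map (\<lambda>i. as ! inv \<sigma> i) [0..<k])"
proof -
  let ?f = "map_sum \<sigma> \<sigma>" and ?as = "map (\<lambda>i. as ! inv \<sigma> i) [0..<k]"
  have inj: "inj ?f" using sum.inj_map permutes_inj[OF \<sigma>] by blast
  have lt: "\<sigma> j < k \<longleftrightarrow> j < k" for j using permutes_in_image[OF \<sigma>, of j] by simp
  have id: "(`) ?f ` id_diagram k = id_diagram k"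
  proof -
    have "(`) ?f ` id_diagram k = (\<lambda>i. {Inl i, Inr i}) ` \<sigma> ` {..<k}" by (simp add: id_diagram_def image_image)
    then show ?thesis unfolding permutes_image[OF \<sigma>] by (simp add: id_diagram_def)
  qed
  have "cycles k ((`) ?f ` p) = (`) ?f ` cycles k p"
    unfolding cycles_def
    using join_image[OF inj_on_subset[OF inj subset_UNIV] diagramsD[OF p] partition_on_id_diagram] id by simp
  then have "diag_moment ((`) ?f ` p) ?as = (\<Prod>c\<in>(`) ?f ` cycles k p. mean (letter_product ?as c))"
    by (simp add: diag_moment_def)
  also have "\<dots> = (\<Prod>c\<in>cycles k p. mean (letter_product ?as (?f ` c)))"
    by (subst prod.reindex) (auto simp: inj_on_def inj_image_eq_iff[OF inj])
  also have "\<dots> = diag_moment p as"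
    unfolding diag_moment_def len
  proof (rule prod.cong[OF refl])
    fix c
    have "letter_product ?as (?f ` c) \<omega> = letter_product as c \<omega>" for \<omega>
    proof -
      have mem: "Inl (\<sigma> j) \<in> ?f ` c \<longleftrightarrow> Inl j \<in> c" for j
        using inj_image_mem_iff[OF inj, of "Inl j" c] by simp
      have "{j. j < k \<and> Inl j \<in> ?f ` c} = \<sigma> ` {j. j < k \<and> Inl j \<in> c}"
      proof (intro equalityI subsetI)
        fix j assume j: "j \<in> {j. j < k \<and> Inl j \<in> ?f ` c}"
        have "\<sigma> (inv \<sigma> j) = j" using permutes_inverses(1)[OF \<sigma>] .
        then have "inv \<sigma> j \<in> {j. j < k \<and> Inl j \<in> c}" using j lt[of "inv \<sigma> j"] mem[of "inv \<sigma> j"] by simp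
        then show "j \<in> \<sigma> ` {j. j < k \<and> Inl j \<in> c}" using \<open>\<sigma> (inv \<sigma> j) = j\<close> by (metis imageI)
      qed (use lt mem in auto)
      then have "letter_product ?as (?f ` c) \<omega> = (\<Prod>j\<in>\<sigma> ` {j. j < k \<and> Inl j \<in> c}. (?as ! j) \<omega>)"
        by (simp add: letter_product_def)
      also have "\<dots> = (\<Prod>j | j < k \<and> Inl j \<in> c. (?as ! \<sigma> j) \<omega>)"
        by (subst prod.reindex) (use permutes_inj[OF \<sigma>] in \<open>auto intro: inj_on_subset\<close>)
      also have "\<dots> = letter_product as c \<omega>"
        unfolding letter_product_def len
        by (rule prod.cong) (use lt permutes_inverses(2)[OF \<sigma>] in auto)
      finally show ?thesis .
    qed
    then show "mean (letter_product ?as (?f ` c)) = mean (letter_product as c)" by (simp add: mean_def)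
  qed
  finally show ?thesis unfolding diagram_conj_perm[OF p \<sigma>] by simp
qed

lemma prod_lessThan_add:
  "(\<Prod>t<m + n. f t) = (\<Prod>t<m. f t) * (\<Prod>t<n. f (m + t))" for f :: "nat \<Rightarrow> complex"
  by (induction n) (simp_all add: algebra_simps)

lemma prod_concat_blocks:
  fixes f :: "'a \<Rightarrow> complex"
  shows "(\<Prod>t<sum_list (map length ass). if P (block_index (map length ass) t) then f (concat ass ! t) else 1) =
    (\<Prod>j<length ass. if P j then prod_list (map f (ass ! j)) else 1)"
proof (induction ass arbitrary: P)
  case (Cons xs ass)
  let ?ns = "map length ass"
  define g where "g t = (if P (block_index (map length (xs # ass)) t) then f (concat (xs # ass) ! t) else 1)" for t
  have gl: "g t = (if P 0 then f (xs ! t) else 1)" if "t < length xs" for t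
    using that by (simp add: g_def nth_append)
  have gr: "g (length xs + t) = (if P (Suc (block_index ?ns t)) then f (concat ass ! t) else 1)" for t
    by (simp add: g_def nth_append)
  have "(\<Prod>t<length xs + sum_list ?ns. g t) = (\<Prod>t<length xs. g t) * (\<Prod>t<sum_list ?ns. g (length xs + t))"
    by (rule prod_lessThan_add)
  moreover have "(\<Prod>t<length xs. g t) = (if P 0 then prod_list (map f xs) else 1)"
    using gl by (simp add: prod.list_conv_set_nth atLeast0LessThan)
  moreover have "(\<Prod>t<sum_list ?ns. g (length xs + t)) =
      (\<Prod>j<length ass. if P (Suc j) then prod_list (map f (ass ! j)) else 1)"
    unfolding gr by (rule Cons.IH[of "\<lambda>j. P (Suc j)"])
  ultimately have "(\<Prod>t<length xs + sum_list ?ns. g t) = (if P 0 then prod_list (map f xs) else 1) *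
      (\<Prod>j<length ass. if P (Suc j) then prod_list (map f (ass ! j)) else 1)" by simp
  also have "\<dots> = (\<Prod>j<length (xs # ass). if P j then prod_list (map f ((xs # ass) ! j)) else 1)"
    unfolding length_Cons prod.lessThan_Suc_shift by (simp cong: if_cong)
  finally show ?case unfolding g_def by simp
qed simp

text \<open>By \<open>cycles_insertion\<close> the cycles of the enlarged diagram are the preimages
  of those of \<open>p\<close>, and as the letters commute they may be regrouped by blocks.\<close>

lemma diag_moment_product:
  assumes p: "p \<in> diagrams k" and len: "length ass = k" and ne: "\<forall>xs\<in>set ass. xs \<noteq> []"
    and ns: "ns = map length ass" and n: "n = sum_list ns"
  shows "diag_moment p (map (list_mult fmul) ass) =
    diag_moment (diagram_comp (insertion n (offsets ns) p) (perm_diagram n (block_cycle ns))) (concat ass)"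
proof -
  let ?g = "map_sum (block_index ns) (block_index ns)"
  have p': "p \<in> diagrams (length ns)" and pos: "0 \<notin> set ns" using p len ne by (auto simp: ns)
  have cd: "cycles k p \<in> diagrams k" by (rule cycles_in_diagrams[OF p])
  have lc: "length (concat ass) = n" by (simp add: n ns length_concat)
  have kn: "k = length ns" using len by (simp add: ns)
  have inj: "inj_on (\<lambda>c. vertices n \<inter> ?g -` c) (cycles k p)"
  proof (rule inj_on_inverseI[of _ "\<lambda>b. ?g ` b"])
    fix c assume c: "c \<in> cycles k p"
    have "v \<in> ?g ` (vertices n \<inter> ?g -` c)" if v: "v \<in> c" for v
    proof -
      have "v \<in> vertices k" using c v partition_onD1[OF diagramsD[OF cd]] by blast
      then have "?g (map_sum ((!) (offsets ns)) ((!) (offsets ns)) v) = v"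
        "map_sum ((!) (offsets ns)) ((!) (offsets ns)) v \<in> vertices n"
        using block_index_offsets[OF pos] offsets_less[OF pos] by (cases v; simp add: n kn)+
      then show ?thesis using v by (metis (no_types, lifting) IntI imageI vimageI)
    qed
    then show "?g ` (vertices n \<inter> ?g -` c) = c" by blast
  qed
  have "diag_moment (diagram_comp (insertion n (offsets ns) p) (perm_diagram n (block_cycle ns))) (concat ass) =
      (\<Prod>c\<in>(\<lambda>c. vertices n \<inter> ?g -` c) ` cycles k p. mean (letter_product (concat ass) c))"
    using cycles_insertion[OF p' pos] by (simp add: diag_moment_def lc n kn)
  also have "\<dots> = (\<Prod>c\<in>cycles k p. mean (letter_product (concat ass) (vertices n \<inter> ?g -` c)))"
    by (subst prod.reindex[OF inj]) simp
  also have "\<dots> = diag_moment p (map (list_mult fmul) ass)"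
    unfolding diag_moment_def length_map len
  proof (rule prod.cong[OF refl])
    fix c
    have "letter_product (concat ass) (vertices n \<inter> ?g -` c) \<omega> = letter_product (map (list_mult fmul) ass) c \<omega>" for \<omega>
    proof -
      have "letter_product (concat ass) (vertices n \<inter> ?g -` c) \<omega> =
          (\<Prod>t\<in>{t \<in> {..<n}. Inl (block_index ns t) \<in> c}. (concat ass ! t) \<omega>)"
        unfolding letter_product_def lc by (rule prod.cong) auto
      also have "\<dots> = (\<Prod>t<n. if Inl (block_index ns t) \<in> c then (concat ass ! t) \<omega> else 1)"
        by (rule prod.inter_filter) simp
      also have "\<dots> = (\<Prod>j<k. if Inl j \<in> c then prod_list (map (\<lambda>x. x \<omega>) (ass ! j)) else 1)"
        using prod_concat_blocks[of "\<lambda>j. Inl j \<in> c" ass "\<lambda>x. x \<omega>"] by (simp add: n ns len)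
      also have "\<dots> = (\<Prod>j\<in>{j \<in> {..<k}. Inl j \<in> c}. prod_list (map (\<lambda>x. x \<omega>) (ass ! j)))"
        by (rule prod.inter_filter[symmetric]) simp
      also have "\<dots> = letter_product (map (list_mult fmul) ass) c \<omega>"
        unfolding letter_product_def
        by (rule prod.cong) (use len ne in \<open>auto simp: list_mult_fmul\<close>)
      finally show ?thesis .
    qed
    then show "mean (letter_product (concat ass) (vertices n \<inter> ?g -` c)) =
        mean (letter_product (map (list_mult fmul) ass) c)" by (simp add: mean_def)
  qed
  finally show ?thesis ..
qed

lemma diag_moment_tracial: "P_tracial_algebra fscale fmul diag_moment"
proof (intro P_tracial_algebra.intro P_tracial_algebra_axioms.intro fmul_complex_algebra)
  show "diag_moment {} [] = 1"
    by (simp add: diag_moment_def cycles_def join_def merge_def id_diagram_def)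
qed (fact diag_moment_multilinear diag_moment_perm diag_moment_product)+

lemma diag_moment_tensor:
  assumes p: "p \<in> diagrams k" and q: "q \<in> diagrams l" and len: "length as = k" "length bs = l"
  shows "diag_moment (diagram_tensor k p q) (as @ bs) = diag_moment p as * diag_moment q bs"
proof -
  note cd = cycles_in_diagrams[OF p] cycles_in_diagrams[OF q]
  have disj: "cycles k p \<inter> (`) (shift k) ` cycles l q = {}"
  proof (rule equals0I)
    fix b assume b: "b \<in> cycles k p \<inter> (`) (shift k) ` cycles l q"
    then have "b \<subseteq> \<Union>(cycles k p) \<inter> \<Union>((`) (shift k) ` cycles l q)" by blast
    then show False using diagram_tensor_disjoint[OF cd] partition_onD3[OF diagramsD[OF cd(1)]] b by simp
  qed
  have "diag_moment (diagram_tensor k p q) (as @ bs) =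
      (\<Prod>c\<in>cycles k p \<union> (`) (shift k) ` cycles l q. mean (letter_product (as @ bs) c))"
    unfolding diag_moment_def length_append len cycles_tensor[OF p q] by (simp add: diagram_tensor_alt)
  also have "\<dots> = (\<Prod>c\<in>cycles k p. mean (letter_product (as @ bs) c)) *
      (\<Prod>c\<in>cycles l q. mean (letter_product (as @ bs) (shift k ` c)))"
    using finite_diagram[OF cd(1)] finite_diagram[OF cd(2)] disj
    by (simp add: prod.union_disjoint prod.reindex inj_on_def inj_image_eq_iff[OF inj_shift])
  also have "(\<Prod>c\<in>cycles k p. mean (letter_product (as @ bs) c)) = diag_moment p as"
    unfolding diag_moment_def len
  proof (rule prod.cong[OF refl])
    fix c assume c: "c \<in> cycles k p"
    have "j < k" if "Inl j \<in> c" for j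
      using that c partition_onD1[OF diagramsD[OF cd(1)]] vertices_iff(1)[of j k] by blast
    then have "{j. j < length (as @ bs) \<and> Inl j \<in> c} = {j. j < length as \<and> Inl j \<in> c}"
      using len by fastforce
    then have "letter_product (as @ bs) c \<omega> = letter_product as c \<omega>" for \<omega>
      unfolding letter_product_def by (intro prod.cong) (auto simp: nth_append)
    then show "mean (letter_product (as @ bs) c) = mean (letter_product as c)" by (simp add: mean_def)
  qed
  also have "(\<Prod>c\<in>cycles l q. mean (letter_product (as @ bs) (shift k ` c))) = diag_moment q bs"
    unfolding diag_moment_def len
  proof (rule prod.cong[OF refl])
    fix c
    have sh: "Inl i \<in> shift k ` c \<longleftrightarrow> (\<exists>j. i = k + j \<and> Inl j \<in> c)" for i
    proof
      assume "Inl i \<in> shift k ` c"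
      then obtain v where "v \<in> c" "Inl i = shift k v" by blast
      then show "\<exists>j. i = k + j \<and> Inl j \<in> c" by (cases v) auto
    qed (auto intro: image_eqI[of _ _ "Inl _"])
    have "{j. j < length (as @ bs) \<and> Inl j \<in> shift k ` c} = (+) k ` {j. j < length bs \<and> Inl j \<in> c}"
      using len by (auto simp: sh)
    then have "letter_product (as @ bs) (shift k ` c) \<omega> = letter_product bs c \<omega>" for \<omega>
      unfolding letter_product_def by (simp add: prod.reindex nth_append len)
    then show "mean (letter_product (as @ bs) (shift k ` c)) = mean (letter_product bs c)" by (simp add: mean_def)
  qed
  finally show ?thesis .
qed

text \<open>Under the uniform measure on \<open>{0, 1, 2, 3}\<close> these are independent signs.\<close>

definition sign1 :: "nat \<Rightarrow> complex" where
  "sign1 \<omega> = (if \<omega> = 0 \<or> \<omega> = 1 then 1 else -1)"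

definition sign2 :: "nat \<Rightarrow> complex" where
  "sign2 \<omega> = (if \<omega> = 0 \<or> \<omega> = 2 then 1 else -1)"

text \<open>The right-hand sides define the algebras of functions of the first and of the second
  sign on the four points.\<close>

lemma generated_sign1: "f \<in> generated_algebra fscale fmul {sign1} \<Longrightarrow> f 0 = f 1 \<and> f 2 = f 3"
  and generated_sign2: "f \<in> generated_algebra fscale fmul {sign2} \<Longrightarrow> f 0 = f 2 \<and> f 1 = f 3"
proof -
  interpret vector_space fscale by (rule fscale_vector_space)
  have "subalgebra fscale fmul {f. f 0 = f 1 \<and> f 2 = f 3}" "subalgebra fscale fmul {f. f 0 = f 2 \<and> f 1 = f 3}"
    by (auto simp: subalgebra_def subspace_def fscale_def fmul_def)
  moreover have "{sign1} \<subseteq> {f. f 0 = f 1 \<and> f 2 = f 3}" "{sign2} \<subseteq> {f. f 0 = f 2 \<and> f 1 = f 3}"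
    by (simp_all add: sign1_def sign2_def)
  ultimately have "generated_algebra fscale fmul {sign1} \<subseteq> {f. f 0 = f 1 \<and> f 2 = f 3}"
    "generated_algebra fscale fmul {sign2} \<subseteq> {f. f 0 = f 2 \<and> f 1 = f 3}"
    unfolding generated_algebra_def by (simp_all add: hull_minimal)
  then show "f \<in> generated_algebra fscale fmul {sign1} \<Longrightarrow> f 0 = f 1 \<and> f 2 = f 3"
    "f \<in> generated_algebra fscale fmul {sign2} \<Longrightarrow> f 0 = f 2 \<and> f 1 = f 3" by blast+
qed

lemma mean_independent:
  assumes "f 0 = f 1 \<and> f 2 = f 3" "g 0 = g 2 \<and> g 1 = g 3"
  shows "mean (\<lambda>\<omega>. f \<omega> * g \<omega>) = mean f * mean g"
  using assms by (simp add: mean_def field_simps)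

text \<open>By independence each cycle may be split into its two coloured parts without changing the moment.\<close>

lemma diag_moment_split:
  assumes p: "p \<in> diagrams k" and len: "length as = k"
    and as: "\<And>i. i < k \<Longrightarrow> as ! i \<in> generated_algebra fscale fmul (if \<epsilon> i then {sign1} else {sign2})"
  obtains q where "q \<in> diagrams k" "join q (id_diagram k) = q" "diag_moment q as = diag_moment p as"
    "\<And>r. \<lbrakk>r \<in> diagrams k; join r (id_diagram k) = r\<rbrakk> \<Longrightarrow> refines (vertices k) r q \<longleftrightarrow>
      refines (vertices k) r (join (id_diagram k) p) \<and> (\<forall>c\<in>r. \<forall>i j. Inl i \<in> c \<and> Inl j \<in> c \<longrightarrow> \<epsilon> i = \<epsilon> j)"
proof
  let ?C = "cycles k p" and ?V = "vertices k"
  let ?col = "case_sum \<epsilon> \<epsilon>"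
  define D where "D t c = {v \<in> c. ?col v = t}" for t :: bool and c :: "(nat + nat) set"
  \<comment> \<open>The coloured parts of the cycles of \<open>p\<close>; a cycle of one colour has
    an empty part, which is removed.\<close>
  define q where "q = D True ` ?C \<union> D False ` ?C - {{}}"
  have cd: "?C \<in> diagrams k" by (rule cycles_in_diagrams[OF p])
  note cpart = diagramsD[OF cd]
  have finC: "finite ?C" by (rule finite_diagram[OF cd])
  have memq: "d \<in> q \<longleftrightarrow> (\<exists>t. \<exists>c\<in>?C. d = D t c \<and> d \<noteq> {})" for d
    unfolding q_def by (auto simp: image_iff) (metis (full_types))+
  have qpart: "partition_on ?V q"
  proof (rule partition_onI)
    show "\<Union>q = ?V"
    proof (intro equalityI subsetI)
      fix v assume "v \<in> \<Union>q"
      then obtain t c where "c \<in> ?C" "v \<in> D t c" using memq by blast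
      then show "v \<in> ?V" using partition_onD1[OF cpart] by (auto simp: D_def)
    next
      fix v assume "v \<in> ?V"
      then obtain c where c: "c \<in> ?C" "v \<in> c" using partition_onD1[OF cpart] by blast
      then have "v \<in> D (?col v) c" by (simp add: D_def)
      then show "v \<in> \<Union>q" using memq c(1) by blast
    qed
    show "{} \<notin> q" by (simp add: q_def)
    fix d d' assume d: "d \<in> q" "d' \<in> q" "d \<noteq> d'"
    obtain t c where tc: "c \<in> ?C" "d = D t c" using d(1) memq by blast
    obtain t' c' where tc': "c' \<in> ?C" "d' = D t' c'" using d(2) memq by blast
    show "disjnt d d'"
    proof (rule ccontr)
      assume "\<not> disjnt d d'"
      then obtain v where "v \<in> d" "v \<in> d'" by (auto simp: disjnt_def)
      then have "v \<in> c" "v \<in> c'" "t = t'" using tc tc' by (auto simp: D_def)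
      then have "d = d'" using partition_on_block_eq[OF cpart tc(1) tc'(1), of v] tc(2) tc'(2) by simp
      then show False using d(3) by simp
    qed
  qed
  show qd: "q \<in> diagrams k" using qpart by (simp add: diagrams_def)
  have refC: "refines ?V q ?C" unfolding refines_def
    using qpart cpart memq by (auto simp: D_def)
  have "refines ?V (id_diagram k) q"
    unfolding refines_def
  proof (intro conjI ballI partition_on_id_diagram qpart)
    fix b assume "b \<in> id_diagram k"
    obtain i where i: "i < k" "b = {Inl i, Inr i}" using \<open>b \<in> id_diagram k\<close> by (auto simp: id_diagram_def)
    then have "Inl i \<in> \<Union>?C" using partition_onD1[OF cpart] vertices_iff(1)[of i k] by simp
    then obtain c where c: "c \<in> ?C" "Inl i \<in> c" by blast
    have "b \<in> p \<union> id_diagram k" "Inl i \<in> b" using \<open>b \<in> id_diagram k\<close> i(2) by auto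
    then have "b \<subseteq> c" using join_absorbs[OF c(1)[unfolded cycles_def], of b "Inl i"] c(2) by simp
    then have "b \<subseteq> D (\<epsilon> i) c" using i(2) by (auto simp: D_def)
    moreover from this have "D (\<epsilon> i) c \<in> q" using memq[of "D (\<epsilon> i) c"] c(1) i(2) by auto
    ultimately show "\<exists>c\<in>q. b \<subseteq> c" by blast
  qed
  then show sat: "join q (id_diagram k) = q" using join_eq_right join_commute by metis
  define F where "F d = mean (letter_product as d)" for d
  have F0: "F {} = 1" by (simp add: F_def letter_product_def mean_def)
  \<comment> \<open>Distinct cycles have the same part of colour \<open>t\<close> only if that part
    is empty, where the factor is 1 by \<open>F0\<close>.\<close>
  have FD: "(\<Prod>d\<in>D t ` ?C. F d) = (\<Prod>c\<in>?C. F (D t c))" for t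
  proof (subst prod.reindex_nontrivial[OF finC])
    fix c c' assume c: "c \<in> ?C" "c' \<in> ?C" "c \<noteq> c'" "D t c = D t c'"
    have "D t c = {}"
    proof (rule equals0I)
      fix v assume v: "v \<in> D t c"
      then have "v \<in> D t c'" using c(4) by simp
      then show False using v partition_on_block_eq[OF cpart c(1,2), of v] c(3) by (simp add: D_def)
    qed
    then show "F (D t c) = 1" using F0 by simp
  qed simp
  have indep: "F c = F (D True c) * F (D False c)" if c: "c \<in> ?C" for c
  proof -
    have split: "letter_product as c = (\<lambda>\<omega>. letter_product as (D True c) \<omega> * letter_product as (D False c) \<omega>)"
    proof
      fix \<omega>
      have "{j. j < length as \<and> Inl j \<in> c} =
          {j. j < length as \<and> Inl j \<in> D True c} \<union> {j. j < length as \<and> Inl j \<in> D False c}"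
        by (auto simp: D_def)
      then show "letter_product as c \<omega> = letter_product as (D True c) \<omega> * letter_product as (D False c) \<omega>"
        unfolding letter_product_def by (simp add: prod.union_disjoint D_def disjoint_iff)
    qed
    have g: "(as ! j) 0 = (as ! j) 1 \<and> (as ! j) 2 = (as ! j) 3" if "j < length as" "Inl j \<in> D True c" for j
      using generated_sign1[of "as ! j"] as[of j] that len by (simp add: D_def)
    have h: "(as ! j) 0 = (as ! j) 2 \<and> (as ! j) 1 = (as ! j) 3" if "j < length as" "Inl j \<in> D False c" for j
      using generated_sign2[of "as ! j"] as[of j] that len by (simp add: D_def)
    show ?thesis
      unfolding F_def split
    proof (rule mean_independent)
      show "letter_product as (D True c) 0 = letter_product as (D True c) 1 \<and>
          letter_product as (D True c) 2 = letter_product as (D True c) 3"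
        unfolding letter_product_def using g by (intro conjI prod.cong) auto
      show "letter_product as (D False c) 0 = letter_product as (D False c) 2 \<and>
          letter_product as (D False c) 1 = letter_product as (D False c) 3"
        unfolding letter_product_def using h by (intro conjI prod.cong) auto
    qed
  qed
  have "diag_moment q as = (\<Prod>d\<in>q. F d)" by (simp add: diag_moment_def len cycles_def sat F_def)
  also have "\<dots> = (\<Prod>d\<in>D True ` ?C \<union> D False ` ?C. F d)"
    unfolding q_def by (rule prod.mono_neutral_left) (use finC F0 in auto)
  also have "\<dots> = (\<Prod>d\<in>D True ` ?C. F d) * (\<Prod>d\<in>D False ` ?C. F d)"
  proof (rule prod.union_inter_neutral)
    show "\<forall>d\<in>D True ` ?C \<inter> D False ` ?C. F d = 1"
    proof
      fix d assume d: "d \<in> D True ` ?C \<inter> D False ` ?C"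
      then have "\<forall>v\<in>d. ?col v = True" "\<forall>v\<in>d. ?col v = False" by (auto simp: D_def)
      then have "d = {}" by blast
      then show "F d = 1" using F0 by simp
    qed
  qed (use finC in auto)
  also have "\<dots> = (\<Prod>c\<in>?C. F c)" unfolding FD using indep by (simp add: prod.distrib[symmetric])
  finally show "diag_moment q as = diag_moment p as" by (simp add: diag_moment_def len F_def)
  fix r assume r: "r \<in> diagrams k" "join r (id_diagram k) = r"
  have eqC: "join (id_diagram k) p = ?C" by (simp add: cycles_def join_commute)
  show "refines ?V r q \<longleftrightarrow> refines ?V r (join (id_diagram k) p) \<and> (\<forall>c\<in>r. \<forall>i j. Inl i \<in> c \<and> Inl j \<in> c \<longrightarrow> \<epsilon> i = \<epsilon> j)"
    unfolding eqC
  proof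
    assume L: "refines ?V r q"
    have "\<epsilon> i = \<epsilon> j" if ij: "c \<in> r" "Inl i \<in> c" "Inl j \<in> c" for c i j
    proof -
      obtain d where "d \<in> q" "c \<subseteq> d" using refinesE[OF L ij(1)] by blast
      then obtain t c' where "c \<subseteq> D t c'" using memq[of d] by auto
      then have "Inl i \<in> D t c'" "Inl j \<in> D t c'" using ij by blast+
      then show ?thesis by (simp add: D_def)
    qed
    then show "refines ?V r ?C \<and> (\<forall>c\<in>r. \<forall>i j. Inl i \<in> c \<and> Inl j \<in> c \<longrightarrow> \<epsilon> i = \<epsilon> j)"
      using refines_trans[OF L refC] by blast
  next
    assume R: "refines ?V r ?C \<and> (\<forall>c\<in>r. \<forall>i j. Inl i \<in> c \<and> Inl j \<in> c \<longrightarrow> \<epsilon> i = \<epsilon> j)"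
    show "refines ?V r q" unfolding refines_def
    proof (intro conjI ballI diagramsD[OF r(1)] qpart)
      fix b assume b: "b \<in> r"
      obtain c where c: "c \<in> ?C" "b \<subseteq> c" using refinesE[OF conjunct1[OF R] b] by blast
      obtain v where v: "v \<in> b" using b partition_onD3[OF diagramsD[OF r(1)]] by fastforce
      have top: "\<exists>i. Inl i \<in> b \<and> \<epsilon> i = ?col u" if u: "u \<in> b" for u
      proof (cases u)
        case (Inl i)
        then show ?thesis using u by auto
      next
        case (Inr i)
        then have "i < k" using u b partition_onD1[OF diagramsD[OF r(1)]] vertices_iff(2)[of i k] by blast
        then have "{Inl i, Inr i} \<in> id_diagram k" by (auto simp: id_diagram_def)
        then have "{Inl i, Inr i} \<subseteq> b"
          using join_absorbs[of b r "id_diagram k" "{Inl i, Inr i}" u] b r(2) u Inr by simp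
        then show ?thesis using Inr by auto
      qed
      have "?col u = ?col v" if u: "u \<in> b" for u
      proof -
        obtain i where i: "Inl i \<in> b" "\<epsilon> i = ?col u" using top[OF u] by blast
        obtain j where j: "Inl j \<in> b" "\<epsilon> j = ?col v" using top[OF v] by blast
        have "\<epsilon> i = \<epsilon> j" using conjunct2[OF R] b i(1) j(1) by blast
        then show ?thesis using i(2) j(2) by simp
      qed
      then have "b \<subseteq> D (?col v) c" using c(2) by (auto simp: D_def)
      then show "\<exists>c\<in>q. b \<subseteq> c" using memq c(1) v by blast
    qed
  qed
qed

text \<open>The cumulants are supported on the good diagrams: coarser than the identity, with one
  colour in each block. The good diagrams below \<open>p\<close> are precisely the diagrams below
  its split \<open>q\<close>, which has the same moment, so uniqueness of the inversion applies. A
  good diagram is its own cycle partition and has no mixed cycle.\<close>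

lemma diag_moment_partition_free: "c_free diagrams fscale fmul diag_moment {sign1} {sign2}"
proof (rule c_freeI)
  have cum: "is_cumulant_family fscale diag_moment diagrams (cumulant fscale diag_moment diagrams)"
    by (rule cumulant_family[OF diag_moment_tracial]) simp
  let ?\<kappa> = "cumulant fscale diag_moment diagrams"
  {
    fix k p as \<epsilon>
    assume p: "p \<in> diagrams k" and len: "length as = k"
      and as: "\<And>i. i < k \<Longrightarrow> as ! i \<in> generated_algebra fscale fmul (if \<epsilon> i then {sign1} else {sign2})"
      and mixed: "\<exists>c\<in>cycles k p. \<exists>i j. Inl i \<in> c \<and> Inl j \<in> c \<and> \<epsilon> i \<noteq> \<epsilon> j"
    define good where "good r \<longleftrightarrow> join r (id_diagram k) = r \<and>
      (\<forall>c\<in>r. \<forall>i j. Inl i \<in> c \<and> Inl j \<in> c \<longrightarrow> \<epsilon> i = \<epsilon> j)" for r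
    have "?\<kappa> p as = (if good p then ?\<kappa> p as else 0)"
    proof (rule moebius_unique[where S = "diagrams k" and le = "geodesic_le k"
          and f = "diagram_dist (id_diagram k)" and h = "\<lambda>p. ?\<kappa> p as"
          and h' = "\<lambda>p. if good p then ?\<kappa> p as else 0"])
      show "diagram_dist (id_diagram k) x < diagram_dist (id_diagram k) y"
        if "x \<in> diagrams k" "y \<in> diagrams k" "geodesic_le k x y" "x \<noteq> y" for x y
        using geodesic_le_dist_less that by blast
      fix p assume p: "p \<in> diagrams k"
      obtain q where q: "q \<in> diagrams k" "join q (id_diagram k) = q" "diag_moment q as = diag_moment p as"
        "\<And>r. \<lbrakk>r \<in> diagrams k; join r (id_diagram k) = r\<rbrakk> \<Longrightarrow> refines (vertices k) r q \<longleftrightarrow>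
          refines (vertices k) r (join (id_diagram k) p) \<and> (\<forall>c\<in>r. \<forall>i j. Inl i \<in> c \<and> Inl j \<in> c \<longrightarrow> \<epsilon> i = \<epsilon> j)"
        using diag_moment_split[OF p len as] by blast
      have jq: "join (id_diagram k) q = q" using q(2) by (simp add: join_commute)
      have below_q: "geodesic_le k r q \<longleftrightarrow> geodesic_le k r p \<and> good r" if r: "r \<in> diagrams k" for r
      proof
        assume le: "geodesic_le k r q"
        have "refines (vertices k) r q" using geodesic_le_refines[OF r q(1) le] jq by simp
        have "card (join r (id_diagram k)) = card r"
          using le join_eq_right[OF \<open>refines (vertices k) r q\<close>] jq by (simp add: geodesic_le_iff)
        then have sat: "join r (id_diagram k) = r"
          using refines_card_le(2)[OF join_is_finest(1)[OF diagramsD[OF r] partition_on_id_diagram] finite_vertices]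
          by simp
        then show "geodesic_le k r p \<and> good r"
          using \<open>refines (vertices k) r q\<close> q(4)[OF r sat] saturated_geodesic_le_iff[OF r p sat]
          by (simp add: good_def)
      next
        assume R: "geodesic_le k r p \<and> good r"
        then have sat: "join r (id_diagram k) = r" by (simp add: good_def)
        then show "geodesic_le k r q"
          using R q(4)[OF r sat] saturated_geodesic_le_iff[OF r p sat] saturated_geodesic_le_iff[OF r q(1) sat] jq
          by (simp add: good_def)
      qed
      have "(\<Sum>r\<in>{r \<in> diagrams k. geodesic_le k r p}. if good r then ?\<kappa> r as else 0) =
          (\<Sum>r\<in>{r \<in> {r \<in> diagrams k. geodesic_le k r p}. good r}. ?\<kappa> r as)"
        by (rule sum.inter_filter[symmetric]) (simp add: finite_diagrams)
      also have "{r \<in> {r \<in> diagrams k. geodesic_le k r p}. good r} = {r \<in> diagrams k. geodesic_le k r q}"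
        using below_q by blast
      also have "(\<Sum>r\<in>{r \<in> diagrams k. geodesic_le k r q}. ?\<kappa> r as) = diag_moment p as"
        using moment_cumulant_sum[OF cum q(1) len] q(3) by simp
      finally show "(\<Sum>r\<in>{r \<in> diagrams k. geodesic_le k r p}. ?\<kappa> r as) =
          (\<Sum>r\<in>{r \<in> diagrams k. geodesic_le k r p}. if good r then ?\<kappa> r as else 0)"
        using moment_cumulant_sum[OF cum p len] by simp
    qed (use p finite_diagrams geodesic_le_refl in auto)
    moreover have "\<not> good p"
    proof
      assume g: "good p"
      then have "cycles k p = p" by (simp add: good_def cycles_def)
      then show False using mixed g unfolding good_def by metis
    qed
    ultimately show "?\<kappa> p as = 0" by simp
  }
  fix k1 k2 p1 p2 and as bs :: "(nat \<Rightarrow> complex) list"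
  assume p: "p1 \<in> diagrams k1" "p2 \<in> diagrams k2" and len: "length as = k1" "length bs = k2"
  show "?\<kappa> (diagram_tensor k1 p1 p2) (as @ bs) = ?\<kappa> p1 as * ?\<kappa> p2 bs"
    by (rule cumulant_tensor_multiplicative[OF _ _ cum len _ p])
      (use diagram_tensor_in_diagrams diag_moment_tensor len in auto)
qed

lemma diag_moment_one_block_cumulant:
  assumes mean: "mean x = 0" "mean (fmul x x) = 1"
  shows "cumulant fscale diag_moment diagrams one_block2 [x, x] = 1"
proof -
  let ?\<kappa> = "cumulant fscale diag_moment diagrams" and ?I = "id_diagram 2"
  have cum: "is_cumulant_family fscale diag_moment diagrams ?\<kappa>"
    by (rule cumulant_family[OF diag_moment_tracial]) simp
  note d = id_diagram_in_diagrams[of 2] diagrams2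
  have len: "length [x, x] = 2" by simp
  \<comment> \<open>The diagrams below the single block are found inside the interval below the
    transposition, which is already known.\<close>
  have "geodesic_le 2 one_block2 swap2" using below_swap2_iff d by simp
  have "\<not> geodesic_le 2 swap2 one_block2"
    using join_id_swap2 join_commute[of swap2 ?I] d
    by (simp add: geodesic_le_iff join_one_block2)
  moreover have "p \<in> {?I, one_block2, swap2}" if "p \<in> diagrams 2" "geodesic_le 2 p one_block2" for p
    using geodesic_le_trans[OF that(1) d(3) d(2) that(2) \<open>geodesic_le 2 one_block2 swap2\<close>] below_swap2_iff that by simp
  ultimately have "{p \<in> diagrams 2. geodesic_le 2 p one_block2} = {?I, one_block2}"
    using id_geodesic_le geodesic_le_refl d by blast
  then have "diag_moment one_block2 [x, x] = ?\<kappa> ?I [x, x] + ?\<kappa> one_block2 [x, x]"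
    using moment_cumulant_sum[OF cum d(3), of "[x, x]"] distinct2 by simp
  moreover have "{p \<in> diagrams 2. geodesic_le 2 p ?I} = {?I}" using below_id_iff d by auto
  then have "diag_moment ?I [x, x] = ?\<kappa> ?I [x, x]" using moment_cumulant_sum[OF cum d(1), of "[x, x]"] by simp
  moreover have "diag_moment ?I [x, x] = 0"
  proof -
    have "{j. j < Suc (Suc 0) \<and> j = 0} = {0}" by auto
    then have "letter_product [x, x] {Inl 0, Inr 0} = x" by (simp add: letter_product_def fun_eq_iff)
    then have "mean (letter_product [x, x] {Inl 0, Inr 0}) = 0" using mean by simp
    then have "(\<Prod>c\<in>?I. mean (letter_product [x, x] c)) = 0"
      using finite_diagram[OF d(1)] by (intro prod_zero) (auto simp: id2_eq)
    then show ?thesis unfolding diag_moment_def len cycles_def by simp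
  qed
  moreover have "diag_moment one_block2 [x, x] = 1"
  proof -
    have "{j. j < Suc (Suc 0) \<and> (j = 0 \<or> j = Suc 0)} = {0, Suc 0}" by auto
    then have "letter_product [x, x] {Inl 0, Inl 1, Inr 0, Inr 1} = fmul x x"
      by (simp add: letter_product_def fun_eq_iff fmul_def)
    then have "(\<Prod>c\<in>one_block2. mean (letter_product [x, x] c)) = 1" using mean by (simp add: one_block2_def)
    then show ?thesis unfolding diag_moment_def len cycles_def using join_one_block2(2)[OF d(1)] by simp
  qed
  ultimately show ?thesis by simp
qed

lemma diag_moment_not_perm_free: "\<not> c_free perm_diagrams fscale fmul diag_moment {sign1} {sign2}"
proof (rule partition_free_not_perm_free[OF diag_moment_tracial diag_moment_partition_free])
  show "cumulant fscale diag_moment diagrams one_block2 [sign1, sign1] *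
      cumulant fscale diag_moment diagrams one_block2 [sign2, sign2] \<noteq> 0"
    by (simp add: diag_moment_one_block_cumulant mean_def sign1_def sign2_def fmul_def)
qed auto


section \<open>An algebra with zero product\<close>

text \<open>The Brauer diagram on two positions that joins the points within each row. Not being a
  permutation, it is invisible to the permutation cumulants.\<close>

definition cap_cup :: diagram where "cap_cup = {{Inl 0, Inl 1}, {Inr 0, Inr 1}}"

abbreviation null_mul :: "(nat \<Rightarrow> complex) \<Rightarrow> (nat \<Rightarrow> complex) \<Rightarrow> nat \<Rightarrow> complex" where
  "null_mul f g \<equiv> (\<lambda>_. 0)"

text \<open>The value 1 on the empty list is what the axiom \<open>m_empty\<close> asks for. On
  \<open>cap_cup\<close> the form is symmetric in its two arguments, as the invariance axiom
  requires.\<close>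

definition pairing_moment :: "diagram \<Rightarrow> (nat \<Rightarrow> complex) list \<Rightarrow> complex" where
  "pairing_moment p as =
    (if as = [] then 1 else if p = cap_cup \<and> length as = 2 then (as ! 0) 0 * (as ! 1) 0 else 0)"

lemma null_mul_complex_algebra: "complex_algebra fscale null_mul"
  by (intro complex_algebra.intro complex_algebra_axioms.intro fscale_vector_space)
    (auto simp: fscale_def fun_eq_iff)

lemma cap_cup_in_brauer: "cap_cup \<in> brauer_diagrams 2"
  unfolding brauer_diagrams_def diagrams_def vertices_2 cap_cup_def
  by (auto intro!: partition_onI simp: disjnt_def)

lemma cap_cup_in_diagrams: "cap_cup \<in> diagrams 2"
  using cap_cup_in_brauer by (simp add: brauer_diagrams_def)

lemma cap_cup_not_perm: "cap_cup \<notin> perm_diagrams k"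
proof
  assume "cap_cup \<in> perm_diagrams k"
  then obtain i j where "{Inl 0, Inl 1} = {Inl i :: nat + nat, Inr j}"
    using perm_diagrams_block[of cap_cup k "{Inl 0, Inl 1}"] by (auto simp: cap_cup_def)
  then show False by (metis Inl_Inr_False insert_iff singletonD)
qed

lemma permutes_2_cases:
  assumes "\<sigma> permutes {..<2}"
  shows "\<sigma> 0 = 0 \<and> \<sigma> 1 = 1 \<or> \<sigma> 0 = 1 \<and> \<sigma> 1 = (0::nat)"
proof -
  have "\<sigma> 0 < 2" "\<sigma> 1 < 2" using permutes_in_image[OF assms, of 0] permutes_in_image[OF assms, of 1] by simp_all
  moreover have "\<sigma> 0 \<noteq> \<sigma> 1" using permutes_inj[OF assms] by (metis injD zero_neq_one)
  ultimately show ?thesis by linarith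
qed

lemma image_cap_cup_iff:
  assumes \<sigma>: "\<sigma> permutes {..<2}"
  shows "(`) (map_sum \<sigma> \<sigma>) ` p = cap_cup \<longleftrightarrow> p = cap_cup"
proof -
  let ?f = "map_sum \<sigma> \<sigma>"
  have "(`) ?f ` cap_cup = cap_cup" using permutes_2_cases[OF \<sigma>] by (auto simp: cap_cup_def insert_commute)
  moreover have "inj ?f" using sum.inj_map permutes_inj[OF \<sigma>] by blast
  then have "inj ((`) ?f)" by (auto simp: inj_on_def inj_image_eq_iff)
  then have "(`) ?f ` p = (`) ?f ` cap_cup \<longleftrightarrow> p = cap_cup" by (rule inj_image_eq_iff)
  ultimately show ?thesis by simp
qed

lemma diagram_comp_id_right:
  assumes "p \<in> diagrams k"
  shows "diagram_comp p (perm_diagram k id) = p"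
  using diagram_comp_perm_right[OF assms permutes_id] by (simp add: sum.map_id0)

lemma block_cycle_replicate_1: "block_cycle (replicate k (Suc 0)) = id"
proof
  show "block_cycle (replicate k (Suc 0)) i = id i" for i
    by (induction k arbitrary: i) auto
qed

lemma insertion_replicate_1:
  assumes p: "p \<in> diagrams k"
  shows "insertion k (offsets (replicate k (Suc 0))) p = p"
proof -
  have off: "offsets (replicate k (Suc 0)) = [0..<k]"
    by (rule nth_equalityI) (simp_all add: offsets_def sum_list_replicate min_def)
  have "map_sum ((!) [0..<k]) ((!) [0..<k]) ` b = b" if b: "b \<in> p" for b
  proof -
    have "map_sum ((!) [0..<k]) ((!) [0..<k]) v = v" if "v \<in> b" for v
    proof -
      have "v \<in> vertices k" using b that partition_onD1[OF diagramsD[OF p]] by blast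
      then show ?thesis by (cases v) auto
    qed
    then show ?thesis by simp
  qed
  then have "(`) (map_sum ((!) [0..<k]) ((!) [0..<k])) ` p = p" by simp
  moreover have "{{Inl i, Inr i} |i. i < k \<and> i \<notin> set [0..<k]} = {}" by auto
  ultimately show ?thesis unfolding insertion_def off by simp
qed

lemma sum_list_eq_2:
  assumes "0 \<notin> set ns" "sum_list ns = 2" "ns \<noteq> replicate (length ns) (Suc 0)"
  shows "ns = [2]"
proof (cases ns)
  case (Cons a ms)
  show ?thesis
  proof (cases ms)
    case (Cons b ls)
    have "a \<noteq> 0" "b \<noteq> 0" "a + (b + sum_list ls) = 2" using assms(1,2) Cons \<open>ns = a # ms\<close> by auto
    then have eq: "a = 1" "b = 1" "sum_list ls = 0" by linarith+
    then have "ls = []" using assms(1) Cons \<open>ns = a # ms\<close> by (cases ls) auto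
    then show ?thesis using assms(3) eq Cons \<open>ns = a # ms\<close> by simp
  qed (use assms \<open>ns = a # ms\<close> in simp)
qed (use assms in simp)

lemma pairing_moment_multilinear: "multilinear_form fscale k (pairing_moment p)"
  unfolding multilinear_form_def
proof (intro allI impI)
  fix as :: "(nat \<Rightarrow> complex) list" and i
  assume i: "length as = k \<and> i < k"
  show "Vector_Spaces.linear fscale (*) (\<lambda>x. pairing_moment p (as[i := x]))"
  proof (cases "p = cap_cup \<and> k = 2")
    case True
    then have "as \<noteq> []" "i = 0 \<or> i = 1" "length as = 2" using i by auto
    then show ?thesis using True
      by (intro linear_fscaleI) (auto simp: pairing_moment_def fscale_def algebra_simps)
  next
    case False
    then have "pairing_moment p (as[i := x]) = 0" for x using i by (auto simp: pairing_moment_def)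
    then show ?thesis by (intro linear_fscaleI) simp_all
  qed
qed

lemma pairing_moment_perm:
  assumes p: "p \<in> diagrams k" and len: "length as = k" and \<sigma>: "\<sigma> permutes {..<k}"
  shows "pairing_moment p as =
    pairing_moment (diagram_comp (perm_diagram k \<sigma>) (diagram_comp p (perm_diagram k (inv \<sigma>))))
      (map (\<lambda>i. as ! inv \<sigma> i) [0..<k])"
proof (cases "k = 2")
  case True
  have \<sigma>2: "\<sigma> permutes {..<2}" using \<sigma> True by simp
  have ne: "as \<noteq> []" "map (\<lambda>i. as ! inv \<sigma> i) [0..<k] \<noteq> []" using len True by auto
  have "(as ! inv \<sigma> 0) 0 * (as ! inv \<sigma> 1) 0 = (as ! 0) 0 * (as ! 1) 0"
    using permutes_2_cases[OF permutes_inv[OF \<sigma>2]] by auto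
  moreover have "map (\<lambda>i. as ! inv \<sigma> i) [0..<k] ! 0 = as ! inv \<sigma> 0"
    "map (\<lambda>i. as ! inv \<sigma> i) [0..<k] ! 1 = as ! inv \<sigma> 1" using True by auto
  ultimately show ?thesis
    unfolding diagram_conj_perm[OF p \<sigma>] pairing_moment_def image_cap_cup_iff[OF \<sigma>2]
    using ne len True by auto
next
  case False
  then show ?thesis using len by (auto simp: pairing_moment_def)
qed

text \<open>If all factors are single letters, nothing changes. Otherwise some product of letters is
  zero, and so is the left side. On the right only words of two letters matter, hence a single
  product of two letters, and then the enlarged diagram contains the block
  \<open>{Inl 0, Inr 1}\<close> and differs from \<open>cap_cup\<close>.\<close>

lemma pairing_moment_product:
  assumes p: "p \<in> diagrams k" and len: "length ass = k" and ne: "\<forall>xs\<in>set ass. xs \<noteq> []"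
    and ns: "ns = map length ass" and n: "n = sum_list ns"
  shows "pairing_moment p (map (list_mult null_mul) ass) =
    pairing_moment (diagram_comp (insertion n (offsets ns) p) (perm_diagram n (block_cycle ns))) (concat ass)"
    (is "?L = pairing_moment ?q _")
proof (cases "ns = replicate k (Suc 0)")
  case True
  have "n = k" using n True by (simp add: sum_list_replicate)
  then have "?q = p" unfolding True block_cycle_replicate_1 insertion_replicate_1[OF p]
    by (simp add: insertion_replicate_1[OF p] diagram_comp_id_right[OF p])
  moreover have "map (list_mult null_mul) ass = concat ass"
  proof -
    have "length xs = Suc 0" if "xs \<in> set ass" for xs
    proof -
      have "length xs \<in> set ns" using that by (simp add: ns)
      then show ?thesis unfolding True by simp
    qed
    then have "\<forall>xs\<in>set ass. [list_mult null_mul xs] = xs" by (metis length_0_conv length_Suc_conv list_mult.simps(2))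
    then show ?thesis by (induction ass) simp_all
  qed
  ultimately show ?thesis by simp
next
  case False
  have lk: "length ns = k" and pos: "0 \<notin> set ns" using len ne by (auto simp: ns)
  have "\<not> (\<forall>x\<in>set ns. x = Suc 0)" using False lk replicate_eqI[of ns k "Suc 0"] by blast
  then obtain xs where xs: "xs \<in> set ass" "length xs \<noteq> Suc 0" by (auto simp: ns)
  then have "xs \<noteq> []" using ne by blast
  then have zero: "list_mult null_mul xs = (\<lambda>_. 0)"
    using xs(2) by (cases xs; cases "tl xs") auto
  have ne': "ass \<noteq> []" "concat ass \<noteq> []" using xs(1) \<open>xs \<noteq> []\<close> by auto
  have "?L = 0"
  proof (cases "k = 2")
    case True
    obtain i where "i < k" "ass ! i = xs" using xs(1) len by (auto simp: in_set_conv_nth)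
    then have "(map (list_mult null_mul) ass ! 0) 0 * (map (list_mult null_mul) ass ! 1) 0 = 0"
      using zero len True by (cases "i = 0") (auto simp: less_2_cases_iff)
    then show ?thesis using ne'(1) unfolding pairing_moment_def by (simp only: map_is_Nil_conv if_False) simp
  next
    case False
    then show ?thesis using ne'(1) len by (simp add: pairing_moment_def)
  qed
  moreover have "pairing_moment ?q (concat ass) = 0"
  proof (cases "n = 2")
    case True
    then have "ns = [2]" using sum_list_eq_2[OF pos] False n lk by simp
    then have off: "offsets ns = [0]" and bc: "block_cycle ns permutes {..<2}" "block_cycle ns 0 = 1"
      using block_cycle_permutes[of ns] by (simp_all add: offsets_def)
    have ins: "insertion n (offsets ns) p \<in> diagrams 2"
      using insertion_in_diagrams[of p ns] p pos lk n True by simp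
    have "inv (block_cycle ns) 1 = 0" using permutes_inv_eq[OF bc(1)] bc(2) by simp
    moreover have "{Inl 1, Inr 1} \<in> insertion n (offsets ns) p" using True off by (auto simp: insertion_def)
    ultimately have "{Inl 0, Inr 1} \<in> (`) (map_sum (inv (block_cycle ns)) id) ` insertion n (offsets ns) p"
      by (intro image_eqI[of _ _ "{Inl 1, Inr 1}"]) auto
    then have "{Inl 0, Inr 1} \<in> ?q" unfolding True diagram_comp_perm_right[OF ins[unfolded True] bc(1)] .
    moreover have "{Inl 0, Inr 1} \<notin> cap_cup" by (simp add: cap_cup_def doubleton_eq_iff)
    ultimately have "?q \<noteq> cap_cup" by metis
    then show ?thesis using ne'(2) by (simp add: pairing_moment_def)
  next
    case False
    then show ?thesis using ne'(2) by (simp add: pairing_moment_def n ns length_concat)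
  qed
  ultimately show ?thesis by simp
qed

lemma pairing_moment_tracial: "P_tracial_algebra fscale null_mul pairing_moment"
proof (intro P_tracial_algebra.intro P_tracial_algebra_axioms.intro null_mul_complex_algebra)
  show "pairing_moment {} [] = 1" by (simp add: pairing_moment_def)
  show "\<And>p k. p \<in> diagrams k \<Longrightarrow> multilinear_form fscale k (pairing_moment p)"
    by (rule pairing_moment_multilinear)
qed (fact pairing_moment_perm pairing_moment_product)+

text \<open>The moments of permutations vanish on nonempty lists, and the inversion is
  unique.\<close>

lemma pairing_moment_perm_cumulant:
  assumes p: "p \<in> perm_diagrams k" and len: "length as = k"
  shows "cumulant fscale pairing_moment perm_diagrams p as = (if as = [] then 1 else 0)"
proof (rule cumulant_unique[OF perm_diagrams_subset _ _ p len])
  show "is_cumulant_family fscale pairing_moment perm_diagrams (cumulant fscale pairing_moment perm_diagrams)"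
    by (rule cumulant_family[OF pairing_moment_tracial perm_diagrams_subset])
  show "is_cumulant_family fscale pairing_moment perm_diagrams (\<lambda>p as. if as = [] then 1 else 0)"
    unfolding is_cumulant_family_def
  proof (intro conjI allI ballI impI)
    fix k p
    show "multilinear_form fscale k (\<lambda>as. if as = [] then 1 else 0)"
      unfolding multilinear_form_def by (intro allI impI linear_fscaleI) auto
    fix as :: "(nat \<Rightarrow> complex) list"
    assume p: "p \<in> perm_diagrams k" and len: "length as = k"
    show "pairing_moment p as =
        (\<Sum>p'\<in>{p' \<in> perm_diagrams k. geodesic_le k p' p}. if as = [] then 1 else 0)"
    proof (cases "as = []")
      case True
      then have "perm_diagrams k = {{}}" using len by (auto simp: perm_diagrams_def perm_diagram_def)
      moreover from this have "geodesic_le k p p" "p = {}"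
        using geodesic_le_refl p perm_diagrams_subset by blast+
      ultimately have "{p' \<in> perm_diagrams k. geodesic_le k p' p} = {{}}" by auto
      then show ?thesis using True by (simp add: pairing_moment_def)
    next
      case False
      have "p \<noteq> cap_cup" using p cap_cup_not_perm by metis
      then show ?thesis using False by (simp add: pairing_moment_def)
    qed
  qed
qed

text \<open>A mixed cycle needs a letter, and permutation cumulants vanish as soon as there is one;
  so the two families are arbitrary, possibly equal.\<close>

lemma pairing_moment_perm_free: "c_free perm_diagrams fscale null_mul pairing_moment A1 A2"
proof (rule c_freeI)
  fix k p and as :: "(nat \<Rightarrow> complex) list" and \<epsilon> :: "nat \<Rightarrow> bool"
  assume p: "p \<in> perm_diagrams k" and len: "length as = k"
    and "\<exists>c\<in>cycles k p. \<exists>i j. Inl i \<in> c \<and> Inl j \<in> c \<and> \<epsilon> i \<noteq> \<epsilon> j"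
  then obtain c i where c: "c \<in> cycles k p" "Inl i \<in> c" by blast
  have "cycles k p \<in> diagrams k" using cycles_in_diagrams p perm_diagrams_subset by blast
  then have "Inl i \<in> vertices k" using c partition_onD1[OF diagramsD] by blast
  then have "as \<noteq> []" using len by auto
  then show "cumulant fscale pairing_moment perm_diagrams p as = 0"
    using pairing_moment_perm_cumulant[OF p len] by simp
next
  fix k1 k2 p1 p2 and as bs :: "(nat \<Rightarrow> complex) list"
  assume p: "p1 \<in> perm_diagrams k1" "p2 \<in> perm_diagrams k2" and len: "length as = k1" "length bs = k2"
  have "diagram_tensor k1 p1 p2 \<in> perm_diagrams (k1 + k2)"
    using perm_diagrams_tensor_iff[of p1 k1 p2 k2] p perm_diagrams_subset by blast
  from pairing_moment_perm_cumulant[OF this, of "as @ bs"]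
  show "cumulant fscale pairing_moment perm_diagrams (diagram_tensor k1 p1 p2) (as @ bs) =
      cumulant fscale pairing_moment perm_diagrams p1 as * cumulant fscale pairing_moment perm_diagrams p2 bs"
    using pairing_moment_perm_cumulant p len by auto
qed

section \<open>The Brauer cumulant of the pairing\<close>

lemma join_id_cap_cup: "join (id_diagram 2) cap_cup = one_block2"
proof -
  have part: "partition_on (vertices 2) (join (id_diagram 2) cap_cup)"
    using diagramsD[OF join_in_diagrams[OF id_diagram_in_diagrams cap_cup_in_diagrams]] .
  obtain c where c: "c \<in> join (id_diagram 2) cap_cup" "Inl 0 \<in> c"
    using partition_onD1[OF part] vertices_2 by blast
  note ab = join_absorbs[OF c(1)]
  have "Inr 0 \<in> c" "Inl 1 \<in> c"
    using ab[of "{Inl 0, Inr 0}" "Inl 0"] ab[of "{Inl 0, Inl 1}" "Inl 0"] c(2) by (simp_all add: id2_eq cap_cup_def)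
  moreover from this have "Inr 1 \<in> c" using ab[of "{Inl 1, Inr 1}" "Inl 1"] by (simp add: id2_eq)
  ultimately have "vertices 2 \<subseteq> c" using c(2) by (simp add: vertices_2)
  then show ?thesis using partition_on_single[OF part c(1)] by (simp add: one_block2_def vertices_2)
qed

lemma card_brauer_2:
  assumes p: "p \<in> brauer_diagrams 2"
  shows "card p = 2"
proof -
  have pd: "p \<in> diagrams 2" using p by (simp add: brauer_diagrams_def)
  have "card (\<Union>p) = (\<Sum>b\<in>p. card b)"
    using partition_onD2[OF diagramsD[OF pd]] p by (intro card_Union_disjoint) (auto simp: brauer_diagrams_def card_2_iff)
  also have "\<dots> = (\<Sum>b\<in>p. 2)" using p by (intro sum.cong) (auto simp: brauer_diagrams_def)
  finally have "card (vertices 2) = 2 * card p" using partition_onD1[OF diagramsD[OF pd]] by simp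
  moreover have "card (vertices 2) = 4" by (simp add: vertices_2)
  ultimately show ?thesis by simp
qed

text \<open>Brauer diagrams on two positions have two blocks. The joins of \<open>p\<close> with the
  identity and with \<open>cap_cup\<close> have three blocks together and at most two each, so one
  of them has two, and \<open>p\<close> equals that diagram.\<close>

lemma brauer_below_cap_cup:
  "{p \<in> brauer_diagrams 2. geodesic_le 2 p cap_cup} = {id_diagram 2, cap_cup}"
proof (intro equalityI subsetI)
  fix p assume "p \<in> {p \<in> brauer_diagrams 2. geodesic_le 2 p cap_cup}"
  then have p: "p \<in> brauer_diagrams 2" and le: "geodesic_le 2 p cap_cup" by auto
  have pd: "p \<in> diagrams 2" using p by (simp add: brauer_diagrams_def)
  have "card (join p (id_diagram 2)) + card (join p cap_cup) = 3"
    using le card_brauer_2[OF p] unfolding geodesic_le_iff join_id_cap_cup by simp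
  moreover have "card (join p q) \<le> 2" if "q \<in> diagrams 2" for q
    using refines_card_le(1)[OF join_is_finest(1)[OF diagramsD[OF pd] diagramsD[OF that]] finite_vertices]
      card_brauer_2[OF p] by simp
  then have "card (join p (id_diagram 2)) \<le> 2" "card (join p cap_cup) \<le> 2"
    using id_diagram_in_diagrams cap_cup_in_diagrams by blast+
  ultimately have "card (join p (id_diagram 2)) = 2 \<or> card (join p cap_cup) = 2" by linarith
  moreover have "p = q" if "card (join p q) = 2" "q \<in> brauer_diagrams 2" for q
  proof -
    have q: "q \<in> diagrams 2" "card q = 2" using that card_brauer_2 by (auto simp: brauer_diagrams_def)
    show ?thesis
      using refines_card_le(2)[OF coarser_than_pairing[OF q(1) pd] finite_vertices] q(2) that(1) card_brauer_2[OF p] by simp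
  qed
  moreover have "id_diagram 2 \<in> brauer_diagrams 2"
    using id_diagram_in_diagrams by (auto simp: brauer_diagrams_def id_diagram_def)
  ultimately show "p \<in> {id_diagram 2, cap_cup}" using cap_cup_in_brauer by blast
next
  fix p assume "p \<in> {id_diagram 2, cap_cup}"
  moreover have "id_diagram 2 \<in> brauer_diagrams 2"
    using id_diagram_in_diagrams by (auto simp: brauer_diagrams_def id_diagram_def)
  ultimately show "p \<in> {p \<in> brauer_diagrams 2. geodesic_le 2 p cap_cup}"
    using cap_cup_in_brauer cap_cup_in_diagrams id_geodesic_le geodesic_le_refl by auto
qed

text \<open>Both families are \<open>{x}\<close>, so the two letters may be attributed to different
  families. The single cycle of \<open>cap_cup\<close> is then mixed, but its cumulant is the square
  of \<open>x 0\<close>, which is 1.\<close>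

lemma pairing_moment_not_brauer_free:
  assumes "x 0 = 1"
  shows "\<not> c_free brauer_diagrams fscale null_mul pairing_moment {x} {x}"
proof
  let ?\<kappa> = "cumulant fscale pairing_moment brauer_diagrams"
  assume free: "c_free brauer_diagrams fscale null_mul pairing_moment {x} {x}"
  have sub: "brauer_diagrams k \<subseteq> diagrams k" for k by (auto simp: brauer_diagrams_def)
  have cum: "is_cumulant_family fscale pairing_moment brauer_diagrams ?\<kappa>"
    by (rule cumulant_family[OF pairing_moment_tracial sub])
  have len: "length [x, x] = 2" by simp
  have id: "id_diagram 2 \<in> brauer_diagrams 2" "id_diagram 2 \<noteq> cap_cup"
    using id_diagram_in_diagrams by (auto simp: brauer_diagrams_def id_diagram_def)
      (auto simp: cap_cup_def lessThan_2 doubleton_eq_iff)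
  have "cycles 2 cap_cup = one_block2" using join_id_cap_cup by (simp add: cycles_def join_commute)
  have mixed: "\<exists>c\<in>cycles 2 cap_cup. \<exists>i j. Inl i \<in> c \<and> Inl j \<in> c \<and> (i = 0) \<noteq> (j = 0)"
  proof (intro bexI exI)
    show "{Inl 0, Inl 1, Inr 0, Inr 1} \<in> cycles 2 cap_cup"
      using \<open>cycles 2 cap_cup = one_block2\<close> by (simp add: one_block2_def)
    show "Inl 0 \<in> {Inl 0, Inl 1, Inr 0, Inr 1} \<and> Inl 1 \<in> {Inl 0, Inl 1, Inr 0, Inr 1} \<and>
        (0 = 0) \<noteq> (1 = (0 :: nat))" by simp
  qed
  have "x \<in> generated_algebra fscale null_mul {x}"
    unfolding generated_algebra_def by (rule hull_inc) simp
  then have "?\<kappa> cap_cup [x, x] = 0"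
    by (intro c_free_mixed[OF free cap_cup_in_brauer len _ mixed]) (auto simp: less_2_cases_iff)
  moreover have "?\<kappa> (id_diagram 2) [x, x] = 0"
  proof -
    have "{p \<in> brauer_diagrams 2. geodesic_le 2 p (id_diagram 2)} = {id_diagram 2}"
      using below_id_iff id(1) sub[of 2] by auto
    then have "pairing_moment (id_diagram 2) [x, x] = ?\<kappa> (id_diagram 2) [x, x]"
      using moment_cumulant_sum[OF cum id(1) len] by simp
    then show ?thesis using id(2) by (simp add: pairing_moment_def)
  qed
  moreover have "pairing_moment cap_cup [x, x] = ?\<kappa> (id_diagram 2) [x, x] + ?\<kappa> cap_cup [x, x]"
    using moment_cumulant_sum[OF cum cap_cup_in_brauer len] id(2) unfolding brauer_below_cap_cup by simp
  ultimately show False using assms by (simp add: pairing_moment_def)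
qed

theorem theorem2p8:
  fixes scale :: "complex \<Rightarrow> 'a::ab_group_add \<Rightarrow> 'a"
    and mul :: "'a \<Rightarrow> 'a \<Rightarrow> 'a"
    and m :: "diagram \<Rightarrow> 'a list \<Rightarrow> complex"
    and A1 A2 :: "'a set"
  assumes "P_tracial_algebra scale mul m"
  shows
    "(deterministic scale mul m (A1 \<union> A2) \<longrightarrow>
        (c_free perm_diagrams scale mul m A1 A2 \<longleftrightarrow>
         voiculescu_free scale mul (\<lambda>a. m (id_diagram 1) [a]) A1 A2)) \<and>
     (c_free brauer_diagrams scale mul m A1 A2 \<or>
      c_free rook_brauer_diagrams scale mul m A1 A2 \<longrightarrow>
        c_free perm_diagrams scale mul m A1 A2) \<and>
     (c_free diagrams scale mul m A1 A2 \<and>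
      (\<exists>a1\<in>A1. \<exists>a2\<in>A1. \<exists>b1\<in>A2. \<exists>b2\<in>A2.
         cumulant scale m diagrams {{Inl 0, Inl 1, Inr 0, Inr 1}} [a1, a2] *
         cumulant scale m diagrams {{Inl 0, Inl 1, Inr 0, Inr 1}} [b1, b2] \<noteq> 0) \<longrightarrow>
        \<not> c_free perm_diagrams scale mul m A1 A2) \<and>
     (\<exists>(scale' :: complex \<Rightarrow> (nat \<Rightarrow> complex) \<Rightarrow> (nat \<Rightarrow> complex)) mul' m' S1 S2.
        P_tracial_algebra scale' mul' m' \<and>
        c_free diagrams scale' mul' m' S1 S2 \<and>
        \<not> c_free perm_diagrams scale' mul' m' S1 S2) \<and>
     (\<exists>(scale' :: complex \<Rightarrow> (nat \<Rightarrow> complex) \<Rightarrow> (nat \<Rightarrow> complex)) mul' m' S1 S2.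
        P_tracial_algebra scale' mul' m' \<and>
        c_free diagrams scale' mul' m' S1 S2 \<and>
        \<not> c_free brauer_diagrams scale' mul' m' S1 S2) \<and>
     (\<exists>(scale' :: complex \<Rightarrow> (nat \<Rightarrow> complex) \<Rightarrow> (nat \<Rightarrow> complex)) mul' m' S1 S2.
        P_tracial_algebra scale' mul' m' \<and>
        c_free perm_diagrams scale' mul' m' S1 S2 \<and>
        \<not> c_free brauer_diagrams scale' mul' m' S1 S2)"
proof -
  interpret P_tracial_algebra scale mul m by fact
  \<comment> \<open>Stated for every algebra, because it serves the given one and, contraposed, the
    example of the two signs.\<close>
  have brauer: "c_free brauer_diagrams scale' mul' m' S1 S2 \<Longrightarrow> c_free perm_diagrams scale' mul' m' S1 S2"
    if "P_tracial_algebra scale' mul' m'"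
    for scale' :: "complex \<Rightarrow> 'b::ab_group_add \<Rightarrow> 'b" and mul' m' S1 S2
    by (rule perm_free_of_larger_class[OF that perm_diagrams_subset_brauer brauer_subset_rook_brauer])
  have rook: "c_free rook_brauer_diagrams scale mul m A1 A2 \<Longrightarrow> c_free perm_diagrams scale mul m A1 A2"
    by (rule perm_free_of_larger_class[OF assms subset_trans[OF perm_diagrams_subset_brauer brauer_subset_rook_brauer] subset_refl])
  have "deterministic scale mul m (A1 \<union> A2) \<longrightarrow>
      (c_free perm_diagrams scale mul m A1 A2 \<longleftrightarrow>
       voiculescu_free scale mul (\<lambda>a. m (id_diagram 1) [a]) A1 A2)"
    using perm_free_iff_voiculescu_free[of A1 A2] unfolding trace_def[abs_def] by blast
  moreover have "c_free brauer_diagrams scale mul m A1 A2 \<or> c_free rook_brauer_diagrams scale mul m A1 A2 \<longrightarrow>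
      c_free perm_diagrams scale mul m A1 A2"
    using brauer[OF assms] rook by blast
  moreover have "c_free diagrams scale mul m A1 A2 \<and>
      (\<exists>a1\<in>A1. \<exists>a2\<in>A1. \<exists>b1\<in>A2. \<exists>b2\<in>A2.
         cumulant scale m diagrams {{Inl 0, Inl 1, Inr 0, Inr 1}} [a1, a2] *
         cumulant scale m diagrams {{Inl 0, Inl 1, Inr 0, Inr 1}} [b1, b2] \<noteq> 0) \<longrightarrow>
      \<not> c_free perm_diagrams scale mul m A1 A2"
    using partition_free_not_perm_free[OF assms] unfolding one_block2_def by blast
  moreover note diag_moment_tracial diag_moment_partition_free diag_moment_not_perm_free
  \<comment> \<open>Assertion (b): the signs are free for all partitions but not for the
    permutations, hence by (2) not for the Brauer diagrams.\<close>
  moreover have "\<not> c_free brauer_diagrams fscale fmul diag_moment {sign1} {sign2}"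
    using brauer[OF diag_moment_tracial] diag_moment_not_perm_free by blast
  moreover have "\<not> c_free brauer_diagrams fscale null_mul pairing_moment {\<lambda>_. 1} {\<lambda>_. 1}"
    by (rule pairing_moment_not_brauer_free) simp
  ultimately show ?thesis using pairing_moment_tracial pairing_moment_perm_free by blast
qed

end
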